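(* Let $\eta\equiv0$. For each $t\in T$, the annihilation operator $\partial_t$ acting on $\mathbf{CP}$ has the representation $$\partial_t=\Psi_{\lambda(t),0}^{-1}(D_t\mathbb G)=\frac{D_t\mathbb G}{\mathbf 1-\lambda(t)D_t\mathbb G}=\sum_{k=1}^\infty\lambda(t)^{k-1}(D_t\mathbb G)^k .$$ In particular, if $\lambda(t)=0$, then $\partial_t=D_t\mathbb G$.
   Context: **Setting.** $T$ is a locally compact Polish space, $\sigma$ a Radon non-atomic measure on its Borel $\sigma$-algebra with $\sigma(O)>0$ for each non-empty open $O\subset T$, and $\lambda:T\to\mathbb R$ a fixed continuous function. $\mathcal D:=C_0(T)$ and $\mathcal D^{(n)}:=C_0(T^n)$ are the spaces of real continuous functions with compact support ($\mathcal D^{(0)}:=\mathbb R$). For $n=0,1,2,\dots$, $[n]_0:=0$ if $n=0$ and $[n]_0:=1$ if $n\ge1$. **Process (case $\eta\equiv0$, the free Gauss–Poisson case).** $\mathbb F=\mathbb R\oplus\bigoplus_{n\ge1}L^2(T^n,\sigma^{\otimes n})$ is the real full Fock space. For $f\in\mathcal D$, $\langle\omega,f\rangle:=X(f)=X^+(f)+X^0(f)+X^-(f)\in\mathscr L(\mathbb F)$, where for $F\in L^2(T^n,\sigma^{\otimes n})$ (and $F\in\mathbb R$ if $n=0$): $X^+(f)F=f\otimes F$; $(X^0(f)F)(t_1,\dots,t_n)=\lambda(t_1)f(t_1)F(t_1,\dots,t_n)$ for $n\ge1$ and $X^0(f)F=0$ for $n=0$; $(X^-(f)F)(t_1,\dots,t_{n-1})=\int_Tf(t)F(t,t_1,\dots,t_{n-1})\,\sigma(dt)$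 for $n\ge1$ and $X^-(f)F=0$ for $n=0$. **Monomials and polynomials.** $\langle\omega^{\otimes n},f_1\otimes\dots\otimes f_n\rangle:=\langle\omega,f_1\rangle\cdots\langle\omega,f_n\rangle$ for $f_i\in\mathcal D$, and this is extended linearly to $\langle\omega^{\otimes n},f^{(n)}\rangle\in\mathscr L(\mathbb F)$, $f^{(n)}\in\mathcal D^{(n)}$, continuously with respect to uniform convergence of functions supported in $K^n$ for a fixed compact $K\subset T$; $\langle\omega^{\otimes0},c\rangle:=c\mathbf 1$. $\mathbf{CP}$ is the linear space of all finite sums $\sum_{i=0}^n\langle\omega^{\otimes i},f^{(i)}\rangle$, $f^{(i)}\in\mathcal D^{(i)}$ (continuous polynomials in $\omega$); such a representation is unique. The orthogonal polynomials $\langle P^{(n)}(\omega),f^{(n)}\rangle$, $f^{(n)}\in\mathcal D^{(n)}$, are given by $\langle P^{(0)}(\omega),c\rangle=c\mathbf 1$, $\langle P^{(1)}(\omega),f\rangle=\langle\omega,f\rangle$ and, for $n\ge2$, $$\langle P^{(n)}(\omega),f_1\otimes\dots\otimes f_n\rangle=\langle\omega,f_1\rangle\langle P^{(n-1)}(\omega),f_2\otimes\dots\otimes f_n\rangle-\langle P^{(n-1)}(\omega),(\lambda f_1f_2)\otimes f_3\otimes\dots\otimes f_n\rangle-\int_Tf_1f_2\,d\sigma\,\langle P^{(n-2)}(\omega),f_3\otimes\dots\otimes f_n\rangle,$$ extended linearly and continuously to $\mathcal D^{(n)}$ in the same sense. Each element of $\mathbf{CP}$ has a unique representation as a finite sum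 of $\langle P^{(n)}(\omega),f^{(n)}\rangle$ with $f^{(n)}\in\mathcal D^{(n)}$. **Operators on $\mathbf{CP}$.** For $t\in T$ the annihilation operator $\partial_t$ is the linear operator on $\mathbf{CP}$ with $\partial_t\langle P^{(n)}(\omega),f^{(n)}\rangle=\langle P^{(n-1)}(\omega),f^{(n)}(t,\cdot)\rangle$ for $n\ge1$, and $\partial_t$ of a constant is $0$. The free differentiation operator $D_t$ is the linear operator on $\mathbf{CP}$ with $D_t\langle\omega^{\otimes n},f^{(n)}\rangle=[n]_0\langle\omega^{\otimes(n-1)},f^{(n)}(t,\cdot)\rangle$ (so $D_t$ of a constant is $0$). Let $NC_{\ge2}(1,\dots,n)$ be the set of non-crossing partitions of $\{1,\dots,n\}$ all of whose blocks contain at least two points. For $\zeta\in NC_{\ge2}(1,\dots,n)$ put $$W^-(\zeta)(t_1,\dots,t_n)=\prod_{l\ge2}\ \prod_{\{i_1,\dots,i_l\}\in\zeta}\lambda^{l-2}(t_{i_1})\,\delta(t_{i_1},\dots,t_{i_l}),$$ where $\delta$ is the formal delta function defined by $\int_{T^l}h(t_1,\dots,t_l)\,\delta(t_1,\dots,t_l)\,\sigma(dt_1)\cdots\sigma(dt_l)=\int_Th(t,\dots,t)\,\sigma(dt)$, and $\lambda^{0}:=1$. The "global" operator $\mathbb G$ on $\mathbf{CP}$ is $$\mathbb G:=\mathbf 1+\sum_{n=2}^\infty\ \sum_{\zeta\in NC_{\ge2}(1,\dots,n)}\int_{T^n}\sigma(dt_1)\cdots\sigma(dt_n)\,W^-(\zeta)(t_1,\dots,t_n)\,D_{t_1}D_{t_2}\cdots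 D_{t_n},$$ i.e. the $(n,\zeta)$ term sends $\langle\omega^{\otimes N},f^{(N)}\rangle$ to $\big\langle\omega^{\otimes(N-n)},\int_{T^n}W^-(\zeta)(t_1,\dots,t_n)f^{(N)}(t_n,\dots,t_1,\cdot)\,\sigma(dt_1)\cdots\sigma(dt_n)\big\rangle$ if $n\le N$ and to $0$ if $n>N$. $\Psi_{\lambda,0}(z)=z/(1+\lambda z)$, with inverse $\Psi_{\lambda,0}^{-1}(z)=z/(1-\lambda z)=\sum_{k\ge1}\lambda^{k-1}z^k$; a function of $D_t\mathbb G$ is understood through this power series. Applied to an element of $\mathbf{CP}$, the sum $\sum_{k\ge1}\lambda(t)^{k-1}(D_t\mathbb G)^k$ has only finitely many non-zero terms (with $\lambda(t)^0:=1$). *)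

theory Defs
  imports "HOL-Analysis.Analysis" "HOL-Computational_Algebra.Formal_Power_Series"
    "HOL-Library.Disjoint_Sets"
begin

section \<open>The underlying space\<close>

text \<open>
  The pair \<open>(T, \<sigma>)\<close> is a type of the following class. The measure is a class parameter because
  the Fock space below is a quotient by almost-everywhere equality and so depends on it.
\<close>

class radon_polish = polish_space +
  fixes \<sigma> :: "'a measure"
  assumes locally_compact: "\<exists>U K. open U \<and> x \<in> U \<and> U \<subseteq> K \<and> compact K"
    and sets_\<sigma>: "sets \<sigma> = sigma_sets UNIV {U. open U}"
    and \<sigma>_finite_compact: "compact K \<Longrightarrow> emeasure \<sigma> K < \<infinity>"
    and \<sigma>_inner_regular:
      "A \<in> sets \<sigma> \<Longrightarrow> emeasure \<sigma> A = (SUP K\<in>{K. K \<subseteq> A \<and> compact K}. emeasure \<sigma> K)"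
    and \<sigma>_nonatomic:
      "A \<in> sets \<sigma> \<Longrightarrow> 0 < emeasure \<sigma> A \<Longrightarrow>
        \<exists>B\<in>sets \<sigma>. B \<subseteq> A \<and> 0 < emeasure \<sigma> B \<and> emeasure \<sigma> B < emeasure \<sigma> A"
    and \<sigma>_open_pos: "open U \<Longrightarrow> U \<noteq> {} \<Longrightarrow> 0 < emeasure \<sigma> U"

lemma sets_\<sigma>_borel: "sets (\<sigma> :: 'a::radon_polish measure) = sets borel"
  by (simp add: sets_\<sigma> borel_def)

text \<open>
  Points of \<open>T\<^sup>n\<close> are functions on \<open>{0, \<dots>, n-1}\<close>, extended by \<open>undefined\<close>. The topology is the one
  induced by the product topology on \<open>nat \<Rightarrow> 'a\<close>; \<open>T\<^sup>0\<close> is a single point of mass \<open>1\<close>, so that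
  real-valued functions on it are real numbers. The point \<open>(t, t\<^sub>1, \<dots>, t\<^sub>n)\<close> of \<open>T\<^sup>n\<^sup>+\<^sup>1\<close> is
  \<open>case_nat t \<omega>\<close> for \<open>\<omega> = (t\<^sub>1, \<dots>, t\<^sub>n)\<close>.
\<close>

definition Tpow :: "nat \<Rightarrow> (nat \<Rightarrow> 'a) set" where
  "Tpow n = (\<Pi>\<^sub>E i\<in>{..<n}. UNIV)"

definition \<sigma>pow :: "nat \<Rightarrow> (nat \<Rightarrow> 'a::radon_polish) measure" where
  "\<sigma>pow n = (\<Pi>\<^sub>M i\<in>{..<n}. \<sigma>)"

text \<open>
  \<open>\<D>1\<close> is $\mathcal D = C_0(T)$ and \<open>\<D> n\<close> is $\mathcal D^{(n)} = C_0(T^n)$. Elements of \<open>\<D> n\<close> vanish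
  outside \<open>Tpow n\<close>, so that equality in \<open>\<D> n\<close> is equality of HOL functions.
\<close>

definition \<D>1 :: "('a::topological_space \<Rightarrow> real) set" where
  "\<D>1 = {f. continuous_on UNIV f \<and> (\<exists>K. compact K \<and> (\<forall>t. t \<notin> K \<longrightarrow> f t = 0))}"

definition \<D> :: "nat \<Rightarrow> ((nat \<Rightarrow> 'a::topological_space) \<Rightarrow> real) set" where
  "\<D> n = {f. continuous_on (Tpow n) f \<and>
             (\<exists>C. compact C \<and> C \<subseteq> Tpow n \<and> (\<forall>\<omega>. \<omega> \<notin> C \<longrightarrow> f \<omega> = 0))}"

definition tensor :: "('a \<Rightarrow> real) list \<Rightarrow> (nat \<Rightarrow> 'a) \<Rightarrow> real" where
  "tensor fs \<omega> = (if \<omega> \<in> Tpow (length fs) then \<Prod>i<length fs. (fs ! i) (\<omega> i) else 0)"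

definition slice :: "'a \<Rightarrow> ((nat \<Rightarrow> 'a) \<Rightarrow> real) \<Rightarrow> (nat \<Rightarrow> 'a) \<Rightarrow> real" where
  "slice t f \<omega> = f (case_nat t \<omega>)"


section \<open>The full Fock space\<close>

definition fock_space :: "(nat \<Rightarrow> (nat \<Rightarrow> 'a::radon_polish) \<Rightarrow> real) set" where
  "fock_space = {F. (\<forall>n. F n \<in> borel_measurable (\<sigma>pow n) \<and>
                         integrable (\<sigma>pow n) (\<lambda>\<omega>. (F n \<omega>)\<^sup>2)) \<and>
                    summable (\<lambda>n. \<integral>\<omega>. (F n \<omega>)\<^sup>2 \<partial>\<sigma>pow n)}"

definition fock_rel ::
    "(nat \<Rightarrow> (nat \<Rightarrow> 'a::radon_polish) \<Rightarrow> real) \<Rightarrow> (nat \<Rightarrow> (nat \<Rightarrow> 'a) \<Rightarrow> real) \<Rightarrow> bool" where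
  "fock_rel F G \<longleftrightarrow> F \<in> fock_space \<and> G \<in> fock_space \<and> (\<forall>n. AE \<omega> in \<sigma>pow n. F n \<omega> = G n \<omega>)"

lemma zero_in_fock_space: "(\<lambda>_ _. 0) \<in> fock_space"
  by (simp add: fock_space_def)

quotient_type (overloaded) 'a fock = "nat \<Rightarrow> (nat \<Rightarrow> 'a::radon_polish) \<Rightarrow> real" / partial: fock_rel
proof (rule part_equivpI)
  show "\<exists>F::nat \<Rightarrow> (nat \<Rightarrow> 'a) \<Rightarrow> real. fock_rel F F"
    using zero_in_fock_space by (auto simp: fock_rel_def)
  show "symp (fock_rel :: (nat \<Rightarrow> (nat \<Rightarrow> 'a) \<Rightarrow> real) \<Rightarrow> _)"
    by (auto simp: symp_def fock_rel_def eq_commute)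
  show "transp (fock_rel :: (nat \<Rightarrow> (nat \<Rightarrow> 'a) \<Rightarrow> real) \<Rightarrow> _)"
  proof (rule transpI)
    fix F G H :: "nat \<Rightarrow> (nat \<Rightarrow> 'a) \<Rightarrow> real"
    assume FG: "fock_rel F G" and GH: "fock_rel G H"
    have "AE \<omega> in \<sigma>pow n. F n \<omega> = H n \<omega>" for n
    proof -
      have "AE \<omega> in \<sigma>pow n. F n \<omega> = G n \<omega>" "AE \<omega> in \<sigma>pow n. G n \<omega> = H n \<omega>"
        using FG GH by (auto simp: fock_rel_def)
      then show ?thesis by eventually_elim simp
    qed
    then show "fock_rel F H" using FG GH by (simp add: fock_rel_def)
  qed
qed

lemma fock_spaceD:
  assumes "F \<in> fock_space"
  shows "F n \<in> borel_measurable (\<sigma>pow n)" "integrable (\<sigma>pow n) (\<lambda>\<omega>. (F n \<omega>)\<^sup>2)"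
    "summable (\<lambda>n. \<integral>\<omega>. (F n \<omega>)\<^sup>2 \<partial>\<sigma>pow n)"
  using assms by (auto simp: fock_space_def)

lemma abs_mult_le_sum_squares: "\<bar>a * b\<bar> \<le> a\<^sup>2 + b\<^sup>2" for a b :: real
proof -
  have "0 \<le> \<bar>a\<bar> * \<bar>b\<bar>" by simp
  moreover have "2 * (\<bar>a\<bar> * \<bar>b\<bar>) \<le> a\<^sup>2 + b\<^sup>2"
    using sum_squares_bound[of "\<bar>a\<bar>" "\<bar>b\<bar>"] by (simp add: mult.assoc)
  ultimately show ?thesis unfolding abs_mult by linarith
qed

lemma fock_integrable_mult:
  assumes "F \<in> fock_space" "G \<in> fock_space"
  shows "integrable (\<sigma>pow n) (\<lambda>\<omega>. F n \<omega> * G n \<omega>)"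
proof (rule Bochner_Integration.integrable_bound)
  show "integrable (\<sigma>pow n) (\<lambda>\<omega>. (F n \<omega>)\<^sup>2 + (G n \<omega>)\<^sup>2)"
    using assms by (intro Bochner_Integration.integrable_add fock_spaceD)
  show "(\<lambda>\<omega>. F n \<omega> * G n \<omega>) \<in> borel_measurable (\<sigma>pow n)"
    using fock_spaceD(1)[OF assms(1)] fock_spaceD(1)[OF assms(2)] by measurable
  show "AE \<omega> in \<sigma>pow n. norm (F n \<omega> * G n \<omega>) \<le> norm ((F n \<omega>)\<^sup>2 + (G n \<omega>)\<^sup>2)"
    by (simp add: abs_mult_le_sum_squares)
qed

lemma fock_summable_mult:
  assumes "F \<in> fock_space" "G \<in> fock_space"
  shows "summable (\<lambda>n. \<integral>\<omega>. F n \<omega> * G n \<omega> \<partial>\<sigma>pow n)"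
proof (rule summable_comparison_test)
  let ?b = "\<lambda>n. (\<integral>\<omega>. (F n \<omega>)\<^sup>2 \<partial>\<sigma>pow n) + (\<integral>\<omega>. (G n \<omega>)\<^sup>2 \<partial>\<sigma>pow n)"
  show "summable ?b" using assms by (intro summable_add fock_spaceD)
  have "norm (\<integral>\<omega>. F n \<omega> * G n \<omega> \<partial>\<sigma>pow n) \<le> ?b n" for n
  proof -
    have "norm (\<integral>\<omega>. F n \<omega> * G n \<omega> \<partial>\<sigma>pow n) \<le> (\<integral>\<omega>. norm (F n \<omega> * G n \<omega>) \<partial>\<sigma>pow n)"
      by (rule integral_norm_bound)
    also have "\<dots> \<le> (\<integral>\<omega>. (F n \<omega>)\<^sup>2 + (G n \<omega>)\<^sup>2 \<partial>\<sigma>pow n)"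
      using assms abs_mult_le_sum_squares
      by (intro integral_mono integrable_norm fock_integrable_mult
          Bochner_Integration.integrable_add fock_spaceD) auto
    also have "\<dots> = ?b n"
      using assms by (intro Bochner_Integration.integral_add fock_spaceD)
    finally show ?thesis .
  qed
  then show "\<exists>N. \<forall>n\<ge>N. norm (\<integral>\<omega>. F n \<omega> * G n \<omega> \<partial>\<sigma>pow n) \<le> ?b n" by blast
qed

lemma fock_space_scale:
  assumes "F \<in> fock_space"
  shows "(\<lambda>n \<omega>. c * F n \<omega>) \<in> fock_space"
  using fock_spaceD[OF assms]
  by (auto simp: fock_space_def power_mult_distrib intro!: borel_measurable_times summable_mult)

lemma fock_space_add:
  assumes "F \<in> fock_space" "G \<in> fock_space"
  shows "(\<lambda>n \<omega>. F n \<omega> + G n \<omega>) \<in> fock_space"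
proof -
  have sq: "(F n \<omega> + G n \<omega>)\<^sup>2 = ((F n \<omega>)\<^sup>2 + (G n \<omega>)\<^sup>2) + 2 * (F n \<omega> * G n \<omega>)" for n \<omega>
    by (simp add: power2_sum)
  note FG = fock_spaceD[OF assms(1)] fock_spaceD[OF assms(2)]
    fock_integrable_mult[OF assms] fock_summable_mult[OF assms]
  have int: "integrable (\<sigma>pow n) (\<lambda>\<omega>. (F n \<omega> + G n \<omega>)\<^sup>2)" for n
    unfolding sq using FG
    by (intro Bochner_Integration.integrable_add integrable_mult_right) auto
  have "(\<integral>\<omega>. (F n \<omega> + G n \<omega>)\<^sup>2 \<partial>\<sigma>pow n) =
      ((\<integral>\<omega>. (F n \<omega>)\<^sup>2 \<partial>\<sigma>pow n) + (\<integral>\<omega>. (G n \<omega>)\<^sup>2 \<partial>\<sigma>pow n)) +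
      2 * (\<integral>\<omega>. F n \<omega> * G n \<omega> \<partial>\<sigma>pow n)" for n
    unfolding sq using FG by simp
  then have "summable (\<lambda>n. \<integral>\<omega>. (F n \<omega> + G n \<omega>)\<^sup>2 \<partial>\<sigma>pow n)"
    using FG by (simp add: summable_add summable_mult)
  then show ?thesis using int FG(1,4) by (auto simp: fock_space_def)
qed

lemma fock_relD:
  assumes "fock_rel F G"
  shows "F \<in> fock_space" "G \<in> fock_space" "AE \<omega> in \<sigma>pow n. F n \<omega> = G n \<omega>"
  using assms by (auto simp: fock_rel_def)

instantiation fock :: (radon_polish) real_inner
begin

lift_definition zero_fock :: "'a fock" is "\<lambda>_ _. 0"
  by (simp add: fock_rel_def zero_in_fock_space)

lift_definition plus_fock :: "'a fock \<Rightarrow> 'a fock \<Rightarrow> 'a fock" is "\<lambda>F G n \<omega>. F n \<omega> + G n \<omega>"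
proof -
  fix F F' G G' :: "nat \<Rightarrow> (nat \<Rightarrow> 'a) \<Rightarrow> real"
  assume r: "fock_rel F F'" "fock_rel G G'"
  have "AE \<omega> in \<sigma>pow n. F n \<omega> + G n \<omega> = F' n \<omega> + G' n \<omega>" for n
    using fock_relD(3)[OF r(1), of n] fock_relD(3)[OF r(2), of n] by eventually_elim simp
  then show "fock_rel (\<lambda>n \<omega>. F n \<omega> + G n \<omega>) (\<lambda>n \<omega>. F' n \<omega> + G' n \<omega>)"
    using r by (simp add: fock_rel_def fock_space_add)
qed

lift_definition scaleR_fock :: "real \<Rightarrow> 'a fock \<Rightarrow> 'a fock" is "\<lambda>c F n \<omega>. c * F n \<omega>"
proof -
  fix c and F F' :: "nat \<Rightarrow> (nat \<Rightarrow> 'a) \<Rightarrow> real"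
  assume r: "fock_rel F F'"
  have "AE \<omega> in \<sigma>pow n. c * F n \<omega> = c * F' n \<omega>" for n
    using fock_relD(3)[OF r, of n] by eventually_elim simp
  then show "fock_rel (\<lambda>n \<omega>. c * F n \<omega>) (\<lambda>n \<omega>. c * F' n \<omega>)"
    using r by (simp add: fock_rel_def fock_space_scale)
qed

definition uminus_fock :: "'a fock \<Rightarrow> 'a fock" where "uminus_fock F = scaleR (-1) F"

definition minus_fock :: "'a fock \<Rightarrow> 'a fock \<Rightarrow> 'a fock" where "minus_fock F G = F + (- G)"

lift_definition inner_fock :: "'a fock \<Rightarrow> 'a fock \<Rightarrow> real" is
  "\<lambda>F G. \<Sum>n. \<integral>\<omega>. F n \<omega> * G n \<omega> \<partial>\<sigma>pow n"
proof -
  fix F F' G G' :: "nat \<Rightarrow> (nat \<Rightarrow> 'a) \<Rightarrow> real"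
  assume r: "fock_rel F F'" "fock_rel G G'"
  have "(\<integral>\<omega>. F n \<omega> * G n \<omega> \<partial>\<sigma>pow n) = (\<integral>\<omega>. F' n \<omega> * G' n \<omega> \<partial>\<sigma>pow n)" for n
  proof (rule integral_cong_AE)
    show "AE \<omega> in \<sigma>pow n. F n \<omega> * G n \<omega> = F' n \<omega> * G' n \<omega>"
      using fock_relD(3)[OF r(1), of n] fock_relD(3)[OF r(2), of n] by eventually_elim simp
  qed (use fock_relD(1,2)[OF r(1)] fock_relD(1,2)[OF r(2)] fock_spaceD(1) in
      \<open>blast intro: borel_measurable_times\<close>)+
  then show "(\<Sum>n. \<integral>\<omega>. F n \<omega> * G n \<omega> \<partial>\<sigma>pow n) = (\<Sum>n. \<integral>\<omega>. F' n \<omega> * G' n \<omega> \<partial>\<sigma>pow n)"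
    by simp
qed

definition norm_fock :: "'a fock \<Rightarrow> real" where "norm_fock F = sqrt (inner F F)"

definition sgn_fock :: "'a fock \<Rightarrow> 'a fock" where "sgn_fock F = scaleR (inverse (norm F)) F"

definition dist_fock :: "'a fock \<Rightarrow> 'a fock \<Rightarrow> real" where "dist_fock F G = norm (F - G)"

definition uniformity_fock :: "('a fock \<times> 'a fock) filter" where
  "uniformity_fock = (INF e\<in>{0<..}. principal {(F, G). dist F G < e})"

definition open_fock :: "'a fock set \<Rightarrow> bool" where
  "open_fock U \<longleftrightarrow> (\<forall>F\<in>U. eventually (\<lambda>(F', G). F' = F \<longrightarrow> G \<in> U) uniformity)"

instance
proof
  fix F G H :: "'a fock" and a b :: real
  show "F + G + H = F + (G + H)"
    by transfer (auto simp: fock_rel_def add.assoc intro!: fock_space_add)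
  show "F + G = G + F"
    by transfer (auto simp: fock_rel_def add.commute intro!: fock_space_add)
  show "0 + F = F"
    by transfer (auto simp: fock_rel_def)
  show "- F + F = 0"
    unfolding uminus_fock_def
    by transfer (auto simp: fock_rel_def zero_in_fock_space intro!: fock_space_add fock_space_scale
        simp del: mult_minus1)
  show "F - G = F + - G" by (simp add: minus_fock_def)
  show "a *\<^sub>R (F + G) = a *\<^sub>R F + a *\<^sub>R G"
    by transfer (auto simp: fock_rel_def distrib_left intro!: fock_space_add fock_space_scale)
  show "(a + b) *\<^sub>R F = a *\<^sub>R F + b *\<^sub>R F"
    by transfer (auto simp: fock_rel_def distrib_right intro!: fock_space_add fock_space_scale)
  show "a *\<^sub>R b *\<^sub>R F = (a * b) *\<^sub>R F"
    by transfer (auto simp: fock_rel_def mult.assoc intro!: fock_space_scale)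
  show "1 *\<^sub>R F = F"
    by transfer (auto simp: fock_rel_def)
  show "sgn F = scaleR (inverse (norm F)) F" by (simp add: sgn_fock_def)
  show "dist F G = norm (F - G)" by (simp add: dist_fock_def)
  show "(uniformity :: ('a fock \<times> 'a fock) filter) =
      (INF e\<in>{0<..}. principal {(F, G). dist F G < e})"
    by (simp add: uniformity_fock_def)
  show "open U \<longleftrightarrow> (\<forall>F\<in>U. eventually (\<lambda>(F', G). F' = F \<longrightarrow> G \<in> U) uniformity)"
    for U :: "'a fock set"
    by (simp add: open_fock_def)
  show "inner F G = inner G F"
    by transfer (simp add: mult.commute)
  show "inner (F + G) H = inner F H + inner G H"
  proof transfer
    fix F G H :: "nat \<Rightarrow> (nat \<Rightarrow> 'a) \<Rightarrow> real"
    assume "fock_rel F F" "fock_rel G G" "fock_rel H H"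
    then have m: "F \<in> fock_space" "G \<in> fock_space" "H \<in> fock_space"
      by (auto simp: fock_rel_def)
    show "(\<Sum>n. \<integral>\<omega>. (F n \<omega> + G n \<omega>) * H n \<omega> \<partial>\<sigma>pow n) =
        (\<Sum>n. \<integral>\<omega>. F n \<omega> * H n \<omega> \<partial>\<sigma>pow n) + (\<Sum>n. \<integral>\<omega>. G n \<omega> * H n \<omega> \<partial>\<sigma>pow n)"
      using m by (simp add: distrib_right fock_integrable_mult suminf_add fock_summable_mult)
  qed
  show "inner (a *\<^sub>R F) G = a * inner F G"
  proof transfer
    fix a and F G :: "nat \<Rightarrow> (nat \<Rightarrow> 'a) \<Rightarrow> real"
    assume "fock_rel F F" "fock_rel G G"
    then have "F \<in> fock_space" "G \<in> fock_space" by (auto simp: fock_rel_def)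
    then show "(\<Sum>n. \<integral>\<omega>. a * F n \<omega> * G n \<omega> \<partial>\<sigma>pow n) = a * (\<Sum>n. \<integral>\<omega>. F n \<omega> * G n \<omega> \<partial>\<sigma>pow n)"
      by (simp add: mult.assoc suminf_mult fock_summable_mult)
  qed
  show "0 \<le> inner F F"
  proof transfer
    fix F :: "nat \<Rightarrow> (nat \<Rightarrow> 'a) \<Rightarrow> real"
    assume "fock_rel F F"
    then have "F \<in> fock_space" by (auto simp: fock_rel_def)
    then show "0 \<le> (\<Sum>n. \<integral>\<omega>. F n \<omega> * F n \<omega> \<partial>\<sigma>pow n)"
      by (intro suminf_nonneg fock_summable_mult) auto
  qed
  show "inner F F = 0 \<longleftrightarrow> F = 0"
  proof transfer
    fix F :: "nat \<Rightarrow> (nat \<Rightarrow> 'a) \<Rightarrow> real"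
    assume "fock_rel F F"
    then have F: "F \<in> fock_space" by (auto simp: fock_rel_def)
    have "(\<Sum>n. \<integral>\<omega>. F n \<omega> * F n \<omega> \<partial>\<sigma>pow n) = 0 \<longleftrightarrow> (\<forall>n. (\<integral>\<omega>. F n \<omega> * F n \<omega> \<partial>\<sigma>pow n) = 0)"
      using F by (intro suminf_eq_zero_iff fock_summable_mult) auto
    also have "\<dots> \<longleftrightarrow> (\<forall>n. AE \<omega> in \<sigma>pow n. F n \<omega> * F n \<omega> = 0)"
      using F by (intro all_cong1 integral_nonneg_eq_0_iff_AE fock_integrable_mult) auto
    also have "\<dots> \<longleftrightarrow> fock_rel F (\<lambda>_ _. 0)"
      using F by (simp add: fock_rel_def zero_in_fock_space)
    finally show "(\<Sum>n. \<integral>\<omega>. F n \<omega> * F n \<omega> \<partial>\<sigma>pow n) = 0 \<longleftrightarrow> fock_rel F (\<lambda>_ _. 0)" .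
  qed
  show "norm F = sqrt (inner F F)" by (simp add: norm_fock_def)
qed

end


section \<open>The process, monomials and orthogonal polynomials\<close>

type_synonym 'a fock_op = "'a fock \<Rightarrow>\<^sub>L 'a fock"

text \<open>For \<open>f \<in> \<D>1\<close> the three maps below are bounded and independent of the representative.\<close>

definition X_plus :: "('a::radon_polish \<Rightarrow> real) \<Rightarrow> 'a fock_op" where
  "X_plus f = Blinfun (\<lambda>F. abs_fock (\<lambda>n \<omega>.
     case n of 0 \<Rightarrow> 0 | Suc m \<Rightarrow> f (\<omega> 0) * rep_fock F m (\<lambda>i. \<omega> (Suc i))))"

definition X_zero :: "('a::radon_polish \<Rightarrow> real) \<Rightarrow> ('a \<Rightarrow> real) \<Rightarrow> 'a fock_op" where
  "X_zero lam f = Blinfun (\<lambda>F. abs_fock (\<lambda>n \<omega>.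
     if n = 0 then 0 else lam (\<omega> 0) * f (\<omega> 0) * rep_fock F n \<omega>))"

definition X_minus :: "('a::radon_polish \<Rightarrow> real) \<Rightarrow> 'a fock_op" where
  "X_minus f = Blinfun (\<lambda>F. abs_fock (\<lambda>n \<omega>.
     \<integral>t. f t * rep_fock F (Suc n) (case_nat t \<omega>) \<partial>\<sigma>))"

definition X :: "('a::radon_polish \<Rightarrow> real) \<Rightarrow> ('a \<Rightarrow> real) \<Rightarrow> 'a fock_op" where
  "X lam f = X_plus f + X_zero lam f + X_minus f"

text \<open>
  \<open>extends_tensors n m M\<close>: the map \<open>M\<close> on \<open>\<D> n\<close> extends \<open>f\<^sub>1 \<otimes> \<dots> \<otimes> f\<^sub>n \<mapsto> m [f\<^sub>1, \<dots>, f\<^sub>n]\<close> linearly,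
  and continuously with respect to uniform convergence of functions supported in \<open>K\<^sup>n\<close>, for every
  compact \<open>K\<close>. The last clause only normalises the values outside \<open>\<D> n\<close>.
\<close>

definition extends_tensors ::
    "nat \<Rightarrow> (('a::radon_polish \<Rightarrow> real) list \<Rightarrow> 'b::real_normed_vector) \<Rightarrow>
     (((nat \<Rightarrow> 'a) \<Rightarrow> real) \<Rightarrow> 'b) \<Rightarrow> bool" where
  "extends_tensors n m M \<longleftrightarrow>
     (\<forall>fs. length fs = n \<and> set fs \<subseteq> \<D>1 \<longrightarrow> M (tensor fs) = m fs) \<and>
     (\<forall>f\<in>\<D> n. \<forall>g\<in>\<D> n. \<forall>a b. M (\<lambda>\<omega>. a * f \<omega> + b * g \<omega>) = a *\<^sub>R M f + b *\<^sub>R M g) \<and>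
     (\<forall>K f h. compact K \<and> h \<in> \<D> n \<and> (\<forall>k. f k \<in> \<D> n) \<and>
        (\<forall>\<omega>. \<omega> \<notin> (\<Pi>\<^sub>E i\<in>{..<n}. K) \<longrightarrow> h \<omega> = 0 \<and> (\<forall>k. f k \<omega> = 0)) \<and>
        uniform_limit (Tpow n) f h sequentially \<longrightarrow> (\<lambda>k. M (f k)) \<longlonglongrightarrow> M h) \<and>
     (\<forall>f. f \<notin> \<D> n \<longrightarrow> M f = 0)"

definition extend_tensors ::
    "nat \<Rightarrow> (('a::radon_polish \<Rightarrow> real) list \<Rightarrow> 'b::real_normed_vector) \<Rightarrow>
     ((nat \<Rightarrow> 'a) \<Rightarrow> real) \<Rightarrow> 'b" where
  "extend_tensors n m = (THE M. extends_tensors n m M)"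

text \<open>\<open>monomial lam n f\<close> is $\langle\omega^{\otimes n}, f\rangle$.\<close>

definition monomial ::
    "('a::radon_polish \<Rightarrow> real) \<Rightarrow> nat \<Rightarrow> ((nat \<Rightarrow> 'a) \<Rightarrow> real) \<Rightarrow> 'a fock_op" where
  "monomial lam n = extend_tensors n (\<lambda>fs. foldr (\<lambda>f A. X lam f o\<^sub>L A) fs id_blinfun)"

definition CP :: "('a::radon_polish \<Rightarrow> real) \<Rightarrow> 'a fock_op set" where
  "CP lam = {\<Sum>i\<le>n. monomial lam i (f i) | n f. \<forall>i\<le>n. f i \<in> \<D> i}"

fun P_tensor ::
    "('a::radon_polish \<Rightarrow> real) \<Rightarrow> ('a \<Rightarrow> real) list \<Rightarrow> 'a fock_op" where
  "P_tensor lam [] = id_blinfun"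
| "P_tensor lam [f] = X lam f"
| "P_tensor lam (f # g # fs) =
     (X lam f o\<^sub>L P_tensor lam (g # fs))
     - P_tensor lam ((\<lambda>t. lam t * f t * g t) # fs)
     - (\<integral>t. f t * g t \<partial>\<sigma>) *\<^sub>R P_tensor lam fs"

text \<open>\<open>P lam n f\<close> is $\langle P^{(n)}(\omega), f\rangle$.\<close>

definition P ::
    "('a::radon_polish \<Rightarrow> real) \<Rightarrow> nat \<Rightarrow> ((nat \<Rightarrow> 'a) \<Rightarrow> real) \<Rightarrow> 'a fock_op" where
  "P lam n = extend_tensors n (P_tensor lam)"


section \<open>Operators on continuous polynomials\<close>

text \<open>
  Linear operators on \<open>CP lam\<close>, as functions that are \<open>undefined\<close> outside \<open>CP lam\<close>; this makes the
  operators characterised by \<open>THE\<close> below unique as HOL functions.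
\<close>

definition CP_operator ::
    "('a::radon_polish \<Rightarrow> real) \<Rightarrow> ('a fock_op \<Rightarrow> 'a fock_op) \<Rightarrow> bool" where
  "CP_operator lam L \<longleftrightarrow> L \<in> CP lam \<rightarrow>\<^sub>E CP lam \<and>
     (\<forall>p\<in>CP lam. \<forall>q\<in>CP lam. \<forall>a b. L (a *\<^sub>R p + b *\<^sub>R q) = a *\<^sub>R L p + b *\<^sub>R L q)"

definition annihilation :: "('a::radon_polish \<Rightarrow> real) \<Rightarrow> 'a \<Rightarrow> 'a fock_op \<Rightarrow> 'a fock_op" where
  "annihilation lam t = (THE L. CP_operator lam L \<and>
     (\<forall>n. \<forall>f\<in>\<D> n. L (P lam n f) = (if n = 0 then 0 else P lam (n - 1) (slice t f))))"

definition bracket0 :: "nat \<Rightarrow> real" where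
  "bracket0 n = (if n = 0 then 0 else 1)"

definition free_diff :: "('a::radon_polish \<Rightarrow> real) \<Rightarrow> 'a \<Rightarrow> 'a fock_op \<Rightarrow> 'a fock_op" where
  "free_diff lam t = (THE L. CP_operator lam L \<and>
     (\<forall>n. \<forall>f\<in>\<D> n. L (monomial lam n f) = bracket0 n *\<^sub>R monomial lam (n - 1) (slice t f)))"

definition noncrossing :: "nat set set \<Rightarrow> bool" where
  "noncrossing \<zeta> \<longleftrightarrow> (\<forall>A\<in>\<zeta>. \<forall>B\<in>\<zeta>. \<forall>i j k l.
     i < j \<and> j < k \<and> k < l \<and> i \<in> A \<and> k \<in> A \<and> j \<in> B \<and> l \<in> B \<longrightarrow> A = B)"

definition NC2 :: "nat \<Rightarrow> nat set set set" where
  "NC2 n = {\<zeta>. partition_on {1..n} \<zeta> \<and> noncrossing \<zeta> \<and> (\<forall>B\<in>\<zeta>. 2 \<le> card B)}"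

definition block_of :: "nat set set \<Rightarrow> nat \<Rightarrow> nat set" where
  "block_of \<zeta> i = (THE B. B \<in> \<zeta> \<and> i \<in> B)"

text \<open>
  \<open>W_integral lam \<zeta> h\<close> is $\int_{T^n} h(t_1, \dots, t_n) W^-(\zeta)(t_1, \dots, t_n)\,
  \sigma(dt_1)\cdots\sigma(dt_n)$, with \<open>h\<close> applied to \<open>i \<mapsto> t\<^sub>i\<close>. Each delta function
  identifies the variables of one block, so one integration variable \<open>s B\<close> per block \<open>B\<close> of \<open>\<zeta>\<close>
  remains and \<open>t\<^sub>i = s B\<close> for \<open>i \<in> B\<close>.
\<close>

definition W_integral ::
    "('a::radon_polish \<Rightarrow> real) \<Rightarrow> nat set set \<Rightarrow> ((nat \<Rightarrow> 'a) \<Rightarrow> real) \<Rightarrow> real" where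
  "W_integral lam \<zeta> h =
     (\<integral>s. (\<Prod>B\<in>\<zeta>. lam (s B) ^ (card B - 2)) * h (\<lambda>i. s (block_of \<zeta> i)) \<partial>(\<Pi>\<^sub>M B\<in>\<zeta>. \<sigma>))"

text \<open>The argument of \<open>f\<close> below is the point \<open>(t\<^sub>n, \<dots>, t\<^sub>1, \<omega>)\<close>.\<close>

definition W_contract ::
    "('a::radon_polish \<Rightarrow> real) \<Rightarrow> nat \<Rightarrow> nat set set \<Rightarrow> ((nat \<Rightarrow> 'a) \<Rightarrow> real) \<Rightarrow>
     (nat \<Rightarrow> 'a) \<Rightarrow> real" where
  "W_contract lam n \<zeta> f \<omega> =
     W_integral lam \<zeta> (\<lambda>t. f (\<lambda>i. if i < n then t (n - i) else \<omega> (i - n)))"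

definition G_term ::
    "('a::radon_polish \<Rightarrow> real) \<Rightarrow> nat \<Rightarrow> nat set set \<Rightarrow> 'a fock_op \<Rightarrow> 'a fock_op" where
  "G_term lam n \<zeta> = (THE L. CP_operator lam L \<and>
     (\<forall>N. \<forall>f\<in>\<D> N. L (monomial lam N f) =
        (if n \<le> N then monomial lam (N - n) (W_contract lam n \<zeta> f) else 0)))"

text \<open>Infinite sums with only finitely many non-zero terms (and the value \<open>0\<close> otherwise).\<close>

definition finite_sum :: "nat set \<Rightarrow> (nat \<Rightarrow> 'b::comm_monoid_add) \<Rightarrow> 'b" where
  "finite_sum I g = (\<Sum>n\<in>{n\<in>I. g n \<noteq> 0}. g n)"

definition G :: "('a::radon_polish \<Rightarrow> real) \<Rightarrow> 'a fock_op \<Rightarrow> 'a fock_op" where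
  "G lam p = p + finite_sum {2..} (\<lambda>n. \<Sum>\<zeta>\<in>NC2 n. G_term lam n \<zeta> p)"

definition DG :: "('a::radon_polish \<Rightarrow> real) \<Rightarrow> 'a \<Rightarrow> 'a fock_op \<Rightarrow> 'a fock_op" where
  "DG lam t p = free_diff lam t (G lam p)"

text \<open>\<open>\<Psi> l\<close> is $\Psi_{l,0}$; its inverse under composition is \<open>fps_inv (\<Psi> l)\<close>.\<close>

definition \<Psi> :: "real \<Rightarrow> real fps" where
  "\<Psi> l = fps_X / (1 + fps_const l * fps_X)"

definition op_series :: "real fps \<Rightarrow> ('b::real_vector \<Rightarrow> 'b) \<Rightarrow> 'b \<Rightarrow> 'b" where
  "op_series c A p = finite_sum UNIV (\<lambda>k. fps_nth c k *\<^sub>R (A ^^ k) p)"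

end

theory Submission
  imports Defs
begin

text \<open>
  For fixed \<open>t\<close> write $A=\partial_t$, $E=D_t\mathbb G$ and $l=\lambda(t)$. Everything follows from
  $A=E+lAE$: since $E$ lowers the degree, iteration gives $A=\sum_{k\ge1}l^{k-1}E^k$, and
  $(1+lA)(1-lE)=1$.

  On a product of $\langle\omega,f_i\rangle$, the operator $E$ picks a factor $f_i$, evaluates it at \<open>t\<close>
  and replaces the factors on its left by their free moment, a sum over non-crossing partitions. The
  operator $A$ satisfies $A\langle\omega,h\rangle=h(t)(1+lA)+Aa(h)$, where $a(h)$ contracts the first variable
  of an orthogonal polynomial with $h$, and $a$ obeys a relation of the same form. Solving these
  relations on a product yields the same moments, because splitting off the block of the first
  factor reproduces the recursion of the sum over non-crossing partitions.

  The identity extends from products to all coefficients by continuity. The required bounds come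
  from the normally ordered form of the orthogonal polynomials, whose summands are integral operators
  on Fock space; applied to the vacuum it also shows that the coefficients are unique.
\<close>

section \<open>Test functions\<close>

text \<open>The obstacle is the definite descriptions: \<open>monomial\<close>, \<open>P\<close> and
  the operators on \<open>CP lam\<close> are given by their values on tensors or on a spanning
  family, so nothing can be computed before existence and uniqueness are known. Existence needs an
  operator bound by the sup norm of the coefficient. The norms of the factors of a tensor give none
  for sums of tensors, whereas Cauchy-Schwarz for integral kernels does. It is carried out for
  \<open>P\<close>, whose normally ordered words have the whole coefficient as kernel; monomials are
  then reached by the finite recursion \<open>mixed\<close>, which transports bounds and leading
  coefficients. All continuity is in the coefficient of a fixed degree. On a product, E yields tails
  weighted by moments, and A yields the same sum with 1 + lA applied to every tail; this is the
  source of A = (1 + lA)E. The opposite product (1 - lE)(1 + lA) = 1 rests on EA = AE, which follows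
  from local nilpotency of E.\<close>

lemma relatively_compact_cover:
  "\<Union>{U :: 'a::radon_polish set. open U \<and> (\<exists>K. U \<subseteq> K \<and> compact K)} = UNIV"
proof (intro set_eqI iffI UNIV_I)
  fix x :: 'a
  obtain U K where "open U" "x \<in> U" "U \<subseteq> K" "compact K"
    using locally_compact[of x] by (elim exE conjE)
  then show "x \<in> \<Union>{U. open U \<and> (\<exists>K. U \<subseteq> K \<and> compact K)}"
    by (intro UnionI[of U] CollectI conjI exI[of _ K])
qed

text \<open>By Lindelof the cover by relatively compact open sets has a countable subcover, and
  subsets of compact sets have finite mass. Fubini and the product measures rest on this.\<close>

lemma sigma_finite_\<sigma>: "sigma_finite_measure (\<sigma> :: 'a::radon_polish measure)"
proof
  define F where "F = {U :: 'a set. open U \<and> (\<exists>K. U \<subseteq> K \<and> compact K)}"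
  have UF: "\<Union>F = UNIV" unfolding F_def by (rule relatively_compact_cover)
  obtain F' where F': "F' \<subseteq> F" "countable F'" "\<Union>F' = \<Union>F"
    by (rule Lindelof[of F]) (auto simp: F_def)
  have "emeasure \<sigma> U \<noteq> \<infinity>" if "U \<in> F'" for U
  proof -
    have "U \<in> F" using F'(1) that by (rule subsetD)
    then obtain K where K: "U \<subseteq> K" "compact K" unfolding F_def by (elim CollectE conjE exE)
    have "emeasure \<sigma> U \<le> emeasure \<sigma> K"
      using K by (intro emeasure_mono) (simp_all add: sets_\<sigma>_borel compact_imp_closed)
    then show ?thesis using \<sigma>_finite_compact[OF K(2)] by (metis infinity_ennreal_def leD)
  qed
  moreover have "F' \<subseteq> sets \<sigma>"
    using F'(1) unfolding F_def sets_\<sigma>_borel by (metis (no_types, lifting) borel_open mem_Collect_eq subset_eq)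
  moreover have "space (\<sigma> :: 'a measure) = UNIV"
    using sets_eq_imp_space_eq[OF sets_\<sigma>_borel] by simp
  ultimately show "\<exists>A. countable A \<and> A \<subseteq> sets \<sigma> \<and> \<Union> A = space (\<sigma> :: 'a measure) \<and> (\<forall>a\<in>A. emeasure \<sigma> a \<noteq> \<infinity>)"
    using F'(2,3) UF by (intro exI[of _ F'] conjI ballI) simp_all
qed

lemma space_\<sigma> [simp]: "space (\<sigma> :: 'a::radon_polish measure) = UNIV"
  using sets_eq_imp_space_eq[OF sets_\<sigma>_borel] by simp

lemma product_sigma_finite_\<sigma>: "product_sigma_finite (\<lambda>_. \<sigma> :: 'a::radon_polish measure)"
  by (simp add: product_sigma_finite.intro sigma_finite_\<sigma>)

lemma measurable_\<sigma>_iff: "f \<in> borel_measurable (\<sigma> :: 'a::radon_polish measure) \<longleftrightarrow> f \<in> borel_measurable borel"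
  by (rule arg_cong[where f="\<lambda>A. f \<in> A"], rule measurable_cong_sets) (simp_all add: sets_\<sigma>_borel)

lemma space_PiM_\<sigma> [simp]: "space (Pi\<^sub>M J (\<lambda>_. \<sigma> :: 'a::radon_polish measure)) = Pi\<^sub>E J (\<lambda>_. UNIV)"
  by (simp add: space_PiM)

lemma space_\<sigma>pow [simp]: "space (\<sigma>pow n) = Tpow n"
  by (simp add: \<sigma>pow_def Tpow_def)

lemma compact_neighbourhood:
  fixes K :: "'a::radon_polish set"
  assumes "compact K"
  shows "\<exists>V K'. open V \<and> K \<subseteq> V \<and> V \<subseteq> K' \<and> compact K'"
proof -
  define F where "F = {U :: 'a set. open U \<and> (\<exists>K. U \<subseteq> K \<and> compact K)}"
  have UF: "\<Union>F = UNIV" unfolding F_def by (rule relatively_compact_cover)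
  have op: "open U" if "U \<in> F" for U using that unfolding F_def by (elim CollectE conjE)
  obtain F' where F': "F' \<subseteq> F" "finite F'" "K \<subseteq> \<Union>F'"
    using op UF by (rule_tac compactE[OF assms, of F]) simp_all
  have "\<exists>K. U \<subseteq> K \<and> compact K" if "U \<in> F'" for U
    using subsetD[OF F'(1) that] unfolding F_def by (elim CollectE conjE)
  then obtain k where k: "\<And>U. U \<in> F' \<Longrightarrow> U \<subseteq> k U \<and> compact (k U)" by metis
  have "open (\<Union>F')" using op F'(1) by (intro open_Union) blast
  moreover have "compact (\<Union>U\<in>F'. k U)" using F'(2) k by (intro compact_UN) auto
  moreover have "\<Union>F' \<subseteq> (\<Union>U\<in>F'. k U)" using k by blast
  ultimately show ?thesis using F'(3) by blast
qed

text \<open>Urysohn's function in a metric space: the distance to the complement of a relatively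
  compact neighbourhood V of K, normalised by the sum of the distances to K and to that
  complement.\<close>

lemma cutoff_exists:
  fixes K :: "'a::radon_polish set"
  assumes "compact K"
  shows "\<exists>\<phi>\<in>\<D>1. (\<forall>t\<in>K. \<phi> t = 1) \<and> (\<forall>t. 0 \<le> \<phi> t \<and> \<phi> t \<le> 1)"
proof -
  obtain V K' where V: "open V" "K \<subseteq> V" "V \<subseteq> K'" "compact K'"
    using compact_neighbourhood[OF assms] by blast
  \<comment> \<open>\<open>infdist\<close> to the empty set is 0, so the quotient used in the third
    case is useless if K or the complement of V is empty. If V is everything, then T is compact and
    the constant 1 is a test function.\<close>
  consider "K = {}" | "V = UNIV" | "K \<noteq> {}" "V \<noteq> UNIV" by blast
  then show ?thesis
  proof cases
    case 1
    then show ?thesis by (intro bexI[of _ "\<lambda>_. 0"]) (auto simp: \<D>1_def)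
  next
    case 2
    then show ?thesis using V by (intro bexI[of _ "\<lambda>_. 1"]) (auto simp: \<D>1_def)
  next
    case 3
    define \<phi> where "\<phi> t = infdist t (- V) / (infdist t K + infdist t (- V))" for t
    have cl: "closed (- V)" "closed K" using V assms by (auto intro: compact_imp_closed)
    have pos: "infdist t K + infdist t (- V) > 0" for t
    proof -
      have "infdist t K \<noteq> 0 \<or> infdist t (- V) \<noteq> 0"
        using in_closed_iff_infdist_zero[OF cl(1), of t] in_closed_iff_infdist_zero[OF cl(2), of t] 3 V(2)
        by auto
      then show ?thesis
        using infdist_nonneg[of t K] infdist_nonneg[of t "-V"] by linarith
    qed
    have "continuous_on UNIV \<phi>" unfolding \<phi>_def
      using pos by (intro continuous_intros) (metis less_irrefl)
    moreover have "\<phi> t = 0" if "t \<notin> K'" for t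
      using that V in_closed_iff_infdist_zero[OF cl(1), of t] 3 by (auto simp: \<phi>_def)
    moreover have "\<phi> t = 1" if "t \<in> K" for t
      using pos[of t] that by (simp add: \<phi>_def)
    moreover have "0 \<le> \<phi> t \<and> \<phi> t \<le> 1" for t
      using pos[of t] by (simp add: \<phi>_def infdist_nonneg divide_le_eq)
    ultimately show ?thesis using V(4) by (intro bexI[of _ \<phi>]) (auto simp: \<D>1_def)
  qed
qed

lemma D1_cont: "f \<in> \<D>1 \<Longrightarrow> continuous_on UNIV f"
  by (simp add: \<D>1_def)

lemma D1_compact_support: "f \<in> \<D>1 \<Longrightarrow> \<exists>K. compact K \<and> (\<forall>t. t \<notin> K \<longrightarrow> f t = 0)"
  by (simp add: \<D>1_def)

lemma D1_mult_cont:
  assumes "continuous_on UNIV c" "f \<in> \<D>1"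
  shows "(\<lambda>t. c t * f t) \<in> \<D>1"
  using assms by (fastforce simp: \<D>1_def intro!: continuous_intros)

lemma D1_mult: "f \<in> \<D>1 \<Longrightarrow> g \<in> \<D>1 \<Longrightarrow> (\<lambda>t. f t * g t) \<in> \<D>1"
  using D1_mult_cont D1_cont by blast

lemma D1_bounded:
  assumes "f \<in> \<D>1"
  shows "\<exists>B\<ge>0. \<forall>t. \<bar>f t\<bar> \<le> B"
proof -
  obtain K where K: "compact K" "\<And>t. t \<notin> K \<Longrightarrow> f t = 0"
    using D1_compact_support[OF assms] by blast
  have "compact (f ` K)"
    using K(1) D1_cont[OF assms] compact_continuous_image continuous_on_subset by blast
  then obtain B where B: "\<And>t. t \<in> K \<Longrightarrow> \<bar>f t\<bar> \<le> B"
    using compact_imp_bounded[of "f ` K"] unfolding bounded_iff by auto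
  have "\<bar>f t\<bar> \<le> max B 0" for t
    using B[of t] K(2)[of t] by (cases "t \<in> K") auto
  then show ?thesis by (intro exI[of _ "max B 0"]) auto
qed

lemma D1_measurable [measurable_dest]: "f \<in> \<D>1 \<Longrightarrow> f \<in> borel_measurable borel"
  using D1_cont borel_measurable_continuous_onI by blast

lemma D1_integrable:
  fixes f :: "'a::radon_polish \<Rightarrow> real"
  assumes "f \<in> \<D>1"
  shows "integrable \<sigma> f"
proof -
  obtain K where K: "compact K" "\<And>t. t \<notin> K \<Longrightarrow> f t = 0"
    using D1_compact_support[OF assms] by blast
  obtain B where B: "\<And>t. \<bar>f t\<bar> \<le> B" using D1_bounded[OF assms] by blast
  show ?thesis
  proof (rule Bochner_Integration.integrable_bound[where f="\<lambda>t. B * indicator K t"])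
    show "integrable \<sigma> (\<lambda>t. B * indicator K t)"
      using K(1) \<sigma>_finite_compact[OF K(1)]
      by (intro integrable_mult_right integrable_real_indicator)
        (simp_all add: sets_\<sigma>_borel borel_closed compact_imp_closed)
    show "f \<in> borel_measurable \<sigma>"
      using assms D1_measurable by (simp add: measurable_\<sigma>_iff)
    show "AE t in \<sigma>. norm (f t) \<le> norm (B * indicator K t)"
      using B K(2) by (intro AE_I2) (auto simp: indicator_def intro: order_trans[OF _ abs_ge_self])
  qed
qed

section \<open>Test functions of several variables\<close>

abbreviation cube :: "nat \<Rightarrow> 'a set \<Rightarrow> (nat \<Rightarrow> 'a) set" where
  "cube n K \<equiv> Pi\<^sub>E {..<n} (\<lambda>_. K)"

definition supported_in :: "nat \<Rightarrow> 'a set \<Rightarrow> ((nat \<Rightarrow> 'a) \<Rightarrow> real) \<Rightarrow> bool" where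
  "supported_in n K f \<longleftrightarrow> (\<forall>\<omega>. \<omega> \<notin> cube n K \<longrightarrow> f \<omega> = 0)"

text \<open>Points of \<open>Tpow n\<close> are functions on all of \<open>nat\<close>. Written as a
  full product with the factor \<open>{undefined}\<close> from n on, the cube falls under
  Tychonoff's theorem.\<close>

lemma compact_cube:
  assumes "compact (K :: 'a::topological_space set)"
  shows "compact (cube n K)"
proof -
  have eq: "cube n K = Pi\<^sub>E UNIV (\<lambda>i. if i < n then K else {undefined})"
    by (auto simp: PiE_def extensional_def Pi_def split: if_splits)
  have "compactin (product_topology (\<lambda>_::nat. euclidean :: 'a topology) UNIV) (cube n K)"
    unfolding eq compactin_PiE using assms by auto
  then show ?thesis by (simp add: euclidean_product_topology)
qed

lemma cube_subset_Tpow: "cube n K \<subseteq> Tpow n"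
  by (auto simp: Tpow_def)

lemma cube_mono: "K \<subseteq> K' \<Longrightarrow> cube n K \<subseteq> cube n K'"
  by (rule PiE_mono) auto

lemma supported_in_mono: "supported_in n K f \<Longrightarrow> K \<subseteq> K' \<Longrightarrow> supported_in n K' f"
  using cube_mono[of K K' n] by (auto simp: supported_in_def)

text \<open>The union K of the coordinate projections of a compact set is compact, and its cube
  contains that set. Supports thus take the form of cubes, in which \<open>extends_tensors\<close>
  and all later bounds are stated.\<close>

lemma D_iff:
  fixes f :: "(nat \<Rightarrow> 'a::topological_space) \<Rightarrow> real"
  shows "f \<in> \<D> n \<longleftrightarrow> continuous_on (Tpow n) f \<and> (\<exists>K. compact K \<and> supported_in n K f)"
proof (intro iffI conjI; (elim conjE exE)?)
  assume f: "f \<in> \<D> n"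
  then show "continuous_on (Tpow n) f" by (simp add: \<D>_def)
  obtain C where C: "compact C" "C \<subseteq> Tpow n" "\<And>\<omega>. \<omega> \<notin> C \<Longrightarrow> f \<omega> = 0"
    using f by (auto simp: \<D>_def)
  define K where "K = (\<Union>i<n. (\<lambda>\<omega>. \<omega> i) ` C)"
  have "compact K" unfolding K_def
    using C(1) by (intro compact_UN finite_lessThan compact_continuous_image)
      (auto intro: continuous_on_subset[OF continuous_on_product_coordinates])
  moreover have "C \<subseteq> cube n K"
    using C(2) by (auto simp: K_def Tpow_def PiE_def Pi_def)
  ultimately show "\<exists>K. compact K \<and> supported_in n K f"
    using C(3) by (auto simp: supported_in_def)
next
  fix K assume "continuous_on (Tpow n) f" "compact K" "supported_in n K f"
  then show "f \<in> \<D> n"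
    using compact_cube[of K n] cube_subset_Tpow[of n K] by (auto simp: \<D>_def supported_in_def)
qed

lemma D_cont: "f \<in> \<D> n \<Longrightarrow> continuous_on (Tpow n) f"
  by (simp add: \<D>_def)

lemma D_zero_outside: "f \<in> \<D> n \<Longrightarrow> \<omega> \<notin> Tpow n \<Longrightarrow> f \<omega> = 0"
  by (auto simp: \<D>_def)

lemma D_supported: "f \<in> \<D> n \<Longrightarrow> \<exists>K. compact K \<and> supported_in n K f"
  by (simp add: D_iff)

lemma supported_lincomb:
  "supported_in n K f \<Longrightarrow> supported_in n K g \<Longrightarrow> supported_in n K (\<lambda>\<omega>. a * f \<omega> + b * g \<omega>)"
  by (simp add: supported_in_def)

lemma D_supported2:
  assumes "f \<in> \<D> n" "g \<in> \<D> n"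
  shows "\<exists>K. compact K \<and> supported_in n K f \<and> supported_in n K g"
proof -
  obtain K1 K2 where "compact K1" "supported_in n K1 f" "compact K2" "supported_in n K2 g"
    using assms[THEN D_supported] by blast
  then show ?thesis
    by (intro exI[of _ "K1 \<union> K2"]) (auto intro: supported_in_mono)
qed

lemma D_lincomb: "f \<in> \<D> n \<Longrightarrow> g \<in> \<D> n \<Longrightarrow> (\<lambda>\<omega>. a * f \<omega> + b * g \<omega>) \<in> \<D> n"
  using D_supported2[of f n g] D_cont[of f n] D_cont[of g n]
  by (auto simp: D_iff intro!: continuous_intros intro: supported_lincomb)

lemma D_zero [simp]: "(\<lambda>_. 0) \<in> \<D> n"
  by (auto simp: D_iff supported_in_def intro: exI[of _ "{}"])

lemma D_bounded:
  fixes f :: "(nat \<Rightarrow> 'a::topological_space) \<Rightarrow> real"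
  assumes "f \<in> \<D> n"
  shows "\<exists>B\<ge>0. \<forall>\<omega>. \<bar>f \<omega>\<bar> \<le> B"
proof -
  obtain C where C: "compact C" "C \<subseteq> Tpow n" "\<And>\<omega>. \<omega> \<notin> C \<Longrightarrow> f \<omega> = 0"
    using assms by (auto simp: \<D>_def)
  have "compact (f ` C)"
    using C D_cont[OF assms] compact_continuous_image continuous_on_subset by blast
  then obtain B where B: "\<And>\<omega>. \<omega> \<in> C \<Longrightarrow> \<bar>f \<omega>\<bar> \<le> B"
    using compact_imp_bounded[of "f ` C"] unfolding bounded_iff by auto
  have "\<bar>f \<omega>\<bar> \<le> max B 0" for \<omega>
    using B[of \<omega>] C(3)[of \<omega>] by (cases "\<omega> \<in> C") auto
  then show ?thesis by (intro exI[of _ "max B 0"]) auto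
qed

text \<open>f is continuous only on \<open>Tpow n\<close>; measurability on the whole function space
  comes from the compact set outside which f is 0. It allows composition with any measurable map
  into \<open>nat \<Rightarrow> 'a\<close>.\<close>

lemma D_measurable:
  fixes f :: "(nat \<Rightarrow> 'a::radon_polish) \<Rightarrow> real"
  assumes "f \<in> \<D> n"
  shows "f \<in> borel_measurable borel"
proof -
  obtain C where C: "compact C" "C \<subseteq> Tpow n" "\<And>\<omega>. \<omega> \<notin> C \<Longrightarrow> f \<omega> = 0"
    using assms by (auto simp: \<D>_def)
  have "(\<lambda>\<omega>. indicator C \<omega> *\<^sub>R f \<omega>) \<in> borel_measurable borel"
    using C(1) continuous_on_subset[OF D_cont[OF assms] C(2)]
    by (intro borel_measurable_continuous_on_indicator) (auto intro!: borel_closed compact_imp_closed)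
  moreover have "(\<lambda>\<omega>. indicator C \<omega> *\<^sub>R f \<omega>) = f"
    using C(3) by (intro ext) (auto simp: indicator_def)
  ultimately show ?thesis by simp
qed

text \<open>The Borel sets of a countable product of second countable spaces are generated by the
  coordinates.\<close>

lemma measurable_into_pow:
  fixes \<tau> :: "'b \<Rightarrow> nat \<Rightarrow> 'a::radon_polish"
  assumes "\<And>i. (\<lambda>x. \<tau> x i) \<in> measurable M borel"
  shows "\<tau> \<in> measurable M borel"
proof -
  have "\<tau> \<in> measurable M (Pi\<^sub>M UNIV (\<lambda>_. borel))"
    using assms
    by (intro measurable_PiM_single') auto
  then show ?thesis
    using measurable_cong_sets[OF refl sets_PiM_equal_borel] by blast
qed

lemma tensor_in_D:
  fixes fs :: "('a::topological_space \<Rightarrow> real) list"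
  assumes "set fs \<subseteq> \<D>1"
  shows "tensor fs \<in> \<D> (length fs)"
proof -
  have "\<forall>i<length fs. \<exists>K. compact K \<and> (\<forall>t. t \<notin> K \<longrightarrow> (fs ! i) t = 0)"
  proof (intro allI impI)
    fix i assume "i < length fs"
    then have "fs ! i \<in> \<D>1" using assms nth_mem by blast
    then show "\<exists>K. compact K \<and> (\<forall>t. t \<notin> K \<longrightarrow> (fs ! i) t = 0)" by (rule D1_compact_support)
  qed
  then obtain k where k: "\<And>i. i < length fs \<Longrightarrow> compact (k i) \<and> (\<forall>t. t \<notin> k i \<longrightarrow> (fs ! i) t = 0)"
    by metis
  define K where "K = (\<Union>i<length fs. k i)"
  have K: "compact K" unfolding K_def using k by (intro compact_UN) auto
  have "supported_in (length fs) K (tensor fs)"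
    unfolding supported_in_def
  proof (intro allI impI)
    fix \<omega> assume w: "\<omega> \<notin> cube (length fs) K"
    show "tensor fs \<omega> = 0"
    proof (cases "\<omega> \<in> Tpow (length fs)")
      case True
      then obtain i where i: "i < length fs" "\<omega> i \<notin> K"
        using w by (auto simp: Tpow_def PiE_def Pi_def)
      then have "(fs ! i) (\<omega> i) = 0" using k[of i] by (auto simp: K_def)
      then show ?thesis using i(1) by (auto simp: tensor_def)
    qed (simp add: tensor_def)
  qed
  moreover have "continuous_on (Tpow (length fs)) (tensor fs)"
  proof -
    have "continuous_on (Tpow (length fs)) (\<lambda>\<omega>. \<Prod>i<length fs. (fs ! i) (\<omega> i))"
    proof (intro continuous_on_prod)
      fix i assume "i \<in> {..<length fs}"
      then have "continuous_on UNIV (fs ! i)" using assms nth_mem D1_cont by blast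
      then show "continuous_on (Tpow (length fs)) (\<lambda>\<omega>. (fs ! i) (\<omega> i))"
        by (rule continuous_on_compose2)
          (auto intro: continuous_on_subset[OF continuous_on_product_coordinates])
    qed
    then show ?thesis
      by (rule continuous_on_cong[THEN iffD1, rotated 2]) (auto simp: tensor_def)
  qed
  ultimately show ?thesis using K by (auto simp: D_iff)
qed


section \<open>Tensor products and bounded linear maps of test functions\<close>

inductive_set tensor_span :: "nat \<Rightarrow> ((nat \<Rightarrow> 'a::topological_space) \<Rightarrow> real) set" for n where
  tensor: "length fs = n \<Longrightarrow> set fs \<subseteq> \<D>1 \<Longrightarrow> tensor fs \<in> tensor_span n"
| lincomb: "f \<in> tensor_span n \<Longrightarrow> g \<in> tensor_span n \<Longrightarrow> (\<lambda>\<omega>. a * f \<omega> + b * g \<omega>) \<in> tensor_span n"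

lemma tensor_span_subset: "f \<in> tensor_span n \<Longrightarrow> f \<in> \<D> n"
  by (induction rule: tensor_span.induct) (use tensor_in_D in \<open>auto intro: D_lincomb\<close>)

lemma tensor_mult:
  assumes "length fs = length gs"
  shows "tensor fs \<omega> * tensor gs \<omega> = tensor (map2 (\<lambda>f g t. f t * g t) fs gs) \<omega>"
  using assms by (simp add: tensor_def prod.distrib)

text \<open>Tensors multiply factorwise, which makes the span an algebra, as Stone-Weierstrass
  requires.\<close>

lemma tensor_span_mult:
  assumes "f \<in> tensor_span n" "g \<in> tensor_span n"
  shows "(\<lambda>\<omega>. f \<omega> * g \<omega>) \<in> tensor_span n"
  using assms
proof (induction arbitrary: g rule: tensor_span.induct)
  case (tensor fs)
  from tensor(3) show ?case
  proof (induction rule: tensor_span.induct)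
    case (tensor gs)
    have "set (map2 (\<lambda>f g t. f t * g t) fs gs) \<subseteq> \<D>1"
      using tensor(2) \<open>set fs \<subseteq> \<D>1\<close>
      by (auto intro!: D1_mult dest: set_zip_leftD set_zip_rightD)
    then have "tensor (map2 (\<lambda>f g t. f t * g t) fs gs) \<in> tensor_span n"
      using tensor(1) \<open>length fs = n\<close> by (intro tensor_span.tensor) simp_all
    then show ?case
      using tensor(1) \<open>length fs = n\<close> by (simp add: tensor_mult)
  next
    case (lincomb g h a b)
    then have "(\<lambda>\<omega>. a * (tensor fs \<omega> * g \<omega>) + b * (tensor fs \<omega> * h \<omega>)) \<in> tensor_span n"
      by (intro tensor_span.lincomb)
    then show ?case by (simp add: algebra_simps)
  qed
next
  case (lincomb f h a b)
  then have "(\<lambda>\<omega>. a * (f \<omega> * g \<omega>) + b * (h \<omega> * g \<omega>)) \<in> tensor_span n"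
    by (intro tensor_span.lincomb) auto
  then show ?case by (simp add: algebra_simps)
qed

lemma tensor_span_separates:
  fixes x y :: "nat \<Rightarrow> 'a::metric_space"
  assumes \<phi>: "\<phi> \<in> \<D>1" "\<And>t. t \<in> K \<Longrightarrow> \<phi> t = 1" and x: "x \<in> cube n K" and y: "y \<in> cube n K" and xy: "x \<noteq> y"
  shows "\<exists>g\<in>tensor_span n. g x \<noteq> g y"
proof -
  obtain i where i: "i < n" "x i \<noteq> y i"
    using x y xy by (meson PiE_ext lessThan_iff)
  \<comment> \<open>The distance to \<open>y i\<close> vanishes at y but not at x. The factor
    \<phi>, equal to 1 on K, makes it compactly supported.\<close>
  define fs where "fs = (replicate n \<phi>)[i := (\<lambda>t. dist t (y i) * \<phi> t)]"
  have "(\<lambda>t. dist t (y i) * \<phi> t) \<in> \<D>1"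
    using \<phi> by (intro D1_mult_cont continuous_intros)
  then have "set fs \<subseteq> \<D>1"
    using \<phi> set_update_subset_insert unfolding fs_def by fastforce
  moreover have "length fs = n" by (simp add: fs_def)
  moreover have "x \<in> Tpow n" "y \<in> Tpow n" using x y cube_subset_Tpow by blast+
  moreover have "(\<Prod>j<n. (fs ! j) (x j)) \<noteq> 0"
  proof -
    have "(fs ! j) (x j) \<noteq> 0" if "j < n" for j
    proof -
      have "x j \<in> K" using x that by (metis PiE_mem lessThan_iff)
      then have "\<phi> (x j) = 1" by (rule \<phi>(2))
      then show ?thesis using i that by (cases "j = i") (simp_all add: fs_def)
    qed
    then show ?thesis by (simp add: prod_zero_iff)
  qed
  moreover have "(\<Prod>j<n. (fs ! j) (y j)) = 0"
    using i by (intro prod_zero bexI[of _ i]) (simp_all add: fs_def)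
  ultimately have "tensor fs x \<noteq> tensor fs y" "tensor fs \<in> tensor_span n"
    by (simp_all only: tensor_def if_True tensor_span.tensor not_False_eq_True)
  then show ?thesis by blast
qed

lemma tensor_replicate_one:
  assumes "\<And>t. t \<in> K \<Longrightarrow> \<phi> t = 1" "\<omega> \<in> cube n K"
  shows "tensor (replicate n \<phi>) \<omega> = 1"
  using assms cube_subset_Tpow[of n K] by (auto simp: tensor_def intro!: prod.neutral)

lemma tensor_replicate_zero:
  assumes "\<And>t. t \<notin> K \<Longrightarrow> \<phi> t = 0" "\<omega> \<notin> cube n K"
  shows "tensor (replicate n \<phi>) \<omega> = 0"
proof (cases "\<omega> \<in> Tpow n")
  case True
  then obtain i where "i < n" "\<omega> i \<notin> K" using assms(2) by (auto simp: Tpow_def PiE_def Pi_def)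
  then have "(\<Prod>j<n. (replicate n \<phi> ! j) (\<omega> j)) = 0"
    using assms(1)[of "\<omega> i"] by (intro prod_zero bexI[of _ i]) simp_all
  then show ?thesis by (simp add: tensor_def)
qed (simp add: tensor_def)

text \<open>Stone-Weierstrass approximates f on a compact cube only, but the continuity clause of
  \<open>extends_tensors\<close> wants approximants that vanish outside one fixed cube. Multiplying
  them by the tensor power of a cutoff \<phi> enforces this and does not worsen the error, since f
  equals its product with that tensor power.\<close>

lemma tensor_span_dense:
  fixes f :: "(nat \<Rightarrow> 'a::radon_polish) \<Rightarrow> real"
  assumes f: "f \<in> \<D> n"
  shows "\<exists>K. compact K \<and> supported_in n K f \<and>
     (\<forall>e>0. \<exists>g\<in>tensor_span n. supported_in n K g \<and> (\<forall>\<omega>. \<bar>f \<omega> - g \<omega>\<bar> < e))"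
proof -
  obtain K0 where K0: "compact K0" "supported_in n K0 f" using D_supported[OF f] by blast
  obtain \<phi> where \<phi>: "\<phi> \<in> \<D>1" "\<forall>t\<in>K0. \<phi> t = 1" "\<forall>t. 0 \<le> \<phi> t \<and> \<phi> t \<le> 1"
    using cutoff_exists[OF K0(1)] by blast
  obtain K1 where K1: "compact K1" "\<forall>t. t \<notin> K1 \<longrightarrow> \<phi> t = 0"
    using D1_compact_support[OF \<phi>(1)] by blast
  define K where "K = K0 \<union> K1"
  have K: "compact K" using K0 K1 by (auto simp: K_def)
  have \<phi>K: "\<And>t. t \<notin> K \<Longrightarrow> \<phi> t = 0" using K1 by (simp add: K_def)
  obtain \<psi> where \<psi>: "\<psi> \<in> \<D>1" "\<And>t. t \<in> K \<Longrightarrow> \<psi> t = 1"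
    using cutoff_exists[OF K] by blast
  let ?S = "cube n K"
  let ?R = "{h. \<exists>g\<in>tensor_span n. \<forall>\<omega>\<in>?S. h \<omega> = g \<omega>}"
  let ?T = "tensor (replicate n \<phi>)"
  interpret function_ring_on ?R ?S
  proof
    show "compact ?S" using K by (rule compact_cube)
    show "continuous_on ?S h" if h: "h \<in> ?R" for h
    proof -
      obtain g where g: "g \<in> tensor_span n" "\<forall>\<omega>\<in>?S. h \<omega> = g \<omega>"
        using h by (elim CollectE bexE)
      have "continuous_on ?S g"
        by (rule continuous_on_subset[OF D_cont[OF tensor_span_subset[OF g(1)]] cube_subset_Tpow])
      then show ?thesis using g(2) continuous_on_cong[of ?S ?S h g] by simp
    qed
    show "(\<lambda>x. h x + h' x) \<in> ?R" if h: "h \<in> ?R" "h' \<in> ?R" for h h'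
    proof -
      obtain g g' where g: "g \<in> tensor_span n" "\<forall>\<omega>\<in>?S. h \<omega> = g \<omega>"
        "g' \<in> tensor_span n" "\<forall>\<omega>\<in>?S. h' \<omega> = g' \<omega>" using h by (elim CollectE bexE)
      show ?thesis using tensor_span.lincomb[OF g(1,3), of 1 1] g(2,4)
        by (intro CollectI bexI[of _ "\<lambda>\<omega>. 1 * g \<omega> + 1 * g' \<omega>"]) simp_all
    qed
    show "(\<lambda>x. h x * h' x) \<in> ?R" if h: "h \<in> ?R" "h' \<in> ?R" for h h'
    proof -
      obtain g g' where g: "g \<in> tensor_span n" "\<forall>\<omega>\<in>?S. h \<omega> = g \<omega>"
        "g' \<in> tensor_span n" "\<forall>\<omega>\<in>?S. h' \<omega> = g' \<omega>" using h by (elim CollectE bexE)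
      show ?thesis using tensor_span_mult[OF g(1,3)] g(2,4)
        by (intro CollectI bexI[of _ "\<lambda>\<omega>. g \<omega> * g' \<omega>"]) simp_all
    qed
    \<comment> \<open>Constants have no compact support in general; on the cube they agree with
      multiples of the tensor power of \<psi>, which is 1 there. This is why \<open>?R\<close> asks
      for agreement on the cube only.\<close>
    show "(\<lambda>_. c) \<in> ?R" for c
    proof -
      have "tensor (replicate n \<psi>) \<in> tensor_span n"
        using \<psi>(1) by (intro tensor_span.tensor) auto
      from tensor_span.lincomb[OF this this, of c 0] show ?thesis
        using tensor_replicate_one[of K \<psi> _ n, OF \<psi>(2)]
        by (intro CollectI bexI[of _ "\<lambda>\<omega>. c * tensor (replicate n \<psi>) \<omega> + 0 * tensor (replicate n \<psi>) \<omega>"])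
          simp_all
    qed
    show "\<exists>h\<in>?R. h x \<noteq> h y" if xy: "x \<in> ?S" "y \<in> ?S" "x \<noteq> y" for x y
    proof -
      obtain g where g: "g \<in> tensor_span n" "g x \<noteq> g y"
        using tensor_span_separates[of \<psi> K, OF \<psi> xy] by blast
      then show ?thesis by (intro bexI[of _ g] CollectI bexI[of _ g]) simp_all
    qed
  qed
  have "\<exists>g\<in>tensor_span n. supported_in n K g \<and> (\<forall>\<omega>. \<bar>f \<omega> - g \<omega>\<bar> < e)" if e: "e > 0" for e :: real
  proof -
    have "continuous_on ?S f" by (rule continuous_on_subset[OF D_cont[OF f] cube_subset_Tpow])
    from Stone_Weierstrass_basic[OF this e]
    obtain h where h: "h \<in> ?R" "\<forall>\<omega>\<in>?S. \<bar>f \<omega> - h \<omega>\<bar> < e" by (elim bexE)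
    obtain g where g': "g \<in> tensor_span n" "\<forall>\<omega>\<in>?S. h \<omega> = g \<omega>"
      using h(1) by (elim CollectE bexE)
    have g: "g \<in> tensor_span n" "\<And>\<omega>. \<omega> \<in> ?S \<Longrightarrow> \<bar>f \<omega> - g \<omega>\<bar> < e"
      using g' h(2) by simp_all
    have T: "?T \<in> tensor_span n" using \<phi>(1) by (intro tensor_span.tensor) auto
    have T0: "?T \<omega> = 0" if "\<omega> \<notin> ?S" for \<omega> using tensor_replicate_zero[OF \<phi>K that] .
    have T1: "0 \<le> ?T \<omega> \<and> ?T \<omega> \<le> 1" for \<omega>
      using \<phi>(3) by (auto simp: tensor_def intro!: prod_nonneg prod_le_1)
    have fT: "f \<omega> = f \<omega> * ?T \<omega>" for \<omega>
    proof (cases "\<omega> \<in> cube n K0")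
      case True
      then show ?thesis using tensor_replicate_one[of K0 \<phi> \<omega> n] \<phi>(2) by simp
    next
      case False
      then show ?thesis using K0(2) by (simp add: supported_in_def)
    qed
    have "\<bar>f \<omega> - g \<omega> * ?T \<omega>\<bar> < e" for \<omega>
    proof (cases "\<omega> \<in> ?S")
      case True
      have "\<bar>f \<omega> - g \<omega> * ?T \<omega>\<bar> = \<bar>f \<omega> - g \<omega>\<bar> * ?T \<omega>"
        using fT[of \<omega>] T1[of \<omega>] by (metis abs_mult abs_of_nonneg left_diff_distrib)
      also have "\<dots> \<le> \<bar>f \<omega> - g \<omega>\<bar> * 1" using T1 by (intro mult_left_mono) auto
      finally show ?thesis using g(2)[OF True] by simp
    next
      case False
      then show ?thesis using T0[OF False] fT[of \<omega>] e by simp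
    qed
    moreover have "supported_in n K (\<lambda>\<omega>. g \<omega> * ?T \<omega>)" using T0 by (simp add: supported_in_def)
    ultimately show ?thesis using tensor_span_mult[OF g(1) T]
      by (intro bexI[of _ "\<lambda>\<omega>. g \<omega> * ?T \<omega>"] conjI allI) simp_all
  qed
  moreover have "supported_in n K f" using supported_in_mono[OF K0(2), of K] by (simp add: K_def)
  ultimately show ?thesis using K by blast
qed

text \<open>Continuity for the inductive limit topology of C_0(T^n): one constant for each compact
  K. An arbitrary bound B takes the place of the sup norm, so that no supremum has to be
  formed.\<close>

definition bdd_fun :: "nat \<Rightarrow> (((nat \<Rightarrow> 'a::radon_polish) \<Rightarrow> real) \<Rightarrow> 'b::real_normed_vector) \<Rightarrow> bool" where
  "bdd_fun n M \<longleftrightarrow>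
     (\<forall>f\<in>\<D> n. \<forall>g\<in>\<D> n. \<forall>a b. M (\<lambda>\<omega>. a * f \<omega> + b * g \<omega>) = a *\<^sub>R M f + b *\<^sub>R M g) \<and>
     (\<forall>K. compact K \<longrightarrow> (\<exists>C. \<forall>f\<in>\<D> n. \<forall>B. supported_in n K f \<longrightarrow> (\<forall>\<omega>. \<bar>f \<omega>\<bar> \<le> B) \<longrightarrow> norm (M f) \<le> C * B))"

text \<open>The same notion for maps between spaces of test functions. The new support K' has to be
  uniform in f, since otherwise composition with a \<open>bdd_fun\<close> would not be
  bounded.\<close>

definition bdd_map :: "nat \<Rightarrow> nat \<Rightarrow> (((nat \<Rightarrow> 'a::radon_polish) \<Rightarrow> real) \<Rightarrow> (nat \<Rightarrow> 'a) \<Rightarrow> real) \<Rightarrow> bool" where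
  "bdd_map n m \<Phi> \<longleftrightarrow> (\<forall>f\<in>\<D> n. \<Phi> f \<in> \<D> m) \<and>
     (\<forall>f\<in>\<D> n. \<forall>g\<in>\<D> n. \<forall>a b. \<Phi> (\<lambda>\<omega>. a * f \<omega> + b * g \<omega>) = (\<lambda>\<omega>. a * \<Phi> f \<omega> + b * \<Phi> g \<omega>)) \<and>
     (\<forall>K. compact K \<longrightarrow> (\<exists>K' C. compact K' \<and> (\<forall>f\<in>\<D> n. \<forall>B. supported_in n K f \<longrightarrow> (\<forall>\<omega>. \<bar>f \<omega>\<bar> \<le> B) \<longrightarrow>
        supported_in m K' (\<Phi> f) \<and> (\<forall>\<omega>. \<bar>\<Phi> f \<omega>\<bar> \<le> C * B))))"

lemma bdd_fun_lincomb:
  "bdd_fun n M \<Longrightarrow> f \<in> \<D> n \<Longrightarrow> g \<in> \<D> n \<Longrightarrow> M (\<lambda>\<omega>. a * f \<omega> + b * g \<omega>) = a *\<^sub>R M f + b *\<^sub>R M g"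
  by (simp add: bdd_fun_def)

lemma bdd_fun_bound:
  "bdd_fun n M \<Longrightarrow> compact K \<Longrightarrow>
    \<exists>C. \<forall>f\<in>\<D> n. \<forall>B. supported_in n K f \<longrightarrow> (\<forall>\<omega>. \<bar>f \<omega>\<bar> \<le> B) \<longrightarrow> norm (M f) \<le> C * B"
  by (simp add: bdd_fun_def)

lemma bdd_map_bound:
  "bdd_map n m \<Phi> \<Longrightarrow> compact K \<Longrightarrow>
    \<exists>K' C. compact K' \<and> (\<forall>f\<in>\<D> n. \<forall>B. supported_in n K f \<longrightarrow> (\<forall>\<omega>. \<bar>f \<omega>\<bar> \<le> B) \<longrightarrow>
        supported_in m K' (\<Phi> f) \<and> (\<forall>\<omega>. \<bar>\<Phi> f \<omega>\<bar> \<le> C * B))"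
  by (simp add: bdd_map_def)

lemma bdd_map_in: "bdd_map n m \<Phi> \<Longrightarrow> f \<in> \<D> n \<Longrightarrow> \<Phi> f \<in> \<D> m"
  by (simp add: bdd_map_def)

lemma bdd_map_lincomb:
  "bdd_map n m \<Phi> \<Longrightarrow> f \<in> \<D> n \<Longrightarrow> g \<in> \<D> n \<Longrightarrow>
    \<Phi> (\<lambda>\<omega>. a * f \<omega> + b * g \<omega>) = (\<lambda>\<omega>. a * \<Phi> f \<omega> + b * \<Phi> g \<omega>)"
  by (simp add: bdd_map_def)

lemma bdd_fun_zero [simp]: "bdd_fun n (\<lambda>_. 0)"
  by (auto simp: bdd_fun_def intro: exI[of _ 0])

lemma bdd_fun_compose:
  assumes M: "bdd_fun m M" and \<Phi>: "bdd_map n m \<Phi>"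
  shows "bdd_fun n (\<lambda>f. M (\<Phi> f))"
  unfolding bdd_fun_def
proof (intro conjI ballI allI impI)
  show "M (\<Phi> (\<lambda>\<omega>. a * f \<omega> + b * g \<omega>)) = a *\<^sub>R M (\<Phi> f) + b *\<^sub>R M (\<Phi> g)" if "f \<in> \<D> n" "g \<in> \<D> n" for f g a b
    using bdd_map_lincomb[OF \<Phi> that] bdd_fun_lincomb[OF M] bdd_map_in[OF \<Phi>] that by simp
  fix K :: "'a set" assume "compact K"
  then obtain K' C where KC: "compact K'" "\<forall>f\<in>\<D> n. \<forall>B. supported_in n K f \<longrightarrow> (\<forall>\<omega>. \<bar>f \<omega>\<bar> \<le> B) \<longrightarrow>
        supported_in m K' (\<Phi> f) \<and> (\<forall>\<omega>. \<bar>\<Phi> f \<omega>\<bar> \<le> C * B)"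
    using bdd_map_bound[OF \<Phi>] by meson
  obtain C' where C': "\<forall>f\<in>\<D> m. \<forall>B. supported_in m K' f \<longrightarrow> (\<forall>\<omega>. \<bar>f \<omega>\<bar> \<le> B) \<longrightarrow> norm (M f) \<le> C' * B"
    using bdd_fun_bound[OF M KC(1)] by blast
  have "norm (M (\<Phi> f)) \<le> (C' * C) * B" if "f \<in> \<D> n" "supported_in n K f" "\<forall>\<omega>. \<bar>f \<omega>\<bar> \<le> B" for f B
    using C'[rule_format, of "\<Phi> f" "C * B"] KC(2) that bdd_map_in[OF \<Phi> that(1)] by (simp add: mult.assoc)
  then show "\<exists>C. \<forall>f\<in>\<D> n. \<forall>B. supported_in n K f \<longrightarrow> (\<forall>\<omega>. \<bar>f \<omega>\<bar> \<le> B) \<longrightarrow> norm (M (\<Phi> f)) \<le> C * B"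
    by blast
qed

lemma bdd_fun_add:
  assumes M: "bdd_fun n M" and M': "bdd_fun n M'"
  shows "bdd_fun n (\<lambda>f. M f + M' f)"
  unfolding bdd_fun_def
proof (intro conjI ballI allI impI)
  show "M (\<lambda>\<omega>. a * f \<omega> + b * g \<omega>) + M' (\<lambda>\<omega>. a * f \<omega> + b * g \<omega>) = a *\<^sub>R (M f + M' f) + b *\<^sub>R (M g + M' g)"
    if "f \<in> \<D> n" "g \<in> \<D> n" for f g a b
    using bdd_fun_lincomb[OF M that] bdd_fun_lincomb[OF M' that] by (simp add: algebra_simps)
  fix K :: "'a set" assume K: "compact K"
  obtain C where C: "\<forall>f\<in>\<D> n. \<forall>B. supported_in n K f \<longrightarrow> (\<forall>\<omega>. \<bar>f \<omega>\<bar> \<le> B) \<longrightarrow> norm (M f) \<le> C * B"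
    using bdd_fun_bound[OF M K] by blast
  obtain C' where C': "\<forall>f\<in>\<D> n. \<forall>B. supported_in n K f \<longrightarrow> (\<forall>\<omega>. \<bar>f \<omega>\<bar> \<le> B) \<longrightarrow> norm (M' f) \<le> C' * B"
    using bdd_fun_bound[OF M' K] by blast
  have "norm (M f + M' f) \<le> (C + C') * B" if "f \<in> \<D> n" "supported_in n K f" "\<forall>\<omega>. \<bar>f \<omega>\<bar> \<le> B" for f B
    using C C' that norm_triangle_mono[of "M f" "C * B" "M' f" "C' * B"] by (simp add: distrib_right)
  then show "\<exists>C. \<forall>f\<in>\<D> n. \<forall>B. supported_in n K f \<longrightarrow> (\<forall>\<omega>. \<bar>f \<omega>\<bar> \<le> B) \<longrightarrow> norm (M f + M' f) \<le> C * B"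
    by blast
qed

lemma bdd_fun_sum:
  "finite I \<Longrightarrow> (\<And>i. i \<in> I \<Longrightarrow> bdd_fun n (M i)) \<Longrightarrow> bdd_fun n (\<lambda>f. \<Sum>i\<in>I. M i f)"
  by (induction I rule: finite_induct) (auto intro: bdd_fun_add)

lemma bdd_fun_bounded_linear:
  assumes M: "bdd_fun n M" and L: "bounded_linear L"
  shows "bdd_fun n (\<lambda>f. L (M f))"
  unfolding bdd_fun_def
proof (intro conjI ballI allI impI)
  interpret L: bounded_linear L by fact
  show "L (M (\<lambda>\<omega>. a * f \<omega> + b * g \<omega>)) = a *\<^sub>R L (M f) + b *\<^sub>R L (M g)"
    if "f \<in> \<D> n" "g \<in> \<D> n" for f g a b
    using bdd_fun_lincomb[OF M that] by (simp add: L.add L.scaleR)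
  obtain D where D: "D \<ge> 0" "\<And>x. norm (L x) \<le> norm x * D" using L.nonneg_bounded by blast
  fix K :: "'a set" assume K: "compact K"
  obtain C where C: "\<forall>f\<in>\<D> n. \<forall>B. supported_in n K f \<longrightarrow> (\<forall>\<omega>. \<bar>f \<omega>\<bar> \<le> B) \<longrightarrow> norm (M f) \<le> C * B"
    using bdd_fun_bound[OF M K] by blast
  have "norm (L (M f)) \<le> (C * D) * B" if "f \<in> \<D> n" "supported_in n K f" "\<forall>\<omega>. \<bar>f \<omega>\<bar> \<le> B" for f B
  proof -
    have "norm (L (M f)) \<le> norm (M f) * D" by (rule D)
    also have "\<dots> \<le> (C * B) * D" using C that D(1) by (intro mult_right_mono) auto
    finally show ?thesis by (simp add: mult_ac)
  qed
  then show "\<exists>C. \<forall>f\<in>\<D> n. \<forall>B. supported_in n K f \<longrightarrow> (\<forall>\<omega>. \<bar>f \<omega>\<bar> \<le> B) \<longrightarrow> norm (L (M f)) \<le> C * B"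
    by blast
qed

text \<open>By linearity the bound for f k - h gives convergence. Uniform convergence is assumed on
  \<open>Tpow n\<close> only, but all functions in \<D> n vanish outside it.\<close>

lemma bdd_fun_extends_tensors:
  fixes M :: "((nat \<Rightarrow> 'a::radon_polish) \<Rightarrow> real) \<Rightarrow> 'b::real_normed_vector"
  assumes M: "bdd_fun n M" and m: "\<And>fs. length fs = n \<Longrightarrow> set fs \<subseteq> \<D>1 \<Longrightarrow> M (tensor fs) = m fs"
  shows "extends_tensors n m (\<lambda>f. if f \<in> \<D> n then M f else 0)"
  unfolding extends_tensors_def
proof (intro conjI allI impI ballI)
  fix fs :: "('a \<Rightarrow> real) list" assume "length fs = n \<and> set fs \<subseteq> \<D>1"
  then show "(if tensor fs \<in> \<D> n then M (tensor fs) else 0) = m fs"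
    using m tensor_in_D[of fs] by auto
next
  fix f g :: "(nat \<Rightarrow> 'a) \<Rightarrow> real" and a b assume "f \<in> \<D> n" "g \<in> \<D> n"
  then show "(if (\<lambda>\<omega>. a * f \<omega> + b * g \<omega>) \<in> \<D> n then M (\<lambda>\<omega>. a * f \<omega> + b * g \<omega>) else 0) =
       a *\<^sub>R (if f \<in> \<D> n then M f else 0) + b *\<^sub>R (if g \<in> \<D> n then M g else 0)"
    using bdd_fun_lincomb[OF M] by (auto simp: D_lincomb)
next
  fix K :: "'a set" and f :: "nat \<Rightarrow> (nat \<Rightarrow> 'a) \<Rightarrow> real" and h :: "(nat \<Rightarrow> 'a) \<Rightarrow> real"
  assume A: "compact K \<and> h \<in> \<D> n \<and> (\<forall>k. f k \<in> \<D> n) \<and>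
    (\<forall>\<omega>. \<omega> \<notin> cube n K \<longrightarrow> h \<omega> = 0 \<and> (\<forall>k. f k \<omega> = 0)) \<and> uniform_limit (Tpow n) f h sequentially"
  obtain C where C: "\<And>f B. f\<in>\<D> n \<Longrightarrow> supported_in n K f \<Longrightarrow> (\<And>\<omega>. \<bar>f \<omega>\<bar> \<le> B) \<Longrightarrow> norm (M f) \<le> C * B"
    using bdd_fun_bound[OF M, of K] A by blast
  have "(\<lambda>k. M (f k)) \<longlonglongrightarrow> M h"
    unfolding tendsto_iff
  proof (intro allI impI)
    fix e :: real assume e: "e > 0"
    \<comment> \<open>The constant C may be zero or negative, hence the denominator \<bar>C\<bar> +
      1.\<close>
    define d where "d = e / (\<bar>C\<bar> + 1)"
    have d: "d > 0" using e by (simp add: d_def)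
    have "C * d \<le> \<bar>C\<bar> * d" using d by (intro mult_right_mono) auto
    also have "\<dots> < e" using e by (simp add: d_def divide_less_eq field_simps)
    finally have Cd: "C * d < e" .
    have "\<forall>\<^sub>F k in sequentially. \<forall>\<omega>\<in>Tpow n. dist (f k \<omega>) (h \<omega>) < d"
      using A d unfolding uniform_limit_iff by blast
    then show "\<forall>\<^sub>F k in sequentially. dist (M (f k)) (M h) < e"
    proof eventually_elim
      case (elim k)
      have "\<bar>1 * f k \<omega> + (-1) * h \<omega>\<bar> \<le> d" for \<omega>
      proof (cases "\<omega> \<in> Tpow n")
        case True
        then have "dist (f k \<omega>) (h \<omega>) < d" using elim by blast
        then show ?thesis by (simp add: dist_real_def)
      next
        case False
        then have "f k \<omega> = 0" "h \<omega> = 0" using A D_zero_outside by blast+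
        then show ?thesis using d by simp
      qed
      moreover have "supported_in n K (\<lambda>\<omega>. 1 * f k \<omega> + (-1) * h \<omega>)"
        using A by (simp add: supported_in_def)
      moreover have "(\<lambda>\<omega>. 1 * f k \<omega> + (-1) * h \<omega>) \<in> \<D> n" using A by (intro D_lincomb) auto
      ultimately have "norm (M (\<lambda>\<omega>. 1 * f k \<omega> + (-1) * h \<omega>)) \<le> C * d" by (intro C)
      moreover have "M (\<lambda>\<omega>. 1 * f k \<omega> + (-1) * h \<omega>) = M (f k) - M h"
        using A by (subst bdd_fun_lincomb[OF M]) auto
      ultimately show ?case using Cd by (simp add: dist_norm)
    qed
  qed
  then show "(\<lambda>k. if f k \<in> \<D> n then M (f k) else 0) \<longlonglongrightarrow> (if h \<in> \<D> n then M h else 0)"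
    using A by simp
qed simp

lemma extends_tensors_tendsto:
  assumes "extends_tensors n m M"
    and "compact K \<and> h \<in> \<D> n \<and> (\<forall>k. f k \<in> \<D> n) \<and>
      (\<forall>\<omega>. \<omega> \<notin> cube n K \<longrightarrow> h \<omega> = 0 \<and> (\<forall>k. f k \<omega> = 0)) \<and> uniform_limit (Tpow n) f h sequentially"
  shows "(\<lambda>k. M (f k)) \<longlonglongrightarrow> M h"
proof -
  have "\<forall>K f h. compact K \<and> h \<in> \<D> n \<and> (\<forall>k. f k \<in> \<D> n) \<and>
      (\<forall>\<omega>. \<omega> \<notin> cube n K \<longrightarrow> h \<omega> = 0 \<and> (\<forall>k. f k \<omega> = 0)) \<and>
      uniform_limit (Tpow n) f h sequentially \<longrightarrow> (\<lambda>k. M (f k)) \<longlonglongrightarrow> M h"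
    using assms(1) unfolding extends_tensors_def by (elim conjE)
  from this[THEN spec, THEN spec, THEN spec, THEN mp, OF assms(2)] show ?thesis .
qed

lemma extends_tensors_unique:
  fixes M M' :: "((nat \<Rightarrow> 'a::radon_polish) \<Rightarrow> real) \<Rightarrow> 'b::real_normed_vector"
  assumes M: "extends_tensors n m M" and M': "extends_tensors n m M'"
  shows "M = M'"
proof
  fix f
  show "M f = M' f"
  proof (cases "f \<in> \<D> n")
    case False
    then show ?thesis using M M' by (simp add: extends_tensors_def)
  next
    case f: True
    have span: "M g = M' g" if "g \<in> tensor_span n" for g
      using that
    proof (induction rule: tensor_span.induct)
      case (tensor fs)
      then show ?case using M M' by (simp add: extends_tensors_def)
    next
      case (lincomb g h a b)
      then show ?case using M M' tensor_span_subset[of g n] tensor_span_subset[of h n]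
        by (simp add: extends_tensors_def)
    qed
    obtain K where K: "compact K" "supported_in n K f"
      "\<forall>e>0. \<exists>g\<in>tensor_span n. supported_in n K g \<and> (\<forall>\<omega>. \<bar>f \<omega> - g \<omega>\<bar> < e)"
      using tensor_span_dense[OF f] by blast
    have "\<exists>g\<in>tensor_span n. supported_in n K g \<and> (\<forall>\<omega>. \<bar>f \<omega> - g \<omega>\<bar> < 1 / real (Suc k))" for k
      using K(3) by simp
    then obtain g where g: "\<And>k. g k \<in> tensor_span n" "\<And>k. supported_in n K (g k)"
      "\<And>k \<omega>. \<bar>f \<omega> - g k \<omega>\<bar> < 1 / real (Suc k)" by metis
    have "uniform_limit (Tpow n) g f sequentially"
      unfolding uniform_limit_iff
    proof (intro allI impI)
      fix e :: real assume "e > 0"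
      then have "\<forall>\<^sub>F k in sequentially. 1 / real (Suc k) < e"
        using order_tendstoD(2)[OF LIMSEQ_inverse_real_of_nat] by (simp add: inverse_eq_divide)
      then show "\<forall>\<^sub>F k in sequentially. \<forall>\<omega>\<in>Tpow n. dist (g k \<omega>) (f \<omega>) < e"
      proof eventually_elim
        case (elim k)
        show ?case
        proof
          fix \<omega>
          have "dist (g k \<omega>) (f \<omega>) < 1 / real (Suc k)"
            using g(3)[of \<omega> k] unfolding dist_real_def by (subst abs_minus_commute)
          then show "dist (g k \<omega>) (f \<omega>) < e" using elim by (rule less_trans)
        qed
      qed
    qed
    moreover have "\<forall>k. g k \<in> \<D> n" using g(1) tensor_span_subset by blast
    ultimately have *: "compact K \<and> f \<in> \<D> n \<and> (\<forall>k. g k \<in> \<D> n) \<and>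
      (\<forall>\<omega>. \<omega> \<notin> cube n K \<longrightarrow> f \<omega> = 0 \<and> (\<forall>k. g k \<omega> = 0)) \<and> uniform_limit (Tpow n) g f sequentially"
      using K(1,2) f g(2) unfolding supported_in_def by simp
    note extends_tensors_tendsto[OF M *] extends_tensors_tendsto[OF M' *]
    then show ?thesis using span[OF g(1)] LIMSEQ_unique by simp
  qed
qed

text \<open>This evaluates the definite descriptions in \<open>monomial\<close> and
  \<open>P\<close>: any bounded candidate with the right values on tensors is the extension.\<close>

lemma extend_tensors_eq:
  fixes M :: "((nat \<Rightarrow> 'a::radon_polish) \<Rightarrow> real) \<Rightarrow> 'b::real_normed_vector"
  assumes M: "bdd_fun n M" and m: "\<And>fs. length fs = n \<Longrightarrow> set fs \<subseteq> \<D>1 \<Longrightarrow> M (tensor fs) = m fs"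
    and f: "f \<in> \<D> n"
  shows "extend_tensors n m f = M f"
proof -
  have e: "extends_tensors n m (\<lambda>f. if f \<in> \<D> n then M f else 0)"
    using M m by (rule bdd_fun_extends_tensors)
  have "extend_tensors n m = (\<lambda>f. if f \<in> \<D> n then M f else 0)"
    unfolding extend_tensors_def
  proof (rule the_equality)
    show "extends_tensors n m (\<lambda>f. if f \<in> \<D> n then M f else 0)" by (rule e)
    show "M' = (\<lambda>f. if f \<in> \<D> n then M f else 0)" if "extends_tensors n m M'" for M'
      using that e by (rule extends_tensors_unique)
  qed
  then show ?thesis using f by simp
qed

text \<open>The principle behind the final passage from products to arbitrary coefficients. Both
  maps are extensions of the values of M on tensors, hence equal.\<close>

lemma bdd_fun_eq:
  fixes M M' :: "((nat \<Rightarrow> 'a::radon_polish) \<Rightarrow> real) \<Rightarrow> 'b::real_normed_vector"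
  assumes "bdd_fun n M" "bdd_fun n M'"
    and "\<And>fs. length fs = n \<Longrightarrow> set fs \<subseteq> \<D>1 \<Longrightarrow> M (tensor fs) = M' (tensor fs)"
    and "f \<in> \<D> n"
  shows "M f = M' f"
  using extend_tensors_eq[OF assms(1), of "\<lambda>fs. M (tensor fs)", OF refl assms(4)]
    extend_tensors_eq[OF assms(2), of "\<lambda>fs. M (tensor fs)", OF _ assms(4)] assms(3) by simp


section \<open>Integral operators on Fock space\<close>

definition join :: "nat \<Rightarrow> (nat \<Rightarrow> 'a) \<Rightarrow> (nat \<Rightarrow> 'a) \<Rightarrow> nat \<Rightarrow> 'a" where
  "join k x z i = (if i < k then x i else z (i - k))"

definition drop_pt :: "nat \<Rightarrow> (nat \<Rightarrow> 'a) \<Rightarrow> nat \<Rightarrow> 'a" where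
  "drop_pt k \<omega> i = \<omega> (i + k)"

lemma Tpow_iff: "\<omega> \<in> Tpow n \<longleftrightarrow> (\<forall>i\<ge>n. \<omega> i = undefined)"
  by (auto simp: Tpow_def PiE_def extensional_def)

lemma join_in_Tpow: "z \<in> Tpow r \<Longrightarrow> join k x z \<in> Tpow (k + r)"
  by (simp add: Tpow_iff join_def)

lemma drop_pt_in_Tpow: "\<omega> \<in> Tpow (k + r) \<Longrightarrow> drop_pt k \<omega> \<in> Tpow r"
  by (simp add: Tpow_iff drop_pt_def)

lemma drop_pt_join [simp]: "drop_pt k (join k x z) = z"
  by (simp add: drop_pt_def join_def fun_eq_iff)

lemma sigma_finite_\<sigma>pow: "sigma_finite_measure (\<sigma>pow n :: (nat \<Rightarrow> 'a::radon_polish) measure)"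
proof -
  interpret product_sigma_finite "\<lambda>_::nat. \<sigma> :: 'a measure" by (rule product_sigma_finite_\<sigma>)
  show ?thesis unfolding \<sigma>pow_def by (rule sigma_finite) simp
qed

lemma pair_sigma_finite_\<sigma>pow:
  "pair_sigma_finite (\<sigma>pow n :: (nat \<Rightarrow> 'a::radon_polish) measure) (\<sigma>pow m :: (nat \<Rightarrow> 'a) measure)"
  by (simp add: pair_sigma_finite_def sigma_finite_\<sigma>pow)

lemma measurable_coordinate: "i < n \<Longrightarrow> (\<lambda>\<omega>. \<omega> i) \<in> measurable (\<sigma>pow n) (\<sigma> :: 'a::radon_polish measure)"
  unfolding \<sigma>pow_def by (rule measurable_component_singleton) simp

lemma measurable_into_\<sigma>pow:
  assumes "\<And>i. i < n \<Longrightarrow> (\<lambda>x. f x i) \<in> measurable M (\<sigma> :: 'a::radon_polish measure)"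
    and "\<And>x. x \<in> space M \<Longrightarrow> f x \<in> Tpow n"
  shows "f \<in> measurable M (\<sigma>pow n)"
  unfolding \<sigma>pow_def using assms by (intro measurable_PiM_single') (auto simp: Tpow_def)

lemma measurable_join:
  "(\<lambda>p. join k (fst p) (snd p)) \<in> measurable (\<sigma>pow k \<Otimes>\<^sub>M \<sigma>pow r) (\<sigma>pow (k + r) :: (nat \<Rightarrow> 'a::radon_polish) measure)"
proof (rule measurable_into_\<sigma>pow)
  fix i assume i: "i < k + r"
  show "(\<lambda>p. join k (fst p) (snd p) i) \<in> measurable (\<sigma>pow k \<Otimes>\<^sub>M \<sigma>pow r) (\<sigma> :: 'a measure)"
  proof (cases "i < k")
    case True
    then show ?thesis
      using measurable_compose[OF measurable_fst measurable_coordinate] by (simp add: join_def)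
  next
    case False
    then have "i - k < r" using i by simp
    then show ?thesis
      using False measurable_compose[OF measurable_snd measurable_coordinate] by (simp add: join_def)
  qed
qed (auto simp: space_pair_measure intro: join_in_Tpow)

lemma measurable_drop_pt:
  "drop_pt k \<in> measurable (\<sigma>pow (k + r)) (\<sigma>pow r :: (nat \<Rightarrow> 'a::radon_polish) measure)"
  by (rule measurable_into_\<sigma>pow) (auto simp: drop_pt_def drop_pt_in_Tpow intro: measurable_coordinate)

text \<open>A measure on the product is determined by its values on boxes, and concatenation pulls a
  box back to a product of two boxes. Fubini for the first k and the last r variables
  follows.\<close>

lemma \<sigma>pow_split:
  "\<sigma>pow (k + r) = distr (\<sigma>pow k \<Otimes>\<^sub>M \<sigma>pow r) (\<sigma>pow (k + r) :: (nat \<Rightarrow> 'a::radon_polish) measure)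
     (\<lambda>p. join k (fst p) (snd p))" (is "_ = ?D")
proof -
  interpret product_sigma_finite "\<lambda>_::nat. \<sigma> :: 'a measure" by (rule product_sigma_finite_\<sigma>)
  interpret R: sigma_finite_measure "\<sigma>pow r :: (nat \<Rightarrow> 'a) measure" by (rule sigma_finite_\<sigma>pow)
  have "?D = Pi\<^sub>M {..<k + r} (\<lambda>_. \<sigma>)"
  proof (rule PiM_eqI)
    show "finite {..<k + r}" by simp
    show "sets ?D = sets (Pi\<^sub>M {..<k + r} (\<lambda>_. \<sigma>))" by (simp add: \<sigma>pow_def)
    fix A :: "nat \<Rightarrow> 'a set" assume A: "\<And>i. i \<in> {..<k + r} \<Longrightarrow> A i \<in> sets \<sigma>"
    have AS: "Pi\<^sub>E {..<k + r} A \<in> sets (\<sigma>pow (k + r))"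
      unfolding \<sigma>pow_def using A by (intro sets_PiM_I_finite) auto
    have pre: "(\<lambda>p. join k (fst p) (snd p)) -` Pi\<^sub>E {..<k + r} A \<inter> space (\<sigma>pow k \<Otimes>\<^sub>M \<sigma>pow r) =
       Pi\<^sub>E {..<k} A \<times> Pi\<^sub>E {..<r} (\<lambda>i. A (i + k))" (is "?L = ?R")
    proof (rule set_eqI)
      fix p :: "(nat \<Rightarrow> 'a) \<times> (nat \<Rightarrow> 'a)"
      obtain x z where p: "p = (x, z)" by (cases p)
      have J: "(\<forall>i\<in>{..<k + r}. join k x z i \<in> A i) \<longleftrightarrow> (\<forall>i<k. x i \<in> A i) \<and> (\<forall>i<r. z i \<in> A (i + k))"
      proof (intro iffI conjI allI impI ballI)
        fix i assume "\<forall>i\<in>{..<k + r}. join k x z i \<in> A i" "i < k"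
        then show "x i \<in> A i" by (auto simp: join_def dest!: bspec[of _ _ i])
      next
        fix i assume "\<forall>i\<in>{..<k + r}. join k x z i \<in> A i" "i < r"
        then show "z i \<in> A (i + k)" by (auto simp: join_def dest!: bspec[of _ _ "i + k"])
      next
        fix i assume h: "(\<forall>i<k. x i \<in> A i) \<and> (\<forall>i<r. z i \<in> A (i + k))" "i \<in> {..<k + r}"
        show "join k x z i \<in> A i"
        proof (cases "i < k")
          case False
          then have "i - k < r" "i - k + k = i" using h(2) by auto
          then show ?thesis using h(1) False by (metis join_def)
        qed (use h in \<open>simp add: join_def\<close>)
      qed
      show "p \<in> ?L \<longleftrightarrow> p \<in> ?R"
      proof (cases "x \<in> Tpow k \<and> z \<in> Tpow r")
        case True
        then have e: "x \<in> extensional {..<k}" "z \<in> extensional {..<r}" "join k x z \<in> extensional {..<k + r}"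
          using join_in_Tpow[of z r k x] by (auto simp: Tpow_def PiE_def)
        show ?thesis using True e J by (simp add: p space_pair_measure PiE_iff Ball_def)
      next
        case False
        then show ?thesis by (auto simp: p space_pair_measure Tpow_def PiE_def)
      qed
    qed
    have sub: "Pi\<^sub>E {..<k} A \<in> sets (\<sigma>pow k)" "Pi\<^sub>E {..<r} (\<lambda>i. A (i + k)) \<in> sets (\<sigma>pow r)"
      unfolding \<sigma>pow_def using A by (auto intro!: sets_PiM_I_finite)
    have "emeasure ?D (Pi\<^sub>E {..<k + r} A) = emeasure (\<sigma>pow k) (Pi\<^sub>E {..<k} A) * emeasure (\<sigma>pow r) (Pi\<^sub>E {..<r} (\<lambda>i. A (i + k)))"
      using AS sub by (subst emeasure_distr[OF measurable_join]) (simp_all only: pre R.emeasure_pair_measure_Times)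
    also have "\<dots> = (\<Prod>i\<in>{..<k}. emeasure \<sigma> (A i)) * (\<Prod>i\<in>{..<r}. emeasure \<sigma> (A (i + k)))"
      unfolding \<sigma>pow_def using A by (subst (1 2) emeasure_PiM) auto
    also have "\<dots> = (\<Prod>i\<in>{..<k + r}. emeasure \<sigma> (A i))"
      by (simp add: lessThan_atLeast0 prod.atLeastLessThan_concat[of 0 k "k + r", symmetric]
          prod.shift_bounds_nat_ivl[of "\<lambda>i. emeasure \<sigma> (A i)" 0 k r, symmetric] add.commute)
    finally show "emeasure ?D (Pi\<^sub>E {..<k + r} A) = (\<Prod>i\<in>{..<k + r}. emeasure \<sigma> (A i))" .
  qed
  then show ?thesis by (simp add: \<sigma>pow_def)
qed

lemma nn_integral_\<sigma>pow_split:
  fixes h :: "(nat \<Rightarrow> 'a::radon_polish) \<Rightarrow> ennreal"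
  assumes h: "h \<in> borel_measurable (\<sigma>pow (k + r))"
  shows "(\<integral>\<^sup>+\<omega>. h \<omega> \<partial>\<sigma>pow (k + r)) = (\<integral>\<^sup>+z. \<integral>\<^sup>+x. h (join k x z) \<partial>\<sigma>pow k \<partial>\<sigma>pow r)"
proof -
  interpret pair_sigma_finite "\<sigma>pow k :: (nat \<Rightarrow> 'a) measure" "\<sigma>pow r :: (nat \<Rightarrow> 'a) measure"
    by (rule pair_sigma_finite_\<sigma>pow)
  have m: "(\<lambda>p. h (join k (fst p) (snd p))) \<in> borel_measurable (\<sigma>pow k \<Otimes>\<^sub>M \<sigma>pow r)"
    using measurable_compose[OF measurable_join h] .
  have "(\<integral>\<^sup>+\<omega>. h \<omega> \<partial>\<sigma>pow (k + r)) = (\<integral>\<^sup>+p. h (join k (fst p) (snd p)) \<partial>(\<sigma>pow k \<Otimes>\<^sub>M \<sigma>pow r))"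
    by (subst \<sigma>pow_split, rule nn_integral_distr[OF measurable_join]) (use h in simp)
  also have "\<dots> = (\<integral>\<^sup>+z. \<integral>\<^sup>+x. h (join k x z) \<partial>\<sigma>pow k \<partial>\<sigma>pow r)"
    using nn_integral_snd[OF m] by simp
  finally show ?thesis .
qed

text \<open>A null set in the last r variables is a null cylinder over the k variables in front. It
  lets exceptional sets of the spectator particles be ignored.\<close>

lemma AE_\<sigma>pow_drop:
  assumes "AE z in (\<sigma>pow r :: (nat \<Rightarrow> 'a::radon_polish) measure). Q z"
    and "{z \<in> Tpow r. Q z} \<in> sets (\<sigma>pow r :: (nat \<Rightarrow> 'a::radon_polish) measure)"
  shows "AE \<omega> in \<sigma>pow (k + r). Q (drop_pt k \<omega>)"
proof -
  interpret pair_sigma_finite "\<sigma>pow k :: (nat \<Rightarrow> 'a) measure" "\<sigma>pow r :: (nat \<Rightarrow> 'a) measure"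
    by (rule pair_sigma_finite_\<sigma>pow)
  have Qm: "Measurable.pred (\<sigma>pow r) Q" using assms(2) by (simp add: pred_def)
  have m: "{p \<in> space (\<sigma>pow k \<Otimes>\<^sub>M \<sigma>pow r). Q (snd p)} \<in> sets (\<sigma>pow k \<Otimes>\<^sub>M \<sigma>pow r :: ((nat \<Rightarrow> 'a) \<times> _) measure)"
    using Qm by measurable
  have m': "{\<omega> \<in> space (\<sigma>pow (k + r)). Q (drop_pt k \<omega>)} \<in> sets (\<sigma>pow (k + r))"
    using measurable_compose[OF measurable_drop_pt Qm] unfolding pred_def .
  have "AE p in \<sigma>pow k \<Otimes>\<^sub>M \<sigma>pow r :: ((nat \<Rightarrow> 'a) \<times> _) measure. Q (snd p)"
    by (rule AE_pair_measure[where P="\<lambda>p. Q (snd p)", OF m]) (use assms(1) in simp)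
  then show ?thesis
    by (subst \<sigma>pow_split) (simp add: AE_distr_iff[OF measurable_join m'])
qed

text \<open>Only the k created and the l consumed variables are confined to K. The kernel may also
  depend on the level N and on further coordinates of \<omega>, because X^0 looks at the first
  remaining particle and vanishes if there is none.\<close>

definition kern_bdd :: "nat \<Rightarrow> nat \<Rightarrow> 'a::radon_polish set \<Rightarrow> real \<Rightarrow>
    (nat \<Rightarrow> (nat \<Rightarrow> 'a) \<Rightarrow> (nat \<Rightarrow> 'a) \<Rightarrow> real) \<Rightarrow> bool" where
  "kern_bdd k l K B \<kappa> \<longleftrightarrow> compact K \<and> 0 \<le> B \<and>
     (\<forall>N. (\<lambda>p. \<kappa> N (fst p) (snd p)) \<in> borel_measurable (\<sigma>pow N \<Otimes>\<^sub>M \<sigma>pow l)) \<and>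
     (\<forall>N \<omega> s. \<bar>\<kappa> N \<omega> s\<bar> \<le> B \<and> (\<kappa> N \<omega> s \<noteq> 0 \<longrightarrow> (\<forall>i<k. \<omega> i \<in> K) \<and> (\<forall>i<l. s i \<in> K)))"

text \<open>
  Consumes \<open>l\<close> particles and creates \<open>k\<close>: the value at level \<open>N\<close> comes from level \<open>l + (N - k)\<close>.
\<close>

definition kernel_map :: "nat \<Rightarrow> nat \<Rightarrow> (nat \<Rightarrow> (nat \<Rightarrow> 'a::radon_polish) \<Rightarrow> (nat \<Rightarrow> 'a) \<Rightarrow> real) \<Rightarrow>
    (nat \<Rightarrow> (nat \<Rightarrow> 'a) \<Rightarrow> real) \<Rightarrow> nat \<Rightarrow> (nat \<Rightarrow> 'a) \<Rightarrow> real" where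
  "kernel_map k l \<kappa> F N \<omega> =
     (if N < k then 0 else \<integral>s. \<kappa> N \<omega> s * F (l + (N - k)) (join l s (drop_pt k \<omega>)) \<partial>\<sigma>pow l)"

lemma kern_bddD:
  assumes "kern_bdd k l K B \<kappa>"
  shows "compact K" "0 \<le> B" "(\<lambda>p. \<kappa> N (fst p) (snd p)) \<in> borel_measurable (\<sigma>pow N \<Otimes>\<^sub>M \<sigma>pow l)"
    "\<bar>\<kappa> N \<omega> s\<bar> \<le> B" "\<kappa> N \<omega> s \<noteq> 0 \<Longrightarrow> i < k \<Longrightarrow> \<omega> i \<in> K" "\<kappa> N \<omega> s \<noteq> 0 \<Longrightarrow> i < l \<Longrightarrow> s i \<in> K"
  using assms by (simp_all add: kern_bdd_def)

abbreviation ind_cube :: "nat \<Rightarrow> 'a set \<Rightarrow> (nat \<Rightarrow> 'a) \<Rightarrow> ennreal" where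
  "ind_cube k K x \<equiv> (\<Prod>i<k. indicator K (x i))"

lemma ind_cube_one: "(\<And>i. i < k \<Longrightarrow> x i \<in> K) \<Longrightarrow> ind_cube k K x = 1"
  by (intro prod.neutral) simp

lemma measurable_ind_cube:
  fixes K :: "'a::radon_polish set"
  assumes "compact K" "k \<le> n"
  shows "ind_cube k K \<in> borel_measurable (\<sigma>pow n)"
proof -
  have "(\<lambda>x. indicator K (x i) :: ennreal) \<in> borel_measurable (\<sigma>pow n)" if "i < k" for i
  proof (rule measurable_compose[OF measurable_coordinate])
    show "i < n" using that assms(2) by simp
    show "indicator K \<in> borel_measurable \<sigma>"
      using assms(1) by (intro borel_measurable_indicator) (simp add: sets_\<sigma>_borel borel_closed compact_imp_closed)
  qed
  then show ?thesis by (intro borel_measurable_prod_ennreal) simp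
qed

lemma nn_integral_ind_cube:
  fixes K :: "'a::radon_polish set"
  assumes "compact K"
  shows "(\<integral>\<^sup>+x. ind_cube k K x \<partial>\<sigma>pow k) = ennreal (measure \<sigma> K ^ k)"
proof -
  interpret product_sigma_finite "\<lambda>_::nat. \<sigma> :: 'a measure" by (rule product_sigma_finite_\<sigma>)
  have K: "K \<in> sets \<sigma>" using assms by (simp add: sets_\<sigma>_borel borel_closed compact_imp_closed)
  have fin: "emeasure \<sigma> K = ennreal (measure \<sigma> K)"
    using \<sigma>_finite_compact[OF assms] by (intro emeasure_eq_ennreal_measure) simp
  have "(\<integral>\<^sup>+x. ind_cube k K x \<partial>\<sigma>pow k) = (\<Prod>i<k. \<integral>\<^sup>+t. indicator K t \<partial>\<sigma>)"
    unfolding \<sigma>pow_def using K by (intro product_nn_integral_prod) auto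
  also have "\<dots> = ennreal (measure \<sigma> K ^ k)"
    using K fin by (simp add: ennreal_power)
  finally show ?thesis .
qed

lemma kern_bdd_square:
  assumes "kern_bdd k l K B \<kappa>"
  shows "(ennreal \<bar>\<kappa> N \<omega> s\<bar>)\<^sup>2 \<le> ennreal (B\<^sup>2) * ind_cube k K \<omega> * ind_cube l K s"
proof (cases "\<kappa> N \<omega> s = 0")
  case False
  then have "ind_cube k K \<omega> = 1" "ind_cube l K s = 1"
    using kern_bddD(5,6)[OF assms False] by (auto intro!: ind_cube_one)
  moreover have "(ennreal \<bar>\<kappa> N \<omega> s\<bar>)\<^sup>2 \<le> ennreal (B\<^sup>2)"
    using power_mono[OF kern_bddD(4)[OF assms] abs_ge_zero, of N \<omega> s 2] by (simp add: ennreal_power)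
  ultimately show ?thesis by simp
qed simp

lemma measurable_join_drop:
  "(\<lambda>p. join l (snd p) (drop_pt k (fst p))) \<in>
    measurable (\<sigma>pow (k + r) \<Otimes>\<^sub>M \<sigma>pow l) (\<sigma>pow (l + r) :: (nat \<Rightarrow> 'a::radon_polish) measure)"
proof -
  have "(\<lambda>p. (snd p, drop_pt k (fst p))) \<in>
      measurable (\<sigma>pow (k + r) \<Otimes>\<^sub>M \<sigma>pow l) (\<sigma>pow l \<Otimes>\<^sub>M (\<sigma>pow r :: (nat \<Rightarrow> 'a) measure))"
    by (intro measurable_Pair measurable_snd measurable_compose[OF measurable_fst measurable_drop_pt])
  from measurable_compose[OF this measurable_join] show ?thesis by simp
qed

lemma measurable_kernel_integrand:
  fixes F :: "nat \<Rightarrow> (nat \<Rightarrow> 'a::radon_polish) \<Rightarrow> real"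
  assumes "kern_bdd k l K B \<kappa>" "F \<in> fock_space"
  shows "(\<lambda>p. \<kappa> (k + r) (fst p) (snd p) * F (l + r) (join l (snd p) (drop_pt k (fst p))))
    \<in> borel_measurable (\<sigma>pow (k + r) \<Otimes>\<^sub>M \<sigma>pow l)"
  using kern_bddD(3)[OF assms(1)] measurable_compose[OF measurable_join_drop fock_spaceD(1)[OF assms(2)]]
  by (intro borel_measurable_times)

lemma measurable_section:
  fixes f :: "'b \<times> 'c \<Rightarrow> real"
  assumes "f \<in> borel_measurable (M \<Otimes>\<^sub>M M')" "x \<in> space M"
  shows "(\<lambda>y. f (x, y)) \<in> borel_measurable M'"
  using measurable_compose[OF measurable_Pair1'[OF assms(2)] assms(1)] .

lemma measurable_kernel_map:
  fixes F :: "nat \<Rightarrow> (nat \<Rightarrow> 'a::radon_polish) \<Rightarrow> real"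
  assumes "kern_bdd k l K B \<kappa>" "F \<in> fock_space"
  shows "kernel_map k l \<kappa> F N \<in> borel_measurable (\<sigma>pow N)"
proof (cases "N < k")
  case True
  then show ?thesis by (simp add: kernel_map_def[abs_def])
next
  case False
  then obtain r where N: "N = k + r" by (metis le_Suc_ex not_less)
  interpret sigma_finite_measure "\<sigma>pow l :: (nat \<Rightarrow> 'a) measure" by (rule sigma_finite_\<sigma>pow)
  have "(\<lambda>\<omega>. \<integral>s. \<kappa> (k + r) \<omega> s * F (l + r) (join l s (drop_pt k \<omega>)) \<partial>\<sigma>pow l) \<in> borel_measurable (\<sigma>pow (k + r))"
    by (rule borel_measurable_lebesgue_integral)
      (use measurable_kernel_integrand[OF assms] in \<open>simp add: case_prod_beta'\<close>)
  then show ?thesis by (simp add: N kernel_map_def[abs_def])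
qed

text \<open>Cauchy-Schwarz in the l consumed variables: the square integral of the kernel
  contributes the constant and the indicator of the created variables, that of F is kept.\<close>

lemma kernel_map_square_le:
  fixes F :: "nat \<Rightarrow> (nat \<Rightarrow> 'a::radon_polish) \<Rightarrow> real"
  assumes \<kappa>: "kern_bdd k l K B \<kappa>" and F: "F \<in> fock_space" and \<omega>: "\<omega> \<in> Tpow (k + r)"
  shows "ennreal ((kernel_map k l \<kappa> F (k + r) \<omega>)\<^sup>2) \<le>
    ennreal (B\<^sup>2 * measure \<sigma> K ^ l) * ind_cube k K \<omega> *
      (\<integral>\<^sup>+s. ennreal ((F (l + r) (join l s (drop_pt k \<omega>)))\<^sup>2) \<partial>\<sigma>pow l)"
proof -
  let ?f = "\<lambda>s. \<kappa> (k + r) \<omega> s" and ?g = "\<lambda>s. F (l + r) (join l s (drop_pt k \<omega>))"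
  have sp: "\<omega> \<in> space (\<sigma>pow (k + r))" using \<omega> by simp
  have mf: "?f \<in> borel_measurable (\<sigma>pow l)"
    using measurable_section[OF kern_bddD(3)[OF \<kappa>] sp] by simp
  have mg: "?g \<in> borel_measurable (\<sigma>pow l)"
    using measurable_section[OF measurable_compose[OF measurable_join_drop fock_spaceD(1)[OF F]] sp] by simp
  have "ennreal \<bar>\<integral>s. ?f s * ?g s \<partial>\<sigma>pow l\<bar> \<le> (\<integral>\<^sup>+s. ennreal \<bar>?f s * ?g s\<bar> \<partial>\<sigma>pow l)"
  proof (cases "integrable (\<sigma>pow l) (\<lambda>s. ?f s * ?g s)")
    case True
    then show ?thesis using integral_norm_bound_ennreal[OF True] by simp
  next
    \<comment> \<open>A non-integrable function has Bochner integral 0 by convention, so the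
      inequality is trivial.\<close>
    case False
    then show ?thesis by (simp add: not_integrable_integral_eq)
  qed
  also have "\<dots> = (\<integral>\<^sup>+s. ennreal \<bar>?f s\<bar> * ennreal \<bar>?g s\<bar> \<partial>\<sigma>pow l)"
    by (simp add: abs_mult ennreal_mult)
  finally have "(ennreal \<bar>\<integral>s. ?f s * ?g s \<partial>\<sigma>pow l\<bar>)\<^sup>2 \<le> (\<integral>\<^sup>+s. ennreal \<bar>?f s\<bar> * ennreal \<bar>?g s\<bar> \<partial>\<sigma>pow l)\<^sup>2"
    by (intro power_mono) simp_all
  also have "\<dots> \<le> (\<integral>\<^sup>+s. (ennreal \<bar>?f s\<bar>)\<^sup>2 \<partial>\<sigma>pow l) * (\<integral>\<^sup>+s. (ennreal \<bar>?g s\<bar>)\<^sup>2 \<partial>\<sigma>pow l)"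
    by (intro Cauchy_Schwarz_nn_integral measurable_compose[OF borel_measurable_abs measurable_ennreal] mf mg)
  also have "(\<integral>\<^sup>+s. (ennreal \<bar>?f s\<bar>)\<^sup>2 \<partial>\<sigma>pow l) \<le> (\<integral>\<^sup>+s. ennreal (B\<^sup>2) * ind_cube k K \<omega> * ind_cube l K s \<partial>\<sigma>pow l)"
    by (intro nn_integral_mono kern_bdd_square[OF \<kappa>])
  also have "\<dots> = ennreal (B\<^sup>2) * ind_cube k K \<omega> * ennreal (measure \<sigma> K ^ l)"
    using kern_bddD(1)[OF \<kappa>] by (simp add: nn_integral_cmult measurable_ind_cube nn_integral_ind_cube)
  also have "\<dots> = ennreal (B\<^sup>2 * measure \<sigma> K ^ l) * ind_cube k K \<omega>"
    by (simp add: ennreal_mult mult_ac)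
  also have "(\<integral>\<^sup>+s. (ennreal \<bar>?g s\<bar>)\<^sup>2 \<partial>\<sigma>pow l) = (\<integral>\<^sup>+s. ennreal ((?g s)\<^sup>2) \<partial>\<sigma>pow l)"
    by (simp add: ennreal_power)
  finally show ?thesis
    by (simp add: kernel_map_def ennreal_power mult_right_mono)
qed

lemma measurable_inner_square:
  fixes F :: "nat \<Rightarrow> (nat \<Rightarrow> 'a::radon_polish) \<Rightarrow> real"
  assumes F: "F \<in> fock_space"
  shows "(\<lambda>z. \<integral>\<^sup>+s. ennreal ((F (l + r) (join l s z))\<^sup>2) \<partial>\<sigma>pow l) \<in> borel_measurable (\<sigma>pow r)"
proof -
  interpret sigma_finite_measure "\<sigma>pow l :: (nat \<Rightarrow> 'a) measure" by (rule sigma_finite_\<sigma>pow)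
  have sw: "(\<lambda>p. (snd p, fst p)) \<in> measurable (\<sigma>pow r \<Otimes>\<^sub>M \<sigma>pow l) (\<sigma>pow l \<Otimes>\<^sub>M (\<sigma>pow r :: (nat \<Rightarrow> 'a) measure))"
    by (intro measurable_Pair measurable_snd measurable_fst)
  have "(\<lambda>p. F (l + r) (join l (snd p) (fst p))) \<in> borel_measurable (\<sigma>pow r \<Otimes>\<^sub>M \<sigma>pow l)"
    using measurable_compose[OF measurable_compose[OF sw measurable_join] fock_spaceD(1)[OF F]] by simp
  then have "(\<lambda>p. ennreal ((F (l + r) (join l (snd p) (fst p)))\<^sup>2)) \<in> borel_measurable (\<sigma>pow r \<Otimes>\<^sub>M \<sigma>pow l)"
    by measurable
  then show ?thesis
    by (intro borel_measurable_nn_integral) (simp add: case_prod_beta')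
qed

lemma nn_integral_fock_split:
  fixes F :: "nat \<Rightarrow> (nat \<Rightarrow> 'a::radon_polish) \<Rightarrow> real"
  assumes F: "F \<in> fock_space"
  shows "(\<integral>\<^sup>+z. \<integral>\<^sup>+s. ennreal ((F (l + r) (join l s z))\<^sup>2) \<partial>\<sigma>pow l \<partial>\<sigma>pow r) =
    ennreal (\<integral>\<omega>. (F (l + r) \<omega>)\<^sup>2 \<partial>\<sigma>pow (l + r))"
proof -
  have "(\<lambda>\<omega>. ennreal ((F (l + r) \<omega>)\<^sup>2)) \<in> borel_measurable (\<sigma>pow (l + r))"
    using fock_spaceD(1)[OF F] by measurable
  from nn_integral_\<sigma>pow_split[OF this] show ?thesis
    using nn_integral_eq_integral[OF fock_spaceD(2)[OF F, of "l + r"]] by simp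
qed

text \<open>Integrating the pointwise bound over the k created variables adds another k powers of
  the mass of K. The spectator variables are common to both sides, so the constant does not depend
  on r; this makes the operator bounded on all levels together.\<close>

lemma kernel_map_L2:
  fixes F :: "nat \<Rightarrow> (nat \<Rightarrow> 'a::radon_polish) \<Rightarrow> real"
  assumes \<kappa>: "kern_bdd k l K B \<kappa>" and F: "F \<in> fock_space"
  shows "integrable (\<sigma>pow (k + r)) (\<lambda>\<omega>. (kernel_map k l \<kappa> F (k + r) \<omega>)\<^sup>2)"
    and "(\<integral>\<omega>. (kernel_map k l \<kappa> F (k + r) \<omega>)\<^sup>2 \<partial>\<sigma>pow (k + r)) \<le>
      B\<^sup>2 * measure \<sigma> K ^ (k + l) * (\<integral>\<omega>. (F (l + r) \<omega>)\<^sup>2 \<partial>\<sigma>pow (l + r))"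
proof -
  let ?H = "\<lambda>z. \<integral>\<^sup>+s. ennreal ((F (l + r) (join l s z))\<^sup>2) \<partial>\<sigma>pow l"
  let ?C = "B\<^sup>2 * measure \<sigma> K ^ l" and ?I = "\<integral>\<omega>. (F (l + r) \<omega>)\<^sup>2 \<partial>\<sigma>pow (l + r)"
  have H: "?H \<in> borel_measurable (\<sigma>pow r)" by (rule measurable_inner_square[OF F])
  have K: "compact K" using kern_bddD(1)[OF \<kappa>] .
  have m: "(\<lambda>\<omega>. ennreal ?C * ind_cube k K \<omega> * ?H (drop_pt k \<omega>)) \<in> borel_measurable (\<sigma>pow (k + r))"
    using measurable_compose[OF measurable_drop_pt H] measurable_ind_cube[OF K, of k "k + r"]
    by (intro borel_measurable_times_ennreal) auto
  have "(\<integral>\<^sup>+\<omega>. ennreal ((kernel_map k l \<kappa> F (k + r) \<omega>)\<^sup>2) \<partial>\<sigma>pow (k + r)) \<le>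
      (\<integral>\<^sup>+\<omega>. ennreal ?C * ind_cube k K \<omega> * ?H (drop_pt k \<omega>) \<partial>\<sigma>pow (k + r))"
    using kernel_map_square_le[OF \<kappa> F] by (intro nn_integral_mono) simp
  also have "\<dots> = (\<integral>\<^sup>+z. \<integral>\<^sup>+x. ennreal ?C * ind_cube k K (join k x z) * ?H z \<partial>\<sigma>pow k \<partial>\<sigma>pow r)"
    by (subst nn_integral_\<sigma>pow_split[OF m]) simp
  also have "\<dots> = (\<integral>\<^sup>+z. (ennreal ?C * ennreal (measure \<sigma> K ^ k)) * ?H z \<partial>\<sigma>pow r)"
  proof (rule nn_integral_cong)
    fix z :: "nat \<Rightarrow> 'a"
    have "(\<integral>\<^sup>+x. ennreal ?C * ind_cube k K (join k x z) * ?H z \<partial>\<sigma>pow k) =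
        (\<integral>\<^sup>+x. (ennreal ?C * ?H z) * ind_cube k K x \<partial>\<sigma>pow k)"
      by (intro nn_integral_cong) (simp add: join_def mult_ac)
    also have "\<dots> = (ennreal ?C * ?H z) * ennreal (measure \<sigma> K ^ k)"
      by (simp add: nn_integral_cmult measurable_ind_cube[OF K] nn_integral_ind_cube[OF K])
    finally show "(\<integral>\<^sup>+x. ennreal ?C * ind_cube k K (join k x z) * ?H z \<partial>\<sigma>pow k) =
        (ennreal ?C * ennreal (measure \<sigma> K ^ k)) * ?H z" by (simp add: mult_ac)
  qed
  also have "\<dots> = (ennreal ?C * ennreal (measure \<sigma> K ^ k)) * ennreal ?I"
    by (subst nn_integral_cmult[OF H]) (simp only: nn_integral_fock_split[OF F])
  also have "\<dots> = ennreal (B\<^sup>2 * measure \<sigma> K ^ (k + l) * ?I)"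
    by (simp add: ennreal_mult power_add mult_ac)
  finally have le: "(\<integral>\<^sup>+\<omega>. ennreal ((kernel_map k l \<kappa> F (k + r) \<omega>)\<^sup>2) \<partial>\<sigma>pow (k + r)) \<le>
      ennreal (B\<^sup>2 * measure \<sigma> K ^ (k + l) * ?I)" .
  have mk: "(\<lambda>\<omega>. (kernel_map k l \<kappa> F (k + r) \<omega>)\<^sup>2) \<in> borel_measurable (\<sigma>pow (k + r))"
    using measurable_kernel_map[OF \<kappa> F] by measurable
  show int: "integrable (\<sigma>pow (k + r)) (\<lambda>\<omega>. (kernel_map k l \<kappa> F (k + r) \<omega>)\<^sup>2)"
    using le mk by (intro integrableI_nonneg) (auto intro: le_less_trans)
  show "(\<integral>\<omega>. (kernel_map k l \<kappa> F (k + r) \<omega>)\<^sup>2 \<partial>\<sigma>pow (k + r)) \<le> B\<^sup>2 * measure \<sigma> K ^ (k + l) * ?I"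
    using le nn_integral_eq_integral[OF int] by (simp add: ennreal_le_iff)
qed

lemma AE_inner_square_finite:
  fixes F :: "nat \<Rightarrow> (nat \<Rightarrow> 'a::radon_polish) \<Rightarrow> real"
  assumes F: "F \<in> fock_space"
  shows "AE \<omega> in \<sigma>pow (k + r). (\<integral>\<^sup>+s. ennreal ((F (l + r) (join l s (drop_pt k \<omega>)))\<^sup>2) \<partial>\<sigma>pow l) < \<infinity>"
proof (rule AE_\<sigma>pow_drop)
  let ?H = "\<lambda>z. \<integral>\<^sup>+s. ennreal ((F (l + r) (join l s z))\<^sup>2) \<partial>\<sigma>pow l"
  have H: "?H \<in> borel_measurable (\<sigma>pow r)" by (rule measurable_inner_square[OF F])
  have "AE z in \<sigma>pow r. ?H z \<noteq> \<infinity>"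
    by (rule nn_integral_PInf_AE[OF H]) (simp add: nn_integral_fock_split[OF F])
  then show "AE z in \<sigma>pow r. ?H z < \<infinity>" by (simp add: less_top)
  have "{z \<in> space (\<sigma>pow r). ?H z < \<infinity>} \<in> sets (\<sigma>pow r)"
    using H by measurable
  then show "{z \<in> Tpow r. ?H z < \<infinity>} \<in> sets (\<sigma>pow r)" by simp
qed

text \<open>Linearity of \<open>kernel_map\<close> in F and in the kernel uses linearity of the
  Bochner integral, hence integrability. By Fubini the inner square integral of F is finite for
  almost every \<omega>, and only there.\<close>

lemma AE_kernel_integrable:
  fixes F :: "nat \<Rightarrow> (nat \<Rightarrow> 'a::radon_polish) \<Rightarrow> real"
  assumes \<kappa>: "kern_bdd k l K B \<kappa>" and F: "F \<in> fock_space"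
  shows "AE \<omega> in \<sigma>pow (k + r). integrable (\<sigma>pow l) (\<lambda>s. \<kappa> (k + r) \<omega> s * F (l + r) (join l s (drop_pt k \<omega>)))"
  using AE_inner_square_finite[OF F, where k=k and r=r and l=l] AE_space
proof eventually_elim
  case (elim \<omega>)
  let ?f = "\<lambda>s. \<kappa> (k + r) \<omega> s" and ?g = "\<lambda>s. F (l + r) (join l s (drop_pt k \<omega>))"
  have sp: "\<omega> \<in> space (\<sigma>pow (k + r))" using elim by simp
  have mf: "?f \<in> borel_measurable (\<sigma>pow l)"
    using measurable_section[OF kern_bddD(3)[OF \<kappa>] sp] by simp
  have mg: "?g \<in> borel_measurable (\<sigma>pow l)"
    using measurable_section[OF measurable_compose[OF measurable_join_drop fock_spaceD(1)[OF F]] sp] by simp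
  have "(\<integral>\<^sup>+s. ennreal ((?f s)\<^sup>2) \<partial>\<sigma>pow l) \<le> (\<integral>\<^sup>+s. ennreal (B\<^sup>2) * ind_cube k K \<omega> * ind_cube l K s \<partial>\<sigma>pow l)"
    using kern_bdd_square[OF \<kappa>] by (intro nn_integral_mono) (simp add: ennreal_power)
  also have "\<dots> = ennreal (B\<^sup>2) * ind_cube k K \<omega> * ennreal (measure \<sigma> K ^ l)"
    using kern_bddD(1)[OF \<kappa>] by (simp add: nn_integral_cmult measurable_ind_cube nn_integral_ind_cube)
  also have "ind_cube k K \<omega> < \<infinity>"
    by (auto simp: ennreal_prod_eq_top less_top[symmetric] indicator_def)
  then have "ennreal (B\<^sup>2) * ind_cube k K \<omega> * ennreal (measure \<sigma> K ^ l) < \<infinity>"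
    by (simp add: ennreal_mult_less_top)
  finally have f: "integrable (\<sigma>pow l) (\<lambda>s. (?f s)\<^sup>2)"
    using mf by (intro integrableI_nonneg) auto
  have g: "integrable (\<sigma>pow l) (\<lambda>s. (?g s)\<^sup>2)"
    using mg elim by (intro integrableI_nonneg) auto
  show ?case
  proof (rule Bochner_Integration.integrable_bound)
    show "integrable (\<sigma>pow l) (\<lambda>s. (?f s)\<^sup>2 + (?g s)\<^sup>2)" using f g by simp
    show "(\<lambda>s. ?f s * ?g s) \<in> borel_measurable (\<sigma>pow l)" using mf mg by measurable
    show "AE s in \<sigma>pow l. norm (?f s * ?g s) \<le> norm ((?f s)\<^sup>2 + (?g s)\<^sup>2)"
      by (simp add: abs_mult_le_sum_squares)
  qed
qed

text \<open>Levels below k receive nothing and level k + r is controlled by level l + r, so the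
  levelwise bounds sum up after a shift of index.\<close>

lemma kernel_map_fock:
  fixes F :: "nat \<Rightarrow> (nat \<Rightarrow> 'a::radon_polish) \<Rightarrow> real"
  assumes \<kappa>: "kern_bdd k l K B \<kappa>" and F: "F \<in> fock_space"
  shows "kernel_map k l \<kappa> F \<in> fock_space"
    and "(\<Sum>N. \<integral>\<omega>. (kernel_map k l \<kappa> F N \<omega>)\<^sup>2 \<partial>\<sigma>pow N) \<le>
      B\<^sup>2 * measure \<sigma> K ^ (k + l) * (\<Sum>n. \<integral>\<omega>. (F n \<omega>)\<^sup>2 \<partial>\<sigma>pow n)"
proof -
  define a where "a N = (\<integral>\<omega>. (kernel_map k l \<kappa> F N \<omega>)\<^sup>2 \<partial>\<sigma>pow N)" for N
  define b where "b n = (\<integral>\<omega>. (F n \<omega>)\<^sup>2 \<partial>\<sigma>pow n)" for n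
  define C where "C = B\<^sup>2 * measure \<sigma> K ^ (k + l)"
  have C: "0 \<le> C" by (simp add: C_def)
  have b: "summable b" "\<And>n. 0 \<le> b n" using fock_spaceD(3)[OF F] by (simp_all add: b_def[abs_def])
  have a0: "a N = 0" if "N < k" for N using that by (simp add: a_def kernel_map_def)
  have a_nn: "0 \<le> a N" for N by (simp add: a_def)
  have le: "a (r + k) \<le> C * b (r + l)" for r
    using kernel_map_L2(2)[OF \<kappa> F, of r] by (simp add: a_def b_def C_def add.commute)
  have sb: "summable (\<lambda>r. C * b (r + l))" using b(1) by (intro summable_mult) (simp add: summable_iff_shift)
  have sa': "summable (\<lambda>r. a (r + k))"
    using le a_nn by (intro summable_comparison_test[OF _ sb]) auto
  then have sa: "summable a" by (simp add: summable_iff_shift)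
  have int: "integrable (\<sigma>pow N) (\<lambda>\<omega>. (kernel_map k l \<kappa> F N \<omega>)\<^sup>2)" for N
  proof (cases "N < k")
    case True then show ?thesis by (simp add: kernel_map_def)
  next
    case False
    then obtain r where "N = k + r" by (metis le_Suc_ex not_less)
    then show ?thesis using kernel_map_L2(1)[OF \<kappa> F] by simp
  qed
  show "kernel_map k l \<kappa> F \<in> fock_space"
    using sa int measurable_kernel_map[OF \<kappa> F] unfolding fock_space_def a_def by simp
  have "suminf a = (\<Sum>r. a (r + k))"
    using suminf_split_initial_segment[OF sa, of k] a0 by simp
  also have "\<dots> \<le> (\<Sum>r. C * b (r + l))" by (intro suminf_le le sa' sb)
  also have "\<dots> = C * (\<Sum>r. b (r + l))" using b(1) by (intro suminf_mult) (simp add: summable_iff_shift)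
  also have "\<dots> \<le> C * suminf b"
    using suminf_split_initial_segment[OF b(1), of l] C b(2) by (intro mult_left_mono) (simp_all add: sum_nonneg)
  finally show "(\<Sum>N. \<integral>\<omega>. (kernel_map k l \<kappa> F N \<omega>)\<^sup>2 \<partial>\<sigma>pow N) \<le>
      B\<^sup>2 * measure \<sigma> K ^ (k + l) * (\<Sum>n. \<integral>\<omega>. (F n \<omega>)\<^sup>2 \<partial>\<sigma>pow n)"
    by (simp add: a_def[abs_def] b_def[abs_def] C_def)
qed

section \<open>Descent of kernel maps to operators on Fock space\<close>

lemma fock_rel_refl: "F \<in> fock_space \<Longrightarrow> fock_rel F F"
  by (simp add: fock_rel_def)

lemma abs_fock_eqI:
  "F \<in> fock_space \<Longrightarrow> F' \<in> fock_space \<Longrightarrow> (\<And>n. AE \<omega> in \<sigma>pow n. F n \<omega> = F' n \<omega>) \<Longrightarrow> abs_fock F = abs_fock F'"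
  by (intro Quotient_rel_abs[OF Quotient_fock]) (simp add: fock_rel_def)

lemma rep_fock_in: "rep_fock v \<in> fock_space"
  using Quotient_rep_reflp[OF Quotient_fock, of v] by (simp add: fock_rel_def)

lemma abs_rep_fock [simp]: "abs_fock (rep_fock v) = v"
  by (rule Quotient_abs_rep[OF Quotient_fock])

lemma rep_abs_fock: "F \<in> fock_space \<Longrightarrow> AE \<omega> in \<sigma>pow n. rep_fock (abs_fock F) n \<omega> = F n \<omega>"
  by (rule fock_relD(3)[OF Quotient_rep_abs[OF Quotient_fock fock_rel_refl]])

lemma abs_fock_add:
  "F \<in> fock_space \<Longrightarrow> F' \<in> fock_space \<Longrightarrow> abs_fock F + abs_fock F' = abs_fock (\<lambda>n \<omega>. F n \<omega> + F' n \<omega>)"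
  by (simp add: plus_fock.abs_eq fock_rel_refl)

lemma abs_fock_scale: "F \<in> fock_space \<Longrightarrow> c *\<^sub>R abs_fock F = abs_fock (\<lambda>n \<omega>. c * F n \<omega>)"
  by (simp add: scaleR_fock.abs_eq fock_rel_refl)

lemma fock_space_lincomb:
  "F \<in> fock_space \<Longrightarrow> F' \<in> fock_space \<Longrightarrow> (\<lambda>n \<omega>. a * F n \<omega> + b * F' n \<omega>) \<in> fock_space"
  by (intro fock_space_add fock_space_scale)

lemma abs_fock_lincomb:
  "F \<in> fock_space \<Longrightarrow> F' \<in> fock_space \<Longrightarrow>
    abs_fock (\<lambda>n \<omega>. a * F n \<omega> + b * F' n \<omega>) = a *\<^sub>R abs_fock F + b *\<^sub>R abs_fock F'"
  by (simp add: abs_fock_add abs_fock_scale fock_space_scale)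

lemma norm_abs_fock:
  "F \<in> fock_space \<Longrightarrow> norm (abs_fock F) = sqrt (\<Sum>n. \<integral>\<omega>. (F n \<omega>)\<^sup>2 \<partial>\<sigma>pow n)"
  by (simp add: norm_fock_def inner_fock.abs_eq fock_rel_refl power2_eq_square)

lemma fock_space_cong:
  assumes F: "F \<in> fock_space" and eq: "\<And>n \<omega>. \<omega> \<in> Tpow n \<Longrightarrow> F' n \<omega> = F n \<omega>"
  shows "F' \<in> fock_space" "abs_fock F' = abs_fock F"
proof -
  have m: "F' n \<in> borel_measurable (\<sigma>pow n)" for n
    using fock_spaceD(1)[OF F, of n] eq by (subst measurable_cong[of _ _ "F n"]) auto
  moreover have "integrable (\<sigma>pow n) (\<lambda>\<omega>. (F' n \<omega>)\<^sup>2)" for n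
    using fock_spaceD(2)[OF F, of n] eq
    by (subst Bochner_Integration.integrable_cong[of _ "\<sigma>pow n" _ "\<lambda>\<omega>. (F n \<omega>)\<^sup>2"]) auto
  moreover have "(\<integral>\<omega>. (F' n \<omega>)\<^sup>2 \<partial>\<sigma>pow n) = (\<integral>\<omega>. (F n \<omega>)\<^sup>2 \<partial>\<sigma>pow n)" for n
    using eq by (intro Bochner_Integration.integral_cong) auto
  ultimately show F': "F' \<in> fock_space"
    using fock_spaceD(3)[OF F] by (simp add: fock_space_def)
  show "abs_fock F' = abs_fock F"
    using F' F eq by (intro abs_fock_eqI) auto
qed

lemma AE_kernel_map_lincomb:
  fixes F F' :: "nat \<Rightarrow> (nat \<Rightarrow> 'a::radon_polish) \<Rightarrow> real"
  assumes \<kappa>: "kern_bdd k l K B \<kappa>" and F: "F \<in> fock_space" "F' \<in> fock_space"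
  shows "AE \<omega> in \<sigma>pow N. kernel_map k l \<kappa> (\<lambda>n \<omega>. a * F n \<omega> + b * F' n \<omega>) N \<omega> =
    a * kernel_map k l \<kappa> F N \<omega> + b * kernel_map k l \<kappa> F' N \<omega>"
proof (cases "N < k")
  case True
  then show ?thesis by (simp add: kernel_map_def)
next
  case False
  then obtain r where N: "N = k + r" by (metis le_Suc_ex not_less)
  show ?thesis unfolding N
    using AE_kernel_integrable[OF \<kappa> F(1), of r] AE_kernel_integrable[OF \<kappa> F(2), of r]
  proof eventually_elim
    case (elim \<omega>)
    let ?f = "\<lambda>s. \<kappa> (k + r) \<omega> s * F (l + r) (join l s (drop_pt k \<omega>))"
    let ?f' = "\<lambda>s. \<kappa> (k + r) \<omega> s * F' (l + r) (join l s (drop_pt k \<omega>))"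
    have "(\<integral>s. a * ?f s + b * ?f' s \<partial>\<sigma>pow l) = a * (\<integral>s. ?f s \<partial>\<sigma>pow l) + b * (\<integral>s. ?f' s \<partial>\<sigma>pow l)"
      using elim by simp
    then show ?case by (simp add: kernel_map_def algebra_simps)
  qed
qed

lemma kern_bdd_lincomb:
  assumes "kern_bdd k l K B \<kappa>" "kern_bdd k l K B' \<kappa>'"
  shows "kern_bdd k l K (\<bar>a\<bar> * B + \<bar>b\<bar> * B') (\<lambda>N \<omega> s. a * \<kappa> N \<omega> s + b * \<kappa>' N \<omega> s)"
  unfolding kern_bdd_def
proof (intro conjI allI impI)
  show "compact K" using kern_bddD(1)[OF assms(1)] .
  show "0 \<le> \<bar>a\<bar> * B + \<bar>b\<bar> * B'" using kern_bddD(2)[OF assms(1)] kern_bddD(2)[OF assms(2)] by simp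
  show "(\<lambda>p. a * \<kappa> N (fst p) (snd p) + b * \<kappa>' N (fst p) (snd p)) \<in> borel_measurable (\<sigma>pow N \<Otimes>\<^sub>M \<sigma>pow l)" for N
    using kern_bddD(3)[OF assms(1)] kern_bddD(3)[OF assms(2)]
    by (intro borel_measurable_add borel_measurable_times) auto
  fix N \<omega> s
  have "\<bar>a * \<kappa> N \<omega> s + b * \<kappa>' N \<omega> s\<bar> \<le> \<bar>a\<bar> * \<bar>\<kappa> N \<omega> s\<bar> + \<bar>b\<bar> * \<bar>\<kappa>' N \<omega> s\<bar>"
    using abs_triangle_ineq[of "a * \<kappa> N \<omega> s" "b * \<kappa>' N \<omega> s"] by (simp add: abs_mult)
  also have "\<dots> \<le> \<bar>a\<bar> * B + \<bar>b\<bar> * B'"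
    by (intro add_mono mult_left_mono kern_bddD(4)[OF assms(1)] kern_bddD(4)[OF assms(2)]) auto
  finally show "\<bar>a * \<kappa> N \<omega> s + b * \<kappa>' N \<omega> s\<bar> \<le> \<bar>a\<bar> * B + \<bar>b\<bar> * B'" .
  assume "a * \<kappa> N \<omega> s + b * \<kappa>' N \<omega> s \<noteq> 0"
  then consider "\<kappa> N \<omega> s \<noteq> 0" | "\<kappa>' N \<omega> s \<noteq> 0" by fastforce
  note * = this
  show "\<omega> i \<in> K" if "i < k" for i
    using * kern_bddD(5)[OF assms(1)] kern_bddD(5)[OF assms(2)] that by cases simp_all
  show "s i \<in> K" if "i < l" for i
    using * kern_bddD(6)[OF assms(1)] kern_bddD(6)[OF assms(2)] that by cases simp_all
qed

lemma AE_kernel_map_kernel_lincomb: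
  fixes F :: "nat \<Rightarrow> (nat \<Rightarrow> 'a::radon_polish) \<Rightarrow> real"
  assumes \<kappa>: "kern_bdd k l K B \<kappa>" "kern_bdd k l K B' \<kappa>'" and F: "F \<in> fock_space"
  shows "AE \<omega> in \<sigma>pow N. kernel_map k l (\<lambda>N \<omega> s. a * \<kappa> N \<omega> s + b * \<kappa>' N \<omega> s) F N \<omega> =
    a * kernel_map k l \<kappa> F N \<omega> + b * kernel_map k l \<kappa>' F N \<omega>"
proof (cases "N < k")
  case True
  then show ?thesis by (simp add: kernel_map_def)
next
  case False
  then obtain r where N: "N = k + r" by (metis le_Suc_ex not_less)
  show ?thesis unfolding N
    using AE_kernel_integrable[OF \<kappa>(1) F, of r] AE_kernel_integrable[OF \<kappa>(2) F, of r]
  proof eventually_elim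
    case (elim \<omega>)
    let ?f = "\<lambda>s. \<kappa> (k + r) \<omega> s * F (l + r) (join l s (drop_pt k \<omega>))"
    let ?f' = "\<lambda>s. \<kappa>' (k + r) \<omega> s * F (l + r) (join l s (drop_pt k \<omega>))"
    have "(\<integral>s. a * ?f s + b * ?f' s \<partial>\<sigma>pow l) = a * (\<integral>s. ?f s \<partial>\<sigma>pow l) + b * (\<integral>s. ?f' s \<partial>\<sigma>pow l)"
      using elim by simp
    then show ?case by (simp add: kernel_map_def algebra_simps)
  qed
qed

lemma abs_kernel_map_lincomb:
  fixes F F' :: "nat \<Rightarrow> (nat \<Rightarrow> 'a::radon_polish) \<Rightarrow> real"
  assumes \<kappa>: "kern_bdd k l K B \<kappa>" and F: "F \<in> fock_space" "F' \<in> fock_space"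
  shows "abs_fock (kernel_map k l \<kappa> (\<lambda>n \<omega>. a * F n \<omega> + b * F' n \<omega>)) =
    a *\<^sub>R abs_fock (kernel_map k l \<kappa> F) + b *\<^sub>R abs_fock (kernel_map k l \<kappa> F')"
proof -
  have "abs_fock (kernel_map k l \<kappa> (\<lambda>n \<omega>. a * F n \<omega> + b * F' n \<omega>)) =
    abs_fock (\<lambda>n \<omega>. a * kernel_map k l \<kappa> F n \<omega> + b * kernel_map k l \<kappa> F' n \<omega>)"
    by (intro abs_fock_eqI kernel_map_fock(1)[OF \<kappa>] fock_space_lincomb F AE_kernel_map_lincomb[OF \<kappa>])
  then show ?thesis by (simp add: abs_fock_lincomb kernel_map_fock(1)[OF \<kappa>] F)
qed

text \<open>The L2 bound for the difference of two representatives gives norm 0, so the map is well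
  defined on classes.\<close>

lemma kernel_map_cong_AE:
  fixes F F' :: "nat \<Rightarrow> (nat \<Rightarrow> 'a::radon_polish) \<Rightarrow> real"
  assumes \<kappa>: "kern_bdd k l K B \<kappa>" and F: "F \<in> fock_space" "F' \<in> fock_space"
    and eq: "\<And>n. AE \<omega> in \<sigma>pow n. F n \<omega> = F' n \<omega>"
  shows "abs_fock (kernel_map k l \<kappa> F) = abs_fock (kernel_map k l \<kappa> F')"
proof -
  let ?D = "\<lambda>n \<omega>. 1 * F n \<omega> + (-1) * F' n \<omega>"
  have D: "?D \<in> fock_space" by (intro fock_space_lincomb F)
  have "(\<integral>\<omega>. (?D n \<omega>)\<^sup>2 \<partial>\<sigma>pow n) = 0" for n
  proof -
    have "AE \<omega> in \<sigma>pow n. (?D n \<omega>)\<^sup>2 = 0" using eq[of n] by eventually_elim simp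
    then show ?thesis by (rule integral_eq_zero_AE)
  qed
  then have "(\<Sum>N. \<integral>\<omega>. (kernel_map k l \<kappa> ?D N \<omega>)\<^sup>2 \<partial>\<sigma>pow N) \<le> 0"
    using kernel_map_fock(2)[OF \<kappa> D] by simp
  then have "norm (abs_fock (kernel_map k l \<kappa> ?D)) \<le> 0"
    using norm_abs_fock[OF kernel_map_fock(1)[OF \<kappa> D]] by simp
  then have "abs_fock (kernel_map k l \<kappa> ?D) = 0" by simp
  then show ?thesis
    by (simp only: abs_kernel_map_lincomb[OF \<kappa> F]) simp
qed

definition kernel_op :: "nat \<Rightarrow> nat \<Rightarrow> (nat \<Rightarrow> (nat \<Rightarrow> 'a::radon_polish) \<Rightarrow> (nat \<Rightarrow> 'a) \<Rightarrow> real) \<Rightarrow> 'a fock_op" where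
  "kernel_op k l \<kappa> = Blinfun (\<lambda>F. abs_fock (kernel_map k l \<kappa> (rep_fock F)))"

text \<open>The operator norm is linear in the sup bound B of the kernel, with a constant depending
  only on K, k and l. This is the estimate that \<open>bdd_fun\<close> asks for once the coefficient
  itself is the kernel.\<close>

lemma
  fixes \<kappa> :: "nat \<Rightarrow> (nat \<Rightarrow> 'a::radon_polish) \<Rightarrow> (nat \<Rightarrow> 'a) \<Rightarrow> real"
  assumes \<kappa>: "kern_bdd k l K B \<kappa>"
  shows kernel_op_abs: "F \<in> fock_space \<Longrightarrow> kernel_op k l \<kappa> (abs_fock F) = abs_fock (kernel_map k l \<kappa> F)"
    and norm_kernel_op: "norm (kernel_op k l \<kappa>) \<le> B * sqrt (measure \<sigma> K ^ (k + l))"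
proof -
  let ?T = "\<lambda>v. abs_fock (kernel_map k l \<kappa> (rep_fock v))"
  let ?C = "B * sqrt (measure \<sigma> K ^ (k + l))"
  have T: "?T (abs_fock F) = abs_fock (kernel_map k l \<kappa> F)" if "F \<in> fock_space" for F
    by (rule kernel_map_cong_AE[OF \<kappa> rep_fock_in that rep_abs_fock[OF that]])
  have lin: "?T (a *\<^sub>R u + b *\<^sub>R v) = a *\<^sub>R ?T u + b *\<^sub>R ?T v" for a b u v
  proof -
    have "a *\<^sub>R u + b *\<^sub>R v = abs_fock (\<lambda>n \<omega>. a * rep_fock u n \<omega> + b * rep_fock v n \<omega>)"
      by (simp add: abs_fock_lincomb rep_fock_in)
    then show ?thesis
      by (simp add: T fock_space_lincomb rep_fock_in abs_kernel_map_lincomb[OF \<kappa>])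
  qed
  have bd: "norm (?T v) \<le> ?C * norm v" for v
  proof -
    have "norm (?T v) \<le> sqrt (B\<^sup>2 * measure \<sigma> K ^ (k + l) * (\<Sum>n. \<integral>\<omega>. (rep_fock v n \<omega>)\<^sup>2 \<partial>\<sigma>pow n))"
      using kernel_map_fock[OF \<kappa> rep_fock_in] by (simp add: norm_abs_fock)
    also have "\<dots> = ?C * norm v"
      using kern_bddD(2)[OF \<kappa>] norm_abs_fock[OF rep_fock_in, of v] by (simp add: real_sqrt_mult)
    finally show ?thesis .
  qed
  have bl: "bounded_linear ?T"
  proof (rule bounded_linear_intro[where K="?C"])
    show "?T (u + v) = ?T u + ?T v" for u v using lin[of 1 u 1 v] by simp
    show "?T (a *\<^sub>R u) = a *\<^sub>R ?T u" for a u using lin[of a u 0 u] by simp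
    show "norm (?T v) \<le> norm v * ?C" for v using bd[of v] by (simp add: mult.commute)
  qed
  have app: "kernel_op k l \<kappa> v = ?T v" for v
    unfolding kernel_op_def by (simp add: bounded_linear_Blinfun_apply[OF bl])
  then show "F \<in> fock_space \<Longrightarrow> kernel_op k l \<kappa> (abs_fock F) = abs_fock (kernel_map k l \<kappa> F)"
    using T by simp
  show "norm (kernel_op k l \<kappa>) \<le> ?C"
    using bd app kern_bddD(2)[OF \<kappa>] by (intro norm_blinfun_bound) auto
qed

lemma fock_op_eqI:
  assumes "\<And>F. F \<in> fock_space \<Longrightarrow> blinfun_apply A (abs_fock F) = blinfun_apply B (abs_fock F)"
  shows "A = (B :: 'a::radon_polish fock_op)"
proof (rule blinfun_eqI)
  show "A v = B v" for v using assms[OF rep_fock_in, of v] by simp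
qed

lemma kernel_op_lincomb:
  assumes \<kappa>: "kern_bdd k l K B \<kappa>" "kern_bdd k l K B' \<kappa>'"
  shows "kernel_op k l (\<lambda>N \<omega> s. a * \<kappa> N \<omega> s + b * \<kappa>' N \<omega> s) = a *\<^sub>R kernel_op k l \<kappa> + b *\<^sub>R kernel_op k l \<kappa>'"
proof (rule fock_op_eqI)
  fix F :: "nat \<Rightarrow> (nat \<Rightarrow> 'a) \<Rightarrow> real" assume F: "F \<in> fock_space"
  have "abs_fock (kernel_map k l (\<lambda>N \<omega> s. a * \<kappa> N \<omega> s + b * \<kappa>' N \<omega> s) F) =
    abs_fock (\<lambda>n \<omega>. a * kernel_map k l \<kappa> F n \<omega> + b * kernel_map k l \<kappa>' F n \<omega>)"
    by (intro abs_fock_eqI kernel_map_fock(1)[OF kern_bdd_lincomb[OF \<kappa>]] fock_space_lincomb F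
        kernel_map_fock(1)[OF \<kappa>(1)] kernel_map_fock(1)[OF \<kappa>(2)] AE_kernel_map_kernel_lincomb[OF \<kappa>])
  then show "kernel_op k l (\<lambda>N \<omega> s. a * \<kappa> N \<omega> s + b * \<kappa>' N \<omega> s) (abs_fock F) =
      (a *\<^sub>R kernel_op k l \<kappa> + b *\<^sub>R kernel_op k l \<kappa>') (abs_fock F)"
    using F by (simp add: kernel_op_abs[OF kern_bdd_lincomb[OF \<kappa>]] kernel_op_abs[OF \<kappa>(1)] kernel_op_abs[OF \<kappa>(2)]
        abs_fock_lincomb kernel_map_fock(1)[OF \<kappa>(1)] kernel_map_fock(1)[OF \<kappa>(2)] plus_blinfun.rep_eq scaleR_blinfun.rep_eq)
qed

lemma integral_\<sigma>pow_0:
  fixes h :: "(nat \<Rightarrow> 'a::radon_polish) \<Rightarrow> real"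
  shows "(\<integral>s. h s \<partial>\<sigma>pow 0) = h (\<lambda>_. undefined)"
proof -
  have sp: "space (Pi\<^sub>M {} (\<lambda>_. \<sigma> :: 'a measure)) = {\<lambda>_::nat. undefined}" by (rule space_PiM_empty)
  have "(\<integral>s. h s \<partial>\<sigma>pow 0) = (\<integral>s. h (\<lambda>_. undefined) \<partial>(\<sigma>pow 0 :: (nat \<Rightarrow> 'a) measure))"
    by (rule Bochner_Integration.integral_cong) (simp_all add: \<sigma>pow_def sp Tpow_def)
  also have "\<dots> = h (\<lambda>_. undefined)"
    unfolding \<sigma>pow_def lessThan_0 by (simp add: sp measure_def)
  finally show ?thesis .
qed

lemma measure_Tpow_0 [simp]: "measure (\<sigma>pow 0) (Tpow 0) = 1"
  using integral_\<sigma>pow_0[of "\<lambda>_. 1"] by simp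

lemma join_0 [simp]: "join 0 x z = z"
  by (simp add: join_def fun_eq_iff)

lemma drop_pt_0 [simp]: "drop_pt 0 \<omega> = \<omega>"
  by (simp add: drop_pt_def fun_eq_iff)

lemma drop_pt_1: "drop_pt (Suc 0) \<omega> = (\<lambda>i. \<omega> (Suc i))"
  by (simp add: drop_pt_def fun_eq_iff)

section \<open>Creation, preservation and annihilation as kernel operators\<close>

definition plus_map :: "('a::radon_polish \<Rightarrow> real) \<Rightarrow> (nat \<Rightarrow> (nat \<Rightarrow> 'a) \<Rightarrow> real) \<Rightarrow> nat \<Rightarrow> (nat \<Rightarrow> 'a) \<Rightarrow> real" where
  "plus_map f F n \<omega> = (case n of 0 \<Rightarrow> 0 | Suc m \<Rightarrow> f (\<omega> 0) * F m (\<lambda>i. \<omega> (Suc i)))"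

text \<open>The argument f stands for the product of \<lambda> and a test function, which is a test
  function again.\<close>

definition zero_map :: "('a::radon_polish \<Rightarrow> real) \<Rightarrow> (nat \<Rightarrow> (nat \<Rightarrow> 'a) \<Rightarrow> real) \<Rightarrow> nat \<Rightarrow> (nat \<Rightarrow> 'a) \<Rightarrow> real" where
  "zero_map f F n \<omega> = (if n = 0 then 0 else f (\<omega> 0) * F n \<omega>)"

definition minus_map :: "('a::radon_polish \<Rightarrow> real) \<Rightarrow> (nat \<Rightarrow> (nat \<Rightarrow> 'a) \<Rightarrow> real) \<Rightarrow> nat \<Rightarrow> (nat \<Rightarrow> 'a) \<Rightarrow> real" where
  "minus_map f F n \<omega> = (\<integral>t. f t * F (Suc n) (case_nat t \<omega>) \<partial>\<sigma>)"

lemma measurable_D1_coordinate: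
  fixes f :: "'a::radon_polish \<Rightarrow> real"
  assumes "f \<in> \<D>1" "i < n"
  shows "(\<lambda>\<omega>. f (\<omega> i)) \<in> borel_measurable (\<sigma>pow n)"
  using measurable_compose[OF measurable_coordinate[OF assms(2)], of f borel] D1_measurable[OF assms(1)]
  by (simp add: measurable_\<sigma>_iff)

lemma kern_bdd_plus:
  assumes "f \<in> \<D>1"
  shows "\<exists>K B. kern_bdd 1 0 K B (\<lambda>N \<omega> s. if N = 0 then 0 else f (\<omega> 0))"
proof -
  obtain K where K: "compact K" "\<And>t. t \<notin> K \<Longrightarrow> f t = 0" using D1_compact_support[OF assms] by blast
  obtain B where B: "0 \<le> B" "\<And>t. \<bar>f t\<bar> \<le> B" using D1_bounded[OF assms] by blast
  have "(\<lambda>p. if N = 0 then 0 else f (fst p 0)) \<in> borel_measurable (\<sigma>pow N \<Otimes>\<^sub>M \<sigma>pow 0)" for N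
    using measurable_compose[OF measurable_fst measurable_D1_coordinate[OF assms, of 0 N]] by (cases N) auto
  then have "kern_bdd 1 0 K B (\<lambda>N \<omega> s. if N = 0 then 0 else f (\<omega> 0))"
    using K B unfolding kern_bdd_def by (auto split: if_splits)
  then show ?thesis by blast
qed

text \<open>X^0 counts as creating and consuming nothing; its kernel looks at the first coordinate
  of the output point. The value 0 at level 0 says that X^0 kills the vacuum level.\<close>

lemma kern_bdd_zero:
  assumes "f \<in> \<D>1"
  shows "\<exists>K B. kern_bdd 0 0 K B (\<lambda>N \<omega> s. if N = 0 then 0 else f (\<omega> 0))"
proof -
  obtain K B where "kern_bdd 1 0 K B (\<lambda>N \<omega> s. if N = 0 then 0 else f (\<omega> 0))"
    using kern_bdd_plus[OF assms] by blast
  then have "kern_bdd 0 0 K B (\<lambda>N \<omega> s. if N = 0 then 0 else f (\<omega> 0))"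
    by (simp add: kern_bdd_def)
  then show ?thesis by blast
qed

lemma kern_bdd_minus:
  assumes "f \<in> \<D>1"
  shows "\<exists>K B. kern_bdd 0 1 K B (\<lambda>N \<omega> s. f (s 0))"
proof -
  obtain K where K: "compact K" "\<And>t. t \<notin> K \<Longrightarrow> f t = 0" using D1_compact_support[OF assms] by blast
  obtain B where B: "0 \<le> B" "\<And>t. \<bar>f t\<bar> \<le> B" using D1_bounded[OF assms] by blast
  have "(\<lambda>p. f (snd p 0)) \<in> borel_measurable (\<sigma>pow N \<Otimes>\<^sub>M \<sigma>pow 1)" for N
    using measurable_compose[OF measurable_snd measurable_D1_coordinate[OF assms, of 0 1]] by simp
  then have "kern_bdd 0 1 K B (\<lambda>N \<omega> s. f (s 0))"
    using K B unfolding kern_bdd_def by auto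
  then show ?thesis by blast
qed

lemma plus_map_eq: "plus_map f F = kernel_map 1 0 (\<lambda>N \<omega> s. if N = 0 then 0 else f (\<omega> 0)) F"
  by (intro ext)
    (simp add: plus_map_def kernel_map_def integral_\<sigma>pow_0 drop_pt_1 split: nat.split)

lemma zero_map_eq: "zero_map f F = kernel_map 0 0 (\<lambda>N \<omega> s. if N = 0 then 0 else f (\<omega> 0)) F"
  by (intro ext) (simp add: zero_map_def kernel_map_def integral_\<sigma>pow_0)

lemma case_nat_in_Tpow: "\<omega> \<in> Tpow n \<Longrightarrow> case_nat t \<omega> \<in> Tpow (Suc n)"
  by (auto simp: Tpow_iff split: nat.split)

lemma measurable_case_nat:
  "(\<lambda>p. case_nat (fst p) (snd p)) \<in> measurable (\<sigma> \<Otimes>\<^sub>M \<sigma>pow n) (\<sigma>pow (Suc n) :: (nat \<Rightarrow> 'a::radon_polish) measure)"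
proof (rule measurable_into_\<sigma>pow)
  fix i assume "i < Suc n"
  then show "(\<lambda>p. case i of 0 \<Rightarrow> fst p | Suc j \<Rightarrow> snd p j) \<in> measurable (\<sigma> \<Otimes>\<^sub>M \<sigma>pow n) (\<sigma> :: 'a measure)"
    using measurable_compose[OF measurable_snd measurable_coordinate] by (cases i) auto
qed (auto simp: space_pair_measure intro: case_nat_in_Tpow)

lemma minus_map_eq:
  fixes F :: "nat \<Rightarrow> (nat \<Rightarrow> 'a::radon_polish) \<Rightarrow> real"
  assumes F: "F \<in> fock_space" and f: "f \<in> \<D>1" and \<omega>: "\<omega> \<in> Tpow N"
  shows "minus_map f F N \<omega> = kernel_map 0 1 (\<lambda>N \<omega> s. f (s 0)) F N \<omega>"
proof -
  interpret product_sigma_finite "\<lambda>_::nat. \<sigma> :: 'a measure" by (rule product_sigma_finite_\<sigma>)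
  have "(\<lambda>t. (t, \<omega>)) \<in> measurable \<sigma> (\<sigma> \<Otimes>\<^sub>M \<sigma>pow N)" using \<omega> by simp
  from measurable_compose[OF measurable_compose[OF this measurable_case_nat] fock_spaceD(1)[OF F]]
  have "(\<lambda>t. F (Suc N) (case_nat t \<omega>)) \<in> borel_measurable \<sigma>" by simp
  then have m: "(\<lambda>t. f t * F (Suc N) (case_nat t \<omega>)) \<in> borel_measurable \<sigma>"
    using D1_measurable[OF f] by (intro borel_measurable_times) (simp_all add: measurable_\<sigma>_iff)
  have j: "join 1 s \<omega> = case_nat (s 0) \<omega>" for s :: "nat \<Rightarrow> 'a"
    by (auto simp: join_def fun_eq_iff split: nat.split)
  have d: "drop_pt 0 \<omega> = \<omega>" by (simp add: drop_pt_def fun_eq_iff)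
  have "{..<1::nat} = {0}" by auto
  then show ?thesis
    using product_integral_singleton[OF m, of 0]
    by (simp add: minus_map_def kernel_map_def j[unfolded One_nat_def] d \<sigma>pow_def)
qed

text \<open>\<open>Blinfun\<close> of a map on chosen representatives can be evaluated only when
  that map is known to be bounded. Identification with a kernel operator supplies this together with
  independence of the representative.\<close>

lemma X_plus_abs:
  assumes "f \<in> \<D>1" "F \<in> fock_space"
  shows "plus_map f F \<in> fock_space" "X_plus f (abs_fock F) = abs_fock (plus_map f F)"
proof -
  obtain K B where \<kappa>: "kern_bdd 1 0 K B (\<lambda>N \<omega> s. if N = 0 then 0 else f (\<omega> 0))"
    using kern_bdd_plus[OF assms(1)] by blast
  show "plus_map f F \<in> fock_space" unfolding plus_map_eq by (rule kernel_map_fock(1)[OF \<kappa> assms(2)])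
  have "X_plus f = kernel_op 1 0 (\<lambda>N \<omega> s. if N = 0 then 0 else f (\<omega> 0))"
    unfolding X_plus_def kernel_op_def plus_map_eq[symmetric] plus_map_def[abs_def] ..
  then show "X_plus f (abs_fock F) = abs_fock (plus_map f F)"
    by (simp only: kernel_op_abs[OF \<kappa> assms(2)] plus_map_eq)
qed

lemma X_zero_abs:
  assumes "(\<lambda>t. lam t * f t) \<in> \<D>1" "F \<in> fock_space"
  shows "zero_map (\<lambda>t. lam t * f t) F \<in> fock_space"
    "X_zero lam f (abs_fock F) = abs_fock (zero_map (\<lambda>t. lam t * f t) F)"
proof -
  let ?f = "\<lambda>t. lam t * f t"
  obtain K B where \<kappa>: "kern_bdd 0 0 K B (\<lambda>N \<omega> s. if N = 0 then 0 else ?f (\<omega> 0))"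
    using kern_bdd_zero[OF assms(1)] by blast
  show "zero_map ?f F \<in> fock_space" unfolding zero_map_eq by (rule kernel_map_fock(1)[OF \<kappa> assms(2)])
  have "X_zero lam f = kernel_op 0 0 (\<lambda>N \<omega> s. if N = 0 then 0 else ?f (\<omega> 0))"
    unfolding X_zero_def kernel_op_def zero_map_eq[of ?f, symmetric] zero_map_def[abs_def] ..
  then show "X_zero lam f (abs_fock F) = abs_fock (zero_map ?f F)"
    by (simp only: kernel_op_abs[OF \<kappa> assms(2)] zero_map_eq)
qed

lemma X_minus_abs:
  assumes f: "f \<in> \<D>1" and F: "F \<in> fock_space"
  shows "minus_map f F \<in> fock_space" "X_minus f (abs_fock F) = abs_fock (minus_map f F)"
proof -
  obtain K B where \<kappa>: "kern_bdd 0 1 K B (\<lambda>N \<omega> s. f (s 0))"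
    using kern_bdd_minus[OF f] by blast
  have eq: "minus_map f F \<in> fock_space \<and> abs_fock (minus_map f F) = abs_fock (kernel_map 0 1 (\<lambda>N \<omega> s. f (s 0)) F)"
    if "F \<in> fock_space" for F
    using fock_space_cong[OF kernel_map_fock(1)[OF \<kappa> that] minus_map_eq[OF that f]] by simp
  then show "minus_map f F \<in> fock_space" using F by simp
  have "X_minus f = kernel_op 0 1 (\<lambda>N \<omega> s. f (s 0))"
    unfolding X_minus_def kernel_op_def
    using conjunct2[OF eq[OF rep_fock_in]] by (simp only: minus_map_def[abs_def])
  then show "X_minus f (abs_fock F) = abs_fock (minus_map f F)"
    using conjunct2[OF eq[OF F]] by (simp only: kernel_op_abs[OF \<kappa> F])
qed


section \<open>Normal ordering of the orthogonal polynomials\<close>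

text \<open>The relation that characterises the free Fock space: annihilation removes exactly the
  particle just created in front, so no term with a permuted order appears.\<close>

lemma X_minus_X_plus:
  assumes f: "f \<in> \<D>1" and g: "g \<in> \<D>1"
  shows "X_minus f o\<^sub>L X_plus g = (\<integral>t. f t * g t \<partial>\<sigma>) *\<^sub>R id_blinfun"
proof (rule fock_op_eqI)
  fix F :: "nat \<Rightarrow> (nat \<Rightarrow> 'a) \<Rightarrow> real" assume F: "F \<in> fock_space"
  note p = X_plus_abs[OF g F]
  have "minus_map f (plus_map g F) = (\<lambda>n \<omega>. (\<integral>t. f t * g t \<partial>\<sigma>) * F n \<omega>)"
    by (simp add: minus_map_def plus_map_def fun_eq_iff mult.assoc[symmetric])
  then show "(X_minus f o\<^sub>L X_plus g) (abs_fock F) = ((\<integral>t. f t * g t \<partial>\<sigma>) *\<^sub>R id_blinfun) (abs_fock F)"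
    using X_minus_abs(2)[OF f p(1)] F by (simp add: p(2) abs_fock_scale scaleR_blinfun.rep_eq)
qed

lemma blinfun_compose_id [simp]: "A o\<^sub>L id_blinfun = A" "id_blinfun o\<^sub>L A = A"
  by (simp_all add: blinfun_eqI)

lemma blinfun_compose_assoc: "(A o\<^sub>L B) o\<^sub>L C = A o\<^sub>L (B o\<^sub>L C)"
  by (rule blinfun_eqI) simp

lemma supported_inD: "supported_in n K f \<Longrightarrow> f \<omega> \<noteq> 0 \<Longrightarrow> \<omega> \<in> cube n K"
  by (auto simp: supported_in_def)

text \<open>
  Expanding the recursion for \<open>P_tensor\<close>, all contractions cancel and only the words
  $X^+(f_1)\cdots X^+(f_k)\,Z\,X^-(f_{k+2})\cdots X^-(f_n)$ remain, with $Z\in\{X^0(f_{k+1}), X^-(f_{k+1})\}$.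
\<close>

primrec ann :: "('a::radon_polish \<Rightarrow> real) list \<Rightarrow> 'a fock_op" where
  "ann [] = id_blinfun"
| "ann (f # fs) = X_minus f o\<^sub>L ann fs"

primrec normal_ordered :: "('a::radon_polish \<Rightarrow> real) \<Rightarrow> ('a \<Rightarrow> real) list \<Rightarrow> 'a fock_op" where
  "normal_ordered lam [] = id_blinfun"
| "normal_ordered lam (f # fs) =
     (X_plus f o\<^sub>L normal_ordered lam fs) + (X_zero lam f o\<^sub>L ann fs) + (X_minus f o\<^sub>L ann fs)"

lemma blinfun_compose_add_left: "(A + B) o\<^sub>L C = (A o\<^sub>L C) + (B o\<^sub>L C)"
  by (rule blinfun_eqI) (simp add: plus_blinfun.rep_eq)

lemma blinfun_compose_add_right: "A o\<^sub>L (B + C) = (A o\<^sub>L B) + (A o\<^sub>L C)"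
  by (rule blinfun_eqI) (simp add: plus_blinfun.rep_eq blinfun.add_right)

context
  fixes lam :: "'a::radon_polish \<Rightarrow> real"
  assumes lam: "continuous_on UNIV lam"
begin

lemma D1_lam: "f \<in> \<D>1 \<Longrightarrow> (\<lambda>t. lam t * f t) \<in> \<D>1"
  by (rule D1_mult_cont[OF lam])

lemma D1_lam_mult: "f \<in> \<D>1 \<Longrightarrow> g \<in> \<D>1 \<Longrightarrow> (\<lambda>t. lam t * f t * g t) \<in> \<D>1"
  by (intro D1_mult D1_lam)

text \<open>In this and the next two relations both operators touch the same first particle, so they
  fuse into one operator with test function \<open>lam t * f t * g t\<close>.\<close>

lemma X_zero_X_plus:
  assumes f: "f \<in> \<D>1" and g: "g \<in> \<D>1"
  shows "X_zero lam f o\<^sub>L X_plus g = X_plus (\<lambda>t. lam t * f t * g t)"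
proof (rule fock_op_eqI)
  fix F :: "nat \<Rightarrow> (nat \<Rightarrow> 'a) \<Rightarrow> real" assume F: "F \<in> fock_space"
  note p = X_plus_abs[OF g F]
  have "zero_map (\<lambda>t. lam t * f t) (plus_map g F) = plus_map (\<lambda>t. lam t * f t * g t) F"
    by (simp add: zero_map_def plus_map_def fun_eq_iff split: nat.split)
  then show "(X_zero lam f o\<^sub>L X_plus g) (abs_fock F) = X_plus (\<lambda>t. lam t * f t * g t) (abs_fock F)"
    using X_zero_abs(2)[OF D1_lam[OF f] p(1)] X_plus_abs(2)[OF D1_lam_mult[OF f g] F] by (simp add: p(2))
qed

lemma X_zero_X_zero:
  assumes f: "f \<in> \<D>1" and g: "g \<in> \<D>1"
  shows "X_zero lam f o\<^sub>L X_zero lam g = X_zero lam (\<lambda>t. lam t * f t * g t)"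
proof (rule fock_op_eqI)
  fix F :: "nat \<Rightarrow> (nat \<Rightarrow> 'a) \<Rightarrow> real" assume F: "F \<in> fock_space"
  note p = X_zero_abs[OF D1_lam[OF g] F]
  have "zero_map (\<lambda>t. lam t * f t) (zero_map (\<lambda>t. lam t * g t) F) = zero_map (\<lambda>t. lam t * (lam t * f t * g t)) F"
    by (simp add: zero_map_def fun_eq_iff)
  then show "(X_zero lam f o\<^sub>L X_zero lam g) (abs_fock F) = X_zero lam (\<lambda>t. lam t * f t * g t) (abs_fock F)"
    using X_zero_abs(2)[OF D1_lam[OF f] p(1)] X_zero_abs(2)[OF D1_lam[OF D1_lam_mult[OF f g]] F] by (simp add: p(2))
qed

lemma X_minus_X_zero:
  assumes f: "f \<in> \<D>1" and g: "g \<in> \<D>1"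
  shows "X_minus f o\<^sub>L X_zero lam g = X_minus (\<lambda>t. lam t * f t * g t)"
proof (rule fock_op_eqI)
  fix F :: "nat \<Rightarrow> (nat \<Rightarrow> 'a) \<Rightarrow> real" assume F: "F \<in> fock_space"
  note p = X_zero_abs[OF D1_lam[OF g] F]
  have "minus_map f (zero_map (\<lambda>t. lam t * g t) F) = minus_map (\<lambda>t. lam t * f t * g t) F"
    by (simp add: zero_map_def minus_map_def fun_eq_iff mult_ac)
  then show "(X_minus f o\<^sub>L X_zero lam g) (abs_fock F) = X_minus (\<lambda>t. lam t * f t * g t) (abs_fock F)"
    using X_minus_abs(2)[OF f p(1)] X_minus_abs(2)[OF D1_lam_mult[OF f g] F] by (simp add: p(2))
qed

text \<open>In the product of X(f) with the words for \<open>g # gs\<close>, the three products that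
  fuse make up the words for the list with the merged factor, and X^- X^+ gives the scalar term.
  These are what the recursion subtracts; the rest is the expansion for
  \<open>f # g # gs\<close>.\<close>

lemma P_tensor_eq_normal_ordered:
  "set fs \<subseteq> \<D>1 \<Longrightarrow> P_tensor lam fs = normal_ordered lam fs"
proof (induction "length fs" arbitrary: fs rule: less_induct)
  case less
  consider "fs = []" | f where "fs = [f]" | f g gs where "fs = f # g # gs"
    by (metis list.exhaust)
  then show ?case
  proof cases
    case 1
    then show ?thesis by simp
  next
    case 2
    then show ?thesis by (simp add: X_def)
  next
    case (3 f g gs)
    let ?h = "\<lambda>t. lam t * f t * g t"
    have D: "f \<in> \<D>1" "g \<in> \<D>1" "set gs \<subseteq> \<D>1" using less(2) 3 by auto
    have h: "?h \<in> \<D>1" using D by (intro D1_lam_mult)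
    have IH: "P_tensor lam (g # gs) = normal_ordered lam (g # gs)"
      "P_tensor lam (?h # gs) = normal_ordered lam (?h # gs)" "P_tensor lam gs = normal_ordered lam gs"
      by (rule less(1); simp add: D h 3)+
    have c: "X_zero lam f o\<^sub>L (X_plus g o\<^sub>L A) = X_plus ?h o\<^sub>L A"
      "X_zero lam f o\<^sub>L (X_zero lam g o\<^sub>L A) = X_zero lam ?h o\<^sub>L A"
      "X_minus f o\<^sub>L (X_plus g o\<^sub>L A) = (\<integral>t. f t * g t \<partial>\<sigma>) *\<^sub>R A"
      "X_minus f o\<^sub>L (X_zero lam g o\<^sub>L A) = X_minus ?h o\<^sub>L A" for A :: "'a fock_op"
      using X_zero_X_plus[OF D(1,2)] X_zero_X_zero[OF D(1,2)] X_minus_X_plus[OF D(1,2)] X_minus_X_zero[OF D(1,2)]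
      by (simp_all add: blinfun_compose_assoc[symmetric]) (simp add: blinfun_eqI scaleR_blinfun.rep_eq)
    show ?thesis
      unfolding 3 P_tensor.simps IH
      by (simp add: X_def blinfun_compose_add_left blinfun_compose_add_right c)
  qed
qed

end

section \<open>Integral kernels of normally ordered words\<close>

lemma integral_\<sigma>pow_Suc:
  fixes h :: "(nat \<Rightarrow> 'a::radon_polish) \<Rightarrow> real"
  assumes h: "integrable (\<sigma>pow (Suc l)) h"
  shows "(\<integral>\<omega>. h \<omega> \<partial>\<sigma>pow (Suc l)) = (\<integral>z. \<integral>t. h (case_nat t z) \<partial>\<sigma> \<partial>\<sigma>pow l)"
proof -
  interpret product_sigma_finite "\<lambda>_::nat. \<sigma> :: 'a measure" by (rule product_sigma_finite_\<sigma>)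
  interpret pair_sigma_finite "\<sigma>pow 1 :: (nat \<Rightarrow> 'a) measure" "\<sigma>pow l :: (nat \<Rightarrow> 'a) measure"
    by (rule pair_sigma_finite_\<sigma>pow)
  have hm: "h \<in> borel_measurable (\<sigma>pow (1 + l))" and h1: "integrable (\<sigma>pow (1 + l)) h" using h by simp_all
  have d: "integrable (distr (\<sigma>pow 1 \<Otimes>\<^sub>M \<sigma>pow l) (\<sigma>pow (1 + l)) (\<lambda>p. join 1 (fst p) (snd p))) h"
    using h1 \<sigma>pow_split[where 'a='a, of 1 l] by metis
  have i: "integrable (\<sigma>pow 1 \<Otimes>\<^sub>M \<sigma>pow l) (\<lambda>p. h (join 1 (fst p) (snd p)))"
    using d by (subst (asm) integrable_distr_eq[OF measurable_join hm])
  have "(\<integral>\<omega>. h \<omega> \<partial>\<sigma>pow (1 + l)) =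
      (\<integral>\<omega>. h \<omega> \<partial>distr (\<sigma>pow 1 \<Otimes>\<^sub>M \<sigma>pow l) (\<sigma>pow (1 + l)) (\<lambda>p. join 1 (fst p) (snd p)))"
    using \<sigma>pow_split[where 'a='a, of 1 l] by metis
  also have "\<dots> = (\<integral>p. h (join 1 (fst p) (snd p)) \<partial>(\<sigma>pow 1 \<Otimes>\<^sub>M \<sigma>pow l))"
    by (rule integral_distr[OF measurable_join hm])
  also have "\<dots> = (\<integral>z. \<integral>x. h (join 1 x z) \<partial>\<sigma>pow 1 \<partial>\<sigma>pow l)"
    using integral_snd[of "\<lambda>x z. h (join 1 x z)"] i by (simp add: case_prod_beta')
  also have "\<dots> = (\<integral>z. \<integral>t. h (case_nat t z) \<partial>\<sigma> \<partial>\<sigma>pow l)"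
  proof (rule Bochner_Integration.integral_cong[OF refl])
    fix z :: "nat \<Rightarrow> 'a" assume "z \<in> space (\<sigma>pow l)"
    then have "(\<lambda>t. (t, z)) \<in> measurable \<sigma> (\<sigma> \<Otimes>\<^sub>M \<sigma>pow l)" by simp
    from measurable_compose[OF measurable_compose[OF this measurable_case_nat], of h borel]
    have m: "(\<lambda>t. h (case_nat t z)) \<in> borel_measurable \<sigma>" using h by simp
    have j: "join 1 x z = case_nat (x 0) z" for x :: "nat \<Rightarrow> 'a"
      by (auto simp: join_def fun_eq_iff split: nat.split)
    have "{..<1::nat} = {0}" by auto
    then show "(\<integral>x. h (join 1 x z) \<partial>\<sigma>pow 1) = (\<integral>t. h (case_nat t z) \<partial>\<sigma>)"
      using product_integral_singleton[OF m, of 0] by (simp add: j[unfolded One_nat_def] \<sigma>pow_def)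
  qed
  finally show ?thesis by simp
qed

lemma kernel_op_X_plus:
  assumes \<kappa>: "kern_bdd k l K B \<kappa>" and \<kappa>': "kern_bdd (Suc k) l K' B' \<kappa>'" and f: "f \<in> \<D>1"
    and eq: "\<And>N \<omega> s. \<kappa>' (Suc N) \<omega> s = f (\<omega> 0) * \<kappa> N (\<lambda>i. \<omega> (Suc i)) s"
  shows "kernel_op (Suc k) l \<kappa>' = X_plus f o\<^sub>L kernel_op k l \<kappa>"
proof (rule fock_op_eqI)
  fix F :: "nat \<Rightarrow> (nat \<Rightarrow> 'a) \<Rightarrow> real" assume F: "F \<in> fock_space"
  have d: "drop_pt k (\<lambda>i. \<omega> (Suc i)) = drop_pt (Suc k) \<omega>" for \<omega> :: "nat \<Rightarrow> 'a"
    by (simp add: drop_pt_def fun_eq_iff)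
  have "kernel_map (Suc k) l \<kappa>' F N \<omega> = plus_map f (kernel_map k l \<kappa> F) N \<omega>" for N \<omega>
    by (cases N) (simp_all add: plus_map_def kernel_map_def eq d mult.assoc)
  then have "kernel_map (Suc k) l \<kappa>' F = plus_map f (kernel_map k l \<kappa> F)" by (intro ext)
  then show "kernel_op (Suc k) l \<kappa>' (abs_fock F) = (X_plus f o\<^sub>L kernel_op k l \<kappa>) (abs_fock F)"
    using X_plus_abs(2)[OF f kernel_map_fock(1)[OF \<kappa> F]] by (simp add: kernel_op_abs[OF \<kappa> F] kernel_op_abs[OF \<kappa>' F])
qed

lemma kernel_op_X_zero:
  assumes \<kappa>: "kern_bdd 0 l K B \<kappa>" and \<kappa>': "kern_bdd 0 l K' B' \<kappa>'" and f: "(\<lambda>t. lam t * f t) \<in> \<D>1"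
    and eq: "\<And>N \<omega> s. \<kappa>' N \<omega> s = (if N = 0 then 0 else lam (\<omega> 0) * f (\<omega> 0) * \<kappa> N \<omega> s)"
  shows "kernel_op 0 l \<kappa>' = X_zero lam f o\<^sub>L kernel_op 0 l \<kappa>"
proof (rule fock_op_eqI)
  fix F :: "nat \<Rightarrow> (nat \<Rightarrow> 'a) \<Rightarrow> real" assume F: "F \<in> fock_space"
  have "kernel_map 0 l \<kappa>' F N \<omega> = zero_map (\<lambda>t. lam t * f t) (kernel_map 0 l \<kappa> F) N \<omega>" for N \<omega>
    by (simp add: zero_map_def kernel_map_def eq mult.assoc)
  then have "kernel_map 0 l \<kappa>' F = zero_map (\<lambda>t. lam t * f t) (kernel_map 0 l \<kappa> F)" by (intro ext)
  then show "kernel_op 0 l \<kappa>' (abs_fock F) = (X_zero lam f o\<^sub>L kernel_op 0 l \<kappa>) (abs_fock F)"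
    using X_zero_abs(2)[OF f kernel_map_fock(1)[OF \<kappa> F]] by (simp add: kernel_op_abs[OF \<kappa> F] kernel_op_abs[OF \<kappa>' F])
qed

text \<open>The annihilation factor is attached on the right, so it acts first and its variable
  becomes the first integration variable. Splitting this variable off is Fubini, valid for almost
  every \<omega>.\<close>

lemma kernel_op_X_minus:
  assumes \<kappa>: "kern_bdd 0 l K B \<kappa>" and \<kappa>': "kern_bdd 0 (Suc l) K' B' \<kappa>'" and g: "g \<in> \<D>1"
    and eq: "\<And>N \<omega> s. \<kappa>' N \<omega> s = g (s 0) * \<kappa> N \<omega> (\<lambda>i. s (Suc i))"
  shows "kernel_op 0 (Suc l) \<kappa>' = kernel_op 0 l \<kappa> o\<^sub>L X_minus g"
proof (rule fock_op_eqI)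
  fix F :: "nat \<Rightarrow> (nat \<Rightarrow> 'a) \<Rightarrow> real" assume F: "F \<in> fock_space"
  note m = X_minus_abs[OF g F]
  have "AE \<omega> in \<sigma>pow N. kernel_map 0 (Suc l) \<kappa>' F N \<omega> = kernel_map 0 l \<kappa> (minus_map g F) N \<omega>" for N
  proof -
    have "AE \<omega> in \<sigma>pow N. integrable (\<sigma>pow (Suc l)) (\<lambda>s. \<kappa>' N \<omega> s * F (Suc l + N) (join (Suc l) s \<omega>))"
      using AE_kernel_integrable[OF \<kappa>' F, of N] unfolding add_0 drop_pt_0 .
    then show ?thesis
    proof eventually_elim
      case (elim \<omega>)
      have j: "join (Suc l) (case_nat t z) \<omega> = case_nat t (join l z \<omega>)" for t z
        by (auto simp: join_def fun_eq_iff split: nat.split)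
      have "kernel_map 0 (Suc l) \<kappa>' F N \<omega> = (\<integral>s. \<kappa>' N \<omega> s * F (Suc l + N) (join (Suc l) s \<omega>) \<partial>\<sigma>pow (Suc l))"
        by (simp add: kernel_map_def)
      also have "\<dots> = (\<integral>z. \<integral>t. \<kappa> N \<omega> z * (g t * F (Suc (l + N)) (case_nat t (join l z \<omega>))) \<partial>\<sigma> \<partial>\<sigma>pow l)"
        by (subst integral_\<sigma>pow_Suc[OF elim]) (simp add: eq j mult_ac)
      also have "\<dots> = kernel_map 0 l \<kappa> (minus_map g F) N \<omega>"
        by (simp add: kernel_map_def minus_map_def)
      finally show ?case .
    qed
  qed
  then have "abs_fock (kernel_map 0 (Suc l) \<kappa>' F) = abs_fock (kernel_map 0 l \<kappa> (minus_map g F))"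
    by (intro abs_fock_eqI kernel_map_fock(1)[OF \<kappa>' F] kernel_map_fock(1)[OF \<kappa> m(1)])
  then show "kernel_op 0 (Suc l) \<kappa>' (abs_fock F) = (kernel_op 0 l \<kappa> o\<^sub>L X_minus g) (abs_fock F)"
    by (simp add: kernel_op_abs[OF \<kappa>' F] m(2) kernel_op_abs[OF \<kappa> m(1)])
qed

text \<open>
  \<open>ker0 n k\<close> and \<open>ker1 lam n k\<close> are the kernels of the normally ordered words with \<open>k\<close> factors $X^+$
  that contain no factor $X^0$ and one factor $X^0$, respectively. The annihilated variables appear in
  reversed order because the last $X^-$ acts first.
\<close>

definition ker0 :: "nat \<Rightarrow> nat \<Rightarrow> ((nat \<Rightarrow> 'a) \<Rightarrow> real) \<Rightarrow> nat \<Rightarrow> (nat \<Rightarrow> 'a) \<Rightarrow> (nat \<Rightarrow> 'a) \<Rightarrow> real" where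
  "ker0 n k f N \<omega> s = f (\<lambda>i. if i < k then \<omega> i else if i < n then s (n - Suc i) else undefined)"

definition ker1 :: "('a \<Rightarrow> real) \<Rightarrow> nat \<Rightarrow> nat \<Rightarrow> ((nat \<Rightarrow> 'a) \<Rightarrow> real) \<Rightarrow> nat \<Rightarrow> (nat \<Rightarrow> 'a) \<Rightarrow> (nat \<Rightarrow> 'a) \<Rightarrow> real" where
  "ker1 lam n k f N \<omega> s = (if N \<le> k then 0 else
     lam (\<omega> k) * f (\<lambda>i. if i \<le> k then \<omega> i else if i < n then s (n - Suc i) else undefined))"

lemma measurable_any_coordinate: "(\<lambda>\<omega>. \<omega> i) \<in> measurable (\<sigma>pow n) (borel :: 'a::radon_polish measure)"
proof (cases "i < n")
  case True
  then show ?thesis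
    using measurable_coordinate[OF True] measurable_cong_sets[OF refl sets_\<sigma>_borel] by blast
next
  case False
  have "(\<lambda>\<omega>. undefined) \<in> measurable (\<sigma>pow n) (borel :: 'a measure)" by simp
  then show ?thesis
    using False by (subst measurable_cong[where g="\<lambda>_. undefined"]) (auto simp: Tpow_iff)
qed

lemma measurable_mixed_point:
  fixes f :: "(nat \<Rightarrow> 'a::radon_polish) \<Rightarrow> real"
  assumes "f \<in> \<D> n"
  shows "(\<lambda>p. f (\<lambda>i. if Q i then fst p i else if i < n then snd p (n - Suc i) else undefined))
    \<in> borel_measurable (\<sigma>pow N \<Otimes>\<^sub>M \<sigma>pow l)"
proof -
  have "(\<lambda>p i. if Q i then fst p i else if i < n then snd p (n - Suc i) else undefined)
      \<in> measurable (\<sigma>pow N \<Otimes>\<^sub>M \<sigma>pow l) (borel :: (nat \<Rightarrow> 'a) measure)"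
  proof (rule measurable_into_pow)
    show "(\<lambda>p. if Q i then fst p i else if i < n then snd p (n - Suc i) else undefined)
      \<in> borel_measurable (\<sigma>pow N \<Otimes>\<^sub>M \<sigma>pow l)" for i
      using measurable_compose[OF measurable_fst measurable_any_coordinate]
        measurable_compose[OF measurable_snd measurable_any_coordinate]
      by (cases "Q i"; cases "i < n") simp_all
  qed
  from measurable_compose[OF this D_measurable[OF assms]] show ?thesis .
qed

lemma kern_bdd_ker0:
  fixes f :: "(nat \<Rightarrow> 'a::radon_polish) \<Rightarrow> real"
  assumes f: "f \<in> \<D> n" and k: "k \<le> n" and K: "compact K" "supported_in n K f" and B: "\<And>\<omega>. \<bar>f \<omega>\<bar> \<le> B"
  shows "kern_bdd k (n - k) K B (ker0 n k f)"
  unfolding kern_bdd_def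
proof (intro conjI allI impI)
  show "0 \<le> B" using B[of undefined] abs_ge_zero by (rule order_trans[rotated])
  show "(\<lambda>p. ker0 n k f N (fst p) (snd p)) \<in> borel_measurable (\<sigma>pow N \<Otimes>\<^sub>M \<sigma>pow (n - k))" for N
    unfolding ker0_def by (rule measurable_mixed_point[OF f])
  fix N \<omega> s
  show "\<bar>ker0 n k f N \<omega> s\<bar> \<le> B" using B by (simp add: ker0_def)
  assume "ker0 n k f N \<omega> s \<noteq> 0"
  then have "(\<lambda>i. if i < k then \<omega> i else if i < n then s (n - Suc i) else undefined) \<in> cube n K"
    unfolding ker0_def by (rule supported_inD[OF K(2)])
  then have *: "(if i < k then \<omega> i else if i < n then s (n - Suc i) else undefined) \<in> K" if "i < n" for i
    using that by (auto simp: PiE_iff)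
  show "\<omega> i \<in> K" if "i < k" for i using *[of i] that k by simp
  show "s i \<in> K" if i: "i < n - k" for i
  proof -
    have "n - Suc (n - Suc i) = i" "\<not> n - Suc i < k" "n - Suc i < n" using i k by arith+
    then show ?thesis using *[of "n - Suc i"] by simp
  qed
qed (rule K(1))

text \<open>\<lambda> may be unbounded on T, but wherever the coefficient does not vanish the point
  \<open>\<omega> k\<close> lies in K, so a bound of \<lambda> on K suffices.\<close>

lemma kern_bdd_ker1:
  fixes f :: "(nat \<Rightarrow> 'a::radon_polish) \<Rightarrow> real"
  assumes lam: "continuous_on UNIV lam"
    and f: "f \<in> \<D> n" and k: "k < n" and K: "compact K" "supported_in n K f" and B: "\<And>\<omega>. \<bar>f \<omega>\<bar> \<le> B"
    and C: "\<And>t. t \<in> K \<Longrightarrow> \<bar>lam t\<bar> \<le> C" "0 \<le> C"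
  shows "kern_bdd k (n - Suc k) K (C * B) (ker1 lam n k f)"
  unfolding kern_bdd_def
proof (intro conjI allI impI)
  have B0: "0 \<le> B" using B[of undefined] abs_ge_zero by (rule order_trans[rotated])
  then show "0 \<le> C * B" using C by simp
  have ml: "(\<lambda>p. lam (fst p k)) \<in> borel_measurable (\<sigma>pow N \<Otimes>\<^sub>M \<sigma>pow (n - Suc k))" for N
    using measurable_compose[OF measurable_compose[OF measurable_fst measurable_any_coordinate]
        borel_measurable_continuous_onI[OF lam]] .
  show "(\<lambda>p. ker1 lam n k f N (fst p) (snd p)) \<in> borel_measurable (\<sigma>pow N \<Otimes>\<^sub>M \<sigma>pow (n - Suc k))" for N
    using borel_measurable_times[OF ml measurable_mixed_point[OF f, of "\<lambda>i. i \<le> k" N "n - Suc k"]]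
    by (cases "N \<le> k") (simp_all add: ker1_def)
  fix N \<omega> s
  have *: "i < n \<Longrightarrow> (if i \<le> k then \<omega> i else if i < n then s (n - Suc i) else undefined) \<in> K"
    if "ker1 lam n k f N \<omega> s \<noteq> 0" for i
  proof -
    have "f (\<lambda>i. if i \<le> k then \<omega> i else if i < n then s (n - Suc i) else undefined) \<noteq> 0"
      using that by (auto simp: ker1_def split: if_splits)
    then have "(\<lambda>i. if i \<le> k then \<omega> i else if i < n then s (n - Suc i) else undefined) \<in> cube n K"
      by (rule supported_inD[OF K(2)])
    then show "i < n \<Longrightarrow> (if i \<le> k then \<omega> i else if i < n then s (n - Suc i) else undefined) \<in> K"
      by (auto simp: PiE_iff)
  qed
  show "\<bar>ker1 lam n k f N \<omega> s\<bar> \<le> C * B"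
  proof (cases "ker1 lam n k f N \<omega> s = 0")
    case True
    then show ?thesis using B0 C(2) by simp
  next
    case False
    have "\<omega> k \<in> K" using *[OF False k] by simp
    then show ?thesis
      using C B B0 by (auto simp: ker1_def abs_mult intro!: mult_mono)
  qed
  show "\<omega> i \<in> K" if "ker1 lam n k f N \<omega> s \<noteq> 0" "i < k" for i using *[OF that(1), of i] that k by simp
  show "s i \<in> K" if i: "ker1 lam n k f N \<omega> s \<noteq> 0" "i < n - Suc k" for i
  proof -
    have "n - Suc (n - Suc i) = i" "\<not> n - Suc i \<le> k" "n - Suc i < n" using i(2) k by arith+
    then show ?thesis using *[OF i(1), of "n - Suc i"] by simp
  qed
qed (rule K(1))

lemma ker0_bounded:
  assumes f: "f \<in> \<D> n" and k: "k \<le> n"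
  shows "\<exists>K B. kern_bdd k (n - k) K B (ker0 n k f)"
  using D_supported[OF f] D_bounded[OF f] kern_bdd_ker0[OF f k] by meson

lemma lam_bounded:
  fixes lam :: "'a::topological_space \<Rightarrow> real"
  assumes "continuous_on UNIV lam" "compact K"
  shows "\<exists>C\<ge>0. \<forall>t\<in>K. \<bar>lam t\<bar> \<le> C"
proof -
  have "compact (lam ` K)" using assms compact_continuous_image continuous_on_subset by blast
  then obtain B where B: "\<And>t. t \<in> K \<Longrightarrow> \<bar>lam t\<bar> \<le> B"
    using compact_imp_bounded[of "lam ` K"] unfolding bounded_iff by auto
  then show ?thesis by (intro exI[of _ "max B 0"]) (auto simp: le_max_iff_disj)
qed

lemma ker1_bounded:
  assumes lam: "continuous_on UNIV lam" and f: "f \<in> \<D> n" and k: "k < n"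
  shows "\<exists>K B. kern_bdd k (n - Suc k) K B (ker1 lam n k f)"
proof -
  obtain K where K: "compact K" "supported_in n K f" using D_supported[OF f] by blast
  obtain B where B: "\<And>\<omega>. \<bar>f \<omega>\<bar> \<le> B" using D_bounded[OF f] by blast
  obtain C where C: "C \<ge> 0" "\<And>t. t \<in> K \<Longrightarrow> \<bar>lam t\<bar> \<le> C" using lam_bounded[OF lam K(1)] by blast
  show ?thesis using kern_bdd_ker1[OF lam f k K B C(2,1)] by blast
qed

lemma tensor_Cons: "tensor (f # fs) \<omega> = f (\<omega> 0) * tensor fs (\<lambda>i. \<omega> (Suc i))"
proof -
  have "\<omega> \<in> Tpow (Suc (length fs)) \<longleftrightarrow> (\<lambda>i. \<omega> (Suc i)) \<in> Tpow (length fs)"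
    unfolding Tpow_iff by (metis Suc_le_D Suc_le_mono)
  then show ?thesis by (simp add: tensor_def prod.lessThan_Suc_shift del: prod.lessThan_Suc)
qed

lemma tensor_Nil: "tensor [] \<omega> = (if \<omega> \<in> Tpow 0 then 1 else 0)"
  by (simp add: tensor_def)

lemma ann_append: "ann (fs @ gs) = ann fs o\<^sub>L ann gs"
  by (induction fs) (simp_all add: blinfun_compose_assoc)

lemma ker0_0_snoc:
  "ker0 (Suc (length fs)) 0 (tensor (fs @ [g])) N \<omega> s =
    g (s 0) * ker0 (length fs) 0 (tensor fs) N \<omega> (\<lambda>i. s (Suc i))"
proof -
  let ?n = "length fs"
  have "(\<Prod>i<?n. ((fs @ [g]) ! i) (if i < Suc ?n then s (Suc ?n - Suc i) else undefined)) =
      (\<Prod>i<?n. (fs ! i) (if i < ?n then s (Suc (?n - Suc i)) else undefined))"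
    by (intro prod.cong refl) (simp add: nth_append Suc_diff_Suc)
  then show ?thesis
    by (simp add: ker0_def tensor_def Tpow_iff nth_append)
qed

text \<open>Reverse induction, because \<open>kernel_op_X_minus\<close> attaches the factor that
  acts first, that is, the last one of the list.\<close>

lemma kernel_op_ker0_0:
  fixes fs :: "('a::radon_polish \<Rightarrow> real) list"
  shows "set fs \<subseteq> \<D>1 \<Longrightarrow> kernel_op 0 (length fs) (ker0 (length fs) 0 (tensor fs)) = ann fs"
proof (induction fs rule: rev_induct)
  case Nil
  have "tensor [] \<in> \<D> 0" using tensor_in_D[of "[]"] by simp
  then obtain K B where \<kappa>: "kern_bdd 0 0 K B (ker0 0 0 (tensor ([] :: ('a \<Rightarrow> real) list)))"
    using ker0_bounded[of "tensor []" 0 0] by auto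
  have "kernel_op 0 0 (ker0 0 0 (tensor [])) = (id_blinfun :: 'a fock_op)"
  proof (rule fock_op_eqI)
    fix F :: "nat \<Rightarrow> (nat \<Rightarrow> 'a) \<Rightarrow> real" assume F: "F \<in> fock_space"
    have "kernel_map 0 0 (ker0 0 0 (tensor [])) F = F"
      by (intro ext) (simp add: kernel_map_def integral_\<sigma>pow_0 ker0_def tensor_Nil Tpow_iff)
    then show "kernel_op 0 0 (ker0 0 0 (tensor [])) (abs_fock F) = id_blinfun (abs_fock F)"
      by (simp add: kernel_op_abs[OF \<kappa> F])
  qed
  then show ?case by simp
next
  case (snoc g fs)
  then have D: "set fs \<subseteq> \<D>1" "g \<in> \<D>1" "set (fs @ [g]) \<subseteq> \<D>1" by auto
  obtain K B where \<kappa>: "kern_bdd 0 (length fs) K B (ker0 (length fs) 0 (tensor fs))"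
    using ker0_bounded[OF tensor_in_D[OF D(1)], of 0] by auto
  obtain K' B' where \<kappa>': "kern_bdd 0 (Suc (length fs)) K' B' (ker0 (Suc (length fs)) 0 (tensor (fs @ [g])))"
    using ker0_bounded[OF tensor_in_D[OF D(3)], of 0] by auto
  show ?case
    using kernel_op_X_minus[OF \<kappa> \<kappa>' D(2) ker0_0_snoc] snoc.IH[OF D(1)] by (simp add: ann_append)
qed

text \<open>The index k counts the factors X^+. Words without X^0 allow k up to n, words with one
  X^0 only up to n - 1.\<close>

definition P_kernel :: "('a::radon_polish \<Rightarrow> real) \<Rightarrow> nat \<Rightarrow> ((nat \<Rightarrow> 'a) \<Rightarrow> real) \<Rightarrow> 'a fock_op" where
  "P_kernel lam n f = (\<Sum>k<Suc n. kernel_op k (n - k) (ker0 n k f)) + (\<Sum>k<n. kernel_op k (n - Suc k) (ker1 lam n k f))"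

lemma bdd_fun_ker0:
  assumes k: "k \<le> n"
  shows "bdd_fun n (\<lambda>f :: (nat \<Rightarrow> 'a::radon_polish) \<Rightarrow> real. kernel_op k (n - k) (ker0 n k f))"
  unfolding bdd_fun_def
proof (intro conjI ballI allI impI)
  fix f g :: "(nat \<Rightarrow> 'a) \<Rightarrow> real" and a b
  assume fg: "f \<in> \<D> n" "g \<in> \<D> n"
  obtain K where K: "compact K" "supported_in n K f" "supported_in n K g" using D_supported2[OF fg] by blast
  obtain B where B: "\<And>\<omega>. \<bar>f \<omega>\<bar> \<le> B" using D_bounded[OF fg(1)] by blast
  obtain B' where B': "\<And>\<omega>. \<bar>g \<omega>\<bar> \<le> B'" using D_bounded[OF fg(2)] by blast
  have "ker0 n k (\<lambda>\<omega>. a * f \<omega> + b * g \<omega>) = (\<lambda>N \<omega> s. a * ker0 n k f N \<omega> s + b * ker0 n k g N \<omega> s)"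
    by (simp add: ker0_def fun_eq_iff)
  then show "kernel_op k (n - k) (ker0 n k (\<lambda>\<omega>. a * f \<omega> + b * g \<omega>)) =
      a *\<^sub>R kernel_op k (n - k) (ker0 n k f) + b *\<^sub>R kernel_op k (n - k) (ker0 n k g)"
    using kernel_op_lincomb[OF kern_bdd_ker0[OF fg(1) k K(1,2) B] kern_bdd_ker0[OF fg(2) k K(1,3) B']] by simp
next
  fix K :: "'a set" assume K: "compact K"
  have "norm (kernel_op k (n - k) (ker0 n k f)) \<le> sqrt (measure \<sigma> K ^ (k + (n - k))) * B"
    if f: "f \<in> \<D> n" "supported_in n K f" "\<forall>\<omega>. \<bar>f \<omega>\<bar> \<le> B" for f B
    using norm_kernel_op[OF kern_bdd_ker0[OF f(1) k K f(2) f(3)[rule_format]]] by (simp add: mult.commute)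
  then show "\<exists>C. \<forall>f\<in>\<D> n. \<forall>B. supported_in n K f \<longrightarrow> (\<forall>\<omega>. \<bar>f \<omega>\<bar> \<le> B) \<longrightarrow>
      norm (kernel_op k (n - k) (ker0 n k f)) \<le> C * B" by blast
qed

lemma bdd_fun_ker1:
  assumes lam: "continuous_on UNIV lam" and k: "k < n"
  shows "bdd_fun n (\<lambda>f :: (nat \<Rightarrow> 'a::radon_polish) \<Rightarrow> real. kernel_op k (n - Suc k) (ker1 lam n k f))"
  unfolding bdd_fun_def
proof (intro conjI ballI allI impI)
  fix f g :: "(nat \<Rightarrow> 'a) \<Rightarrow> real" and a b
  assume fg: "f \<in> \<D> n" "g \<in> \<D> n"
  obtain K where K: "compact K" "supported_in n K f" "supported_in n K g" using D_supported2[OF fg] by blast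
  obtain B where B: "\<And>\<omega>. \<bar>f \<omega>\<bar> \<le> B" using D_bounded[OF fg(1)] by blast
  obtain B' where B': "\<And>\<omega>. \<bar>g \<omega>\<bar> \<le> B'" using D_bounded[OF fg(2)] by blast
  obtain C where C: "C \<ge> 0" "\<And>t. t \<in> K \<Longrightarrow> \<bar>lam t\<bar> \<le> C" using lam_bounded[OF lam K(1)] by blast
  have "ker1 lam n k (\<lambda>\<omega>. a * f \<omega> + b * g \<omega>) = (\<lambda>N \<omega> s. a * ker1 lam n k f N \<omega> s + b * ker1 lam n k g N \<omega> s)"
    by (simp add: ker1_def fun_eq_iff algebra_simps)
  then show "kernel_op k (n - Suc k) (ker1 lam n k (\<lambda>\<omega>. a * f \<omega> + b * g \<omega>)) =
      a *\<^sub>R kernel_op k (n - Suc k) (ker1 lam n k f) + b *\<^sub>R kernel_op k (n - Suc k) (ker1 lam n k g)"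
    using kernel_op_lincomb[OF kern_bdd_ker1[OF lam fg(1) k K(1,2) B C(2,1)] kern_bdd_ker1[OF lam fg(2) k K(1,3) B' C(2,1)]]
    by simp
next
  fix K :: "'a set" assume K: "compact K"
  obtain C where C: "C \<ge> 0" "\<And>t. t \<in> K \<Longrightarrow> \<bar>lam t\<bar> \<le> C" using lam_bounded[OF lam K] by blast
  have "norm (kernel_op k (n - Suc k) (ker1 lam n k f)) \<le> (C * sqrt (measure \<sigma> K ^ (k + (n - Suc k)))) * B"
    if f: "f \<in> \<D> n" "supported_in n K f" "\<forall>\<omega>. \<bar>f \<omega>\<bar> \<le> B" for f B
    using norm_kernel_op[OF kern_bdd_ker1[OF lam f(1) k K f(2) f(3)[rule_format] C(2,1)]] by (simp add: mult_ac)
  then show "\<exists>C. \<forall>f\<in>\<D> n. \<forall>B. supported_in n K f \<longrightarrow> (\<forall>\<omega>. \<bar>f \<omega>\<bar> \<le> B) \<longrightarrow>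
      norm (kernel_op k (n - Suc k) (ker1 lam n k f)) \<le> C * B" by blast
qed

lemma bdd_fun_P_kernel:
  "continuous_on UNIV lam \<Longrightarrow> bdd_fun n (P_kernel lam n)"
  unfolding P_kernel_def[abs_def]
  by (intro bdd_fun_add bdd_fun_sum) (auto intro!: bdd_fun_ker0 bdd_fun_ker1)

text \<open>Words with k > 0 begin with X^+(f), and removing it leaves the words of the tail with k
  - 1. The two words with k = 0 begin with X^-(f) or X^0(f), followed by annihilation only.\<close>

lemma P_kernel_tensor:
  fixes lam :: "'a::radon_polish \<Rightarrow> real"
  assumes lam: "continuous_on UNIV lam"
  shows "set fs \<subseteq> \<D>1 \<Longrightarrow> P_kernel lam (length fs) (tensor fs) = normal_ordered lam fs"
proof (induction fs)
  case Nil
  then show ?case using kernel_op_ker0_0[of "[] :: ('a \<Rightarrow> real) list"] by (simp add: P_kernel_def)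
next
  case (Cons f fs)
  let ?n = "length fs"
  have D: "set fs \<subseteq> \<D>1" "f \<in> \<D>1" "set (f # fs) \<subseteq> \<D>1" using Cons.prems by auto
  have T: "tensor fs \<in> \<D> ?n" "tensor (f # fs) \<in> \<D> (Suc ?n)" using tensor_in_D[OF D(1)] tensor_in_D[OF D(3)] by auto
  have a: "kernel_op (Suc k) (?n - k) (ker0 (Suc ?n) (Suc k) (tensor (f # fs))) =
      X_plus f o\<^sub>L kernel_op k (?n - k) (ker0 ?n k (tensor fs))" if k: "k \<le> ?n" for k
  proof -
    obtain K B where \<kappa>: "kern_bdd k (?n - k) K B (ker0 ?n k (tensor fs))" using ker0_bounded[OF T(1) k] by blast
    obtain K' B' where \<kappa>': "kern_bdd (Suc k) (?n - k) K' B' (ker0 (Suc ?n) (Suc k) (tensor (f # fs)))"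
      using ker0_bounded[OF T(2), of "Suc k"] k by auto
    show ?thesis by (rule kernel_op_X_plus[OF \<kappa> \<kappa>' D(2)]) (simp add: ker0_def tensor_Cons cong: if_cong)
  qed
  have b: "kernel_op (Suc k) (?n - Suc k) (ker1 lam (Suc ?n) (Suc k) (tensor (f # fs))) =
      X_plus f o\<^sub>L kernel_op k (?n - Suc k) (ker1 lam ?n k (tensor fs))" if k: "k < ?n" for k
  proof -
    obtain K B where \<kappa>: "kern_bdd k (?n - Suc k) K B (ker1 lam ?n k (tensor fs))" using ker1_bounded[OF lam T(1) k] by blast
    obtain K' B' where \<kappa>': "kern_bdd (Suc k) (?n - Suc k) K' B' (ker1 lam (Suc ?n) (Suc k) (tensor (f # fs)))"
      using ker1_bounded[OF lam T(2), of "Suc k"] k by auto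
    show ?thesis by (rule kernel_op_X_plus[OF \<kappa> \<kappa>' D(2)]) (simp add: ker1_def tensor_Cons cong: if_cong)
  qed
  have c: "kernel_op 0 (Suc ?n) (ker0 (Suc ?n) 0 (tensor (f # fs))) = X_minus f o\<^sub>L ann fs"
    using kernel_op_ker0_0[OF D(3)] by simp
  have d: "kernel_op 0 ?n (ker1 lam (Suc ?n) 0 (tensor (f # fs))) = X_zero lam f o\<^sub>L ann fs"
  proof -
    obtain K B where \<kappa>: "kern_bdd 0 ?n K B (ker0 ?n 0 (tensor fs))" using ker0_bounded[OF T(1), of 0] by auto
    obtain K' B' where \<kappa>': "kern_bdd 0 ?n K' B' (ker1 lam (Suc ?n) 0 (tensor (f # fs)))"
      using ker1_bounded[OF lam T(2), of 0] by auto
    have "kernel_op 0 ?n (ker1 lam (Suc ?n) 0 (tensor (f # fs))) = X_zero lam f o\<^sub>L kernel_op 0 ?n (ker0 ?n 0 (tensor fs))"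
      by (rule kernel_op_X_zero[OF \<kappa> \<kappa>' D1_lam[OF lam D(2)]]) (simp add: ker0_def ker1_def tensor_Cons cong: if_cong)
    then show ?thesis using kernel_op_ker0_0[OF D(1)] by simp
  qed
  have add: "X_plus f o\<^sub>L (\<Sum>k\<in>I. A k) = (\<Sum>k\<in>I. X_plus f o\<^sub>L A k)" for I :: "nat set" and A :: "nat \<Rightarrow> 'a fock_op"
    by (rule blinfun_eqI) (simp add: blinfun.sum_left blinfun.sum_right)
  let ?T = "tensor (f # fs)"
  have "(\<Sum>k<Suc (Suc ?n). kernel_op k (Suc ?n - k) (ker0 (Suc ?n) k ?T)) =
      kernel_op 0 (Suc ?n) (ker0 (Suc ?n) 0 ?T) + (\<Sum>k<Suc ?n. kernel_op (Suc k) (?n - k) (ker0 (Suc ?n) (Suc k) ?T))"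
    by (subst sum.lessThan_Suc_shift) simp
  also have "(\<Sum>k<Suc ?n. kernel_op (Suc k) (?n - k) (ker0 (Suc ?n) (Suc k) ?T)) =
      (\<Sum>k<Suc ?n. X_plus f o\<^sub>L kernel_op k (?n - k) (ker0 ?n k (tensor fs)))"
    by (intro sum.cong refl a) simp
  finally have s0: "(\<Sum>k<Suc (Suc ?n). kernel_op k (Suc ?n - k) (ker0 (Suc ?n) k ?T)) =
      (X_minus f o\<^sub>L ann fs) + (\<Sum>k<Suc ?n. X_plus f o\<^sub>L kernel_op k (?n - k) (ker0 ?n k (tensor fs)))"
    unfolding c .
  have "(\<Sum>k<Suc ?n. kernel_op k (Suc ?n - Suc k) (ker1 lam (Suc ?n) k ?T)) =
      kernel_op 0 ?n (ker1 lam (Suc ?n) 0 ?T) + (\<Sum>k<?n. kernel_op (Suc k) (?n - Suc k) (ker1 lam (Suc ?n) (Suc k) ?T))"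
    by (subst sum.lessThan_Suc_shift) simp
  also have "(\<Sum>k<?n. kernel_op (Suc k) (?n - Suc k) (ker1 lam (Suc ?n) (Suc k) ?T)) =
      (\<Sum>k<?n. X_plus f o\<^sub>L kernel_op k (?n - Suc k) (ker1 lam ?n k (tensor fs)))"
    by (intro sum.cong refl b) simp
  finally have s1: "(\<Sum>k<Suc ?n. kernel_op k (Suc ?n - Suc k) (ker1 lam (Suc ?n) k ?T)) =
      (X_zero lam f o\<^sub>L ann fs) + (\<Sum>k<?n. X_plus f o\<^sub>L kernel_op k (?n - Suc k) (ker1 lam ?n k (tensor fs)))"
    unfolding d .
  have "P_kernel lam (Suc ?n) ?T =
     (X_minus f o\<^sub>L ann fs) + (\<Sum>k<Suc ?n. X_plus f o\<^sub>L kernel_op k (?n - k) (ker0 ?n k (tensor fs))) +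
     ((X_zero lam f o\<^sub>L ann fs) + (\<Sum>k<?n. X_plus f o\<^sub>L kernel_op k (?n - Suc k) (ker1 lam ?n k (tensor fs))))"
    unfolding P_kernel_def s0 s1 ..
  also have "\<dots> = (X_minus f o\<^sub>L ann fs) + (X_zero lam f o\<^sub>L ann fs) + (X_plus f o\<^sub>L P_kernel lam ?n (tensor fs))"
    unfolding P_kernel_def blinfun_compose_add_right add by simp
  also have "\<dots> = normal_ordered lam (f # fs)" using Cons.IH[OF D(1)] by simp
  finally show ?case by simp
qed

lemma P_eq: 
  assumes lam: "continuous_on UNIV lam" and f: "f \<in> \<D> n"
  shows "P lam n f = P_kernel lam n f"
  unfolding P_def
  using P_kernel_tensor[OF lam] P_tensor_eq_normal_ordered[OF lam]
  by (intro extend_tensors_eq bdd_fun_P_kernel lam f) auto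

lemma P_of_tensor:
  assumes lam: "continuous_on UNIV lam" and fs: "set fs \<subseteq> \<D>1"
  shows "P lam (length fs) (tensor fs) = P_tensor lam fs"
  using P_eq[OF lam tensor_in_D[OF fs]] P_kernel_tensor[OF lam fs] P_tensor_eq_normal_ordered[OF lam fs] by simp

lemma bdd_fun_cong:
  assumes "bdd_fun n M" "\<And>f. f \<in> \<D> n \<Longrightarrow> M' f = M f"
  shows "bdd_fun n M'"
  using assms(1) unfolding bdd_fun_def by (simp add: assms(2) D_lincomb)

lemma bdd_fun_P: "continuous_on UNIV lam \<Longrightarrow> bdd_fun n (P lam n)"
  using bdd_fun_cong[OF bdd_fun_P_kernel P_eq] by blast

section \<open>Action on the vacuum and uniqueness of coefficients\<close>

definition vacuum :: "nat \<Rightarrow> (nat \<Rightarrow> 'a) \<Rightarrow> real" where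
  "vacuum n \<omega> = (if n = 0 then 1 else 0)"

definition level :: "nat \<Rightarrow> ((nat \<Rightarrow> 'a) \<Rightarrow> real) \<Rightarrow> nat \<Rightarrow> (nat \<Rightarrow> 'a) \<Rightarrow> real" where
  "level n f m \<omega> = (if m = n then f \<omega> else 0)"

lemma vacuum_fock: "vacuum \<in> fock_space"
proof -
  have e: "emeasure (\<sigma>pow 0 :: (nat \<Rightarrow> 'a) measure) (Tpow 0) = 1"
    using emeasure_PiM_empty[of "\<lambda>_::nat. \<sigma> :: 'a measure"] by (simp add: \<sigma>pow_def Tpow_def)
  interpret finite_measure "\<sigma>pow 0 :: (nat \<Rightarrow> 'a) measure" by (rule finite_measureI) (simp add: e)
  have "integrable (\<sigma>pow n) (\<lambda>\<omega> :: nat \<Rightarrow> 'a. (vacuum n \<omega>)\<^sup>2)" for n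
    by (cases n) (simp_all add: vacuum_def)
  moreover have "vacuum n \<in> borel_measurable (\<sigma>pow n :: (nat \<Rightarrow> 'a) measure)" for n
    by (simp add: vacuum_def[abs_def])
  moreover have "summable (\<lambda>n. \<integral>\<omega>. (vacuum n \<omega>)\<^sup>2 \<partial>(\<sigma>pow n :: (nat \<Rightarrow> 'a) measure))"
    by (rule summable_finite[of "{0}"]) (auto simp: vacuum_def)
  ultimately show ?thesis by (simp add: fock_space_def)
qed

lemma zero_fock_eq: "(0 :: 'a::radon_polish fock) = abs_fock (\<lambda>_ _. 0)"
  using abs_fock_scale[OF zero_in_fock_space, of 0] by simp

text \<open>Only the word made of creation factors alone survives on the vacuum: in every other word
  the factor that acts first is X^- or X^0, and both kill it. Hence the coefficient can be read off
  at level n.\<close>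

lemma
  fixes lam :: "'a::radon_polish \<Rightarrow> real"
  assumes lam: "continuous_on UNIV lam" and f: "f \<in> \<D> n"
  shows level_fock: "level n f \<in> fock_space"
    and P_vacuum: "P lam n f (abs_fock vacuum) = abs_fock (level n f)"
proof -
  obtain K B where \<kappa>: "kern_bdd n 0 K B (ker0 n n f)" using ker0_bounded[OF f, of n] by auto
  have eq: "level n f N \<omega> = kernel_map n 0 (ker0 n n f) vacuum N \<omega>" if \<omega>: "\<omega> \<in> Tpow N" for N \<omega>
  proof (cases "N = n")
    case True
    have "(\<lambda>i. if i < n then \<omega> i else undefined) = \<omega>" using \<omega> True by (intro ext) (simp add: Tpow_iff)
    then have "(\<lambda>i. if i < n then \<omega> i else if i < n then s (n - Suc i) else undefined) = \<omega>" for s :: "nat \<Rightarrow> 'a"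
      using \<omega> True by (intro ext) (simp add: Tpow_iff)
    then show ?thesis using True by (simp add: level_def kernel_map_def integral_\<sigma>pow_0 vacuum_def ker0_def)
  next
    case False
    then show ?thesis by (auto simp: level_def kernel_map_def integral_\<sigma>pow_0 vacuum_def)
  qed
  note lev = fock_space_cong[OF kernel_map_fock(1)[OF \<kappa> vacuum_fock], of "level n f", OF eq]
  show "level n f \<in> fock_space" by (rule lev(1))
  have top: "kernel_op n (n - n) (ker0 n n f) (abs_fock vacuum) = abs_fock (level n f)"
    using lev(2) by (simp add: kernel_op_abs[OF \<kappa> vacuum_fock])
  have z0: "kernel_op k (n - k) (ker0 n k f) (abs_fock vacuum) = 0" if k: "k < n" for k
  proof -
    obtain K B where \<kappa>: "kern_bdd k (n - k) K B (ker0 n k f)" using ker0_bounded[OF f, of k] k by auto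
    have "kernel_map k (n - k) (ker0 n k f) vacuum = (\<lambda>_ _. 0)"
      using k by (intro ext) (simp add: kernel_map_def vacuum_def)
    then show ?thesis by (simp add: kernel_op_abs[OF \<kappa> vacuum_fock] zero_fock_eq)
  qed
  have z1: "kernel_op k (n - Suc k) (ker1 lam n k f) (abs_fock vacuum) = 0" if k: "k < n" for k
  proof -
    obtain K B where \<kappa>: "kern_bdd k (n - Suc k) K B (ker1 lam n k f)" using ker1_bounded[OF lam f k] by auto
    \<comment> \<open>\<open>ker1\<close> is 0 for N \<le> k, and for N > k the vacuum is evaluated
      at a positive level.\<close>
    have z: "ker1 lam n k f N \<omega> s * vacuum (n - Suc k + (N - k)) z = 0" for N \<omega> s z
      by (simp add: ker1_def vacuum_def)
    then have "kernel_map k (n - Suc k) (ker1 lam n k f) vacuum = (\<lambda>_ _. 0)"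
      by (intro ext) (simp only: kernel_map_def z Bochner_Integration.integral_zero if_cancel)
    then show ?thesis by (simp add: kernel_op_abs[OF \<kappa> vacuum_fock] zero_fock_eq)
  qed
  show "P lam n f (abs_fock vacuum) = abs_fock (level n f)"
    using z0 z1 top by (simp add: P_eq[OF lam f] P_kernel_def plus_blinfun.rep_eq blinfun.sum_left)
qed

text \<open>A nonzero value of a continuous function persists on a box of nonempty open sets, which
  has positive mass. Coefficients are therefore determined as functions and not just almost
  everywhere.\<close>

lemma D_AE_zero:
  fixes f :: "(nat \<Rightarrow> 'a::radon_polish) \<Rightarrow> real"
  assumes f: "f \<in> \<D> n" and ae: "AE \<omega> in \<sigma>pow n. f \<omega> = 0"
  shows "f = (\<lambda>_. 0)"
proof (rule ccontr)
  interpret product_sigma_finite "\<lambda>_::nat. \<sigma> :: 'a measure" by (rule product_sigma_finite_\<sigma>)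
  assume "f \<noteq> (\<lambda>_. 0)"
  then obtain w where w: "f w \<noteq> 0" by auto
  then have wT: "w \<in> Tpow n" using D_zero_outside[OF f] by auto
  have "open (- {0 :: real})" by (simp add: open_Compl)
  \<comment> \<open>Continuity is known on \<open>Tpow n\<close> only, so V is open in the full
    function space. A basic box inside V needs attention only in the first n coordinates, since all
    points of \<open>Tpow n\<close> agree beyond them.\<close>
  then obtain V where V: "open V" "V \<inter> Tpow n = f -` (- {0}) \<inter> Tpow n"
    using D_cont[OF f] unfolding continuous_on_open_invariant by blast
  have "w \<in> V" using V(2) w wT by auto
  moreover have "openin (product_topology (\<lambda>_. euclidean) UNIV) V" using V(1) by (simp add: euclidean_product_topology)
  ultimately obtain Y where Y: "w \<in> Pi\<^sub>E UNIV Y" "\<And>i. open (Y i)" "Pi\<^sub>E UNIV Y \<subseteq> V"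
    using product_topology_open_contains_basis[of "\<lambda>_::nat. euclidean :: 'a topology" UNIV V w] by auto
  let ?Q = "Pi\<^sub>E {..<n} Y"
  have QV: "f \<omega> \<noteq> 0" if \<omega>: "\<omega> \<in> ?Q" for \<omega>
  proof -
    have T: "\<omega> \<in> Tpow n" using \<omega> by (auto simp: Tpow_def)
    have "\<omega> i \<in> Y i" for i
    proof (cases "i < n")
      case True then show ?thesis using \<omega> by (auto simp: PiE_iff)
    next
      case False
      then have "\<omega> i = w i" using T wT by (simp add: Tpow_iff)
      then show ?thesis using Y(1) by (auto simp: PiE_iff)
    qed
    then have "\<omega> \<in> V" using Y(3) by (auto simp: PiE_iff)
    then show ?thesis using V(2) T by auto
  qed
  have Q: "?Q \<subseteq> Tpow n" by (auto simp: Tpow_def)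
  have "AE \<omega> in \<sigma>pow n. \<omega> \<notin> ?Q" using ae by eventually_elim (use QV in blast)
  then have "emeasure (\<sigma>pow n) {\<omega> \<in> space (\<sigma>pow n). \<omega> \<in> ?Q} = 0" by (rule emeasure_eq_0_AE)
  moreover have "{\<omega> \<in> space (\<sigma>pow n). \<omega> \<in> ?Q} = ?Q" using Q by auto
  moreover have "emeasure (\<sigma>pow n) ?Q = (\<Prod>i\<in>{..<n}. emeasure \<sigma> (Y i))"
    unfolding \<sigma>pow_def using Y(2) by (intro emeasure_PiM) (auto simp: sets_\<sigma>_borel)
  ultimately obtain i where "i < n" "emeasure \<sigma> (Y i) = 0" by auto
  moreover have "Y i \<noteq> {}" using Y(1) by (auto simp: PiE_iff)
  ultimately show False using \<sigma>_open_pos[OF Y(2), of i] by simp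
qed

lemma P_independent:
  fixes lam :: "'a::radon_polish \<Rightarrow> real"
  assumes lam: "continuous_on UNIV lam" and f: "\<And>i. i \<le> n \<Longrightarrow> f i \<in> \<D> i"
    and sum: "(\<Sum>i\<le>n. P lam i (f i)) = 0" and m: "m \<le> n"
  shows "f m = (\<lambda>_. 0)"
proof -
  let ?F = "\<lambda>n m \<omega>. if m \<le> n then f m \<omega> else 0"
  have F: "?F k \<in> fock_space \<and> (\<Sum>i\<le>k. P lam i (f i) (abs_fock vacuum)) = abs_fock (?F k)" if "k \<le> n" for k
    using that
  proof (induction k)
    case 0
    have "?F 0 = level 0 (f 0)" by (auto simp: level_def fun_eq_iff)
    then show ?case using level_fock[OF lam f] P_vacuum[OF lam f] by simp
  next
    case (Suc k)
    have e: "?F (Suc k) = (\<lambda>m \<omega>. ?F k m \<omega> + level (Suc k) (f (Suc k)) m \<omega>)"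
      by (auto simp: level_def fun_eq_iff)
    have l: "level (Suc k) (f (Suc k)) \<in> fock_space" using level_fock[OF lam f] Suc by blast
    have IH: "?F k \<in> fock_space" "(\<Sum>i\<le>k. P lam i (f i) (abs_fock vacuum)) = abs_fock (?F k)"
      using Suc by auto
    have "abs_fock (?F (Suc k)) = abs_fock (?F k) + abs_fock (level (Suc k) (f (Suc k)))"
      unfolding e by (rule abs_fock_add[symmetric, OF IH(1) l])
    moreover have "?F (Suc k) \<in> fock_space" unfolding e by (rule fock_space_add[OF IH(1) l])
    ultimately show ?case using IH(2) P_vacuum[OF lam f[OF Suc.prems]] by simp
  qed
  have "abs_fock (?F n) = (\<Sum>i\<le>n. P lam i (f i)) (abs_fock vacuum)"
    using F[of n] by (simp add: blinfun.sum_left)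
  then have "abs_fock (?F n) = abs_fock (\<lambda>_ _. 0)" using sum by (simp add: zero_fock_eq)
  then have "fock_rel (?F n) (\<lambda>_ _. 0)"
    using F[of n] zero_in_fock_space Quotient_rel[OF Quotient_fock] fock_rel_refl by blast
  then have "AE \<omega> in \<sigma>pow m. ?F n m \<omega> = 0" by (simp add: fock_rel_def)
  then show ?thesis using m D_AE_zero[OF f[OF m]] by simp
qed


section \<open>Restriction and contraction of test functions\<close>

text \<open>A common scheme for restriction to a point or a diagonal, contraction with a function,
  and integration over the blocks of a partition: substitute \<tau>, multiply by a weight, integrate
  over finitely many variables. The hypothesis \<open>ctrl\<close> is a properness condition: an
  argument in a compact cube confines both the free and the integrated variables.\<close>

lemma bdd_map_integral:
  fixes \<tau> :: "('b \<Rightarrow> 'a::radon_polish) \<Rightarrow> (nat \<Rightarrow> 'a) \<Rightarrow> nat \<Rightarrow> 'a" and a :: "('b \<Rightarrow> 'a) \<Rightarrow> (nat \<Rightarrow> 'a) \<Rightarrow> real"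
  assumes fin: "finite J"
    and \<tau>_in: "\<And>s \<omega>. s \<in> Pi\<^sub>E J (\<lambda>_. UNIV) \<Longrightarrow> \<omega> \<in> Tpow m \<Longrightarrow> \<tau> s \<omega> \<in> Tpow n"
    and \<tau>_cont: "\<And>s. s \<in> Pi\<^sub>E J (\<lambda>_. UNIV) \<Longrightarrow> continuous_on (Tpow m) (\<tau> s)"
    and a_cont: "\<And>s. s \<in> Pi\<^sub>E J (\<lambda>_. UNIV) \<Longrightarrow> continuous_on (Tpow m) (a s)"
    and \<tau>_meas: "\<And>\<omega>. \<omega> \<in> Tpow m \<Longrightarrow> (\<lambda>s. \<tau> s \<omega>) \<in> measurable (Pi\<^sub>M J (\<lambda>_. \<sigma>)) borel"
    and a_meas: "\<And>\<omega>. \<omega> \<in> Tpow m \<Longrightarrow> (\<lambda>s. a s \<omega>) \<in> borel_measurable (Pi\<^sub>M J (\<lambda>_. \<sigma>))"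
    and ctrl: "\<And>K. compact K \<Longrightarrow> \<exists>K' A. compact K' \<and> 0 \<le> A \<and>
      (\<forall>s \<omega>. s \<in> Pi\<^sub>E J (\<lambda>_. UNIV) \<longrightarrow> \<omega> \<in> Tpow m \<longrightarrow> a s \<omega> \<noteq> 0 \<longrightarrow> \<tau> s \<omega> \<in> cube n K \<longrightarrow>
        \<omega> \<in> cube m K' \<and> s \<in> Pi\<^sub>E J (\<lambda>_. K') \<and> \<bar>a s \<omega>\<bar> \<le> A)"
    and \<Phi>: "\<And>f \<omega>. f \<in> \<D> n \<Longrightarrow> \<Phi> f \<omega> = (if \<omega> \<in> Tpow m then \<integral>s. a s \<omega> * f (\<tau> s \<omega>) \<partial>Pi\<^sub>M J (\<lambda>_. \<sigma>) else 0)"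
  shows "bdd_map n m \<Phi>"
proof -
  interpret product_sigma_finite "\<lambda>_::'b. \<sigma> :: 'a measure" by (rule product_sigma_finite_\<sigma>)
  let ?M = "Pi\<^sub>M J (\<lambda>_. \<sigma> :: 'a measure)"
  have meas: "(\<lambda>s. a s \<omega> * f (\<tau> s \<omega>)) \<in> borel_measurable ?M" if "\<omega> \<in> Tpow m" "f \<in> \<D> n" for \<omega> f
    using a_meas[OF that(1)] measurable_compose[OF \<tau>_meas[OF that(1)] D_measurable[OF that(2)]]
    by (rule borel_measurable_times)
  have main: "\<exists>K' C. compact K' \<and> (\<forall>f\<in>\<D> n. \<forall>B. supported_in n K f \<longrightarrow> (\<forall>\<omega>. \<bar>f \<omega>\<bar> \<le> B) \<longrightarrow>
      (\<forall>\<omega>\<in>Tpow m. integrable ?M (\<lambda>s. a s \<omega> * f (\<tau> s \<omega>))) \<and>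
      continuous_on (Tpow m) (\<Phi> f) \<and> supported_in m K' (\<Phi> f) \<and> (\<forall>\<omega>. \<bar>\<Phi> f \<omega>\<bar> \<le> C * B))"
    if K: "compact K" for K
  proof -
    obtain K' A where K': "compact K'" "0 \<le> A"
      and c: "\<And>s \<omega>. s \<in> Pi\<^sub>E J (\<lambda>_. UNIV) \<Longrightarrow> \<omega> \<in> Tpow m \<Longrightarrow> a s \<omega> \<noteq> 0 \<Longrightarrow> \<tau> s \<omega> \<in> cube n K \<Longrightarrow>
        \<omega> \<in> cube m K' \<and> s \<in> Pi\<^sub>E J (\<lambda>_. K') \<and> \<bar>a s \<omega>\<bar> \<le> A"
      using ctrl[OF K] by metis
    let ?Q = "Pi\<^sub>E J (\<lambda>_. K')"
    have K's: "K' \<in> sets \<sigma>" using K'(1) by (simp add: sets_\<sigma>_borel borel_closed compact_imp_closed)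
    have Q: "?Q \<in> sets ?M" using K's fin by (intro sets_PiM_I_finite) auto
    have "emeasure ?M ?Q = (\<Prod>i\<in>J. emeasure \<sigma> K')" using fin K's by (intro emeasure_PiM) auto
    also have "\<dots> < \<infinity>" using \<sigma>_finite_compact[OF K'(1)] by (simp add: power_less_top_ennreal)
    finally have Qf: "emeasure ?M ?Q < \<infinity>" .
    \<comment> \<open>This function dominates the integrand for all \<omega> at once; it yields
      integrability, the bound and, by dominated convergence, continuity.\<close>
    have intQ: "integrable ?M (\<lambda>s. A * B * indicator ?Q s)" for B
      using Q Qf by (intro integrable_mult_right integrable_real_indicator)
    have "supported_in m K' (\<Phi> f) \<and> continuous_on (Tpow m) (\<Phi> f) \<and>
        (\<forall>\<omega>\<in>Tpow m. integrable ?M (\<lambda>s. a s \<omega> * f (\<tau> s \<omega>))) \<and> (\<forall>\<omega>. \<bar>\<Phi> f \<omega>\<bar> \<le> (A * measure ?M ?Q) * B)"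
      if f: "f \<in> \<D> n" "supported_in n K f" "\<forall>\<omega>. \<bar>f \<omega>\<bar> \<le> B" for f B
    proof -
      have B0: "0 \<le> B" using f(3) abs_ge_zero[of "f undefined"] order_trans by blast
      have le: "norm (a s \<omega> * f (\<tau> s \<omega>)) \<le> A * B * indicator ?Q s" and out: "\<omega> \<notin> cube m K' \<Longrightarrow> a s \<omega> * f (\<tau> s \<omega>) = 0"
        if "s \<in> Pi\<^sub>E J (\<lambda>_. UNIV)" "\<omega> \<in> Tpow m" for s \<omega>
      proof -
        have "\<omega> \<in> cube m K' \<and> s \<in> ?Q \<and> \<bar>a s \<omega>\<bar> \<le> A" if nz: "a s \<omega> * f (\<tau> s \<omega>) \<noteq> 0"
          using c[OF \<open>s \<in> _\<close> \<open>\<omega> \<in> Tpow m\<close>] supported_inD[OF f(2), of "\<tau> s \<omega>"] nz by simp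
        note nz = this
        then show "\<omega> \<notin> cube m K' \<Longrightarrow> a s \<omega> * f (\<tau> s \<omega>) = 0" by blast
        show "norm (a s \<omega> * f (\<tau> s \<omega>)) \<le> A * B * indicator ?Q s"
        proof (cases "a s \<omega> * f (\<tau> s \<omega>) = 0")
          case True
          have "0 \<le> A * B * indicator ?Q s" using K'(2) B0 by (intro mult_nonneg_nonneg indicator_pos_le)
          then show ?thesis unfolding True by simp
        next
          case False
          have "\<bar>a s \<omega>\<bar> * \<bar>f (\<tau> s \<omega>)\<bar> \<le> A * B"
            using nz[OF False] f(3) K'(2) by (intro mult_mono) simp_all
          moreover have "indicator ?Q s = (1 :: real)" using nz[OF False] by (simp only: indicator_simps)
          ultimately show ?thesis by (simp add: abs_mult)
        qed
      qed
      have int: "integrable ?M (\<lambda>s. a s \<omega> * f (\<tau> s \<omega>))" if "\<omega> \<in> Tpow m" for \<omega>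
      proof (rule Bochner_Integration.integrable_bound[OF intQ[of B] meas[OF that f(1)]])
        show "AE s in ?M. norm (a s \<omega> * f (\<tau> s \<omega>)) \<le> norm (A * B * indicator ?Q s)"
          using le[OF _ that] by (intro AE_I2) (auto intro: order_trans[OF _ abs_ge_self])
      qed
      have sup: "supported_in m K' (\<Phi> f)"
        unfolding supported_in_def
      proof (intro allI impI)
        fix \<omega> assume \<omega>: "\<omega> \<notin> cube m K'"
        show "\<Phi> f \<omega> = 0"
        proof (cases "\<omega> \<in> Tpow m")
          case True
          have "(\<integral>s. a s \<omega> * f (\<tau> s \<omega>) \<partial>?M) = (\<integral>s. 0 \<partial>?M)"
            using out[OF _ True \<omega>] by (intro Bochner_Integration.integral_cong) auto
          then show ?thesis using True by (simp add: \<Phi>[OF f(1)])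
        qed (simp add: \<Phi>[OF f(1)])
      qed
      have bd: "\<bar>\<Phi> f \<omega>\<bar> \<le> (A * measure ?M ?Q) * B" for \<omega>
      proof (cases "\<omega> \<in> Tpow m")
        case True
        have "norm (\<integral>s. a s \<omega> * f (\<tau> s \<omega>) \<partial>?M) \<le> (\<integral>s. norm (a s \<omega> * f (\<tau> s \<omega>)) \<partial>?M)"
          by (rule integral_norm_bound)
        also have "\<dots> \<le> (\<integral>s. A * B * indicator ?Q s \<partial>?M)"
          using int[OF True] le[OF _ True] by (intro integral_mono intQ integrable_norm) auto
        also have "\<dots> = A * B * measure ?M ?Q"
        proof -
          have "?Q \<inter> Pi\<^sub>E J (\<lambda>_. UNIV) = ?Q" by (rule Int_absorb2) (auto simp: PiE_iff)
          then show ?thesis using Q Qf by simp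
        qed
        finally show ?thesis using True by (simp add: \<Phi>[OF f(1)] mult_ac)
      next
        case False
        then show ?thesis using K'(2) B0 by (simp add: \<Phi>[OF f(1)])
      qed
      have "continuous_on (Tpow m) (\<Phi> f)"
        unfolding continuous_on_sequentially
      proof (intro allI ballI impI)
        fix x :: "nat \<Rightarrow> nat \<Rightarrow> 'a" and \<omega> assume \<omega>: "\<omega> \<in> Tpow m" and x: "(\<forall>k. x k \<in> Tpow m) \<and> x \<longlonglongrightarrow> \<omega>"
        have "(\<lambda>k. \<integral>s. a s (x k) * f (\<tau> s (x k)) \<partial>?M) \<longlonglongrightarrow> (\<integral>s. a s \<omega> * f (\<tau> s \<omega>) \<partial>?M)"
        proof (rule integral_dominated_convergence[OF meas[OF \<omega> f(1)] _ intQ[of B]])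
          show "(\<lambda>s. a s (x k) * f (\<tau> s (x k))) \<in> borel_measurable ?M" for k using x f(1) by (intro meas) auto
          show "AE s in ?M. (\<lambda>k. a s (x k) * f (\<tau> s (x k))) \<longlonglongrightarrow> a s \<omega> * f (\<tau> s \<omega>)"
          proof (rule AE_I2)
            fix s assume "s \<in> space ?M"
            then have s: "s \<in> Pi\<^sub>E J (\<lambda>_. UNIV)" by simp
            have "continuous_on (Tpow m) (\<lambda>\<omega>. a s \<omega> * f (\<tau> s \<omega>))"
              using \<tau>_in[OF s] by (intro continuous_on_mult a_cont[OF s] continuous_on_compose2[OF D_cont[OF f(1)] \<tau>_cont[OF s]]) auto
            then show "(\<lambda>k. a s (x k) * f (\<tau> s (x k))) \<longlonglongrightarrow> a s \<omega> * f (\<tau> s \<omega>)"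
              using x \<omega> unfolding continuous_on_sequentially comp_def by blast
          qed
          show "AE s in ?M. norm (a s (x k) * f (\<tau> s (x k))) \<le> A * B * indicator ?Q s" for k
            using le x by (intro AE_I2) auto
        qed
        then show "(\<Phi> f \<circ> x) \<longlonglongrightarrow> \<Phi> f \<omega>" using x \<omega> by (simp add: \<Phi>[OF f(1)] comp_def)
      qed
      then show ?thesis using sup int bd by blast
    qed
    then show ?thesis using K'(1) by (intro exI[of _ K'] exI[of _ "A * measure ?M ?Q"]) auto
  qed
  have one: "(\<forall>\<omega>\<in>Tpow m. integrable ?M (\<lambda>s. a s \<omega> * f (\<tau> s \<omega>))) \<and> \<Phi> f \<in> \<D> m" if f: "f \<in> \<D> n" for f
  proof -
    obtain K where K: "compact K" "supported_in n K f" using D_supported[OF f] by blast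
    obtain B where B: "\<And>\<omega>. \<bar>f \<omega>\<bar> \<le> B" using D_bounded[OF f] by blast
    from main[OF K(1)] obtain K' C where K': "compact K'"
      and *: "\<forall>f\<in>\<D> n. \<forall>B. supported_in n K f \<longrightarrow> (\<forall>\<omega>. \<bar>f \<omega>\<bar> \<le> B) \<longrightarrow>
      (\<forall>\<omega>\<in>Tpow m. integrable ?M (\<lambda>s. a s \<omega> * f (\<tau> s \<omega>))) \<and>
      continuous_on (Tpow m) (\<Phi> f) \<and> supported_in m K' (\<Phi> f) \<and> (\<forall>\<omega>. \<bar>\<Phi> f \<omega>\<bar> \<le> C * B)"
      by (elim exE conjE)
    have "(\<forall>\<omega>\<in>Tpow m. integrable ?M (\<lambda>s. a s \<omega> * f (\<tau> s \<omega>))) \<and>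
      continuous_on (Tpow m) (\<Phi> f) \<and> supported_in m K' (\<Phi> f) \<and> (\<forall>\<omega>. \<bar>\<Phi> f \<omega>\<bar> \<le> C * B)"
      using *[THEN bspec, OF f, THEN spec, THEN mp, OF K(2), THEN mp, of B] B by blast
    then show ?thesis using K' unfolding D_iff by blast
  qed
  show ?thesis
    unfolding bdd_map_def
  proof (intro conjI ballI allI impI)
    show "\<Phi> f \<in> \<D> m" if "f \<in> \<D> n" for f using one[OF that] by blast
    show "\<Phi> (\<lambda>\<omega>. b * f \<omega> + c * g \<omega>) = (\<lambda>\<omega>. b * \<Phi> f \<omega> + c * \<Phi> g \<omega>)" if fg: "f \<in> \<D> n" "g \<in> \<D> n" for f g b c
    proof
      fix \<omega>
      show "\<Phi> (\<lambda>\<omega>. b * f \<omega> + c * g \<omega>) \<omega> = b * \<Phi> f \<omega> + c * \<Phi> g \<omega>"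
      proof (cases "\<omega> \<in> Tpow m")
        case True
        have "(\<integral>s. b * (a s \<omega> * f (\<tau> s \<omega>)) + c * (a s \<omega> * g (\<tau> s \<omega>)) \<partial>?M) =
            b * (\<integral>s. a s \<omega> * f (\<tau> s \<omega>) \<partial>?M) + c * (\<integral>s. a s \<omega> * g (\<tau> s \<omega>) \<partial>?M)"
          using one[OF fg(1)] one[OF fg(2)] True by simp
        then show ?thesis using True by (simp add: \<Phi> fg D_lincomb algebra_simps)
      qed (simp add: \<Phi> fg D_lincomb)
    qed
    fix K :: "'a set" assume "compact K"
    from main[OF this] show "\<exists>K' C. compact K' \<and> (\<forall>f\<in>\<D> n. \<forall>B. supported_in n K f \<longrightarrow> (\<forall>\<omega>. \<bar>f \<omega>\<bar> \<le> B) \<longrightarrow>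
        supported_in m K' (\<Phi> f) \<and> (\<forall>\<omega>. \<bar>\<Phi> f \<omega>\<bar> \<le> C * B))" by meson
  qed
qed

lemma continuous_on_coordinate: "continuous_on S (\<lambda>\<omega> :: nat \<Rightarrow> 'a::topological_space. \<omega> i)"
  by (rule continuous_on_subset[OF continuous_on_product_coordinates]) simp

text \<open>The case without integration variables, in which the product measure is a unit mass at
  one point.\<close>

lemma bdd_map_point:
  fixes \<tau> :: "(nat \<Rightarrow> 'a::radon_polish) \<Rightarrow> nat \<Rightarrow> 'a" and a :: "(nat \<Rightarrow> 'a) \<Rightarrow> real"
  assumes \<tau>_in: "\<And>\<omega>. \<omega> \<in> Tpow m \<Longrightarrow> \<tau> \<omega> \<in> Tpow n"
    and \<tau>_cont: "continuous_on (Tpow m) \<tau>" and a_cont: "continuous_on (Tpow m) a"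
    and ctrl: "\<And>K. compact K \<Longrightarrow> \<exists>K' A. compact K' \<and> 0 \<le> A \<and>
      (\<forall>\<omega>. \<omega> \<in> Tpow m \<longrightarrow> a \<omega> \<noteq> 0 \<longrightarrow> \<tau> \<omega> \<in> cube n K \<longrightarrow> \<omega> \<in> cube m K' \<and> \<bar>a \<omega>\<bar> \<le> A)"
    and \<Phi>: "\<And>f \<omega>. f \<in> \<D> n \<Longrightarrow> \<Phi> f \<omega> = (if \<omega> \<in> Tpow m then a \<omega> * f (\<tau> \<omega>) else 0)"
  shows "bdd_map n m \<Phi>"
proof (rule bdd_map_integral[where J="{} :: nat set" and \<tau>="\<lambda>_. \<tau>" and a="\<lambda>_. a"])
  fix K :: "'a set" assume "compact K"
  from ctrl[OF this] obtain K' A where "compact K'" "0 \<le> A"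
    "\<forall>\<omega>. \<omega> \<in> Tpow m \<longrightarrow> a \<omega> \<noteq> 0 \<longrightarrow> \<tau> \<omega> \<in> cube n K \<longrightarrow> \<omega> \<in> cube m K' \<and> \<bar>a \<omega>\<bar> \<le> A" by blast
  then show "\<exists>K' A. compact K' \<and> 0 \<le> A \<and> (\<forall>s \<omega>. s \<in> Pi\<^sub>E ({} :: nat set) (\<lambda>_. UNIV) \<longrightarrow> \<omega> \<in> Tpow m \<longrightarrow> a \<omega> \<noteq> 0 \<longrightarrow>
      \<tau> \<omega> \<in> cube n K \<longrightarrow> \<omega> \<in> cube m K' \<and> s \<in> Pi\<^sub>E {} (\<lambda>_. K') \<and> \<bar>a \<omega>\<bar> \<le> A)"
    by (intro exI[of _ K'] exI[of _ A]) simp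
next
  fix f :: "(nat \<Rightarrow> 'a) \<Rightarrow> real" and \<omega> :: "nat \<Rightarrow> 'a" assume f: "f \<in> \<D> n"
  have "(\<integral>s. a \<omega> * f (\<tau> \<omega>) \<partial>Pi\<^sub>M ({} :: nat set) (\<lambda>_. \<sigma> :: 'a measure)) = a \<omega> * f (\<tau> \<omega>)"
    using integral_\<sigma>pow_0[of "\<lambda>_ :: nat \<Rightarrow> 'a. a \<omega> * f (\<tau> \<omega>)", unfolded \<sigma>pow_def lessThan_0] .
  then show "\<Phi> f \<omega> = (if \<omega> \<in> Tpow m then \<integral>s. a \<omega> * f (\<tau> \<omega>) \<partial>Pi\<^sub>M ({} :: nat set) (\<lambda>_. \<sigma> :: 'a measure) else 0)"
    unfolding \<Phi>[OF f] by (simp only:)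
qed (auto intro: \<tau>_in \<tau>_cont a_cont)

lemma bdd_map_integral1:
  fixes \<tau> :: "'a::radon_polish \<Rightarrow> (nat \<Rightarrow> 'a) \<Rightarrow> nat \<Rightarrow> 'a" and a :: "'a \<Rightarrow> (nat \<Rightarrow> 'a) \<Rightarrow> real"
  assumes \<tau>_in: "\<And>t \<omega>. \<omega> \<in> Tpow m \<Longrightarrow> \<tau> t \<omega> \<in> Tpow n"
    and \<tau>_cont: "\<And>t. continuous_on (Tpow m) (\<tau> t)" and a_cont: "\<And>t. continuous_on (Tpow m) (a t)"
    and \<tau>_meas: "\<And>\<omega>. \<omega> \<in> Tpow m \<Longrightarrow> (\<lambda>t. \<tau> t \<omega>) \<in> measurable borel borel"
    and a_meas: "\<And>\<omega>. \<omega> \<in> Tpow m \<Longrightarrow> (\<lambda>t. a t \<omega>) \<in> borel_measurable borel"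
    and ctrl: "\<And>K. compact K \<Longrightarrow> \<exists>K' A. compact K' \<and> 0 \<le> A \<and>
      (\<forall>t \<omega>. \<omega> \<in> Tpow m \<longrightarrow> a t \<omega> \<noteq> 0 \<longrightarrow> \<tau> t \<omega> \<in> cube n K \<longrightarrow> \<omega> \<in> cube m K' \<and> t \<in> K' \<and> \<bar>a t \<omega>\<bar> \<le> A)"
    and \<Phi>: "\<And>f \<omega>. f \<in> \<D> n \<Longrightarrow> \<Phi> f \<omega> = (if \<omega> \<in> Tpow m then \<integral>t. a t \<omega> * f (\<tau> t \<omega>) \<partial>\<sigma> else 0)"
  shows "bdd_map n m \<Phi>"
proof (rule bdd_map_integral[where J="{0 :: nat}" and \<tau>="\<lambda>s. \<tau> (s 0)" and a="\<lambda>s. a (s 0)"])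
  interpret product_sigma_finite "\<lambda>_::nat. \<sigma> :: 'a measure" by (rule product_sigma_finite_\<sigma>)
  have c: "(\<lambda>s. s 0) \<in> measurable (Pi\<^sub>M {0::nat} (\<lambda>_. \<sigma>)) (borel :: 'a measure)"
    using measurable_component_singleton[of 0 "{0::nat}" "\<lambda>_. \<sigma> :: 'a measure"]
      measurable_cong_sets[OF refl sets_\<sigma>_borel] by blast
  show "(\<lambda>s. \<tau> (s 0) \<omega>) \<in> measurable (Pi\<^sub>M {0::nat} (\<lambda>_. \<sigma>)) borel" if "\<omega> \<in> Tpow m" for \<omega>
    using measurable_compose[OF c \<tau>_meas[OF that]] .
  show "(\<lambda>s. a (s 0) \<omega>) \<in> borel_measurable (Pi\<^sub>M {0::nat} (\<lambda>_. \<sigma>))" if "\<omega> \<in> Tpow m" for \<omega>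
    using measurable_compose[OF c a_meas[OF that]] .
  fix K :: "'a set" assume "compact K"
  from ctrl[OF this] obtain K' A where K': "compact K'" "0 \<le> A"
    "\<And>t \<omega>. \<omega> \<in> Tpow m \<Longrightarrow> a t \<omega> \<noteq> 0 \<Longrightarrow> \<tau> t \<omega> \<in> cube n K \<Longrightarrow> \<omega> \<in> cube m K' \<and> t \<in> K' \<and> \<bar>a t \<omega>\<bar> \<le> A" by blast
  then show "\<exists>K' A. compact K' \<and> 0 \<le> A \<and> (\<forall>s \<omega>. s \<in> Pi\<^sub>E {0::nat} (\<lambda>_. UNIV) \<longrightarrow> \<omega> \<in> Tpow m \<longrightarrow> a (s 0) \<omega> \<noteq> 0 \<longrightarrow>
      \<tau> (s 0) \<omega> \<in> cube n K \<longrightarrow> \<omega> \<in> cube m K' \<and> s \<in> Pi\<^sub>E {0} (\<lambda>_. K') \<and> \<bar>a (s 0) \<omega>\<bar> \<le> A)"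
    by (intro exI[of _ K'] exI[of _ A]) (auto simp: PiE_iff)
next
  interpret product_sigma_finite "\<lambda>_::nat. \<sigma> :: 'a measure" by (rule product_sigma_finite_\<sigma>)
  fix f :: "(nat \<Rightarrow> 'a) \<Rightarrow> real" and \<omega> :: "nat \<Rightarrow> 'a" assume f: "f \<in> \<D> n"
  have "(\<integral>s. a (s 0) \<omega> * f (\<tau> (s 0) \<omega>) \<partial>Pi\<^sub>M {0::nat} (\<lambda>_. \<sigma>)) = (\<integral>t. a t \<omega> * f (\<tau> t \<omega>) \<partial>\<sigma>)" if "\<omega> \<in> Tpow m"
  proof (rule product_integral_singleton)
    show "(\<lambda>t. a t \<omega> * f (\<tau> t \<omega>)) \<in> borel_measurable \<sigma>"
      using a_meas[OF that] measurable_compose[OF \<tau>_meas[OF that] D_measurable[OF f]]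
      unfolding measurable_\<sigma>_iff by (rule borel_measurable_times)
  qed
  then show "\<Phi> f \<omega> = (if \<omega> \<in> Tpow m then \<integral>s. a (s 0) \<omega> * f (\<tau> (s 0) \<omega>) \<partial>Pi\<^sub>M {0::nat} (\<lambda>_. \<sigma>) else 0)"
    unfolding \<Phi>[OF f] by simp
qed (auto intro: \<tau>_in \<tau>_cont a_cont)

lemma bdd_map_slice: "bdd_map (Suc m) m (slice (t :: 'a::radon_polish))"
proof (rule bdd_map_point[where \<tau>="case_nat t" and a="\<lambda>_. 1"])
  show "continuous_on (Tpow m) (case_nat t :: _ \<Rightarrow> nat \<Rightarrow> 'a)"
  proof (rule continuous_on_coordinatewise_then_product)
    show "continuous_on (Tpow m) (\<lambda>\<omega>. case_nat t \<omega> i)" for i by (cases i) (simp_all add: continuous_on_coordinate)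
  qed
  fix K :: "'a set" assume K: "compact K"
  have "\<omega> \<in> cube m K" if w: "\<omega> \<in> Tpow m" "case_nat t \<omega> \<in> cube (Suc m) K" for \<omega>
  proof -
    have "\<omega> i \<in> K" if "i < m" for i using PiE_mem[OF w(2), of "Suc i"] that by simp
    then show ?thesis using w(1) by (auto simp: PiE_iff Tpow_def)
  qed
  then show "\<exists>K' A. compact K' \<and> 0 \<le> A \<and> (\<forall>\<omega>. \<omega> \<in> Tpow m \<longrightarrow> 1 \<noteq> (0::real) \<longrightarrow> case_nat t \<omega> \<in> cube (Suc m) K \<longrightarrow>
      \<omega> \<in> cube m K' \<and> \<bar>1 :: real\<bar> \<le> A)" using K by (intro exI[of _ K] exI[of _ 1]) auto
next
  fix f :: "(nat \<Rightarrow> 'a) \<Rightarrow> real" and \<omega> :: "nat \<Rightarrow> 'a" assume f: "f \<in> \<D> (Suc m)"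
  have "\<omega> \<in> Tpow m" if "case_nat t \<omega> \<in> Tpow (Suc m)"
    using that unfolding Tpow_iff by (metis Suc_le_mono old.nat.simps(5))
  then show "slice t f \<omega> = (if \<omega> \<in> Tpow m then 1 * f (case_nat t \<omega>) else 0)"
    using D_zero_outside[OF f, of "case_nat t \<omega>"] by (auto simp: slice_def)
qed (auto intro: case_nat_in_Tpow)

text \<open>\<open>diag\<close> and \<open>pair_int\<close> extend the two lower order terms of the
  recursion of \<open>P\<close> to general coefficients: the factors at positions i and i + 1 are
  merged with weight \<lambda>, or integrated out against each other. The index i is the number of
  factors to their left.\<close>

definition diag :: "('a \<Rightarrow> real) \<Rightarrow> nat \<Rightarrow> ((nat \<Rightarrow> 'a) \<Rightarrow> real) \<Rightarrow> (nat \<Rightarrow> 'a) \<Rightarrow> real" where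
  "diag lam i f \<omega> = lam (\<omega> i) * f (\<lambda>j. if j \<le> i then \<omega> j else \<omega> (j - 1))"

definition pair_int :: "nat \<Rightarrow> ((nat \<Rightarrow> 'a::radon_polish) \<Rightarrow> real) \<Rightarrow> (nat \<Rightarrow> 'a) \<Rightarrow> real" where
  "pair_int i f \<omega> = (\<integral>t. f (\<lambda>j. if j < i then \<omega> j else if j < i + 2 then t else \<omega> (j - 2)) \<partial>\<sigma>)"

definition contract :: "('a::radon_polish \<Rightarrow> real) \<Rightarrow> ((nat \<Rightarrow> 'a) \<Rightarrow> real) \<Rightarrow> (nat \<Rightarrow> 'a) \<Rightarrow> real" where
  "contract g f \<omega> = (\<integral>t. g t * f (case_nat t \<omega>) \<partial>\<sigma>)"

lemma bdd_map_diag: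
  fixes lam :: "'a::radon_polish \<Rightarrow> real"
  assumes lam: "continuous_on UNIV lam" and i: "i < m"
  shows "bdd_map (Suc m) m (diag lam i)"
proof (rule bdd_map_point[where \<tau>="\<lambda>\<omega> j. if j \<le> i then \<omega> j else \<omega> (j - 1)" and a="\<lambda>\<omega>. lam (\<omega> i)"])
  show "(\<lambda>j. if j \<le> i then \<omega> j else \<omega> (j - 1)) \<in> Tpow (Suc m)" if "\<omega> \<in> Tpow m" for \<omega> :: "nat \<Rightarrow> 'a"
    using that i by (auto simp: Tpow_iff)
  show "continuous_on (Tpow m) (\<lambda>\<omega> :: nat \<Rightarrow> 'a. \<lambda>j. if j \<le> i then \<omega> j else \<omega> (j - 1))"
  proof (rule continuous_on_coordinatewise_then_product)
    show "continuous_on (Tpow m) (\<lambda>\<omega> :: nat \<Rightarrow> 'a. if j \<le> i then \<omega> j else \<omega> (j - 1))" for j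
      by (cases "j \<le> i") (simp_all add: continuous_on_coordinate)
  qed
  show "continuous_on (Tpow m) (\<lambda>\<omega>. lam (\<omega> i))"
    by (rule continuous_on_compose2[OF lam continuous_on_coordinate]) simp
  fix K :: "'a set" assume K: "compact K"
  obtain C where C: "C \<ge> 0" "\<And>t. t \<in> K \<Longrightarrow> \<bar>lam t\<bar> \<le> C" using lam_bounded[OF lam K] by blast
  have "\<omega> \<in> cube m K \<and> \<bar>lam (\<omega> i)\<bar> \<le> C"
    if w: "\<omega> \<in> Tpow m" "(\<lambda>j. if j \<le> i then \<omega> j else \<omega> (j - 1)) \<in> cube (Suc m) K" for \<omega>
  proof -
    have "\<omega> j \<in> K" if "j < m" for j
      using PiE_mem[OF w(2), of j] PiE_mem[OF w(2), of "Suc j"] that by (cases "j \<le> i") simp_all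
    then show ?thesis using w(1) C(2) i by (auto simp: PiE_iff Tpow_def)
  qed
  then show "\<exists>K' A. compact K' \<and> 0 \<le> A \<and> (\<forall>\<omega>. \<omega> \<in> Tpow m \<longrightarrow> lam (\<omega> i) \<noteq> 0 \<longrightarrow>
      (\<lambda>j. if j \<le> i then \<omega> j else \<omega> (j - 1)) \<in> cube (Suc m) K \<longrightarrow> \<omega> \<in> cube m K' \<and> \<bar>lam (\<omega> i)\<bar> \<le> A)"
    using K C(1) by (intro exI[of _ K] exI[of _ C]) auto
next
  fix f :: "(nat \<Rightarrow> 'a) \<Rightarrow> real" and \<omega> :: "nat \<Rightarrow> 'a" assume f: "f \<in> \<D> (Suc m)"
  have "f (\<lambda>j. if j \<le> i then \<omega> j else \<omega> (j - 1)) = 0" if \<omega>: "\<omega> \<notin> Tpow m"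
  proof (rule D_zero_outside[OF f])
    obtain j where j: "j \<ge> m" "\<omega> j \<noteq> undefined" using \<omega> by (auto simp: Tpow_iff)
    then have "\<not> Suc j \<le> i" "Suc j \<ge> Suc m" using i by auto
    then show "(\<lambda>j. if j \<le> i then \<omega> j else \<omega> (j - 1)) \<notin> Tpow (Suc m)"
      using j unfolding Tpow_iff by (metis diff_Suc_1)
  qed
  then show "diag lam i f \<omega> = (if \<omega> \<in> Tpow m then lam (\<omega> i) * f (\<lambda>j. if j \<le> i then \<omega> j else \<omega> (j - 1)) else 0)"
    by (simp add: diag_def)
qed

lemma bdd_map_pair_int:
  assumes i: "i \<le> m"
  shows "bdd_map (Suc (Suc m)) m (pair_int i :: ((nat \<Rightarrow> 'a::radon_polish) \<Rightarrow> real) \<Rightarrow> _)"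
proof (rule bdd_map_integral1[where \<tau>="\<lambda>t \<omega> j. if j < i then \<omega> j else if j < i + 2 then t else \<omega> (j - 2)" and a="\<lambda>_ _. 1"])
  show "(\<lambda>j. if j < i then \<omega> j else if j < i + 2 then t else \<omega> (j - 2)) \<in> Tpow (Suc (Suc m))"
    if "\<omega> \<in> Tpow m" for \<omega> and t :: 'a
    using that i by (auto simp: Tpow_iff)
  show "continuous_on (Tpow m) (\<lambda>\<omega> j. if j < i then \<omega> j else if j < i + 2 then t else \<omega> (j - 2))" for t :: 'a
  proof (rule continuous_on_coordinatewise_then_product)
    show "continuous_on (Tpow m) (\<lambda>\<omega>. if j < i then \<omega> j else if j < i + 2 then t else \<omega> (j - 2))" for j
      by (cases "j < i"; cases "j < i + 2") (simp_all add: continuous_on_coordinate)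
  qed
  show "(\<lambda>t. \<lambda>j. if j < i then \<omega> j else if j < i + 2 then t else \<omega> (j - 2)) \<in> measurable borel borel"
    for \<omega> :: "nat \<Rightarrow> 'a"
  proof (rule measurable_into_pow)
    show "(\<lambda>t. if j < i then \<omega> j else if j < i + 2 then t else \<omega> (j - 2)) \<in> measurable borel borel" for j
      by (cases "j < i"; cases "j < i + 2") simp_all
  qed
  fix K :: "'a set" assume K: "compact K"
  have "\<omega> \<in> cube m K \<and> t \<in> K"
    if w: "\<omega> \<in> Tpow m" "(\<lambda>j. if j < i then \<omega> j else if j < i + 2 then t else \<omega> (j - 2)) \<in> cube (Suc (Suc m)) K" for \<omega> t
  proof -
    have "\<omega> j \<in> K" if "j < m" for j
      using PiE_mem[OF w(2), of j] PiE_mem[OF w(2), of "j + 2"] that by (cases "j < i") simp_all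
    moreover have "t \<in> K" using PiE_mem[OF w(2), of i] i by simp
    ultimately show ?thesis using w(1) by (auto simp: PiE_iff Tpow_def)
  qed
  then show "\<exists>K' A. compact K' \<and> 0 \<le> A \<and> (\<forall>t \<omega>. \<omega> \<in> Tpow m \<longrightarrow> 1 \<noteq> (0::real) \<longrightarrow>
      (\<lambda>j. if j < i then \<omega> j else if j < i + 2 then t else \<omega> (j - 2)) \<in> cube (Suc (Suc m)) K \<longrightarrow>
      \<omega> \<in> cube m K' \<and> t \<in> K' \<and> \<bar>1 :: real\<bar> \<le> A)"
    using K by (intro exI[of _ K] exI[of _ 1]) auto
next
  fix f :: "(nat \<Rightarrow> 'a) \<Rightarrow> real" and \<omega> :: "nat \<Rightarrow> 'a" assume f: "f \<in> \<D> (Suc (Suc m))"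
  have "f (\<lambda>j. if j < i then \<omega> j else if j < i + 2 then t else \<omega> (j - 2)) = 0" if \<omega>: "\<omega> \<notin> Tpow m" for t
  proof (rule D_zero_outside[OF f])
    obtain j where j: "j \<ge> m" "\<omega> j \<noteq> undefined" using \<omega> by (auto simp: Tpow_iff)
    then have "\<not> j + 2 < i" "\<not> j + 2 < i + 2" "j + 2 \<ge> Suc (Suc m)" "j + 2 - 2 = j" using i by auto
    then show "(\<lambda>j. if j < i then \<omega> j else if j < i + 2 then t else \<omega> (j - 2)) \<notin> Tpow (Suc (Suc m))"
      using j unfolding Tpow_iff by metis
  qed
  then show "pair_int i f \<omega> = (if \<omega> \<in> Tpow m then
      \<integral>t. 1 * f (\<lambda>j. if j < i then \<omega> j else if j < i + 2 then t else \<omega> (j - 2)) \<partial>\<sigma> else 0)"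
    by (simp add: pair_int_def)
qed simp_all

lemma bdd_map_contract:
  assumes g: "g \<in> \<D>1"
  shows "bdd_map (Suc m) m (contract (g :: 'a::radon_polish \<Rightarrow> real))"
proof (rule bdd_map_integral1[where \<tau>="case_nat" and a="\<lambda>t _. g t"])
  show "continuous_on (Tpow m) (case_nat t :: _ \<Rightarrow> nat \<Rightarrow> 'a)" for t
  proof (rule continuous_on_coordinatewise_then_product)
    show "continuous_on (Tpow m) (\<lambda>\<omega>. case_nat t \<omega> i)" for i by (cases i) (simp_all add: continuous_on_coordinate)
  qed
  show "(\<lambda>t. case_nat t \<omega>) \<in> measurable borel borel" for \<omega> :: "nat \<Rightarrow> 'a"
  proof (rule measurable_into_pow)
    show "(\<lambda>t. case_nat t \<omega> i) \<in> measurable borel borel" for i by (cases i) simp_all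
  qed
  show "(\<lambda>t. g t) \<in> borel_measurable borel" using D1_measurable[OF g] .
  fix K :: "'a set" assume K: "compact K"
  obtain B where B: "0 \<le> B" "\<And>t. \<bar>g t\<bar> \<le> B" using D1_bounded[OF g] by blast
  have "\<omega> \<in> cube m K \<and> t \<in> K" if w: "\<omega> \<in> Tpow m" "case_nat t \<omega> \<in> cube (Suc m) K" for \<omega> t
  proof -
    have "\<omega> i \<in> K" if "i < m" for i using PiE_mem[OF w(2), of "Suc i"] that by simp
    moreover have "t \<in> K" using PiE_mem[OF w(2), of 0] by simp
    ultimately show ?thesis using w(1) by (auto simp: PiE_iff Tpow_def)
  qed
  then show "\<exists>K' A. compact K' \<and> 0 \<le> A \<and> (\<forall>t \<omega>. \<omega> \<in> Tpow m \<longrightarrow> g t \<noteq> 0 \<longrightarrow> case_nat t \<omega> \<in> cube (Suc m) K \<longrightarrow>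
      \<omega> \<in> cube m K' \<and> t \<in> K' \<and> \<bar>g t\<bar> \<le> A)" using K B by (intro exI[of _ K] exI[of _ B]) auto
next
  fix f :: "(nat \<Rightarrow> 'a) \<Rightarrow> real" and \<omega> :: "nat \<Rightarrow> 'a" assume f: "f \<in> \<D> (Suc m)"
  have "\<omega> \<in> Tpow m" if "case_nat t \<omega> \<in> Tpow (Suc m)" for t
    using that unfolding Tpow_iff by (metis Suc_le_mono old.nat.simps(5))
  then have "f (case_nat t \<omega>) = 0" if "\<omega> \<notin> Tpow m" for t using D_zero_outside[OF f, of "case_nat t \<omega>"] that by auto
  then show "contract g f \<omega> = (if \<omega> \<in> Tpow m then \<integral>t. g t * f (case_nat t \<omega>) \<partial>\<sigma> else 0)"
    by (simp add: contract_def)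
qed (auto intro: case_nat_in_Tpow)

lemma block_of_eq: "partition_on S \<zeta> \<Longrightarrow> B \<in> \<zeta> \<Longrightarrow> i \<in> B \<Longrightarrow> block_of \<zeta> i = B"
  unfolding block_of_def partition_on_def disjoint_def by (rule the_equality) auto

text \<open>There is one integration variable per block. Blocks are nonempty, so each variable
  \<open>s B\<close> occurs as a coordinate of the argument of f and is confined to K together with
  the free variables; hence \<lambda> is bounded where it matters.\<close>

lemma bdd_map_W_contract:
  fixes lam :: "'a::radon_polish \<Rightarrow> real"
  assumes lam: "continuous_on UNIV lam" and p: "partition_on {1..n} \<zeta>" and nN: "n \<le> N"
  shows "bdd_map N (N - n) (W_contract lam n \<zeta>)"
proof (rule bdd_map_integral[where J=\<zeta> and \<tau>="\<lambda>s \<omega> i. if i < n then s (block_of \<zeta> (n - i)) else \<omega> (i - n)"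
      and a="\<lambda>s _. \<Prod>B\<in>\<zeta>. lam (s B) ^ (card B - 2)"])
  let ?\<tau> = "\<lambda>(s :: nat set \<Rightarrow> 'a) \<omega> i. if i < n then s (block_of \<zeta> (n - i)) else \<omega> (i - n)"
  show fin: "finite \<zeta>" using p finite_elements by blast
  have blk: "block_of \<zeta> (n - i) \<in> \<zeta>" if "i < n" for i
  proof -
    have "n - i \<in> \<Union>\<zeta>" using p that by (auto simp: partition_on_def)
    then obtain B where "B \<in> \<zeta>" "n - i \<in> B" by blast
    then show ?thesis using block_of_eq[OF p] by metis
  qed
  show "?\<tau> s \<omega> \<in> Tpow N" if "\<omega> \<in> Tpow (N - n)" for s \<omega>
    using that nN by (auto simp: Tpow_iff)
  show "continuous_on (Tpow (N - n)) (?\<tau> s)" for s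
  proof (rule continuous_on_coordinatewise_then_product)
    show "continuous_on (Tpow (N - n)) (\<lambda>\<omega>. ?\<tau> s \<omega> i)" for i
      by (cases "i < n") (simp_all add: continuous_on_coordinate)
  qed
  have comp: "(\<lambda>s. s B) \<in> measurable (Pi\<^sub>M \<zeta> (\<lambda>_. \<sigma>)) (borel :: 'a measure)" if "B \<in> \<zeta>" for B
    using measurable_component_singleton[OF that, of "\<lambda>_. \<sigma> :: 'a measure"]
      measurable_cong_sets[OF refl sets_\<sigma>_borel] by blast
  show "(\<lambda>s. ?\<tau> s \<omega>) \<in> measurable (Pi\<^sub>M \<zeta> (\<lambda>_. \<sigma>)) borel" for \<omega>
  proof (rule measurable_into_pow)
    show "(\<lambda>s. ?\<tau> s \<omega> i) \<in> measurable (Pi\<^sub>M \<zeta> (\<lambda>_. \<sigma>)) borel" for i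
      using comp[OF blk] by (cases "i < n") simp_all
  qed
  show "(\<lambda>s. \<Prod>B\<in>\<zeta>. lam (s B) ^ (card B - 2)) \<in> borel_measurable (Pi\<^sub>M \<zeta> (\<lambda>_. \<sigma>))"
    by (intro borel_measurable_prod borel_measurable_power
        measurable_compose[OF comp borel_measurable_continuous_onI[OF lam]])
  fix K :: "'a set" assume K: "compact K"
  obtain C where C: "C \<ge> 0" "\<And>t. t \<in> K \<Longrightarrow> \<bar>lam t\<bar> \<le> C" using lam_bounded[OF lam K] by blast
  have "\<omega> \<in> cube (N - n) K \<and> s \<in> Pi\<^sub>E \<zeta> (\<lambda>_. K) \<and> \<bar>\<Prod>B\<in>\<zeta>. lam (s B) ^ (card B - 2)\<bar> \<le> (\<Prod>B\<in>\<zeta>. C ^ (card B - 2))"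
    if s: "s \<in> Pi\<^sub>E \<zeta> (\<lambda>_. UNIV)" and w: "\<omega> \<in> Tpow (N - n)" and c: "?\<tau> s \<omega> \<in> cube N K" for s \<omega>
  proof -
    have "\<omega> j \<in> K" if "j < N - n" for j
      using PiE_mem[OF c, of "n + j"] that by simp
    then have 1: "\<omega> \<in> cube (N - n) K" using w by (auto simp: PiE_iff Tpow_def)
    have sK: "s B \<in> K" if B: "B \<in> \<zeta>" for B
    proof -
      have "B \<noteq> {}" "B \<subseteq> {1..n}" using p B by (auto simp: partition_on_def)
      then obtain x where x: "x \<in> B" "1 \<le> x" "x \<le> n" by fastforce
      then have "n - (n - x) = x" "n - x < n" by auto
      then show ?thesis using PiE_mem[OF c, of "n - x"] block_of_eq[OF p B x(1)] nN by simp
    qed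
    then have 2: "s \<in> Pi\<^sub>E \<zeta> (\<lambda>_. K)" using s by (auto simp: PiE_iff)
    have "\<bar>\<Prod>B\<in>\<zeta>. lam (s B) ^ (card B - 2)\<bar> = (\<Prod>B\<in>\<zeta>. \<bar>lam (s B)\<bar> ^ (card B - 2))"
      by (simp add: abs_prod power_abs)
    also have "\<dots> \<le> (\<Prod>B\<in>\<zeta>. C ^ (card B - 2))"
      using C(2)[OF sK] by (intro prod_mono conjI power_mono) auto
    finally show ?thesis using 1 2 by blast
  qed
  then show "\<exists>K' A. compact K' \<and> 0 \<le> A \<and> (\<forall>s \<omega>. s \<in> Pi\<^sub>E \<zeta> (\<lambda>_. UNIV) \<longrightarrow> \<omega> \<in> Tpow (N - n) \<longrightarrow>
      (\<Prod>B\<in>\<zeta>. lam (s B) ^ (card B - 2)) \<noteq> 0 \<longrightarrow> ?\<tau> s \<omega> \<in> cube N K \<longrightarrow>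
      \<omega> \<in> cube (N - n) K' \<and> s \<in> Pi\<^sub>E \<zeta> (\<lambda>_. K') \<and> \<bar>\<Prod>B\<in>\<zeta>. lam (s B) ^ (card B - 2)\<bar> \<le> A)"
    using K C(1) by (intro exI[of _ K] exI[of _ "\<Prod>B\<in>\<zeta>. C ^ (card B - 2)"]) (auto intro!: prod_nonneg)
next
  fix f :: "(nat \<Rightarrow> 'a) \<Rightarrow> real" and \<omega> :: "nat \<Rightarrow> 'a" assume f: "f \<in> \<D> N"
  have z: "f (\<lambda>i. if i < n then t (n - i) else \<omega> (i - n)) = 0" if \<omega>: "\<omega> \<notin> Tpow (N - n)" for t
  proof (rule D_zero_outside[OF f])
    obtain j where j: "j \<ge> N - n" "\<omega> j \<noteq> undefined" using \<omega> by (auto simp: Tpow_iff)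
    then have "\<not> j + n < n" "j + n \<ge> N" "j + n - n = j" by auto
    then show "(\<lambda>i. if i < n then t (n - i) else \<omega> (i - n)) \<notin> Tpow N"
      using j unfolding Tpow_iff by metis
  qed
  have "f (\<lambda>i. if i < n then s (block_of \<zeta> (n - i)) else \<omega> (i - n)) = 0" if "\<omega> \<notin> Tpow (N - n)" for s
    using z[OF that, of "\<lambda>x. s (block_of \<zeta> x)"] .
  then show "W_contract lam n \<zeta> f \<omega> = (if \<omega> \<in> Tpow (N - n) then
      \<integral>s. (\<Prod>B\<in>\<zeta>. lam (s B) ^ (card B - 2)) * f (\<lambda>i. if i < n then s (block_of \<zeta> (n - i)) else \<omega> (i - n)) \<partial>Pi\<^sub>M \<zeta> (\<lambda>_. \<sigma>) else 0)"
    by (simp add: W_contract_def W_integral_def)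
qed simp


section \<open>Linear operators on continuous polynomials\<close>

definition linear_on_D :: "nat \<Rightarrow> (((nat \<Rightarrow> 'a::topological_space) \<Rightarrow> real) \<Rightarrow> 'b::real_vector) \<Rightarrow> bool" where
  "linear_on_D n M \<longleftrightarrow>
     (\<forall>f\<in>\<D> n. \<forall>g\<in>\<D> n. \<forall>a b. M (\<lambda>\<omega>. a * f \<omega> + b * g \<omega>) = a *\<^sub>R M f + b *\<^sub>R M g)"

lemma linear_on_DD:
  "linear_on_D n M \<Longrightarrow> f \<in> \<D> n \<Longrightarrow> g \<in> \<D> n \<Longrightarrow> M (\<lambda>\<omega>. a * f \<omega> + b * g \<omega>) = a *\<^sub>R M f + b *\<^sub>R M g"
  by (simp add: linear_on_D_def)

lemma linear_on_D_zero: "linear_on_D n M \<Longrightarrow> M (\<lambda>_. 0) = 0"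
  using linear_on_DD[of n M "\<lambda>_. 0" "\<lambda>_. 0" 0 0] by simp

lemma bdd_fun_linear: "bdd_fun n M \<Longrightarrow> linear_on_D n M"
  by (simp add: bdd_fun_def linear_on_D_def)

text \<open>The strict bound on the degree makes the span for d = 0 trivial, which starts the
  inductions on d and the nilpotency argument.\<close>

definition graded_span :: "(nat \<Rightarrow> ((nat \<Rightarrow> 'a::topological_space) \<Rightarrow> real) \<Rightarrow> 'b::real_vector) \<Rightarrow> nat \<Rightarrow> 'b set" where
  "graded_span \<beta> d = {\<Sum>i<d. \<beta> i (f i) | f. \<forall>i. f i \<in> \<D> i}"

lemma graded_spanI: "(\<And>i. f i \<in> \<D> i) \<Longrightarrow> p = (\<Sum>i<d. \<beta> i (f i)) \<Longrightarrow> p \<in> graded_span \<beta> d"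
  unfolding graded_span_def by (intro CollectI exI[of _ f] conjI allI)

text \<open>Independence determines the coefficients below d only. With zeros from d on, the
  coefficient family of an element becomes unique and independent of d.\<close>

lemma graded_span_eq_truncated:
  assumes lin: "\<And>i. linear_on_D i (\<beta> i)"
  shows "p \<in> graded_span \<beta> d \<longleftrightarrow>
    (\<exists>f. (\<forall>i. f i \<in> \<D> i) \<and> (\<forall>i\<ge>d. f i = (\<lambda>_. 0)) \<and> p = (\<Sum>i<d. \<beta> i (f i)))"
proof
  assume "p \<in> graded_span \<beta> d"
  then obtain f where f: "\<forall>i. f i \<in> \<D> i" "p = (\<Sum>i<d. \<beta> i (f i))" by (auto simp: graded_span_def)
  then show "\<exists>f. (\<forall>i. f i \<in> \<D> i) \<and> (\<forall>i\<ge>d. f i = (\<lambda>_. 0)) \<and> p = (\<Sum>i<d. \<beta> i (f i))"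
    by (intro exI[of _ "\<lambda>i. if i < d then f i else (\<lambda>_. 0)"]) auto
qed (auto simp: graded_span_def)

lemma sum_truncated:
  assumes lin: "\<And>i. linear_on_D i (\<beta> i)" and "\<forall>i\<ge>d. f i = (\<lambda>_. 0)" "d \<le> e"
  shows "(\<Sum>i<e. \<beta> i (f i)) = (\<Sum>i<d. \<beta> i (f i))"
proof (rule sum.mono_neutral_right)
  show "\<forall>i\<in>{..<e} - {..<d}. \<beta> i (f i) = 0"
    using assms(2) linear_on_D_zero[OF lin] by auto
qed (use assms(3) in auto)

lemma graded_span_mono:
  assumes lin: "\<And>i. linear_on_D i (\<beta> i)" and "d \<le> e"
  shows "graded_span \<beta> d \<subseteq> graded_span \<beta> e"
proof
  fix p assume "p \<in> graded_span \<beta> d"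
  then obtain f where f: "\<forall>i. f i \<in> \<D> i" "\<forall>i\<ge>d. f i = (\<lambda>_. 0)" "p = (\<Sum>i<d. \<beta> i (f i))"
    unfolding graded_span_eq_truncated[OF lin] by blast
  then have "p = (\<Sum>i<e. \<beta> i (f i))" using sum_truncated[OF lin f(2) assms(2)] by simp
  then show "p \<in> graded_span \<beta> e" using f(1) by (auto simp: graded_span_def)
qed

lemma graded_span_lincomb:
  assumes lin: "\<And>i. linear_on_D i (\<beta> i)" and "p \<in> graded_span \<beta> d" "q \<in> graded_span \<beta> d"
  shows "a *\<^sub>R p + b *\<^sub>R q \<in> graded_span \<beta> d"
proof -
  obtain f g where f: "\<forall>i. f i \<in> \<D> i" "p = (\<Sum>i<d. \<beta> i (f i))"
    and g: "\<forall>i. g i \<in> \<D> i" "q = (\<Sum>i<d. \<beta> i (g i))"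
    using assms(2,3) by (auto simp: graded_span_def)
  have "a *\<^sub>R p + b *\<^sub>R q = (\<Sum>i<d. \<beta> i (\<lambda>\<omega>. a * f i \<omega> + b * g i \<omega>))"
    using f g by (simp add: linear_on_DD[OF lin] scaleR_sum_right sum.distrib)
  then show ?thesis using f g by (intro graded_spanI[where f="\<lambda>i \<omega>. a * f i \<omega> + b * g i \<omega>"] D_lincomb) auto
qed

lemma graded_span_zero:
  assumes lin: "\<And>i. linear_on_D i (\<beta> i)"
  shows "0 \<in> graded_span \<beta> d"
  by (rule graded_spanI[where f="\<lambda>_ _. 0"]) (simp_all add: linear_on_D_zero[OF lin])

lemma graded_span_add:
  "(\<And>i. linear_on_D i (\<beta> i)) \<Longrightarrow> p \<in> graded_span \<beta> d \<Longrightarrow> q \<in> graded_span \<beta> d \<Longrightarrow> p + q \<in> graded_span \<beta> d"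
  using graded_span_lincomb[of \<beta> p d q 1 1] by simp

lemma graded_span_diff:
  "(\<And>i. linear_on_D i (\<beta> i)) \<Longrightarrow> p \<in> graded_span \<beta> d \<Longrightarrow> q \<in> graded_span \<beta> d \<Longrightarrow> p - q \<in> graded_span \<beta> d"
  using graded_span_lincomb[of \<beta> p d q 1 "-1"] by simp

lemma graded_span_sum:
  "(\<And>i. linear_on_D i (\<beta> i)) \<Longrightarrow> (\<And>i. i \<in> I \<Longrightarrow> p i \<in> graded_span \<beta> d) \<Longrightarrow> (\<Sum>i\<in>I. p i) \<in> graded_span \<beta> d"
  by (induction I rule: infinite_finite_induct) (auto intro: graded_span_add graded_span_zero)

lemma graded_span_base:
  assumes lin: "\<And>i. linear_on_D i (\<beta> i)" and f: "f \<in> \<D> n" and n: "n < d"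
  shows "\<beta> n f \<in> graded_span \<beta> d"
proof -
  let ?f = "\<lambda>i. if i = n then f else (\<lambda>_. 0)"
  have "(\<Sum>i<d. \<beta> i (?f i)) = (\<Sum>i<d. if i = n then \<beta> n f else 0)"
    using linear_on_D_zero[OF lin] by (intro sum.cong) auto
  also have "\<dots> = \<beta> n f" using n by simp
  finally have "\<beta> n f = (\<Sum>i<d. \<beta> i (?f i))" ..
  then show ?thesis using f by (intro graded_spanI[where f="?f"]) auto
qed

definition independent_family :: "(nat \<Rightarrow> ((nat \<Rightarrow> 'a::topological_space) \<Rightarrow> real) \<Rightarrow> 'b::real_vector) \<Rightarrow> bool" where
  "independent_family \<beta> \<longleftrightarrow> (\<forall>f d. (\<forall>i. f i \<in> \<D> i) \<longrightarrow> (\<Sum>i<d. \<beta> i (f i)) = 0 \<longrightarrow> (\<forall>i<d. f i = (\<lambda>_. 0)))"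

lemma CP_eq_graded_span:
  assumes lin: "\<And>i. linear_on_D i (monomial lam i)"
  shows "CP lam = (\<Union>d. graded_span (monomial lam) d)"
proof
  show "CP lam \<subseteq> (\<Union>d. graded_span (monomial lam) d)"
  proof
    fix p assume "p \<in> CP lam"
    then obtain n f where f: "p = (\<Sum>i\<le>n. monomial lam i (f i))" "\<forall>i\<le>n. f i \<in> \<D> i" by (auto simp: CP_def)
    have "p = (\<Sum>i<Suc n. monomial lam i (if i \<le> n then f i else (\<lambda>_. 0)))"
      unfolding f(1) lessThan_Suc_atMost by (intro sum.cong) auto
    then show "p \<in> (\<Union>d. graded_span (monomial lam) d)"
      using f(2) unfolding graded_span_def
      by (intro UN_I[of "Suc n"] UNIV_I CollectI exI[of _ "\<lambda>i. if i \<le> n then f i else (\<lambda>_. 0)"]) auto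
  qed
  show "(\<Union>d. graded_span (monomial lam) d) \<subseteq> CP lam"
  proof
    fix p assume "p \<in> (\<Union>d. graded_span (monomial lam) d)"
    then obtain d where "p \<in> graded_span (monomial lam) d" by blast
    then have "p \<in> graded_span (monomial lam) (Suc d)" using graded_span_mono[OF lin, of d "Suc d"] by auto
    then show "p \<in> CP lam" unfolding graded_span_def CP_def lessThan_Suc_atMost by blast
  qed
qed

lemma CP_lincomb:
  assumes lin: "\<And>i. linear_on_D i (monomial lam i)" and "p \<in> CP lam" "q \<in> CP lam"
  shows "a *\<^sub>R p + b *\<^sub>R q \<in> CP lam"
proof -
  obtain d e where "p \<in> graded_span (monomial lam) d" "q \<in> graded_span (monomial lam) e"
    using assms(2,3) unfolding CP_eq_graded_span[OF lin] by blast
  then have "p \<in> graded_span (monomial lam) (max d e)" "q \<in> graded_span (monomial lam) (max d e)"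
    using graded_span_mono[OF lin, of d "max d e"] graded_span_mono[OF lin, of e "max d e"] by auto
  from graded_span_lincomb[OF lin this] show ?thesis unfolding CP_eq_graded_span[OF lin] by blast
qed

lemma CP_operator_lincomb:
  "CP_operator lam L \<Longrightarrow> p \<in> CP lam \<Longrightarrow> q \<in> CP lam \<Longrightarrow> L (a *\<^sub>R p + b *\<^sub>R q) = a *\<^sub>R L p + b *\<^sub>R L q"
  by (simp add: CP_operator_def)

lemma CP_operator_in: "CP_operator lam L \<Longrightarrow> p \<in> CP lam \<Longrightarrow> L p \<in> CP lam"
  by (auto simp: CP_operator_def PiE_iff)

lemma CP_operator_eqI:
  "CP_operator lam L \<Longrightarrow> CP_operator lam L' \<Longrightarrow> (\<And>p. p \<in> CP lam \<Longrightarrow> L p = L' p) \<Longrightarrow> L = L'"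
  unfolding CP_operator_def by (elim conjE, rule PiE_ext[of _ "CP lam" "\<lambda>_. CP lam"])

text \<open>This discharges the definite descriptions of all operators on \<open>CP lam\<close>. By
  independence every element has one truncated coefficient family, on which the operator is defined
  termwise; the value \<open>undefined\<close> outside \<open>CP lam\<close> makes the HOL function
  unique.\<close>

lemma CP_operator_exists_unique:
  fixes lam :: "'a::radon_polish \<Rightarrow> real" and \<beta> \<Phi> :: "nat \<Rightarrow> ((nat \<Rightarrow> 'a) \<Rightarrow> real) \<Rightarrow> 'a fock_op"
  assumes mlin: "\<And>i. linear_on_D i (monomial lam i)"
    and lin: "\<And>i. linear_on_D i (\<beta> i)" and ind: "independent_family \<beta>"
    and CP: "CP lam = (\<Union>d. graded_span \<beta> d)"
    and \<Phi>lin: "\<And>i. linear_on_D i (\<Phi> i)" and \<Phi>CP: "\<And>i f. f \<in> \<D> i \<Longrightarrow> \<Phi> i f \<in> CP lam"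
  shows "\<exists>!L. CP_operator lam L \<and> (\<forall>n. \<forall>f\<in>\<D> n. L (\<beta> n f) = \<Phi> n f)"
proof -
  define rep where "rep f p \<longleftrightarrow> (\<forall>i. f i \<in> \<D> i) \<and> (\<exists>d. (\<forall>i\<ge>d. f i = (\<lambda>_. 0)) \<and> p = (\<Sum>i<d. \<beta> i (f i)))" for f p
  have rep_ex: "\<exists>f. rep f p" if "p \<in> CP lam" for p
    using that unfolding CP rep_def UN_iff graded_span_eq_truncated[OF lin] by blast
  have rep_lincomb: "rep (\<lambda>i \<omega>. a * f i \<omega> + b * g i \<omega>) (a *\<^sub>R p + b *\<^sub>R q)" if f: "rep f p" and g: "rep g q" for f p g q a b
  proof -
    obtain d e where d: "\<forall>i. f i \<in> \<D> i" "\<forall>i\<ge>d. f i = (\<lambda>_. 0)" "p = (\<Sum>i<d. \<beta> i (f i))"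
      and e: "\<forall>i. g i \<in> \<D> i" "\<forall>i\<ge>e. g i = (\<lambda>_. 0)" "q = (\<Sum>i<e. \<beta> i (g i))" using f g unfolding rep_def by blast
    have "p = (\<Sum>i<max d e. \<beta> i (f i))" "q = (\<Sum>i<max d e. \<beta> i (g i))"
      using sum_truncated[OF lin d(2), of "max d e"] sum_truncated[OF lin e(2), of "max d e"] d(3) e(3) by simp_all
    then have "a *\<^sub>R p + b *\<^sub>R q = (\<Sum>i<max d e. \<beta> i (\<lambda>\<omega>. a * f i \<omega> + b * g i \<omega>))"
      using d(1) e(1) by (simp add: linear_on_DD[OF lin] scaleR_sum_right sum.distrib)
    then show ?thesis unfolding rep_def using d e
      by (intro conjI exI[of _ "max d e"]) (auto intro: D_lincomb)
  qed
  have rep_zero: "f i = (\<lambda>_. 0)" if f: "rep f 0" for f i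
  proof -
    obtain d where d: "\<forall>i. f i \<in> \<D> i" "\<forall>i\<ge>d. f i = (\<lambda>_. 0)" "(\<Sum>i<d. \<beta> i (f i)) = 0" using f unfolding rep_def by metis
    show ?thesis
    proof (cases "i < d")
      case True then show ?thesis using ind d(1,3) unfolding independent_family_def by blast
    next
      case False then show ?thesis using d(2) by simp
    qed
  qed
  have rep_unique: "f = g" if "rep f p" "rep g p" for f g p
  proof (rule ext, rule ext)
    fix i \<omega>
    have "rep (\<lambda>i \<omega>. 1 * f i \<omega> + (-1) * g i \<omega>) 0" using rep_lincomb[OF that, of 1 "-1"] by simp
    from fun_cong[OF rep_zero[OF this, of i], of \<omega>] show "f i \<omega> = g i \<omega>" by simp
  qed
  define co where "co p = (THE f. rep f p)" for p
  have co: "rep (co p) p" if "p \<in> CP lam" for p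
    unfolding co_def using rep_ex[OF that] rep_unique by (metis theI')
  have co_eq: "co p = f" if "rep f p" for f p
    unfolding co_def using that rep_unique by (metis the_equality)
  \<comment> \<open>Some degree bound of the family is chosen; \<open>L_eq\<close> shows that the
    choice does not influence the sum.\<close>
  define bd where "bd f = (SOME d. \<forall>i\<ge>d. f i = (\<lambda>_. 0))" for f :: "nat \<Rightarrow> (nat \<Rightarrow> 'a) \<Rightarrow> real"
  define L where "L p = (if p \<in> CP lam then \<Sum>i<bd (co p). \<Phi> i (co p i) else undefined)" for p
  have L_eq: "L p = (\<Sum>i<d. \<Phi> i (f i))" if p: "p \<in> CP lam" and f: "rep f p" and d: "\<forall>i\<ge>d. f i = (\<lambda>_. 0)" for p f d
  proof -
    have s: "\<forall>i\<ge>bd f. f i = (\<lambda>_. 0)" unfolding bd_def using d by (rule someI)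
    have "(\<Sum>i<bd f. \<Phi> i (f i)) = (\<Sum>i<max d (bd f). \<Phi> i (f i))" using sum_truncated[OF \<Phi>lin s, of "max d (bd f)"] by simp
    also have "\<dots> = (\<Sum>i<d. \<Phi> i (f i))" using sum_truncated[OF \<Phi>lin d, of "max d (bd f)"] by simp
    finally show ?thesis using p co_eq[OF f] by (simp add: L_def)
  qed
  have L_lin: "L (a *\<^sub>R p + b *\<^sub>R q) = a *\<^sub>R L p + b *\<^sub>R L q" if p: "p \<in> CP lam" and q: "q \<in> CP lam" for p q a b
  proof -
    obtain d e where d: "\<forall>i. co p i \<in> \<D> i" "\<forall>i\<ge>d. co p i = (\<lambda>_. 0)" and e: "\<forall>i. co q i \<in> \<D> i" "\<forall>i\<ge>e. co q i = (\<lambda>_. 0)"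
      using co[OF p] co[OF q] unfolding rep_def by blast
    let ?m = "max d e"
    have m: "\<forall>i\<ge>?m. co p i = (\<lambda>_. 0)" "\<forall>i\<ge>?m. co q i = (\<lambda>_. 0)" using d(2) e(2) by simp_all
    have "L (a *\<^sub>R p + b *\<^sub>R q) = (\<Sum>i<?m. \<Phi> i (\<lambda>\<omega>. a * co p i \<omega> + b * co q i \<omega>))"
      using m by (intro L_eq CP_lincomb[OF mlin p q] rep_lincomb co p q) simp
    also have "\<dots> = a *\<^sub>R (\<Sum>i<?m. \<Phi> i (co p i)) + b *\<^sub>R (\<Sum>i<?m. \<Phi> i (co q i))"
      using d(1) e(1) by (simp add: linear_on_DD[OF \<Phi>lin] scaleR_sum_right sum.distrib)
    also have "\<dots> = a *\<^sub>R L p + b *\<^sub>R L q"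
      using L_eq[OF p co[OF p] m(1)] L_eq[OF q co[OF q] m(2)] by simp
    finally show ?thesis .
  qed
  have zero_CP: "0 \<in> CP lam" using graded_span_zero[OF lin] CP by blast
  have sum_CP: "(\<Sum>i<d. \<Phi> i (f i)) \<in> CP lam" if "\<forall>i. f i \<in> \<D> i" for d :: nat and f
  proof (induction d)
    case (Suc d)
    then show ?case using CP_lincomb[OF mlin Suc \<Phi>CP[of "f d" d], of 1 1] that by simp
  qed (simp add: zero_CP)
  have L_op: "CP_operator lam L"
    unfolding CP_operator_def
  proof (intro conjI ballI allI PiE_I)
    show "L p \<in> CP lam" if p: "p \<in> CP lam" for p
    proof -
      have "L p = (\<Sum>i<bd (co p). \<Phi> i (co p i))" using p by (simp add: L_def)
      moreover have "\<forall>i. co p i \<in> \<D> i" using co[OF p] by (simp add: rep_def)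
      ultimately show ?thesis using sum_CP by simp
    qed
    show "L p = undefined" if "p \<notin> CP lam" for p using that by (simp add: L_def)
  qed (rule L_lin)
  have base_CP: "\<beta> n f \<in> CP lam" if "f \<in> \<D> n" for n f
    unfolding CP using graded_span_base[OF lin that lessI] by blast
  have L_base: "L (\<beta> n f) = \<Phi> n f" if f: "f \<in> \<D> n" for n f
  proof -
    let ?f = "\<lambda>i. if i = n then f else (\<lambda>_. 0)"
    have s: "(\<Sum>i<Suc n. \<gamma> i (?f i)) = \<gamma> n f" if "\<And>i. linear_on_D i (\<gamma> i)" for \<gamma> :: "nat \<Rightarrow> ((nat \<Rightarrow> 'a) \<Rightarrow> real) \<Rightarrow> 'a fock_op"
    proof -
      have "(\<Sum>i<n. \<gamma> i (?f i)) = 0" using linear_on_D_zero[OF that] by (intro sum.neutral) auto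
      then show ?thesis by simp
    qed
    have r: "rep ?f (\<beta> n f)" unfolding rep_def using f s[OF lin] by (intro conjI exI[of _ "Suc n"]) auto
    have "L (\<beta> n f) = (\<Sum>i<Suc n. \<Phi> i (?f i))" by (rule L_eq[OF base_CP[OF f] r]) auto
    then show ?thesis using s[OF \<Phi>lin] by simp
  qed
  show ?thesis
  proof (rule ex1I[of _ L])
    show "CP_operator lam L \<and> (\<forall>n. \<forall>f\<in>\<D> n. L (\<beta> n f) = \<Phi> n f)" using L_op L_base by blast
    fix L' assume L': "CP_operator lam L' \<and> (\<forall>n. \<forall>f\<in>\<D> n. L' (\<beta> n f) = \<Phi> n f)"
    then have L'op: "CP_operator lam L'" by blast
    have L'0: "L' 0 = 0" using CP_operator_lincomb[OF L'op zero_CP zero_CP, of 0 0] by simp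
    have "L' (\<Sum>i<d. \<beta> i (f i)) = (\<Sum>i<d. \<Phi> i (f i)) \<and> (\<Sum>i<d. \<beta> i (f i)) \<in> CP lam" if f: "\<forall>i. f i \<in> \<D> i" for d :: nat and f
    proof (induction d)
      case 0
      then show ?case using L'0 zero_CP by simp
    next
      case (Suc d)
      have "L' (1 *\<^sub>R (\<Sum>i<d. \<beta> i (f i)) + 1 *\<^sub>R \<beta> d (f d)) = 1 *\<^sub>R L' (\<Sum>i<d. \<beta> i (f i)) + 1 *\<^sub>R L' (\<beta> d (f d))"
        using Suc f base_CP by (intro CP_operator_lincomb[OF L'op]) auto
      moreover have "1 *\<^sub>R (\<Sum>i<d. \<beta> i (f i)) + 1 *\<^sub>R \<beta> d (f d) \<in> CP lam"
        using Suc f base_CP by (intro CP_lincomb[OF mlin]) auto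
      ultimately show ?case using Suc L' f by simp
    qed
    note * = this
    show "L' = L"
    proof (rule CP_operator_eqI[OF L'op L_op])
      fix p assume p: "p \<in> CP lam"
      then obtain d where d: "\<forall>i. co p i \<in> \<D> i" "\<forall>i\<ge>d. co p i = (\<lambda>_. 0)" "p = (\<Sum>i<d. \<beta> i (co p i))"
        using co[OF p] unfolding rep_def by blast
      have "L' p = (\<Sum>i<d. \<Phi> i (co p i))" using *[OF d(1), of d] d(3) by simp
      then show "L' p = L p" using L_eq[OF p co[OF p] d(2)] by simp
    qed
  qed
qed

lemma independent_familyD:
  "independent_family \<beta> \<Longrightarrow> (\<And>i. f i \<in> \<D> i) \<Longrightarrow> (\<Sum>i<d. \<beta> i (f i)) = 0 \<Longrightarrow> i < d \<Longrightarrow> f i = (\<lambda>_. 0)"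
  unfolding independent_family_def by blast

section \<open>Comparison of monomials with orthogonal polynomials\<close>

definition mon :: "('a::radon_polish \<Rightarrow> real) \<Rightarrow> ('a \<Rightarrow> real) list \<Rightarrow> 'a fock_op" where
  "mon lam fs = foldr (\<lambda>f A. X lam f o\<^sub>L A) fs id_blinfun"

lemma mon_Nil [simp]: "mon lam [] = id_blinfun"
  by (simp add: mon_def)

lemma mon_Cons [simp]: "mon lam (f # fs) = X lam f o\<^sub>L mon lam fs"
  by (simp add: mon_def)

lemma mon_append: "mon lam (fs @ gs) = mon lam fs o\<^sub>L mon lam gs"
  by (induction fs) (simp_all add: blinfun_compose_assoc)

text \<open>
  \<open>mixed lam j k\<close> is the extension of
  $f_1\otimes\dots\otimes f_{j+k}\mapsto\langle\omega,f_1\rangle\cdots\langle\omega,f_j\rangle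
  \langle P^{(k)}(\omega),f_{j+1}\otimes\dots\otimes f_{j+k}\rangle$. It interpolates between \<open>P\<close> and
  \<open>monomial\<close>, and the recursion moves one factor across with the defining recursion of \<open>P\<close>.
\<close>

fun mixed :: "('a::radon_polish \<Rightarrow> real) \<Rightarrow> nat \<Rightarrow> nat \<Rightarrow> ((nat \<Rightarrow> 'a) \<Rightarrow> real) \<Rightarrow> 'a fock_op" where
  "mixed lam 0 k f = P lam k f"
| "mixed lam (Suc j) 0 f = mixed lam j 1 f"
| "mixed lam (Suc j) (Suc k) f =
     mixed lam j (Suc (Suc k)) f + mixed lam j (Suc k) (diag lam j f) + mixed lam j k (pair_int j f)"

lemma diag_tensor:
  "diag lam (length fs) (tensor (fs @ f # g # gs)) = tensor (fs @ (\<lambda>t. lam t * f t * g t) # gs)"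
proof (induction fs)
  case Nil
  show ?case by (rule ext) (simp add: diag_def tensor_Cons mult.assoc)
next
  case (Cons e fs)
  show ?case
  proof
    fix \<omega> :: "nat \<Rightarrow> 'a"
    let ?T = "tensor (fs @ f # g # gs)"
    have "(\<lambda>i. if Suc i \<le> Suc (length fs) then \<omega> (Suc i) else \<omega> (Suc i - 1)) =
        (\<lambda>i. if i \<le> length fs then \<omega> (Suc i) else \<omega> (Suc (i - 1)))"
      by (intro ext) auto
    then have "diag lam (length (e # fs)) (tensor ((e # fs) @ f # g # gs)) \<omega> =
        e (\<omega> 0) * diag lam (length fs) ?T (\<lambda>i. \<omega> (Suc i))"
      by (simp add: diag_def tensor_Cons)
    then show "diag lam (length (e # fs)) (tensor ((e # fs) @ f # g # gs)) \<omega> =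
        tensor ((e # fs) @ (\<lambda>t. lam t * f t * g t) # gs) \<omega>"
      unfolding Cons.IH by (simp add: tensor_Cons)
  qed
qed

lemma pair_int_tensor:
  "pair_int (length fs) (tensor (fs @ f # g # gs)) = (\<lambda>\<omega>. (\<integral>t. f t * g t \<partial>\<sigma>) * tensor (fs @ gs) \<omega>)"
proof (induction fs)
  case Nil
  show ?case by (rule ext) (simp add: pair_int_def tensor_Cons mult.assoc[symmetric])
next
  case (Cons e fs)
  show ?case
  proof
    fix \<omega> :: "nat \<Rightarrow> 'a"
    let ?T = "tensor (fs @ f # g # gs)"
    have "(\<lambda>i. if Suc i < Suc (length fs) then \<omega> (Suc i) else if Suc i < Suc (length fs) + 2 then t else \<omega> (Suc i - 2)) =
        (\<lambda>i. if i < length fs then \<omega> (Suc i) else if i < length fs + 2 then t else \<omega> (Suc (i - 2)))" for t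
    proof
      fix i
      show "(if Suc i < Suc (length fs) then \<omega> (Suc i) else if Suc i < Suc (length fs) + 2 then t else \<omega> (Suc i - 2)) =
        (if i < length fs then \<omega> (Suc i) else if i < length fs + 2 then t else \<omega> (Suc (i - 2)))"
        by (cases "i < length fs + 2") (auto intro!: arg_cong[where f=\<omega>])
    qed
    then have "pair_int (length (e # fs)) (tensor ((e # fs) @ f # g # gs)) \<omega> =
        e (\<omega> 0) * pair_int (length fs) ?T (\<lambda>i. \<omega> (Suc i))"
      by (simp add: pair_int_def tensor_Cons)
    then show "pair_int (length (e # fs)) (tensor ((e # fs) @ f # g # gs)) \<omega> =
        (\<integral>t. f t * g t \<partial>\<sigma>) * tensor ((e # fs) @ gs) \<omega>"
      unfolding Cons.IH by (simp add: tensor_Cons)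
  qed
qed

lemma contract_tensor: "contract h (tensor (f # fs)) = (\<lambda>\<omega>. (\<integral>t. h t * f t \<partial>\<sigma>) * tensor fs \<omega>)"
  by (rule ext) (simp add: contract_def tensor_Cons mult.assoc[symmetric])

lemma slice_tensor: "slice t (tensor (f # fs)) = (\<lambda>\<omega>. f t * tensor fs \<omega>)"
  by (rule ext) (simp add: slice_def tensor_Cons)

context
  fixes lam :: "'a::radon_polish \<Rightarrow> real"
  assumes lam: "continuous_on UNIV lam"
begin

text \<open>Here monomials inherit continuity from \<open>P\<close>: each step composes known bounds
  with \<open>diag\<close> and \<open>pair_int\<close>. The index k is kept general because the
  recursion raises it.\<close>

lemma bdd_fun_mixed: "bdd_fun (j + k) (mixed lam j k)"
proof (induction j arbitrary: k)
  case 0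
  show ?case using bdd_fun_P[OF lam, of k] by (simp add: bdd_fun_def)
next
  case (Suc j)
  show ?case
  proof (cases k)
    case 0
    then show ?thesis using Suc[of 1] by (simp add: bdd_fun_def)
  next
    case (Suc k')
    have "bdd_fun (Suc (j + Suc k')) (\<lambda>f. mixed lam j (Suc k') (diag lam j f))"
      by (rule bdd_fun_compose[OF Suc.IH bdd_map_diag[OF lam]]) simp
    moreover have "bdd_fun (Suc (Suc (j + k'))) (\<lambda>f. mixed lam j k' (pair_int j f))"
      by (rule bdd_fun_compose[OF Suc.IH bdd_map_pair_int]) simp
    moreover have "bdd_fun (Suc (Suc (j + k'))) (\<lambda>f. mixed lam j (Suc (Suc k')) f)"
      using Suc.IH[of "Suc (Suc k')"] by simp
    ultimately have "bdd_fun (Suc (Suc (j + k'))) (\<lambda>f. mixed lam j (Suc (Suc k')) f + mixed lam j (Suc k') (diag lam j f) +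
        mixed lam j k' (pair_int j f))"
      by (intro bdd_fun_add) simp_all
    then show ?thesis by (simp add: Suc)
  qed
qed

lemma linear_P: "linear_on_D i (P lam i)"
  by (rule bdd_fun_linear[OF bdd_fun_P[OF lam]])

lemma linear_mixed: "linear_on_D (j + k) (mixed lam j k)"
  by (rule bdd_fun_linear[OF bdd_fun_mixed])

lemma linear_on_D_scale: "linear_on_D n M \<Longrightarrow> f \<in> \<D> n \<Longrightarrow> M (\<lambda>\<omega>. c * f \<omega>) = c *\<^sub>R M f"
  using linear_on_DD[of n M f f c 0] by simp

lemma compose_P_tensor:
  "X lam f o\<^sub>L P_tensor lam (g # gs) = P_tensor lam (f # g # gs) + P_tensor lam ((\<lambda>t. lam t * f t * g t) # gs) +
    (\<integral>t. f t * g t \<partial>\<sigma>) *\<^sub>R P_tensor lam gs"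
  by simp

lemma blinfun_compose_scale_right: "A o\<^sub>L (c *\<^sub>R B) = c *\<^sub>R (A o\<^sub>L (B :: 'a fock_op))" for A :: "'a fock_op"
  by (rule blinfun_eqI) (simp add: scaleR_blinfun.rep_eq blinfun.scaleR_right)

text \<open>Reverse induction on the left list: its last factor is the one that the recursion moves
  into the argument of \<open>P\<close>, and \<open>compose_P_tensor\<close> is the recursion of
  \<open>P\<close> read as a product formula.\<close>

lemma mixed_tensor:
  "set fs \<subseteq> \<D>1 \<Longrightarrow> set gs \<subseteq> \<D>1 \<Longrightarrow> mixed lam (length fs) (length gs) (tensor (fs @ gs)) = mon lam fs o\<^sub>L P_tensor lam gs"
proof (induction fs arbitrary: gs rule: rev_induct)
  case Nil
  then show ?case by (simp add: P_of_tensor[OF lam])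
next
  case (snoc f fs)
  have D: "f \<in> \<D>1" "set fs \<subseteq> \<D>1" using snoc.prems by auto
  show ?case
  proof (cases gs)
    case Nil
    then show ?thesis using snoc.IH[OF D(2), of "[f]"] D by (simp add: mon_append)
  next
    case (Cons g gs')
    let ?h = "\<lambda>t. lam t * f t * g t"
    have D': "g \<in> \<D>1" "set gs' \<subseteq> \<D>1" "?h \<in> \<D>1" using snoc.prems Cons D D1_lam_mult[OF lam] by auto
    have T: "tensor (fs @ gs') \<in> \<D> (length fs + length gs')" using tensor_in_D[of "fs @ gs'"] D D' by simp
    have "mixed lam (length (fs @ [f])) (length gs) (tensor ((fs @ [f]) @ gs)) =
        mixed lam (length fs) (length (f # g # gs')) (tensor (fs @ f # g # gs')) +
        mixed lam (length fs) (length (?h # gs')) (tensor (fs @ ?h # gs')) +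
        (\<integral>t. f t * g t \<partial>\<sigma>) *\<^sub>R mixed lam (length fs) (length gs') (tensor (fs @ gs'))"
      by (simp add: Cons diag_tensor pair_int_tensor linear_on_D_scale[OF linear_mixed T])
    also have "\<dots> = mon lam fs o\<^sub>L (P_tensor lam (f # g # gs') + P_tensor lam (?h # gs') + (\<integral>t. f t * g t \<partial>\<sigma>) *\<^sub>R P_tensor lam gs')"
      using D D' by (simp only: snoc.IH set_simps insert_subset blinfun_compose_add_right blinfun_compose_scale_right)
    also have "\<dots> = mon lam (fs @ [f]) o\<^sub>L P_tensor lam gs"
      unfolding compose_P_tensor[symmetric] by (simp only: Cons mon_append mon_Cons mon_Nil blinfun_compose_id blinfun_compose_assoc)
    finally show ?thesis .
  qed
qed

lemma monomial_eq_mixed: "f \<in> \<D> n \<Longrightarrow> monomial lam n f = mixed lam n 0 f"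
  unfolding monomial_def
proof (rule extend_tensors_eq)
  show "bdd_fun n (mixed lam n 0)" using bdd_fun_mixed[of n 0] by simp
  show "mixed lam n 0 (tensor fs) = foldr (\<lambda>f A. X lam f o\<^sub>L A) fs id_blinfun" if "length fs = n" "set fs \<subseteq> \<D>1" for fs
    using mixed_tensor[of fs "[]"] that by (simp add: mon_def)
qed

lemma bdd_fun_monomial: "bdd_fun n (monomial lam n)"
  using bdd_fun_cong[OF _ monomial_eq_mixed] bdd_fun_mixed[of n 0] by simp

lemma linear_monomial: "linear_on_D i (monomial lam i)"
  by (rule bdd_fun_linear[OF bdd_fun_monomial])

lemma monomial_tensor:
  assumes "set fs \<subseteq> \<D>1"
  shows "monomial lam (length fs) (tensor fs) = mon lam fs"
  using mixed_tensor[OF assms, of "[]"] monomial_eq_mixed[OF tensor_in_D[OF assms]] by simp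

text \<open>Moving a factor across changes terms of lower degree only. Monomials and orthogonal
  polynomials are thus related by a unitriangular transformation, which equates their graded spans
  and transfers independence.\<close>

lemma mixed_leading: "f \<in> \<D> (j + k) \<Longrightarrow> mixed lam j k f - P lam (j + k) f \<in> graded_span (P lam) (j + k)"
proof (induction j arbitrary: k f)
  case 0
  then show ?case using graded_span_zero[OF linear_P] by simp
next
  case (Suc j)
  have in_span: "mixed lam j k' g \<in> graded_span (P lam) (Suc (j + k'))" if g: "g \<in> \<D> (j + k')" for k' g
  proof -
    have "mixed lam j k' g - P lam (j + k') g \<in> graded_span (P lam) (Suc (j + k'))"
      using Suc.IH[OF g] graded_span_mono[OF linear_P, of "j + k'" "Suc (j + k')"] by auto
    from graded_span_add[OF linear_P this graded_span_base[OF linear_P g lessI]] show ?thesis by simp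
  qed
  show ?case
  proof (cases k)
    case 0
    then show ?thesis using Suc.IH[of f 1] Suc.prems by simp
  next
    case (Suc k')
    have f: "f \<in> \<D> (Suc (Suc (j + k')))" using Suc.prems Suc by simp
    have d: "diag lam j f \<in> \<D> (j + Suc k')" using bdd_map_in[OF bdd_map_diag[OF lam], of j "Suc (j + k')" f] f by simp
    have p: "pair_int j f \<in> \<D> (j + k')" using bdd_map_in[OF bdd_map_pair_int, of j "j + k'" f] f by simp
    have "mixed lam j (Suc (Suc k')) f - P lam (Suc (Suc (j + k'))) f \<in> graded_span (P lam) (Suc (Suc (j + k')))"
      using Suc.IH[of f "Suc (Suc k')"] f by simp
    moreover have "mixed lam j (Suc k') (diag lam j f) \<in> graded_span (P lam) (Suc (Suc (j + k')))"
      using in_span[OF d] by simp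
    moreover have "mixed lam j k' (pair_int j f) \<in> graded_span (P lam) (Suc (Suc (j + k')))"
      using in_span[OF p] graded_span_mono[OF linear_P, of "Suc (j + k')" "Suc (Suc (j + k'))"] by auto
    ultimately have "(mixed lam j (Suc (Suc k')) f - P lam (Suc (Suc (j + k'))) f) +
        mixed lam j (Suc k') (diag lam j f) + mixed lam j k' (pair_int j f) \<in> graded_span (P lam) (Suc (Suc (j + k')))"
      by (intro graded_span_add[OF linear_P])
    then show ?thesis by (simp add: Suc algebra_simps)
  qed
qed

lemma monomial_leading: "f \<in> \<D> n \<Longrightarrow> monomial lam n f - P lam n f \<in> graded_span (P lam) n"
  using mixed_leading[of f n 0] monomial_eq_mixed[of f n] by simp

lemma independent_P: "independent_family (P lam)"
  unfolding independent_family_def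
proof (intro allI impI)
  fix f :: "nat \<Rightarrow> (nat \<Rightarrow> 'a) \<Rightarrow> real" and d i
  assume f: "\<forall>i. f i \<in> \<D> i" and s: "(\<Sum>i<d. P lam i (f i)) = 0" and i: "i < d"
  obtain n where n: "d = Suc n" using i by (cases d) auto
  show "f i = (\<lambda>_. 0)"
    using P_independent[OF lam, of n f i] f s i by (simp add: n lessThan_Suc_atMost)
qed

lemma graded_span_monomial: "graded_span (monomial lam) d = graded_span (P lam) d"
proof (induction d)
  case 0
  show ?case by (simp add: graded_span_def)
next
  case (Suc d)
  have mono: "graded_span (P lam) d \<subseteq> graded_span (P lam) (Suc d)" "graded_span (monomial lam) d \<subseteq> graded_span (monomial lam) (Suc d)"
    by (intro graded_span_mono linear_P linear_monomial; simp)+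
  show ?case
  proof (intro equalityI subsetI)
    fix p assume "p \<in> graded_span (monomial lam) (Suc d)"
    then obtain f where f: "\<And>i. f i \<in> \<D> i" "p = (\<Sum>i<Suc d. monomial lam i (f i))" by (auto simp: graded_span_def)
    have "(\<Sum>i<d. monomial lam i (f i)) \<in> graded_span (P lam) (Suc d)"
      using Suc mono(1) graded_spanI[where f=f and d=d and \<beta>="monomial lam", OF f(1) refl] by auto
    moreover have "(monomial lam d (f d) - P lam d (f d)) + P lam d (f d) \<in> graded_span (P lam) (Suc d)"
      using monomial_leading[OF f(1), of d] mono(1) graded_span_base[OF linear_P f(1), of d "Suc d"]
      by (intro graded_span_add[OF linear_P]) auto
    ultimately show "p \<in> graded_span (P lam) (Suc d)" using graded_span_add[OF linear_P] f(2) by simp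
  next
    fix p assume "p \<in> graded_span (P lam) (Suc d)"
    then obtain f where f: "\<And>i. f i \<in> \<D> i" "p = (\<Sum>i<Suc d. P lam i (f i))" by (auto simp: graded_span_def)
    have "(\<Sum>i<d. P lam i (f i)) \<in> graded_span (monomial lam) (Suc d)"
      using Suc mono(2) graded_spanI[where f=f and d=d and \<beta>="P lam", OF f(1) refl] by auto
    moreover have "P lam d (f d) \<in> graded_span (monomial lam) (Suc d)"
    proof -
      have "monomial lam d (f d) - P lam d (f d) \<in> graded_span (monomial lam) (Suc d)"
        using monomial_leading[OF f(1), of d] Suc mono(2) by auto
      from graded_span_diff[OF linear_monomial graded_span_base[OF linear_monomial f(1) lessI] this]
      show ?thesis by simp
    qed
    ultimately show "p \<in> graded_span (monomial lam) (Suc d)" using graded_span_add[OF linear_monomial] f(2) by simp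
  qed
qed

lemma independent_monomial: "independent_family (monomial lam)"
  unfolding independent_family_def
proof (intro allI)
  fix f :: "nat \<Rightarrow> (nat \<Rightarrow> 'a) \<Rightarrow> real" and d
  show "(\<forall>i. f i \<in> \<D> i) \<longrightarrow> (\<Sum>i<d. monomial lam i (f i)) = 0 \<longrightarrow> (\<forall>i<d. f i = (\<lambda>_. 0))"
  proof (induction d)
    case (Suc d)
    show ?case
    proof (intro impI)
      assume f: "\<forall>i. f i \<in> \<D> i" and s: "(\<Sum>i<Suc d. monomial lam i (f i)) = 0"
      have "(\<Sum>i<d. monomial lam i (f i)) + (monomial lam d (f d) - P lam d (f d)) \<in> graded_span (P lam) d"
        using f graded_spanI[where f=f and d=d and \<beta>="monomial lam", OF _ refl] graded_span_monomial monomial_leading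
        by (intro graded_span_add[OF linear_P]) auto
      then obtain g where g: "\<forall>i. g i \<in> \<D> i"
        "(\<Sum>i<d. monomial lam i (f i)) + (monomial lam d (f d) - P lam d (f d)) = (\<Sum>i<d. P lam i (g i))"
        by (auto simp: graded_span_def)
      \<comment> \<open>All terms except \<open>P lam d (f d)\<close> have been rewritten in degree
        below d. So \<open>f d\<close> is the top coefficient of a vanishing expansion in
        \<open>P\<close>.\<close>
      let ?g = "\<lambda>i. if i = d then f d else g i"
      have "(\<Sum>i<d. P lam i (?g i)) = (\<Sum>i<d. P lam i (g i))" by (intro sum.cong) auto
      then have "(\<Sum>i<Suc d. P lam i (?g i)) = (\<Sum>i<Suc d. monomial lam i (f i))" using g(2)[symmetric] by simp
      then have "(\<Sum>i<Suc d. P lam i (?g i)) = 0" using s by simp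
      moreover have "\<forall>i. ?g i \<in> \<D> i" using f g(1) by simp
      ultimately have "?g d = (\<lambda>_. 0)" by (intro independent_familyD[OF independent_P, of ?g "Suc d" d]) auto
      then have fd: "f d = (\<lambda>_. 0)" by simp
      then have "(\<Sum>i<d. monomial lam i (f i)) = 0" using s linear_on_D_zero[OF linear_monomial] by simp
      then have "\<forall>i<d. f i = (\<lambda>_. 0)" using Suc f by blast
      then show "\<forall>i<Suc d. f i = (\<lambda>_. 0)" using fd less_Suc_eq by metis
    qed
  qed simp
qed

lemma CP_eq: "CP lam = (\<Union>d. graded_span (monomial lam) d)"
  by (rule CP_eq_graded_span[OF linear_monomial])

lemma CP_eq_P: "CP lam = (\<Union>d. graded_span (P lam) d)"
  unfolding CP_eq graded_span_monomial ..

lemma monomial_in_CP: "f \<in> \<D> n \<Longrightarrow> monomial lam n f \<in> CP lam"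
  unfolding CP_eq using graded_span_base[OF linear_monomial _ lessI] by blast

lemma P_in_CP: "f \<in> \<D> n \<Longrightarrow> P lam n f \<in> CP lam"
  unfolding CP_eq_P using graded_span_base[OF linear_P _ lessI] by blast

lemma zero_in_CP: "0 \<in> CP lam"
  unfolding CP_eq using graded_span_zero[OF linear_monomial] by blast

lemma CP_lincomb': "p \<in> CP lam \<Longrightarrow> q \<in> CP lam \<Longrightarrow> a *\<^sub>R p + b *\<^sub>R q \<in> CP lam"
  by (rule CP_lincomb[OF linear_monomial])

section \<open>Evaluation of the operators defined by description\<close>

lemma P_operator:
  assumes "\<And>i. linear_on_D i (\<Phi> i)" "\<And>i f. f \<in> \<D> i \<Longrightarrow> \<Phi> i f \<in> CP lam"
  shows "\<exists>!L. CP_operator lam L \<and> (\<forall>n. \<forall>f\<in>\<D> n. L (P lam n f) = \<Phi> n f)"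
  using assms by (intro CP_operator_exists_unique linear_monomial linear_P independent_P CP_eq_P)

lemma monomial_operator:
  assumes "\<And>i. linear_on_D i (\<Phi> i)" "\<And>i f. f \<in> \<D> i \<Longrightarrow> \<Phi> i f \<in> CP lam"
  shows "\<exists>!L. CP_operator lam L \<and> (\<forall>n. \<forall>f\<in>\<D> n. L (monomial lam n f) = \<Phi> n f)"
  using assms by (intro CP_operator_exists_unique linear_monomial independent_monomial CP_eq)

lemma linear_on_D_0: "linear_on_D n (\<lambda>_. 0)"
  by (simp add: linear_on_D_def)

lemma annihilation:
  "CP_operator lam (annihilation lam t)"
  "f \<in> \<D> n \<Longrightarrow> annihilation lam t (P lam n f) = (if n = 0 then 0 else P lam (n - 1) (slice t f))"
proof -
  let ?\<Phi> = "\<lambda>n f. if n = 0 then 0 else P lam (n - 1) (slice t f)"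
  have "linear_on_D n (?\<Phi> n)" for n
    using bdd_fun_linear[OF bdd_fun_compose[OF bdd_fun_P[OF lam] bdd_map_slice]] by (cases n) (simp_all add: linear_on_D_0)
  moreover have "?\<Phi> n f \<in> CP lam" if "f \<in> \<D> n" for n f
    using that P_in_CP[OF bdd_map_in[OF bdd_map_slice]] zero_in_CP by (cases n) auto
  ultimately have "\<exists>!L. CP_operator lam L \<and> (\<forall>n. \<forall>f\<in>\<D> n. L (P lam n f) = ?\<Phi> n f)" by (rule P_operator)
  from theI'[OF this] show "CP_operator lam (annihilation lam t)"
    "f \<in> \<D> n \<Longrightarrow> annihilation lam t (P lam n f) = ?\<Phi> n f"
    unfolding annihilation_def by blast+
qed

lemma free_diff:
  "CP_operator lam (free_diff lam t)"
  "f \<in> \<D> n \<Longrightarrow> free_diff lam t (monomial lam n f) = bracket0 n *\<^sub>R monomial lam (n - 1) (slice t f)"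
proof -
  let ?\<Phi> = "\<lambda>n f. bracket0 n *\<^sub>R monomial lam (n - 1) (slice t f)"
  have "linear_on_D n (?\<Phi> n)" for n
    using bdd_fun_linear[OF bdd_fun_compose[OF bdd_fun_monomial bdd_map_slice]]
    by (cases n) (simp_all add: linear_on_D_0 bracket0_def)
  moreover have "?\<Phi> n f \<in> CP lam" if "f \<in> \<D> n" for n f
    using that monomial_in_CP[OF bdd_map_in[OF bdd_map_slice]] zero_in_CP by (cases n) (auto simp: bracket0_def)
  ultimately have "\<exists>!L. CP_operator lam L \<and> (\<forall>n. \<forall>f\<in>\<D> n. L (monomial lam n f) = ?\<Phi> n f)" by (rule monomial_operator)
  from theI'[OF this] show "CP_operator lam (free_diff lam t)"
    "f \<in> \<D> n \<Longrightarrow> free_diff lam t (monomial lam n f) = ?\<Phi> n f"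
    unfolding free_diff_def by blast+
qed

lemma G_term:
  assumes \<zeta>: "partition_on {1..n} \<zeta>"
  shows "CP_operator lam (G_term lam n \<zeta>)"
  "f \<in> \<D> N \<Longrightarrow> G_term lam n \<zeta> (monomial lam N f) =
     (if n \<le> N then monomial lam (N - n) (W_contract lam n \<zeta> f) else 0)"
proof -
  let ?\<Phi> = "\<lambda>N f. if n \<le> N then monomial lam (N - n) (W_contract lam n \<zeta> f) else 0"
  have "linear_on_D N (?\<Phi> N)" for N
    using bdd_fun_linear[OF bdd_fun_compose[OF bdd_fun_monomial bdd_map_W_contract[OF lam \<zeta>]], of N]
    by (cases "n \<le> N") (simp_all add: linear_on_D_0)
  moreover have "?\<Phi> N f \<in> CP lam" if "f \<in> \<D> N" for N f
    using that monomial_in_CP[OF bdd_map_in[OF bdd_map_W_contract[OF lam \<zeta>]]] zero_in_CP by auto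
  ultimately have "\<exists>!L. CP_operator lam L \<and> (\<forall>N. \<forall>f\<in>\<D> N. L (monomial lam N f) = ?\<Phi> N f)" by (rule monomial_operator)
  from theI'[OF this] show "CP_operator lam (G_term lam n \<zeta>)"
    "f \<in> \<D> N \<Longrightarrow> G_term lam n \<zeta> (monomial lam N f) = ?\<Phi> N f"
    unfolding G_term_def by blast+
qed

end

text \<open>On vectors obtained from the vacuum it acts as \<open>X_minus g\<close>, because
  \<open>P lam n f\<close> sends the vacuum to f at level n and \<open>contract\<close> removes the
  first particle. As an operator on \<open>CP lam\<close> it can be composed with the other
  operators there.\<close>

definition contract_op :: "('a::radon_polish \<Rightarrow> real) \<Rightarrow> ('a \<Rightarrow> real) \<Rightarrow> 'a fock_op \<Rightarrow> 'a fock_op" where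
  "contract_op lam g = (THE L. CP_operator lam L \<and>
     (\<forall>n. \<forall>f\<in>\<D> n. L (P lam n f) = (if n = 0 then 0 else P lam (n - 1) (contract g f))))"

lemma contract_op:
  assumes lam: "continuous_on UNIV lam" and g: "g \<in> \<D>1"
  shows "CP_operator lam (contract_op lam g)"
  "f \<in> \<D> n \<Longrightarrow> contract_op lam g (P lam n f) = (if n = 0 then 0 else P lam (n - 1) (contract g f))"
proof -
  let ?\<Phi> = "\<lambda>n f. if n = 0 then 0 else P lam (n - 1) (contract g f)"
  have "linear_on_D n (?\<Phi> n)" for n
    using bdd_fun_linear[OF bdd_fun_compose[OF bdd_fun_P[OF lam] bdd_map_contract[OF g]]]
    by (cases n) (simp_all add: linear_on_D_0[OF lam])
  moreover have "?\<Phi> n f \<in> CP lam" if "f \<in> \<D> n" for n f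
    using that P_in_CP[OF lam bdd_map_in[OF bdd_map_contract[OF g]]] zero_in_CP[OF lam] by (cases n) auto
  ultimately have "\<exists>!L. CP_operator lam L \<and> (\<forall>n. \<forall>f\<in>\<D> n. L (P lam n f) = ?\<Phi> n f)" by (rule P_operator[OF lam])
  from theI'[OF this] show "CP_operator lam (contract_op lam g)"
    "f \<in> \<D> n \<Longrightarrow> contract_op lam g (P lam n f) = ?\<Phi> n f"
    unfolding contract_op_def by blast+
qed


section \<open>Sums over non-crossing partitions\<close>

text \<open>Arbitrary sets of points are allowed because splitting a partition leads to subsets of
  {1..n}.\<close>

definition NC2_on :: "nat set \<Rightarrow> nat set set set" where
  "NC2_on S = {\<zeta>. partition_on S \<zeta> \<and> noncrossing \<zeta> \<and> (\<forall>B\<in>\<zeta>. 2 \<le> card B)}"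

lemma NC2_eq: "NC2 n = NC2_on {1..n}"
  by (simp add: NC2_def NC2_on_def)

definition NC2_sum :: "(nat set \<Rightarrow> real) \<Rightarrow> nat set \<Rightarrow> real" where
  "NC2_sum \<phi> S = (\<Sum>\<zeta>\<in>NC2_on S. \<Prod>B\<in>\<zeta>. \<phi> B)"

lemma same_block: "partition_on S \<zeta> \<Longrightarrow> A \<in> \<zeta> \<Longrightarrow> B \<in> \<zeta> \<Longrightarrow> x \<in> A \<Longrightarrow> x \<in> B \<Longrightarrow> A = B"
  by (auto simp: partition_on_def disjoint_def)

lemma partition_onI_same_block:
  assumes "\<Union>\<zeta> = S" "{} \<notin> \<zeta>" "\<And>A B x. A \<in> \<zeta> \<Longrightarrow> B \<in> \<zeta> \<Longrightarrow> x \<in> A \<Longrightarrow> x \<in> B \<Longrightarrow> A = B"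
  shows "partition_on S \<zeta>"
  using assms by (auto simp: partition_on_def disjoint_def)

lemma noncrossingD:
  "noncrossing \<zeta> \<Longrightarrow> A \<in> \<zeta> \<Longrightarrow> B \<in> \<zeta> \<Longrightarrow> i < j \<Longrightarrow> j < k \<Longrightarrow> k < l \<Longrightarrow>
    i \<in> A \<Longrightarrow> k \<in> A \<Longrightarrow> j \<in> B \<Longrightarrow> l \<in> B \<Longrightarrow> A = B"
  unfolding noncrossing_def by metis

lemma noncrossingI:
  assumes "\<And>A B i j k l. A \<in> \<zeta> \<Longrightarrow> B \<in> \<zeta> \<Longrightarrow> i < j \<Longrightarrow> j < k \<Longrightarrow> k < l \<Longrightarrow>
    i \<in> A \<Longrightarrow> k \<in> A \<Longrightarrow> j \<in> B \<Longrightarrow> l \<in> B \<Longrightarrow> A = B"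
  shows "noncrossing \<zeta>"
  unfolding noncrossing_def by (intro ballI allI impI, elim conjE) (rule assms)

lemma noncrossing_subset: "noncrossing \<zeta> \<Longrightarrow> \<zeta>' \<subseteq> \<zeta> \<Longrightarrow> noncrossing \<zeta>'"
  by (rule noncrossingI) (meson noncrossingD subsetD)

lemma NC2_on_finite:
  assumes "finite S"
  shows "finite (NC2_on S)" "\<zeta> \<in> NC2_on S \<Longrightarrow> finite \<zeta>" "\<zeta> \<in> NC2_on S \<Longrightarrow> B \<in> \<zeta> \<Longrightarrow> finite B"
proof -
  have sub: "\<zeta> \<subseteq> Pow S" if "\<zeta> \<in> NC2_on S" for \<zeta>
    using that by (auto simp: NC2_on_def partition_on_def)
  then have "NC2_on S \<subseteq> Pow (Pow S)" by blast
  then show "finite (NC2_on S)" using assms finite_subset by blast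
  show "finite \<zeta>" if "\<zeta> \<in> NC2_on S" using sub[OF that] assms finite_subset by blast
  show "finite B" if "\<zeta> \<in> NC2_on S" "B \<in> \<zeta>" using sub[OF that(1)] that(2) assms finite_subset by blast
qed

lemma NC2_sum_empty [simp]: "NC2_sum \<phi> {} = 1"
proof -
  have "NC2_on {} = {{}}" by (auto simp: NC2_on_def noncrossing_def partition_on_def)
  then show ?thesis by (simp add: NC2_sum_def)
qed

lemma NC2_sum_cong:
  assumes "\<And>B. B \<subseteq> S \<Longrightarrow> \<phi> B = \<psi> B"
  shows "NC2_sum \<phi> S = NC2_sum \<psi> S"
  unfolding NC2_sum_def
  using assms by (intro sum.cong prod.cong refl) (auto simp: NC2_on_def partition_on_def)

context
  fixes m j :: nat and U V :: "nat set"
  assumes finU: "finite U" and finV: "finite V"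
    and ordU: "\<And>i. i \<in> U \<Longrightarrow> j < i \<and> i < m" and ordV: "\<And>i. i \<in> V \<Longrightarrow> i < j" and jm: "j < m"
begin

text \<open>
  Partitions of \<open>insert m (insert j (V \<union> U))\<close> are decomposed according to the largest
  neighbour \<open>j\<close> of the maximum \<open>m\<close> in its block: the points \<open>U\<close> between \<open>j\<close> and \<open>m\<close> are then
  separated from the rest.
\<close>

definition linked :: "nat set set set" where
  "linked = {\<eta> \<in> NC2_on (insert m (insert j V)). \<exists>B\<in>\<eta>. m \<in> B \<and> j \<in> B}"

text \<open>The points of U lie strictly between j and m, all other points do not. So a block inside
  U and a block outside it cannot cross.\<close>

lemma NC2_on_split_union:
  assumes \<alpha>: "\<alpha> \<in> NC2_on U" and \<eta>: "\<eta> \<in> linked"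
  shows "\<alpha> \<union> \<eta> \<in> NC2_on (insert m (insert j (V \<union> U)))"
    "\<exists>B\<in>\<alpha> \<union> \<eta>. m \<in> B \<and> j \<in> B \<and> B \<inter> U = {}"
    "{B \<in> \<alpha> \<union> \<eta>. B \<subseteq> U} = \<alpha>" "{B \<in> \<alpha> \<union> \<eta>. \<not> B \<subseteq> U} = \<eta>" "\<alpha> \<inter> \<eta> = {}"
proof -
  let ?W = "insert m (insert j V)"
  have \<eta>': "\<eta> \<in> NC2_on ?W" using \<eta> by (simp add: linked_def)
  have p: "partition_on U \<alpha>" "partition_on ?W \<eta>" "noncrossing \<alpha>" "noncrossing \<eta>"
    using \<alpha> \<eta>' by (auto simp: NC2_on_def)
  have dis: "U \<inter> ?W = {}" using ordU ordV jm by fastforce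
  have subU: "B \<subseteq> U" if "B \<in> \<alpha>" for B using p(1) that by (auto simp: partition_on_def)
  have subW: "B \<subseteq> ?W" if "B \<in> \<eta>" for B using p(2) that unfolding partition_on_def by blast
  have ne: "B \<noteq> {}" if "B \<in> \<alpha> \<union> \<eta>" for B using p(1,2) that by (auto simp: partition_on_def)
  have "U \<union> ?W = insert m (insert j (V \<union> U))" by auto
  moreover have "\<Union>\<alpha> = U" "\<Union>\<eta> = ?W" using p(1,2) by (simp_all add: partition_on_def)
  ultimately have un: "\<Union>(\<alpha> \<union> \<eta>) = insert m (insert j (V \<union> U))" by (simp only: Union_Un_distrib)
  have part: "partition_on (insert m (insert j (V \<union> U))) (\<alpha> \<union> \<eta>)"
  proof (rule partition_onI_same_block[OF un])
    show "{} \<notin> \<alpha> \<union> \<eta>" using ne by blast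
    show "A = B" if "A \<in> \<alpha> \<union> \<eta>" "B \<in> \<alpha> \<union> \<eta>" "x \<in> A" "x \<in> B" for A B x
    proof -
      have "\<not> (x \<in> U \<and> x \<in> ?W)" using dis by blast
      then have "A \<in> \<alpha> \<and> B \<in> \<alpha> \<or> A \<in> \<eta> \<and> B \<in> \<eta>"
        using that(1,2) subsetD[OF subU that(3)] subsetD[OF subU that(4)]
          subsetD[OF subW that(3)] subsetD[OF subW that(4)] unfolding Un_iff by metis
      then show ?thesis using same_block[OF p(1) _ _ that(3,4)] same_block[OF p(2) _ _ that(3,4)] by blast
    qed
  qed
  have "noncrossing (\<alpha> \<union> \<eta>)"
  proof (rule noncrossingI)
    fix A B a b c d
    assume AB: "A \<in> \<alpha> \<union> \<eta>" "B \<in> \<alpha> \<union> \<eta>" and lt: "a < b" "b < c" "c < d"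
      and mem: "a \<in> A" "c \<in> A" "b \<in> B" "d \<in> B"
    \<comment> \<open>No point of the remaining set separates two points of U; this one fact
      excludes all mixed crossings.\<close>
    have gap: False if "x \<in> U" "z \<in> U" "y \<in> ?W" "x < y" "y < z" for x y z
      using that ordU[of x] ordU[of z] ordV[of y] jm by auto
    consider "A \<in> \<alpha>" "B \<in> \<alpha>" | "A \<in> \<eta>" "B \<in> \<eta>" | "A \<in> \<alpha>" "B \<in> \<eta>" | "A \<in> \<eta>" "B \<in> \<alpha>"
      using AB by blast
    then show "A = B"
    proof cases
      case 1 then show ?thesis using noncrossingD[OF p(3)] lt mem by blast
    next
      case 2 then show ?thesis using noncrossingD[OF p(4)] lt mem by blast
    next
      case 3 then show ?thesis using gap[of a c b] subU[of A] subW[of B] lt mem by blast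
    next
      case 4 then show ?thesis using gap[of b d c] subU[of B] subW[of A] lt mem by blast
    qed
  qed
  then show "\<alpha> \<union> \<eta> \<in> NC2_on (insert m (insert j (V \<union> U)))"
    using part \<alpha> \<eta>' by (auto simp: NC2_on_def)
  obtain B where "B \<in> \<eta>" "m \<in> B" "j \<in> B" using \<eta> by (auto simp: linked_def)
  moreover have "B \<inter> U = {}" using subW[OF \<open>B \<in> \<eta>\<close>] dis by blast
  ultimately show "\<exists>B\<in>\<alpha> \<union> \<eta>. m \<in> B \<and> j \<in> B \<and> B \<inter> U = {}" by blast
  have notU: "\<not> B \<subseteq> U" if "B \<in> \<eta>" for B using subW[OF that] ne[of B] that dis by blast
  show "{B \<in> \<alpha> \<union> \<eta>. B \<subseteq> U} = \<alpha>" "{B \<in> \<alpha> \<union> \<eta>. \<not> B \<subseteq> U} = \<eta>" "\<alpha> \<inter> \<eta> = {}"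
    using subU notU unfolding set_eq_iff mem_Collect_eq Un_iff Int_iff empty_iff by metis+
qed

text \<open>A block that meets U stays inside U. It is not the block of j and m, which misses U; and
  a point y < j in it, with x from U, would give y < j < x < m, a crossing with that block.\<close>

lemma NC2_on_split:
  assumes \<zeta>: "\<zeta> \<in> NC2_on (insert m (insert j (V \<union> U)))"
    and B0: "B0 \<in> \<zeta>" "m \<in> B0" "j \<in> B0" "B0 \<inter> U = {}"
  shows "{B \<in> \<zeta>. B \<subseteq> U} \<in> NC2_on U" "{B \<in> \<zeta>. \<not> B \<subseteq> U} \<in> linked"
proof -
  have p: "partition_on (insert m (insert j (V \<union> U))) \<zeta>" "noncrossing \<zeta>"
    "\<And>B. B \<in> \<zeta> \<Longrightarrow> 2 \<le> card B"
    using \<zeta> by (auto simp: NC2_on_def)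
  have cov: "\<Union>\<zeta> = insert m (insert j (V \<union> U))" using p(1) by (auto simp: partition_on_def)
  have dich: "B \<subseteq> U" if B: "B \<in> \<zeta>" "x \<in> B" "x \<in> U" for B x
  proof
    fix y assume y: "y \<in> B"
    have "B \<noteq> B0" using B B0(4) by blast
    then have "m \<notin> B" "j \<notin> B" using same_block[OF p(1) B(1) B0(1)] B0(2,3) by blast+
    then have "y \<in> V \<union> U" using y B(1) cov by auto
    moreover have "y \<notin> V"
    proof
      assume "y \<in> V"
      then have "y < j" "j < x" "x < m" using ordV ordU B(3) by auto
      then have "B = B0" by (rule noncrossingD[OF p(2) B(1) B0(1) _ _ _ y B(2) B0(3,2)])
      then show False using \<open>B \<noteq> B0\<close> by blast
    qed
    ultimately show "y \<in> U" by blast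
  qed
  have UW: "x \<notin> U" if "x \<in> insert m (insert j V)" for x
    using that ordU[of x] ordV[of x] jm by auto
  have "partition_on U {B \<in> \<zeta>. B \<subseteq> U}"
  proof (rule partition_onI_same_block)
    show "\<Union>{B \<in> \<zeta>. B \<subseteq> U} = U"
    proof
      show "U \<subseteq> \<Union>{B \<in> \<zeta>. B \<subseteq> U}"
      proof
        fix x assume x: "x \<in> U"
        then obtain B where "B \<in> \<zeta>" "x \<in> B" using cov by blast
        then show "x \<in> \<Union>{B \<in> \<zeta>. B \<subseteq> U}" using dich x by blast
      qed
    qed blast
  qed (use p(1) same_block[OF p(1)] in \<open>auto simp: partition_on_def\<close>)
  then show "{B \<in> \<zeta>. B \<subseteq> U} \<in> NC2_on U"
    using noncrossing_subset[OF p(2), of "{B \<in> \<zeta>. B \<subseteq> U}"] p(3) by (auto simp: NC2_on_def)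
  have "partition_on (insert m (insert j V)) {B \<in> \<zeta>. \<not> B \<subseteq> U}"
  proof (rule partition_onI_same_block)
    show "\<Union>{B \<in> \<zeta>. \<not> B \<subseteq> U} = insert m (insert j V)"
    proof (intro equalityI subsetI)
      fix x assume "x \<in> \<Union>{B \<in> \<zeta>. \<not> B \<subseteq> U}"
      then obtain B where B: "B \<in> \<zeta>" "\<not> B \<subseteq> U" "x \<in> B" by blast
      then have "x \<notin> U" using dich by blast
      then show "x \<in> insert m (insert j V)" using B cov by blast
    next
      fix x assume x: "x \<in> insert m (insert j V)"
      then have "x \<in> \<Union>\<zeta>" unfolding cov by auto
      then obtain B where B: "B \<in> \<zeta>" "x \<in> B" by (elim UnionE)
      then have "\<not> B \<subseteq> U" using UW[OF x] subsetD by metis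
      then show "x \<in> \<Union>{B \<in> \<zeta>. \<not> B \<subseteq> U}" using B by (intro UnionI[of B] CollectI conjI)
    qed
  qed (use p(1) same_block[OF p(1)] in \<open>auto simp: partition_on_def\<close>)
  then show "{B \<in> \<zeta>. \<not> B \<subseteq> U} \<in> linked"
    using noncrossing_subset[OF p(2), of "{B \<in> \<zeta>. \<not> B \<subseteq> U}"] p(3) B0 UW[of m]
    by (auto simp: NC2_on_def linked_def)
qed

lemma NC2_sum_split:
  "(\<Sum>\<zeta> | \<zeta> \<in> NC2_on (insert m (insert j (V \<union> U))) \<and> (\<exists>B\<in>\<zeta>. m \<in> B \<and> j \<in> B \<and> B \<inter> U = {}). \<Prod>B\<in>\<zeta>. \<phi> B)
    = NC2_sum \<phi> U * (\<Sum>\<eta>\<in>linked. \<Prod>B\<in>\<eta>. \<phi> B)"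
proof -
  have "(\<Sum>\<zeta> | \<zeta> \<in> NC2_on (insert m (insert j (V \<union> U))) \<and> (\<exists>B\<in>\<zeta>. m \<in> B \<and> j \<in> B \<and> B \<inter> U = {}). \<Prod>B\<in>\<zeta>. \<phi> B)
    = (\<Sum>(\<alpha>, \<eta>)\<in>NC2_on U \<times> linked. (\<Prod>B\<in>\<alpha>. \<phi> B) * (\<Prod>B\<in>\<eta>. \<phi> B))"
  proof (rule sum.reindex_bij_witness[where i="\<lambda>(\<alpha>, \<eta>). \<alpha> \<union> \<eta>"
        and j="\<lambda>\<zeta>. ({B \<in> \<zeta>. B \<subseteq> U}, {B \<in> \<zeta>. \<not> B \<subseteq> U})"], goal_cases)
    case (1 \<zeta>)
    show ?case by auto
  next
    case (2 \<zeta>)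
    then show ?case using NC2_on_split by blast
  next
    case (3 b)
    then obtain \<alpha> \<eta> where b: "b = (\<alpha>, \<eta>)" "\<alpha> \<in> NC2_on U" "\<eta> \<in> linked" by blast
    show ?case using NC2_on_split_union(3,4)[OF b(2,3)] by (simp add: b(1) del: Un_iff)
  next
    case (4 b)
    then obtain \<alpha> \<eta> where b: "b = (\<alpha>, \<eta>)" "\<alpha> \<in> NC2_on U" "\<eta> \<in> linked" by blast
    show ?case using NC2_on_split_union(1,2)[OF b(2,3)] by (simp add: b(1) del: Un_iff)
  next
    case (5 \<zeta>)
    have "finite \<zeta>" using 5 finU finV by (intro NC2_on_finite(2)[where S="insert m (insert j (V \<union> U))"]) auto
    then have "(\<Prod>B\<in>\<zeta>. \<phi> B) = (\<Prod>B\<in>{B \<in> \<zeta>. B \<subseteq> U}. \<phi> B) * (\<Prod>B\<in>{B \<in> \<zeta>. \<not> B \<subseteq> U}. \<phi> B)"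
      by (subst prod.union_disjoint[symmetric]) (auto intro!: prod.cong)
    then show ?case by simp
  qed
  then show ?thesis
    by (simp add: NC2_sum_def sum.cartesian_product[symmetric] sum_product)
qed

text \<open>On linked partitions where the block of j and m has a further point, this is the inverse
  of deleting m.\<close>

definition add_to_block :: "nat set \<Rightarrow> nat set" where
  "add_to_block B = (if j \<in> B then insert m B else B)"

lemma remove_add_to_block: "m \<notin> B \<Longrightarrow> add_to_block B - {m} = B"
  by (auto simp: add_to_block_def)

lemma m_notin: "m \<notin> insert j V"
  using jm ordV by fastforce

lemma linked_add_pair:
  assumes "\<eta> \<in> NC2_on V"
  shows "insert {j, m} \<eta> \<in> linked" "{j, m} \<notin> \<eta>"
proof -
  have p: "partition_on V \<eta>" "noncrossing \<eta>" "\<And>B. B \<in> \<eta> \<Longrightarrow> 2 \<le> card B"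
    using assms by (auto simp: NC2_on_def)
  have sub: "B \<subseteq> V" if "B \<in> \<eta>" for B using p(1) that by (auto simp: partition_on_def)
  have jV: "j \<notin> V" using ordV by blast
  show "{j, m} \<notin> \<eta>" using sub jV by blast
  have "partition_on (insert m (insert j V)) (insert {j, m} \<eta>)"
  proof (rule partition_onI_same_block)
    show "\<Union> (insert {j, m} \<eta>) = insert m (insert j V)" using p(1) by (auto simp: partition_on_def)
    show "{} \<notin> insert {j, m} \<eta>" using p(1) by (auto simp: partition_on_def)
    show "A = B" if "A \<in> insert {j, m} \<eta>" "B \<in> insert {j, m} \<eta>" "x \<in> A" "x \<in> B" for A B x
    proof -
      have "x \<notin> {j, m}" if "x \<in> V" using that jV m_notin by blast
      then show ?thesis using that sub same_block[OF p(1), of A B x] by blast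
    qed
  qed
  moreover have "noncrossing (insert {j, m} \<eta>)"
  proof (rule noncrossingI)
    fix A B a b c d
    assume AB: "A \<in> insert {j, m} \<eta>" "B \<in> insert {j, m} \<eta>" and lt: "a < b" "b < c" "c < d"
      and mem: "a \<in> A" "c \<in> A" "b \<in> B" "d \<in> B"
    have lj: "x < j" if "x \<in> C" "C \<in> \<eta>" for x C using that sub ordV by blast
    show "A = B"
    proof (cases "A = {j, m}")
      case True
      then have "a = j" "c = m" using mem lt jm by auto
      then show ?thesis using lj[of d B] AB(2) lt mem True jm by auto
    next
      case False
      then have A: "A \<in> \<eta>" using AB by blast
      show ?thesis
      proof (cases "B = {j, m}")
        case True
        then have "b = j" using mem lt jm by auto
        then show ?thesis using lj[OF mem(2) A] lt by simp
      next
        case False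
        then show ?thesis using AB A noncrossingD[OF p(2) A] lt mem by blast
      qed
    qed
  qed
  moreover have "card {j, m} = 2" using jm by simp
  ultimately show "insert {j, m} \<eta> \<in> linked"
    using p(3) by (auto simp: linked_def NC2_on_def)
qed

lemma linked_remove_pair:
  assumes "\<eta> \<in> linked" "{j, m} \<in> \<eta>"
  shows "\<eta> - {{j, m}} \<in> NC2_on V"
proof -
  have p: "partition_on (insert m (insert j V)) \<eta>" "noncrossing \<eta>" "\<And>B. B \<in> \<eta> \<Longrightarrow> 2 \<le> card B"
    using assms by (auto simp: NC2_on_def linked_def)
  have jV: "j \<notin> V" "m \<notin> V" using ordV m_notin by blast+
  have "partition_on V (\<eta> - {{j, m}})"
  proof (rule partition_onI_same_block)
    have "\<Union>\<eta> = insert m (insert j V)" using p(1) by (auto simp: partition_on_def)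
    moreover have "B \<inter> {j, m} = {}" if "B \<in> \<eta>" "B \<noteq> {j, m}" for B
      using same_block[OF p(1) that(1) assms(2)] that by blast
    ultimately show "\<Union> (\<eta> - {{j, m}}) = V" using jV assms(2) by blast
  qed (use p(1) same_block[OF p(1)] in \<open>auto simp: partition_on_def\<close>)
  then show ?thesis using p(3) noncrossing_subset[OF p(2)] by (auto simp: NC2_on_def)
qed

text \<open>j is the largest point present and m comes right after it, so adding m to the block of j
  amounts to doubling j. A crossing that involves m would already be one that involves j, or its two
  blocks coincide.\<close>

lemma linked_add_to_block:
  assumes "\<eta> \<in> NC2_on (insert j V)"
  shows "add_to_block ` \<eta> \<in> linked" "{j, m} \<notin> add_to_block ` \<eta>" "inj_on add_to_block \<eta>"
    "(\<lambda>B. B - {m}) ` add_to_block ` \<eta> = \<eta>"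
proof -
  have p: "partition_on (insert j V) \<eta>" "noncrossing \<eta>" "\<And>B. B \<in> \<eta> \<Longrightarrow> 2 \<le> card B"
    using assms by (auto simp: NC2_on_def)
  have cov: "\<Union>\<eta> = insert j V" using p(1) by (auto simp: partition_on_def)
  have covD: "x \<le> j" if "x \<in> B" "B \<in> \<eta>" for x B
  proof -
    have "x \<in> insert j V" using that cov by blast
    then show ?thesis using ordV[of x] by auto
  qed
  have nm: "m \<notin> B" if "B \<in> \<eta>" for B using cov that m_notin by blast
  have fin: "finite B" if "B \<in> \<eta>" for B
    using NC2_on_finite(3)[OF _ assms that] finV by simp
  show img: "(\<lambda>B. B - {m}) ` add_to_block ` \<eta> = \<eta>"
    using nm remove_add_to_block by (force simp: image_image)
  show inj: "inj_on add_to_block \<eta>"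
    using nm remove_add_to_block by (metis inj_onI)
  obtain B0 where B0: "B0 \<in> \<eta>" "j \<in> B0" using cov by blast
  have mem: "x \<in> add_to_block B \<longleftrightarrow> x \<in> B \<or> x = m \<and> B = B0" if "B \<in> \<eta>" for x B
    using that same_block[OF p(1) that B0(1), of j] B0(2) by (auto simp: add_to_block_def)
  have "partition_on (insert m (insert j V)) (add_to_block ` \<eta>)"
  proof (rule partition_onI_same_block)
    show "\<Union> (add_to_block ` \<eta>) = insert m (insert j V)" using cov mem B0 by (auto simp: set_eq_iff)
    show "{} \<notin> add_to_block ` \<eta>" using p(1) by (auto simp: partition_on_def add_to_block_def)
    show "A = B" if "A \<in> add_to_block ` \<eta>" "B \<in> add_to_block ` \<eta>" "x \<in> A" "x \<in> B" for A B x
      using that mem same_block[OF p(1)] nm by auto metis+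
  qed
  moreover have "noncrossing (add_to_block ` \<eta>)"
  proof (rule noncrossingI)
    fix A B a b c d
    assume AB: "A \<in> add_to_block ` \<eta>" "B \<in> add_to_block ` \<eta>" and lt: "a < b" "b < c" "c < d"
      and ms: "a \<in> A" "c \<in> A" "b \<in> B" "d \<in> B"
    obtain A' B' where A': "A' \<in> \<eta>" "A = add_to_block A'" and B': "B' \<in> \<eta>" "B = add_to_block B'"
      using AB by blast
    have le: "x \<le> m" if "x \<in> add_to_block C" "C \<in> \<eta>" for x C
      using that mem[OF that(2), of x] covD[of x C] jm by auto
    have "d \<le> m" using le ms(4) B' by blast
    then have a: "a \<in> A'" "c \<in> A'" "b \<in> B'" "c < m"
      using lt ms mem[OF A'(1)] mem[OF B'(1)] A'(2) B'(2) by auto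
    have "A' = B'"
    proof (cases "d = m")
      case False
      then have "d \<in> B'" using ms mem[OF B'(1)] B'(2) by auto
      then show ?thesis using noncrossingD[OF p(2) A'(1) B'(1)] lt a by blast
    next
      case True
      then have "B' = B0" using ms mem[OF B'(1)] B'(2) nm[OF B'(1)] by auto
      have "c \<le> j" using a(2) A'(1) by (rule covD)
      show ?thesis
      proof (cases "c = j")
        case True
        then show ?thesis using same_block[OF p(1) A'(1) B0(1) a(2)] B0(2) \<open>B' = B0\<close> by blast
      next
        case False
        then have "c < j" using \<open>c \<le> j\<close> by simp
        then show ?thesis
          using noncrossingD[OF p(2) A'(1) B'(1) lt(1,2) _ a(1,2,3), of j] B0(2) \<open>B' = B0\<close> by blast
      qed
    qed
    then show "A = B" using A' B' by blast
  qed
  moreover have "2 \<le> card B" if B: "B \<in> add_to_block ` \<eta>" for B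
  proof -
    obtain B' where B': "B' \<in> \<eta>" "B = add_to_block B'" using B by blast
    have "B' \<subseteq> B" "finite B" using B' fin[OF B'(1)] by (auto simp: add_to_block_def)
    then show ?thesis using p(3)[OF B'(1)] card_mono by (meson le_trans)
  qed
  moreover have "m \<in> add_to_block B0" "j \<in> add_to_block B0" using B0 by (auto simp: add_to_block_def)
  ultimately show "add_to_block ` \<eta> \<in> linked" using B0(1) by (auto simp: linked_def NC2_on_def)
  show "{j, m} \<notin> add_to_block ` \<eta>"
  proof
    assume "{j, m} \<in> add_to_block ` \<eta>"
    then obtain B' where B': "B' \<in> \<eta>" "{j, m} = add_to_block B'" by blast
    then have "B' = {j, m} - {m}" using remove_add_to_block[OF nm[OF B'(1)]] by simp
    then have "card B' = 1" using jm by auto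
    then show False using p(3)[OF B'(1)] by simp
  qed
qed

lemma linked_remove_from_block:
  assumes "\<eta> \<in> linked" "{j, m} \<notin> \<eta>"
  shows "(\<lambda>B. B - {m}) ` \<eta> \<in> NC2_on (insert j V)" "add_to_block ` (\<lambda>B. B - {m}) ` \<eta> = \<eta>"
proof -
  have p: "partition_on (insert m (insert j V)) \<eta>" "noncrossing \<eta>" "\<And>B. B \<in> \<eta> \<Longrightarrow> 2 \<le> card B"
    using assms by (auto simp: NC2_on_def linked_def)
  have cov: "\<Union>\<eta> = insert m (insert j V)" using p(1) by (auto simp: partition_on_def)
  obtain B0 where B0: "B0 \<in> \<eta>" "m \<in> B0" "j \<in> B0" using assms(1) by (auto simp: linked_def)
  have inv: "add_to_block (B - {m}) = B" if "B \<in> \<eta>" for B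
    using that B0 jm same_block[OF p(1) that B0(1)] by (auto simp: add_to_block_def)
  show "add_to_block ` (\<lambda>B. B - {m}) ` \<eta> = \<eta>" using inv by (force simp: image_image)
  have fin: "finite B" if "B \<in> \<eta>" for B
    using NC2_on_finite(3)[of "insert m (insert j V)" \<eta> B] that assms(1) finV by (simp add: linked_def)
  \<comment> \<open>Only the block of j and m loses a point, and it has at least three because it is
    not the pair itself.\<close>
  have c2: "2 \<le> card (B - {m})" if B: "B \<in> \<eta>" for B
  proof (cases "B = B0")
    case False
    then have "m \<notin> B" using same_block[OF p(1) B B0(1)] B0(2) by blast
    then show ?thesis using p(3)[OF B] by simp
  next
    case True
    have "B0 \<noteq> {j, m}" using assms(2) B0 by blast
    then have "{j, m} \<subset> B0" using B0 by blast
    then have "card {j, m} < card B0" using fin[OF B0(1)] by (intro psubset_card_mono)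
    then show ?thesis using True B0 fin[OF B0(1)] jm by simp
  qed
  have "partition_on (insert j V) ((\<lambda>B. B - {m}) ` \<eta>)"
  proof (rule partition_onI_same_block)
    show "\<Union> ((\<lambda>B. B - {m}) ` \<eta>) = insert j V" using cov m_notin by auto
    show "{} \<notin> (\<lambda>B. B - {m}) ` \<eta>" 
    proof
      assume "{} \<in> (\<lambda>B. B - {m}) ` \<eta>"
      then obtain B where "B \<in> \<eta>" "B - {m} = {}" by blast
      then have "card (B - {m}) = card ({} :: nat set)" by (intro arg_cong[where f=card])
      then show False using c2[OF \<open>B \<in> \<eta>\<close>] by (simp del: card_Diff_insert)
    qed
    show "A = B" if "A \<in> (\<lambda>B. B - {m}) ` \<eta>" "B \<in> (\<lambda>B. B - {m}) ` \<eta>" "x \<in> A" "x \<in> B" for A B x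
      using that same_block[OF p(1)] by blast
  qed
  moreover have "noncrossing ((\<lambda>B. B - {m}) ` \<eta>)"
  proof (rule noncrossingI)
    fix A B a b c d
    assume AB: "A \<in> (\<lambda>B. B - {m}) ` \<eta>" "B \<in> (\<lambda>B. B - {m}) ` \<eta>" and lt: "a < b" "b < c" "c < d"
      and ms: "a \<in> A" "c \<in> A" "b \<in> B" "d \<in> B"
    obtain A' B' where A': "A' \<in> \<eta>" "A = A' - {m}" and B': "B' \<in> \<eta>" "B = B' - {m}"
      using AB by blast
    have "A' = B'" using noncrossingD[OF p(2) A'(1) B'(1) lt] ms A'(2) B'(2) by blast
    then show "A = B" using A' B' by blast
  qed
  ultimately show "(\<lambda>B. B - {m}) ` \<eta> \<in> NC2_on (insert j V)" using c2 by (auto simp: NC2_on_def)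
qed

lemma sum_linked:
  "(\<Sum>\<eta>\<in>linked. \<Prod>B\<in>\<eta>. \<phi> B) =
     \<phi> {j, m} * NC2_sum \<phi> V + NC2_sum (\<lambda>B. if j \<in> B then \<phi> (insert m B) else \<phi> B) (insert j V)"
proof -
  have fin: "finite linked" using NC2_on_finite(1)[of "insert m (insert j V)"] finV
    by (simp add: linked_def)
  have finV': "\<eta> \<in> NC2_on V \<Longrightarrow> finite \<eta>" for \<eta> using NC2_on_finite(2) finV by blast
  have "(\<Sum>\<eta>\<in>linked. \<Prod>B\<in>\<eta>. \<phi> B) =
      (\<Sum>\<eta> | \<eta> \<in> linked \<and> {j, m} \<in> \<eta>. \<Prod>B\<in>\<eta>. \<phi> B) + (\<Sum>\<eta> | \<eta> \<in> linked \<and> {j, m} \<notin> \<eta>. \<Prod>B\<in>\<eta>. \<phi> B)"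
    using fin by (subst sum.union_disjoint[symmetric]) (auto intro!: sum.cong)
  also have "(\<Sum>\<eta> | \<eta> \<in> linked \<and> {j, m} \<in> \<eta>. \<Prod>B\<in>\<eta>. \<phi> B) =
      (\<Sum>\<eta>\<in>NC2_on V. \<phi> {j, m} * (\<Prod>B\<in>\<eta>. \<phi> B))"
  proof (rule sum.reindex_bij_witness[where i="insert {j, m}" and j="\<lambda>\<eta>. \<eta> - {{j, m}}"], goal_cases)
    case (5 \<eta>)
    have "finite \<eta>" using 5 NC2_on_finite(2)[of "insert m (insert j V)" \<eta>] finV by (simp add: linked_def)
    then show ?case using 5 by (simp add: prod.remove[of \<eta> "{j, m}"])
  qed (use linked_add_pair linked_remove_pair in auto)
  also have "\<dots> = \<phi> {j, m} * NC2_sum \<phi> V" by (simp add: NC2_sum_def sum_distrib_left)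
  also have "(\<Sum>\<eta> | \<eta> \<in> linked \<and> {j, m} \<notin> \<eta>. \<Prod>B\<in>\<eta>. \<phi> B) =
      (\<Sum>\<eta>\<in>NC2_on (insert j V). \<Prod>B\<in>\<eta>. \<phi> (add_to_block B))"
  proof (rule sum.reindex_bij_witness[where i="\<lambda>\<eta>. add_to_block ` \<eta>" and j="\<lambda>\<eta>. (\<lambda>B. B - {m}) ` \<eta>"], goal_cases)
    case (5 \<eta>)
    then have *: "\<eta> \<in> linked" "{j, m} \<notin> \<eta>" by auto
    show ?case
      using linked_add_to_block(3)[OF linked_remove_from_block(1)[OF *]] linked_remove_from_block(2)[OF *]
      by (metis (no_types, lifting) prod.reindex_cong)
  qed (use linked_add_to_block linked_remove_from_block in \<open>auto simp del: image_image\<close>)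
  also have "\<dots> = NC2_sum (\<lambda>B. if j \<in> B then \<phi> (insert m B) else \<phi> B) (insert j V)"
    unfolding NC2_sum_def by (intro sum.cong prod.cong refl) (simp add: add_to_block_def)
  finally show ?thesis .
qed

end

text \<open>
  If the block \<open>{j, m}\<close> is not alone, deleting \<open>m\<close> from it is a bijection; the modified weight
  remembers that \<open>m\<close> belongs to the block of \<open>j\<close>.
\<close>

lemma NC2_sum_insert:
  assumes fin: "finite S" and max: "\<And>i. i \<in> S \<Longrightarrow> i < m"
  shows "NC2_sum \<phi> (insert m S) =
    (\<Sum>j\<in>S. NC2_sum \<phi> {i\<in>S. j < i} * (\<phi> {j, m} * NC2_sum \<phi> {i\<in>S. i < j} +
       NC2_sum (\<lambda>B. if j \<in> B then \<phi> (insert m B) else \<phi> B) {i\<in>S. i \<le> j}))"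
proof -
  let ?N = "NC2_on (insert m S)"
  let ?Z = "\<lambda>j. {\<zeta>. \<zeta> \<in> ?N \<and> (\<exists>B\<in>\<zeta>. m \<in> B \<and> j \<in> B \<and> B \<inter> {i\<in>S. j < i} = {})}"
  have mS: "m \<notin> S" using max by blast
  have ex: "\<exists>j\<in>S. \<zeta> \<in> ?Z j" if z: "\<zeta> \<in> ?N" for \<zeta>
  proof -
    have p: "\<Union>\<zeta> = insert m S" "\<And>B. B \<in> \<zeta> \<Longrightarrow> 2 \<le> card B"
      using z by (auto simp: NC2_on_def partition_on_def)
    then obtain B where B: "B \<in> \<zeta>" "m \<in> B" by blast
    have fB: "finite B" using NC2_on_finite(3)[OF _ z B(1)] fin by simp
    \<comment> \<open>Blocks have at least two points, so m has a neighbour in its block; the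
      largest one serves as j.\<close>
    have "B - {m} \<noteq> {}"
    proof
      assume "B - {m} = {}"
      then have "B = {m}" using B(2) by blast
      then show False using p(2)[OF B(1)] by simp
    qed
    then have "Max (B - {m}) \<in> B - {m}" using fB by (intro Max_in) auto
    moreover have "x \<le> Max (B - {m})" if "x \<in> B" "x \<noteq> m" for x using fB that by simp
    ultimately have "Max (B - {m}) \<in> S" "m \<in> B \<and> Max (B - {m}) \<in> B \<and> B \<inter> {i\<in>S. Max (B - {m}) < i} = {}"
      using B p(1) mS by (auto simp: not_less[symmetric])
    then show ?thesis using z B(1) by blast
  qed
  have uniq: "j = j'" if z: "\<zeta> \<in> ?Z j" "\<zeta> \<in> ?Z j'" "j \<in> S" "j' \<in> S" for \<zeta> j j'
  proof -
    obtain B B' where B: "B \<in> \<zeta>" "m \<in> B" "j \<in> B" "B \<inter> {i\<in>S. j < i} = {}"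
      and B': "B' \<in> \<zeta>" "m \<in> B'" "j' \<in> B'" "B' \<inter> {i\<in>S. j' < i} = {}" using z(1,2) by blast
    have "partition_on (insert m S) \<zeta>" using z(1) by (simp add: NC2_on_def)
    then have "B = B'" by (rule same_block[OF _ B(1) B'(1) B(2) B'(2)])
    then have "\<not> j < j'" "\<not> j' < j" using B(3,4) B'(3,4) z(3,4) by auto
    then show ?thesis by simp
  qed
  have finN: "finite ?N" by (intro NC2_on_finite(1)) (simp add: fin)
  have "NC2_sum \<phi> (insert m S) = (\<Sum>\<zeta>\<in>(\<Union>j\<in>S. ?Z j). \<Prod>B\<in>\<zeta>. \<phi> B)"
    unfolding NC2_sum_def using ex by (intro sum.cong) auto
  also have "\<dots> = (\<Sum>j\<in>S. \<Sum>\<zeta>\<in>?Z j. \<Prod>B\<in>\<zeta>. \<phi> B)"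
  proof (rule sum.UNION_disjoint[OF fin])
    show "\<forall>j\<in>S. finite (?Z j)" using finN by simp
    show "\<forall>j\<in>S. \<forall>j'\<in>S. j \<noteq> j' \<longrightarrow> ?Z j \<inter> ?Z j' = {}"
    proof (intro ballI impI equals0I)
      fix j j' \<zeta> assume *: "j \<in> S" "j' \<in> S" "j \<noteq> j'" and "\<zeta> \<in> ?Z j \<inter> ?Z j'"
      then have "j = j'" by (intro uniq[of \<zeta>]) (rule IntD1 IntD2, assumption | assumption)+
      with *(3) show False by (rule notE)
    qed
  qed
  also have "\<dots> = (\<Sum>j\<in>S. NC2_sum \<phi> {i\<in>S. j < i} * (\<phi> {j, m} * NC2_sum \<phi> {i\<in>S. i < j} +
       NC2_sum (\<lambda>B. if j \<in> B then \<phi> (insert m B) else \<phi> B) {i\<in>S. i \<le> j}))"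
  proof (rule sum.cong[OF refl])
    fix j assume j: "j \<in> S"
    have S: "insert m S = insert m (insert j ({i\<in>S. i < j} \<union> {i\<in>S. j < i}))" using j by auto
    have S': "{i\<in>S. i \<le> j} = insert j {i\<in>S. i < j}" using j by auto
    show "(\<Sum>\<zeta>\<in>?Z j. \<Prod>B\<in>\<zeta>. \<phi> B) = NC2_sum \<phi> {i\<in>S. j < i} * (\<phi> {j, m} * NC2_sum \<phi> {i\<in>S. i < j} +
       NC2_sum (\<lambda>B. if j \<in> B then \<phi> (insert m B) else \<phi> B) {i\<in>S. i \<le> j})"
    proof -
      have "(\<Sum>\<zeta>\<in>?Z j. \<Prod>B\<in>\<zeta>. \<phi> B) =
          NC2_sum \<phi> {i\<in>S. j < i} * (\<Sum>\<eta>\<in>linked m j {i\<in>S. i < j}. \<Prod>B\<in>\<eta>. \<phi> B)"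
        unfolding S by (rule NC2_sum_split) (use fin max j in auto)
      also have "(\<Sum>\<eta>\<in>linked m j {i\<in>S. i < j}. \<Prod>B\<in>\<eta>. \<phi> B) = \<phi> {j, m} * NC2_sum \<phi> {i\<in>S. i < j} +
          NC2_sum (\<lambda>B. if j \<in> B then \<phi> (insert m B) else \<phi> B) {i\<in>S. i \<le> j}"
        unfolding S' by (rule sum_linked[where U="{}"]) (use fin max j in auto)
      finally show ?thesis .
    qed
  qed
  finally show ?thesis .
qed

text \<open>Smaller sets do not occur as blocks. They must be excluded below, where the truncated
  exponent \<open>card B - 2\<close> would not grow with B.\<close>

lemma NC2_sum_cong_blocks:
  assumes "\<And>B. B \<subseteq> S \<Longrightarrow> 2 \<le> card B \<Longrightarrow> \<phi> B = \<psi> B"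
  shows "NC2_sum \<phi> S = NC2_sum \<psi> S"
  unfolding NC2_sum_def
  using assms by (intro sum.cong prod.cong refl) (auto simp: NC2_on_def partition_on_def)

lemma NC2_sum_singleton [simp]: "NC2_sum \<phi> {x} = 0"
  using NC2_sum_insert[of "{}" x \<phi>] by simp

text \<open>Induction through \<open>NC2_sum_insert\<close>: that recursion sees the points only
  through their order, which translation preserves.\<close>

lemma NC2_sum_shift:
  assumes "finite S"
  shows "NC2_sum \<phi> ((+) c ` S) = NC2_sum (\<lambda>B. \<phi> ((+) c ` B)) S"
  using assms
proof (induction "card S" arbitrary: S \<phi> rule: less_induct)
  case less
  show ?case
  proof (cases "S = {}")
    case False
    define m where "m = Max S"
    define S0 where "S0 = S - {m}"
    have m: "m \<in> S" using less(2) False by (simp add: m_def)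
    have S: "S = insert m S0" "finite S0" using m less(2) by (auto simp: S0_def)
    have lt: "i < m" if "i \<in> S0" for i
      using that less(2) by (metis DiffD1 DiffD2 Max_ge S0_def insertCI le_neq_implies_less m_def)
    have lt': "i < c + m" if "i \<in> (+) c ` S0" for i using that lt by auto
    have card: "card T < card S" if "T \<subseteq> S0" for T
      using that S m_def S0_def m less(2) by (metis card_Diff1_less card_mono le_less_trans)
    have IH: "NC2_sum \<psi> ((+) c ` T) = NC2_sum (\<lambda>B. \<psi> ((+) c ` B)) T" if "T \<subseteq> S0" for T \<psi>
      using less(1)[OF card[OF that]] that S(2) finite_subset by blast
    have e: "{i \<in> (+) c ` S0. c + j < i} = (+) c ` {i \<in> S0. j < i}"
      "{i \<in> (+) c ` S0. i < c + j} = (+) c ` {i \<in> S0. i < j}"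
      "{i \<in> (+) c ` S0. i \<le> c + j} = (+) c ` {i \<in> S0. i \<le> j}" for j by auto
    have mg: "(\<lambda>B. if c + j \<in> (+) c ` B then \<phi> (insert (c + m) ((+) c ` B)) else \<phi> ((+) c ` B)) =
        (\<lambda>B. if j \<in> B then \<phi> ((+) c ` insert m B) else \<phi> ((+) c ` B))" for j by (intro ext) (auto simp: image_iff)
    have "NC2_sum \<phi> ((+) c ` S) = NC2_sum \<phi> (insert (c + m) ((+) c ` S0))" by (simp add: S(1))
    also have "\<dots> = (\<Sum>j\<in>(+) c ` S0. NC2_sum \<phi> {i \<in> (+) c ` S0. j < i} * (\<phi> {j, c + m} * NC2_sum \<phi> {i \<in> (+) c ` S0. i < j} +
       NC2_sum (\<lambda>B. if j \<in> B then \<phi> (insert (c + m) B) else \<phi> B) {i \<in> (+) c ` S0. i \<le> j}))"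
      using S(2) lt' by (intro NC2_sum_insert) auto
    also have "\<dots> = (\<Sum>j\<in>S0. NC2_sum \<phi> {i \<in> (+) c ` S0. c + j < i} * (\<phi> {c + j, c + m} * NC2_sum \<phi> {i \<in> (+) c ` S0. i < c + j} +
       NC2_sum (\<lambda>B. if c + j \<in> B then \<phi> (insert (c + m) B) else \<phi> B) {i \<in> (+) c ` S0. i \<le> c + j}))"
      by (subst sum.reindex) (auto simp: inj_on_def)
    also have "\<dots> = (\<Sum>j\<in>S0. NC2_sum (\<lambda>B. \<phi> ((+) c ` B)) {i \<in> S0. j < i} * (\<phi> ((+) c ` {j, m}) * NC2_sum (\<lambda>B. \<phi> ((+) c ` B)) {i \<in> S0. i < j} +
       NC2_sum (\<lambda>B. if j \<in> B then \<phi> ((+) c ` insert m B) else \<phi> ((+) c ` B)) {i \<in> S0. i \<le> j}))"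
      unfolding e by (intro sum.cong refl) (simp add: IH mg)
    also have "\<dots> = NC2_sum (\<lambda>B. \<phi> ((+) c ` B)) S"
      unfolding S(1) using S(2) lt by (intro NC2_sum_insert[symmetric]) auto
    finally show ?thesis .
  qed simp
qed

text \<open>The free cumulant of the factors in the block; the sum over non-crossing partitions is
  then the free moment-cumulant formula. First cumulants vanish, hence no singleton blocks.\<close>

definition block_weight :: "('a::radon_polish \<Rightarrow> real) \<Rightarrow> (nat \<Rightarrow> 'a \<Rightarrow> real) \<Rightarrow> nat set \<Rightarrow> real" where
  "block_weight lam g B = (\<integral>t. lam t ^ (card B - 2) * (\<Prod>i\<in>B. g i t) \<partial>\<sigma>)"

text \<open>
  The vacuum expectation of $\langle\omega,f_1\rangle\cdots\langle\omega,f_n\rangle$. The reversed indexing is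
  the one of the formula for \<open>W_contract\<close>.
\<close>

definition moment :: "('a::radon_polish \<Rightarrow> real) \<Rightarrow> ('a \<Rightarrow> real) list \<Rightarrow> real" where
  "moment lam fs = NC2_sum (block_weight lam (\<lambda>i. fs ! (length fs - i))) {1..length fs}"

lemma moment_Nil [simp]: "moment lam [] = 1"
  by (simp add: moment_def)

lemma moment_single [simp]: "moment lam [f] = 0"
  by (simp add: moment_def)

lemma block_weight_cong: "(\<And>i. i \<in> B \<Longrightarrow> g i = h i) \<Longrightarrow> block_weight lam g B = block_weight lam h B"
  unfolding block_weight_def by (simp cong: prod.cong)

lemma moment_eq:
  assumes "\<And>i. i \<in> {1..length fs} \<Longrightarrow> g (c + i) = fs ! (length fs - i)"
  shows "NC2_sum (block_weight lam g) {c + 1..c + length fs} = moment lam fs"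
proof -
  have "{c + 1..c + length fs} = (+) c ` {1..length fs}" by (simp add: add.commute image_add_atLeastAtMost)
  then have "NC2_sum (block_weight lam g) {c + 1..c + length fs} =
      NC2_sum (\<lambda>B. block_weight lam g ((+) c ` B)) {1..length fs}"
    by (simp only: NC2_sum_shift finite_atLeastAtMost)
  also have "\<dots> = moment lam fs"
    unfolding moment_def
  proof (rule NC2_sum_cong)
    fix B assume B: "B \<subseteq> {1..length fs}"
    have "card ((+) c ` B) = card B" by (intro card_image) (simp add: inj_on_def)
    moreover have "(\<Prod>i\<in>(+) c ` B. g i t) = (\<Prod>i\<in>B. (fs ! (length fs - i)) t)" for t
      using assms B by (subst prod.reindex) (auto simp: inj_on_def subset_iff intro!: prod.cong)
    ultimately show "block_weight lam g ((+) c ` B) = block_weight lam (\<lambda>i. fs ! (length fs - i)) B"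
      by (simp add: block_weight_def)
  qed
  finally show ?thesis .
qed

text \<open>In the reversed indexing the head h is the largest point, and \<open>L ! i\<close>, at
  position \<open>length L - i\<close>, is the next member of its block; \<open>take i L\<close> are
  the factors enclosed between the two. Either the block is this pair, or h is absorbed into
  \<open>L ! i\<close>, and the factor \<lambda> makes up for the block having lost a point.\<close>

lemma moment_Cons:
  "moment lam (h # L) = (\<Sum>i<length L. moment lam (take i L) *
     ((\<integral>t. h t * (L ! i) t \<partial>\<sigma>) * moment lam (drop (Suc i) L) +
      moment lam ((\<lambda>t. lam t * h t * (L ! i) t) # drop (Suc i) L)))"
proof -
  let ?n = "length L"
  let ?g = "\<lambda>i. (h # L) ! (Suc ?n - i)"
  let ?\<phi> = "block_weight lam ?g"
  have "{1..Suc ?n} = insert (Suc ?n) {1..?n}" by auto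
  then have "moment lam (h # L) = NC2_sum ?\<phi> (insert (Suc ?n) {1..?n})" by (simp add: moment_def)
  also have "\<dots> = (\<Sum>j\<in>{1..?n}. NC2_sum ?\<phi> {i\<in>{1..?n}. j < i} * (?\<phi> {j, Suc ?n} * NC2_sum ?\<phi> {i\<in>{1..?n}. i < j} +
       NC2_sum (\<lambda>B. if j \<in> B then ?\<phi> (insert (Suc ?n) B) else ?\<phi> B) {i\<in>{1..?n}. i \<le> j}))"
    by (intro NC2_sum_insert) auto
  also have "\<dots> = (\<Sum>i<?n. moment lam (take i L) * ((\<integral>t. h t * (L ! i) t \<partial>\<sigma>) * moment lam (drop (Suc i) L) +
      moment lam ((\<lambda>t. lam t * h t * (L ! i) t) # drop (Suc i) L)))"
  proof (rule sum.reindex_bij_witness[where i="\<lambda>i. ?n - i" and j="\<lambda>j. ?n - j"])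
    fix j assume j: "j \<in> {1..?n}"
    let ?i = "?n - j"
    let ?e = "\<lambda>t. lam t * h t * (L ! ?i) t"
    have i: "?i < ?n" "?n - ?i = j" using j by auto
    have gap: "NC2_sum ?\<phi> {i\<in>{1..?n}. j < i} = moment lam (take ?i L)"
    proof -
      have "{i\<in>{1..?n}. j < i} = {j + 1..j + length (take ?i L)}" using j by auto
      also have "NC2_sum ?\<phi> \<dots> = moment lam (take ?i L)"
      proof (rule moment_eq)
        fix x assume x: "x \<in> {1..length (take ?i L)}"
        have "Suc ?n - (j + x) = Suc (?i - x)" "length (take ?i L) - x = ?i - x" "?i - x < ?i" using x by auto
        then show "(h # L) ! (Suc ?n - (j + x)) = take ?i L ! (length (take ?i L) - x)" by (simp only: nth_take nth_Cons_Suc)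
      qed
      finally show ?thesis .
    qed
    have low: "NC2_sum ?\<phi> {i\<in>{1..?n}. i < j} = moment lam (drop (Suc ?i) L)"
    proof -
      have "{i\<in>{1..?n}. i < j} = {0 + 1..0 + length (drop (Suc ?i) L)}" using j by auto
      also have "NC2_sum ?\<phi> \<dots> = moment lam (drop (Suc ?i) L)"
      proof (rule moment_eq)
        fix x assume x: "x \<in> {1..length (drop (Suc ?i) L)}"
        then have "Suc ?n - (0 + x) = Suc (?n - x)" "Suc ?i + (length (drop (Suc ?i) L) - x) = ?n - x" using j by auto
        then show "(h # L) ! (Suc ?n - (0 + x)) = drop (Suc ?i) L ! (length (drop (Suc ?i) L) - x)"
          by (simp only: nth_Cons_Suc nth_drop Suc_leI[OF i(1)])
      qed
      finally show ?thesis .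
    qed
    have gj: "?g j = L ! ?i" using j by (simp add: Suc_diff_le)
    have pair: "?\<phi> {j, Suc ?n} = (\<integral>t. h t * (L ! ?i) t \<partial>\<sigma>)"
    proof -
      have "j \<noteq> Suc ?n" using j by simp
      then show ?thesis using gj by (simp add: block_weight_def mult.commute)
    qed
    have merged: "NC2_sum (\<lambda>B. if j \<in> B then ?\<phi> (insert (Suc ?n) B) else ?\<phi> B) {i\<in>{1..?n}. i \<le> j} =
        moment lam (?e # drop (Suc ?i) L)"
    proof -
      let ?f = "\<lambda>x. (?e # drop (Suc ?i) L) ! (j - x)"
      have len: "length (?e # drop (Suc ?i) L) = j" using j by auto
      have S: "{i\<in>{1..?n}. i \<le> j} = {1..j}" using j by auto
      have fg: "?f x = ?g x" if "x \<in> {1..j}" "x \<noteq> j" for x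
      proof -
        have "j - x = Suc (j - x - 1)" "Suc ?i + (j - x - 1) = ?n - x" "Suc ?n - x = Suc (?n - x)" using that j by auto
        then show ?thesis using j by (metis add_diff_cancel_left' i(1) less_imp_le nth_Cons_Suc nth_drop Suc_leI)
      qed
      have "NC2_sum (\<lambda>B. if j \<in> B then ?\<phi> (insert (Suc ?n) B) else ?\<phi> B) {1..j} = NC2_sum (block_weight lam ?f) {1..j}"
      proof (rule NC2_sum_cong_blocks)
        fix B assume B: "B \<subseteq> {1..j}" "2 \<le> card B"
        have fin: "finite B" using B(1) finite_subset by blast
        show "(if j \<in> B then ?\<phi> (insert (Suc ?n) B) else ?\<phi> B) = block_weight lam ?f B"
        proof (cases "j \<in> B")
          case False
          have "?g x = ?f x" if x: "x \<in> B" for x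
          proof (rule fg[symmetric])
            show "x \<in> {1..j}" using B(1) x by (rule subsetD)
            show "x \<noteq> j" using False x by metis
          qed
          then show ?thesis using False by (simp only: if_False) (rule block_weight_cong)
        next
          case True
          have nB: "Suc ?n \<notin> B" using B(1) j by auto
          have "lam t ^ (card (insert (Suc ?n) B) - 2) * (\<Prod>i\<in>insert (Suc ?n) B. ?g i t) =
              lam t ^ (card B - 2) * (\<Prod>i\<in>B. ?f i t)" for t
          proof -
            \<comment> \<open>The exponent rises by exactly one when h joins the block, since B
              already has two points. The additional \<lambda> is the one in
              \<open>?e\<close>.\<close>
            have c: "card (insert (Suc ?n) B) - 2 = Suc (card B - 2)" using nB fin B(2) by simp
            have r: "(\<Prod>i\<in>B - {j}. ?g i t) = (\<Prod>i\<in>B - {j}. ?f i t)"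
            proof (rule prod.cong[OF refl])
              fix x assume "x \<in> B - {j}"
              then have "x \<in> {1..j}" "x \<noteq> j" using subsetD[OF B(1)] by auto
              then show "?g x t = ?f x t" by (rule fun_cong[OF fg[symmetric]])
            qed
            have "(\<Prod>i\<in>insert (Suc ?n) B. ?g i t) = h t * ((L ! ?i) t * (\<Prod>i\<in>B - {j}. ?g i t))"
              using nB fin True gj by (simp add: prod.remove[of B j])
            moreover have "(\<Prod>i\<in>B. ?f i t) = ?e t * (\<Prod>i\<in>B - {j}. ?f i t)"
              using fin True by (simp add: prod.remove[of B j])
            ultimately show ?thesis unfolding c r by (simp add: mult_ac)
          qed
          then show ?thesis using True by (simp add: block_weight_def)
        qed
      qed
      then show ?thesis unfolding S moment_def len .
    qed
    show "moment lam (take ?i L) * ((\<integral>t. h t * (L ! ?i) t \<partial>\<sigma>) * moment lam (drop (Suc ?i) L) + moment lam (?e # drop (Suc ?i) L)) =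
      NC2_sum ?\<phi> {i\<in>{1..?n}. j < i} * (?\<phi> {j, Suc ?n} * NC2_sum ?\<phi> {i\<in>{1..?n}. i < j} +
       NC2_sum (\<lambda>B. if j \<in> B then ?\<phi> (insert (Suc ?n) B) else ?\<phi> B) {i\<in>{1..?n}. i \<le> j})"
      unfolding gap low pair merged ..
  qed auto
  finally show ?thesis .
qed


section \<open>Annihilation operators on monomials\<close>

lemma CP_operator_scale:
  assumes "continuous_on UNIV lam" "CP_operator lam L" "p \<in> CP lam"
  shows "L (c *\<^sub>R p) = c *\<^sub>R L p"
  using CP_operator_lincomb[OF assms(2,3,3), of c 0] by simp

lemma CP_operator_add:
  "CP_operator lam L \<Longrightarrow> p \<in> CP lam \<Longrightarrow> q \<in> CP lam \<Longrightarrow> L (p + q) = L p + L q"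
  using CP_operator_lincomb[of lam L p q 1 1] by simp

text \<open>Finite combinations only: the commutation relations are verified algebraically on this
  set, which contains all products of test functions and is preserved by left multiplication with
  \<open>X lam h\<close> for test functions h.\<close>

inductive_set tensor_poly :: "('a::radon_polish \<Rightarrow> real) \<Rightarrow> 'a fock_op set" for lam where
  base: "set gs \<subseteq> \<D>1 \<Longrightarrow> P_tensor lam gs \<in> tensor_poly lam"
| lincomb: "p \<in> tensor_poly lam \<Longrightarrow> q \<in> tensor_poly lam \<Longrightarrow> a *\<^sub>R p + b *\<^sub>R q \<in> tensor_poly lam"

context
  fixes lam :: "'a::radon_polish \<Rightarrow> real"
  assumes lam: "continuous_on UNIV lam"
begin

lemma CP_add: "p \<in> CP lam \<Longrightarrow> q \<in> CP lam \<Longrightarrow> p + q \<in> CP lam"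
  using CP_lincomb'[OF lam, of p q 1 1] by simp

lemma CP_scale: "p \<in> CP lam \<Longrightarrow> c *\<^sub>R p \<in> CP lam"
  using CP_lincomb'[OF lam, of p p c 0] by simp

lemma CP_sum: "(\<And>i. i \<in> I \<Longrightarrow> p i \<in> CP lam) \<Longrightarrow> (\<Sum>i\<in>I. p i) \<in> CP lam"
  by (induction I rule: infinite_finite_induct) (auto intro: CP_add zero_in_CP[OF lam])

lemma CP_operator_zero: "CP_operator lam L \<Longrightarrow> L 0 = 0"
  using CP_operator_lincomb[OF _ zero_in_CP[OF lam] zero_in_CP[OF lam], of L 0 0] by simp

lemma CP_operator_sum:
  assumes L: "CP_operator lam L"
  shows "finite I \<Longrightarrow> (\<And>i. i \<in> I \<Longrightarrow> p i \<in> CP lam) \<Longrightarrow> L (\<Sum>i\<in>I. p i) = (\<Sum>i\<in>I. L (p i))"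
proof (induction I rule: finite_induct)
  case (insert i I)
  then show ?case using CP_operator_add[OF L, of "p i" "\<Sum>i\<in>I. p i"] CP_sum[of I p] by simp
qed (simp add: CP_operator_zero[OF L])

lemma P_tensor_in_CP: "set gs \<subseteq> \<D>1 \<Longrightarrow> P_tensor lam gs \<in> CP lam"
  using P_in_CP[OF lam tensor_in_D] P_of_tensor[OF lam] by metis

lemma tensor_poly_CP: "p \<in> tensor_poly lam \<Longrightarrow> p \<in> CP lam"
  by (induction rule: tensor_poly.induct) (auto intro: P_tensor_in_CP CP_lincomb'[OF lam])

lemma tensor_poly_add: "p \<in> tensor_poly lam \<Longrightarrow> q \<in> tensor_poly lam \<Longrightarrow> p + q \<in> tensor_poly lam"
  using tensor_poly.lincomb[of p lam q 1 1] by simp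

lemma tensor_poly_scale: "p \<in> tensor_poly lam \<Longrightarrow> c *\<^sub>R p \<in> tensor_poly lam"
  using tensor_poly.lincomb[of p lam p c 0] by simp

lemma X_single: "X lam h o\<^sub>L P_tensor lam [] = P_tensor lam [h]"
  by simp

lemma compose_lincomb: "A o\<^sub>L (a *\<^sub>R B + b *\<^sub>R C) = a *\<^sub>R (A o\<^sub>L B) + b *\<^sub>R (A o\<^sub>L C)" for A B C :: "'a fock_op"
  by (simp add: blinfun_compose_add_right blinfun_compose_scale_right[OF lam])

lemma X_tensor_poly:
  assumes h: "h \<in> \<D>1" and p: "p \<in> tensor_poly lam"
  shows "X lam h o\<^sub>L p \<in> tensor_poly lam"
  using p
proof (induction rule: tensor_poly.induct)
  case (base gs)
  show ?case
  proof (cases gs)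
    case Nil
    then show ?thesis using h tensor_poly.base[of "[h]" lam] X_single[of h] by simp
  next
    case (Cons g gs')
    have D: "g \<in> \<D>1" "set gs' \<subseteq> \<D>1" using base Cons by auto
    show ?thesis unfolding Cons compose_P_tensor[OF lam]
      using h D D1_lam_mult[OF lam h D(1)] by (intro tensor_poly_add tensor_poly_scale tensor_poly.base) auto
  qed
qed (auto simp: compose_lincomb intro: tensor_poly.lincomb)

lemma mon_tensor_poly: "set fs \<subseteq> \<D>1 \<Longrightarrow> mon lam fs \<in> tensor_poly lam"
proof (induction fs)
  case Nil
  then show ?case using tensor_poly.base[of "[]" lam] by simp
qed (auto intro: X_tensor_poly)

lemma mon_in_CP: "set fs \<subseteq> \<D>1 \<Longrightarrow> mon lam fs \<in> CP lam"
  by (rule tensor_poly_CP[OF mon_tensor_poly])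

lemma contract_op_P_tensor:
  assumes "f \<in> \<D>1" "set (g # gs) \<subseteq> \<D>1"
  shows "contract_op lam f (P_tensor lam (g # gs)) = (\<integral>t. f t * g t \<partial>\<sigma>) *\<^sub>R P_tensor lam gs"
proof -
  have D: "set gs \<subseteq> \<D>1" using assms(2) by simp
  have T: "tensor (g # gs) \<in> \<D> (Suc (length gs))" "tensor gs \<in> \<D> (length gs)"
    using tensor_in_D[OF assms(2)] tensor_in_D[OF D] by auto
  show "contract_op lam f (P_tensor lam (g # gs)) = (\<integral>t. f t * g t \<partial>\<sigma>) *\<^sub>R P_tensor lam gs"
    using contract_op(2)[OF lam assms(1) T(1)] P_of_tensor[OF lam assms(2)] P_of_tensor[OF lam D]
    by (simp add: contract_tensor linear_on_D_scale[OF lam linear_P[OF lam] T(2)])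
qed

lemma tensor_Nil_in_D: "tensor [] \<in> (\<D> 0 :: ((nat \<Rightarrow> 'a) \<Rightarrow> real) set)"
  using tensor_in_D[of "[]"] by simp

lemma contract_op_id: "f \<in> \<D>1 \<Longrightarrow> contract_op lam f id_blinfun = 0"
  using contract_op(2)[OF lam _ tensor_Nil_in_D] P_of_tensor[OF lam, of "[]"] by simp

lemma annihilation_id: "annihilation lam t id_blinfun = 0"
  using annihilation(2)[OF lam tensor_Nil_in_D] P_of_tensor[OF lam, of "[]"] by simp

lemma annihilation_P_tensor:
  assumes "set (g # gs) \<subseteq> \<D>1"
  shows "annihilation lam t (P_tensor lam (g # gs)) = g t *\<^sub>R P_tensor lam gs"
proof -
  have D: "set gs \<subseteq> \<D>1" using assms by simp
  have T: "tensor (g # gs) \<in> \<D> (Suc (length gs))" "tensor gs \<in> \<D> (length gs)"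
    using tensor_in_D[OF assms] tensor_in_D[OF D] by auto
  show "annihilation lam t (P_tensor lam (g # gs)) = g t *\<^sub>R P_tensor lam gs"
    using annihilation(2)[OF lam T(1)] P_of_tensor[OF lam assms] P_of_tensor[OF lam D]
    by (simp add: slice_tensor linear_on_D_scale[OF lam linear_P[OF lam] T(2)])
qed

text \<open>
  The commutation relation of an annihilation-type operator with left multiplication by \<open>X lam h\<close>:
  \<open>contract_op lam h\<close> plays the role of the part of \<open>X lam h\<close> that lowers the degree.
\<close>

definition lowering :: "('a fock_op \<Rightarrow> 'a fock_op) \<Rightarrow> (('a \<Rightarrow> real) \<Rightarrow> real) \<Rightarrow>
    (('a \<Rightarrow> real) \<Rightarrow> 'a fock_op \<Rightarrow> 'a fock_op) \<Rightarrow> bool" where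
  "lowering Q q Y \<longleftrightarrow> CP_operator lam Q \<and> Q id_blinfun = 0 \<and>
     (\<forall>h\<in>\<D>1. \<forall>p\<in>tensor_poly lam. Q (X lam h o\<^sub>L p) = q h *\<^sub>R p + Y h p + Q (contract_op lam h p))"

lemma CP_operator_contract: "h \<in> \<D>1 \<Longrightarrow> CP_operator lam (contract_op lam h)"
  by (rule contract_op(1)[OF lam])

lemma contract_in_CP: "h \<in> \<D>1 \<Longrightarrow> p \<in> CP lam \<Longrightarrow> contract_op lam h p \<in> CP lam"
  by (rule CP_operator_in[OF CP_operator_contract])

text \<open>The three terms of the product formula for X(h) give the three terms of the relation one
  by one. For the merged factor, contracting \<lambda> h g with f is the same as contracting g with
  \<lambda> f h, which produces Y.\<close>

lemma lowering_contract:
  assumes f: "f \<in> \<D>1"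
  shows "lowering (contract_op lam f) (\<lambda>h. \<integral>t. f t * h t \<partial>\<sigma>) (\<lambda>h. contract_op lam (\<lambda>t. lam t * f t * h t))"
  unfolding lowering_def
proof (intro conjI ballI)
  show L: "CP_operator lam (contract_op lam f)" by (rule CP_operator_contract[OF f])
  show "contract_op lam f id_blinfun = 0" by (rule contract_op_id[OF f])
  fix h :: "'a \<Rightarrow> real" and p assume h: "h \<in> \<D>1" and p: "p \<in> tensor_poly lam"
  let ?e = "\<lambda>t. lam t * f t * h t"
  have e: "?e \<in> \<D>1" by (rule D1_lam_mult[OF lam f h])
  from p show "contract_op lam f (X lam h o\<^sub>L p) =
      (\<integral>t. f t * h t \<partial>\<sigma>) *\<^sub>R p + contract_op lam ?e p + contract_op lam f (contract_op lam h p)"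
  proof (induction rule: tensor_poly.induct)
    case (base gs)
    show ?case
    proof (cases gs)
      case Nil
      then show ?thesis using contract_op_P_tensor[OF f, of h "[]"] contract_op_id[OF e] contract_op_id[OF h] h CP_operator_zero[OF L] X_single[of h] by simp
    next
      case (Cons g gs')
      have D: "g \<in> \<D>1" "set gs' \<subseteq> \<D>1" using base Cons by auto
      let ?l = "\<lambda>t. lam t * h t * g t"
      have l: "?l \<in> \<D>1" by (rule D1_lam_mult[OF lam h D(1)])
      have in_CP: "P_tensor lam (h # g # gs') \<in> CP lam" "P_tensor lam (?l # gs') \<in> CP lam" "P_tensor lam gs' \<in> CP lam"
        using h D l by (intro P_tensor_in_CP; simp)+
      have "contract_op lam f (X lam h o\<^sub>L P_tensor lam gs) =
          contract_op lam f (P_tensor lam (h # g # gs')) + contract_op lam f (P_tensor lam (?l # gs')) +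
          (\<integral>t. h t * g t \<partial>\<sigma>) *\<^sub>R contract_op lam f (P_tensor lam gs')"
        unfolding Cons compose_P_tensor[OF lam] using in_CP
        by (simp only: CP_operator_add[OF L] CP_operator_scale[OF lam L] CP_add CP_scale)
      moreover have "contract_op lam f (P_tensor lam (h # g # gs')) = (\<integral>t. f t * h t \<partial>\<sigma>) *\<^sub>R P_tensor lam gs"
        using contract_op_P_tensor[OF f, of h "g # gs'"] h D by (simp add: Cons)
      moreover have "contract_op lam f (P_tensor lam (?l # gs')) = contract_op lam ?e (P_tensor lam gs)"
        using contract_op_P_tensor[OF f, of ?l gs'] contract_op_P_tensor[OF e, of g gs'] h D l
        by (simp add: Cons mult_ac)
      moreover have "contract_op lam f (contract_op lam h (P_tensor lam gs)) =
          (\<integral>t. h t * g t \<partial>\<sigma>) *\<^sub>R contract_op lam f (P_tensor lam gs')"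
        using contract_op_P_tensor[OF h, of g gs'] D CP_operator_scale[OF lam L in_CP(3)] by (simp add: Cons)
      ultimately show ?thesis by simp
    qed
  next
    case (lincomb p q a b)
    have C: "p \<in> CP lam" "q \<in> CP lam" "X lam h o\<^sub>L p \<in> CP lam" "X lam h o\<^sub>L q \<in> CP lam"
      "contract_op lam h p \<in> CP lam" "contract_op lam h q \<in> CP lam"
      using lincomb.hyps X_tensor_poly[OF h] tensor_poly_CP contract_in_CP[OF h] by auto
    show ?case
      unfolding compose_lincomb CP_operator_lincomb[OF L C(3,4)] lincomb.IH
        CP_operator_lincomb[OF CP_operator_contract[OF h] C(1,2)] CP_operator_lincomb[OF L C(5,6)]
        CP_operator_lincomb[OF CP_operator_contract[OF e] C(1,2)]
      by (simp add: algebra_simps)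
  qed
qed

text \<open>The same computation with evaluation at t in place of contraction. From the merged
  factor only the number \<lambda>(t) h(t) splits off, so Y is a multiple of the annihilation
  operator itself.\<close>

lemma lowering_annihilation:
  "lowering (annihilation lam t) (\<lambda>h. h t) (\<lambda>h p. (lam t * h t) *\<^sub>R annihilation lam t p)"
  unfolding lowering_def
proof (intro conjI ballI)
  show L: "CP_operator lam (annihilation lam t)" by (rule annihilation(1)[OF lam])
  show "annihilation lam t id_blinfun = 0" by (rule annihilation_id)
  fix h :: "'a \<Rightarrow> real" and p assume h: "h \<in> \<D>1" and p: "p \<in> tensor_poly lam"
  from p show "annihilation lam t (X lam h o\<^sub>L p) =
      h t *\<^sub>R p + (lam t * h t) *\<^sub>R annihilation lam t p + annihilation lam t (contract_op lam h p)"
  proof (induction rule: tensor_poly.induct)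
    case (base gs)
    show ?case
    proof (cases gs)
      case Nil
      then show ?thesis using annihilation_P_tensor[of h "[]" t]
          annihilation_id contract_op_id[OF h] h CP_operator_zero[OF L] X_single[of h] by simp
    next
      case (Cons g gs')
      have D: "g \<in> \<D>1" "set gs' \<subseteq> \<D>1" using base Cons by auto
      let ?l = "\<lambda>t. lam t * h t * g t"
      have l: "?l \<in> \<D>1" by (rule D1_lam_mult[OF lam h D(1)])
      have in_CP: "P_tensor lam (h # g # gs') \<in> CP lam" "P_tensor lam (?l # gs') \<in> CP lam" "P_tensor lam gs' \<in> CP lam"
        using h D l by (intro P_tensor_in_CP; simp)+
      have "annihilation lam t (X lam h o\<^sub>L P_tensor lam gs) =
          annihilation lam t (P_tensor lam (h # g # gs')) + annihilation lam t (P_tensor lam (?l # gs')) +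
          (\<integral>t. h t * g t \<partial>\<sigma>) *\<^sub>R annihilation lam t (P_tensor lam gs')"
        unfolding Cons compose_P_tensor[OF lam] using in_CP
        by (simp only: CP_operator_add[OF L] CP_operator_scale[OF lam L] CP_add CP_scale)
      moreover have "annihilation lam t (P_tensor lam (h # g # gs')) = h t *\<^sub>R P_tensor lam gs"
        using annihilation_P_tensor[of h "g # gs'" t] h D by (simp add: Cons)
      moreover have "annihilation lam t (P_tensor lam (?l # gs')) = (lam t * h t) *\<^sub>R annihilation lam t (P_tensor lam gs)"
        using annihilation_P_tensor[of ?l gs' t] annihilation_P_tensor[of g gs' t] h D l
        by (simp add: Cons)
      moreover have "annihilation lam t (contract_op lam h (P_tensor lam gs)) =
          (\<integral>t. h t * g t \<partial>\<sigma>) *\<^sub>R annihilation lam t (P_tensor lam gs')"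
        using contract_op_P_tensor[OF h, of g gs'] D CP_operator_scale[OF lam L in_CP(3)] by (simp add: Cons)
      ultimately show ?thesis by simp
    qed
  next
    case (lincomb p q a b)
    have C: "p \<in> CP lam" "q \<in> CP lam" "X lam h o\<^sub>L p \<in> CP lam" "X lam h o\<^sub>L q \<in> CP lam"
      "contract_op lam h p \<in> CP lam" "contract_op lam h q \<in> CP lam"
      using lincomb.hyps X_tensor_poly[OF h] tensor_poly_CP contract_in_CP[OF h] by auto
    show ?case
      unfolding compose_lincomb CP_operator_lincomb[OF L C(3,4)] lincomb.IH CP_operator_lincomb[OF L C(1,2)]
        CP_operator_lincomb[OF CP_operator_contract[OF h] C(1,2)] CP_operator_lincomb[OF L C(5,6)]
      by (simp add: algebra_simps)
  qed
qed

text \<open>The solution of the relation in \<open>lowering\<close> on a product: the factors to the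
  left of a position are replaced by their moment, the factor there is consumed through q or Y, and
  the tail survives.\<close>

definition split_sum :: "(('a \<Rightarrow> real) \<Rightarrow> real) \<Rightarrow> (('a \<Rightarrow> real) \<Rightarrow> 'a fock_op \<Rightarrow> 'a fock_op) \<Rightarrow>
    ('a \<Rightarrow> real) list \<Rightarrow> 'a fock_op" where
  "split_sum q Y L = (\<Sum>i<length L. moment lam (take i L) *\<^sub>R
     (q (L ! i) *\<^sub>R mon lam (drop (Suc i) L) + Y (L ! i) (mon lam (drop (Suc i) L))))"

text \<open>The triangle of pairs i < k, summed first by i and the distance from it, then by k. In
  the application k is the factor consumed by Q, and i one consumed before it.\<close>

lemma sum_nested_shift:
  fixes a :: "nat \<Rightarrow> nat \<Rightarrow> 'b::comm_monoid_add"
  shows "(\<Sum>i<n. \<Sum>j<n - Suc i. a i (Suc i + j)) = (\<Sum>k<n. \<Sum>i<k. a i k)"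
proof -
  have "(\<Sum>i<n. \<Sum>j<n - Suc i. a i (Suc i + j)) = (\<Sum>(i, j)\<in>(SIGMA i:{..<n}. {..<n - Suc i}). a i (Suc i + j))"
    by (rule sum.Sigma) auto
  also have "\<dots> = (\<Sum>(k, i)\<in>(SIGMA k:{..<n}. {..<k}). a i k)"
    by (rule sum.reindex_bij_witness[where i="\<lambda>(k, i). (i, k - Suc i)" and j="\<lambda>(i, j). (Suc i + j, i)"]) auto
  also have "\<dots> = (\<Sum>k<n. \<Sum>i<k. a i k)"
    by (rule sum.Sigma[symmetric]) auto
  finally show ?thesis .
qed

lemma split_sum_Cons:
  "split_sum q Y (h # L) = q h *\<^sub>R mon lam L + Y h (mon lam L) +
    (\<Sum>k<length L. moment lam (h # take k L) *\<^sub>R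
      (q (L ! k) *\<^sub>R mon lam (drop (Suc k) L) + Y (L ! k) (mon lam (drop (Suc k) L))))"
  unfolding split_sum_def by (simp add: sum.lessThan_Suc_shift del: sum.lessThan_Suc)

text \<open>Strong induction on the length. The relation leaves Q applied to the contraction of the
  tail; R expands this contraction into shorter tails, to which the induction hypothesis applies.
  Collecting the terms with a common surviving tail gives the recursion \<open>moment_Cons\<close>.
  R is limited to lengths below n because for Q = \<open>contract_op\<close> it will be an induction
  hypothesis itself.\<close>

lemma lowering_mon:
  assumes low: "lowering Q q Y"
    and R: "\<And>L f. length L < n \<Longrightarrow> set L \<subseteq> \<D>1 \<Longrightarrow> f \<in> \<D>1 \<Longrightarrow>
      contract_op lam f (mon lam L) = split_sum (\<lambda>h. \<integral>t. f t * h t \<partial>\<sigma>) (\<lambda>h. contract_op lam (\<lambda>t. lam t * f t * h t)) L"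
  shows "length L \<le> n \<Longrightarrow> set L \<subseteq> \<D>1 \<Longrightarrow> Q (mon lam L) = split_sum q Y L"
proof (induction "length L" arbitrary: L rule: less_induct)
  case less
  have Q: "CP_operator lam Q" "Q id_blinfun = 0"
    "\<And>h p. h \<in> \<D>1 \<Longrightarrow> p \<in> tensor_poly lam \<Longrightarrow> Q (X lam h o\<^sub>L p) = q h *\<^sub>R p + Y h p + Q (contract_op lam h p)"
    using low by (auto simp: lowering_def)
  show ?case
  proof (cases L)
    case Nil
    then show ?thesis using Q(2) by (simp add: split_sum_def)
  next
    case (Cons h M)
    have D: "h \<in> \<D>1" "set M \<subseteq> \<D>1" using less.prems Cons by auto
    define T where "T k = q (M ! k) *\<^sub>R mon lam (drop (Suc k) M) + Y (M ! k) (mon lam (drop (Suc k) M))" for k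
    have nth: "M ! i \<in> \<D>1" if "i < length M" for i using D(2) that nth_mem by blast
    have drop: "set (drop i M) \<subseteq> \<D>1" for i using D(2) set_drop_subset by fast
    have lD: "(\<lambda>t. lam t * h t * (M ! i) t) \<in> \<D>1" if "i < length M" for i by (rule D1_lam_mult[OF lam D(1) nth[OF that]])
    have tail: "Q (mon lam (drop (Suc i) M)) = (\<Sum>j<length M - Suc i. moment lam (take j (drop (Suc i) M)) *\<^sub>R T (Suc i + j))"
      if i: "i < length M" for i
    proof -
      have "Q (mon lam (drop (Suc i) M)) = split_sum q Y (drop (Suc i) M)"
        using i Cons less.prems drop by (intro less.hyps) auto
      then show ?thesis using i by (simp add: split_sum_def T_def add.commute)
    qed
    \<comment> \<open>The relation is read backwards for the product that starts with the merged
      factor. It is shorter than L, so its value under Q is known, and the first two terms cancel on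
      both sides.\<close>
    have tail': "Q (contract_op lam (\<lambda>t. lam t * h t * (M ! i) t) (mon lam (drop (Suc i) M))) =
        (\<Sum>j<length M - Suc i. moment lam ((\<lambda>t. lam t * h t * (M ! i) t) # take j (drop (Suc i) M)) *\<^sub>R T (Suc i + j))"
      if i: "i < length M" for i
    proof -
      let ?e = "\<lambda>t. lam t * h t * (M ! i) t" and ?D = "drop (Suc i) M"
      have "Q (mon lam (?e # ?D)) = split_sum q Y (?e # ?D)"
        using i Cons less.prems drop lD[OF i] by (intro less.hyps) auto
      moreover have "Q (mon lam (?e # ?D)) = q ?e *\<^sub>R mon lam ?D + Y ?e (mon lam ?D) + Q (contract_op lam ?e (mon lam ?D))"
        using Q(3)[OF lD[OF i] mon_tensor_poly[OF drop]] by simp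
      ultimately show ?thesis using i by (simp add: split_sum_Cons T_def add.commute)
    qed
    let ?p = "\<lambda>i. \<integral>t. h t * (M ! i) t \<partial>\<sigma>" and ?e = "\<lambda>i t. lam t * h t * (M ! i) t"
    have CPs: "mon lam (drop (Suc i) M) \<in> CP lam" "contract_op lam (?e i) (mon lam (drop (Suc i) M)) \<in> CP lam" if "i < length M" for i
      using mon_in_CP[OF drop] contract_in_CP[OF lD[OF that]] by auto
    have c: "contract_op lam h (mon lam M) = (\<Sum>i<length M. moment lam (take i M) *\<^sub>R
        (?p i *\<^sub>R mon lam (drop (Suc i) M) + contract_op lam (?e i) (mon lam (drop (Suc i) M))))"
      using R[of M h] less.prems Cons D by (simp add: split_sum_def)
    have "Q (contract_op lam h (mon lam M)) = (\<Sum>i<length M. Q (moment lam (take i M) *\<^sub>R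
        (?p i *\<^sub>R mon lam (drop (Suc i) M) + contract_op lam (?e i) (mon lam (drop (Suc i) M)))))"
      unfolding c
    proof (rule CP_operator_sum[OF Q(1) finite_lessThan])
      fix i assume "i \<in> {..<length M}"
      then have i: "i < length M" by simp
      show "moment lam (take i M) *\<^sub>R (?p i *\<^sub>R mon lam (drop (Suc i) M) + contract_op lam (?e i) (mon lam (drop (Suc i) M))) \<in> CP lam"
        by (intro CP_scale CP_add CPs[OF i])
    qed
    also have "\<dots> = (\<Sum>i<length M. moment lam (take i M) *\<^sub>R
        (?p i *\<^sub>R Q (mon lam (drop (Suc i) M)) + Q (contract_op lam (?e i) (mon lam (drop (Suc i) M)))))"
      using CPs by (intro sum.cong refl) (simp add: CP_operator_add[OF Q(1)] CP_operator_scale[OF lam Q(1)] CP_add CP_scale)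
    also have "\<dots> = (\<Sum>i<length M. \<Sum>j<length M - Suc i. (moment lam (take i M) *
        (?p i * moment lam (take j (drop (Suc i) M)) + moment lam (?e i # take j (drop (Suc i) M)))) *\<^sub>R T (Suc i + j))"
      by (intro sum.cong refl)
        (simp add: tail tail' scaleR_sum_right sum.distrib[symmetric] scaleR_add_left[symmetric] distrib_left)
    \<comment> \<open>With k = i + 1 + j, \<open>take j (drop (Suc i) M)\<close> is
      \<open>drop (Suc i) (take k M)\<close>, so that all moments refer to the common list
      \<open>take k M\<close>.\<close>
    also have "\<dots> = (\<Sum>i<length M. \<Sum>j<length M - Suc i. (\<lambda>i k. (moment lam (take i (take k M)) *
        (?p i * moment lam (drop (Suc i) (take k M)) + moment lam (?e i # drop (Suc i) (take k M)))) *\<^sub>R T k) i (Suc i + j))"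
      by (intro sum.cong refl) (simp add: drop_take min_def)
    also have "\<dots> = (\<Sum>k<length M. \<Sum>i<k. (moment lam (take i (take k M)) *
        (?p i * moment lam (drop (Suc i) (take k M)) + moment lam (?e i # drop (Suc i) (take k M)))) *\<^sub>R T k)"
      by (rule sum_nested_shift)
    \<comment> \<open>The inner sum runs over the next member i of the block of h and is
      \<open>moment_Cons\<close> for h followed by the first k factors.\<close>
    also have "\<dots> = (\<Sum>k<length M. moment lam (h # take k M) *\<^sub>R T k)"
    proof (rule sum.cong[OF refl])
      fix k assume "k \<in> {..<length M}"
      then have len: "length (take k M) = k" by simp
      show "(\<Sum>i<k. (moment lam (take i (take k M)) *
          (?p i * moment lam (drop (Suc i) (take k M)) + moment lam (?e i # drop (Suc i) (take k M)))) *\<^sub>R T k) =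
          moment lam (h # take k M) *\<^sub>R T k"
        unfolding moment_Cons[of lam h "take k M"] len scaleR_sum_left
        by (intro sum.cong refl) simp
    qed
    finally have "Q (contract_op lam h (mon lam M)) = (\<Sum>k<length M. moment lam (h # take k M) *\<^sub>R T k)" .
    then show ?thesis
      using Q(3)[OF D(1) mon_tensor_poly[OF D(2)]] by (simp add: Cons split_sum_Cons T_def)
  qed
qed

text \<open>The argument of \<open>lowering_mon\<close> closes on itself: for Q =
  \<open>contract_op lam f\<close> the required expansions concern shorter products and all test
  functions, hence f is general in the induction.\<close>

lemma contract_op_mon:
  "set L \<subseteq> \<D>1 \<Longrightarrow> f \<in> \<D>1 \<Longrightarrow>
    contract_op lam f (mon lam L) = split_sum (\<lambda>h. \<integral>t. f t * h t \<partial>\<sigma>) (\<lambda>h. contract_op lam (\<lambda>t. lam t * f t * h t)) L"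
proof (induction "length L" arbitrary: L f rule: less_induct)
  case less
  show ?case
    by (rule lowering_mon[OF lowering_contract[OF less.prems(2)], of "length L"]) (use less in auto)
qed

lemma annihilation_mon:
  assumes "set L \<subseteq> \<D>1"
  shows "annihilation lam t (mon lam L) =
    split_sum (\<lambda>h. h t) (\<lambda>h p. (lam t * h t) *\<^sub>R annihilation lam t p) L"
  by (rule lowering_mon[OF lowering_annihilation, of "length L"]) (use assms contract_op_mon in auto)

end


section \<open>The free derivative of the global operator\<close>

lemma finite_sum_eq:
  assumes "finite J" "J \<subseteq> I" "\<And>n. n \<in> I - J \<Longrightarrow> g n = 0"
  shows "finite_sum I g = sum g J"
  unfolding finite_sum_def using assms by (intro sum.mono_neutral_left) auto

lemma D1_prod: "finite B \<Longrightarrow> B \<noteq> {} \<Longrightarrow> (\<And>x. x \<in> B \<Longrightarrow> g x \<in> \<D>1) \<Longrightarrow> (\<lambda>t. \<Prod>x\<in>B. g x t) \<in> \<D>1"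
  by (induction B rule: finite_ne_induct) (auto intro: D1_mult)

lemma tensor_prefix:
  "n \<le> length fs \<Longrightarrow> tensor fs (\<lambda>i. if i < n then a i else \<omega> (i - n)) =
    (\<Prod>i<n. (fs ! i) (a i)) * tensor (drop n fs) \<omega>"
proof (induction n arbitrary: fs a)
  case (Suc n)
  then obtain f gs where fs: "fs = f # gs" "n \<le> length gs" by (cases fs) auto
  show ?case using Suc.IH[OF fs(2), of "\<lambda>i. a (Suc i)"]
    by (simp add: fs(1) tensor_Cons prod.lessThan_Suc_shift del: prod.lessThan_Suc cong: if_cong)
qed simp

lemma NC2_partition: "\<zeta> \<in> NC2 n \<Longrightarrow> partition_on {1..n} \<zeta>"
  by (simp add: NC2_def)

lemma finite_NC2: "finite (NC2 n)"
  unfolding NC2_eq by (rule NC2_on_finite) simp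

context
  fixes lam :: "'a::radon_polish \<Rightarrow> real"
  assumes lam: "continuous_on UNIV lam"
begin

lemma D1_lam_power: "f \<in> \<D>1 \<Longrightarrow> (\<lambda>t. lam t ^ k * f t) \<in> \<D>1"
proof (induction k)
  case (Suc k)
  then show ?case using D1_lam[OF lam Suc.IH] by (simp add: mult.assoc)
qed simp

text \<open>Regrouping the factors by blocks makes the integrand a product of functions of one block
  variable each, and the integral over the product measure factorises into block weights.\<close>

lemma W_contract_tensor:
  assumes p: "partition_on {1..n} \<zeta>" and n: "n \<le> length fs" and fs: "set fs \<subseteq> \<D>1"
  shows "W_contract lam n \<zeta> (tensor fs) =
    (\<lambda>\<omega>. (\<Prod>B\<in>\<zeta>. block_weight lam (\<lambda>i. fs ! (n - i)) B) * tensor (drop n fs) \<omega>)"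
proof
  fix \<omega> :: "nat \<Rightarrow> 'a"
  interpret product_sigma_finite "\<lambda>_ :: nat set. \<sigma> :: 'a measure" by (rule product_sigma_finite_\<sigma>)
  let ?g = "\<lambda>B t. lam t ^ (card B - 2) * (\<Prod>x\<in>B. (fs ! (n - x)) t)"
  have fin: "finite \<zeta>" using p finite_elements by blast
  have B: "finite B" "B \<noteq> {}" "B \<subseteq> {1..n}" if "B \<in> \<zeta>" for B
  proof -
    show "B \<noteq> {}" "B \<subseteq> {1..n}" using p that by (auto simp: partition_on_def)
    then show "finite B" using finite_subset by blast
  qed
  have blocks: "(\<Prod>i<n. (fs ! i) (s (block_of \<zeta> (n - i)))) = (\<Prod>B\<in>\<zeta>. \<Prod>x\<in>B. (fs ! (n - x)) (s B))" for s
  proof -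
    have "(\<Prod>i<n. (fs ! i) (s (block_of \<zeta> (n - i)))) = (\<Prod>x\<in>{1..n}. (fs ! (n - x)) (s (block_of \<zeta> x)))"
      by (rule prod.reindex_bij_witness[where i="\<lambda>x. n - x" and j="\<lambda>i. n - i"]) auto
    also have "\<dots> = (\<Prod>x\<in>\<Union>\<zeta>. (fs ! (n - x)) (s (block_of \<zeta> x)))"
      using p by (simp add: partition_on_def)
    also have "\<dots> = (\<Prod>B\<in>\<zeta>. \<Prod>x\<in>B. (fs ! (n - x)) (s (block_of \<zeta> x)))"
      using p B(1) by (subst prod.Union_disjoint) (auto simp: partition_on_def disjoint_def)
    also have "\<dots> = (\<Prod>B\<in>\<zeta>. \<Prod>x\<in>B. (fs ! (n - x)) (s B))"
      by (intro prod.cong refl) (simp add: block_of_eq[OF p])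
    finally show ?thesis .
  qed
  have int: "integrable \<sigma> (?g B)" if b: "B \<in> \<zeta>" for B
  proof (intro D1_integrable D1_lam_power D1_prod B[OF b])
    fix x assume "x \<in> B"
    then have "n - x < length fs" using B(3)[OF b] n by (auto simp: subset_iff)
    then show "fs ! (n - x) \<in> \<D>1" using fs nth_mem by blast
  qed
  have "W_contract lam n \<zeta> (tensor fs) \<omega> =
      (\<integral>s. (\<Prod>B\<in>\<zeta>. lam (s B) ^ (card B - 2)) * (\<Prod>B\<in>\<zeta>. \<Prod>x\<in>B. (fs ! (n - x)) (s B)) * tensor (drop n fs) \<omega> \<partial>Pi\<^sub>M \<zeta> (\<lambda>_. \<sigma>))"
    unfolding W_contract_def W_integral_def tensor_prefix[OF n, of "\<lambda>i. _ (block_of \<zeta> (n - i))"] blocks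
    by (simp add: mult.assoc)
  also have "\<dots> = (\<integral>s. (\<Prod>B\<in>\<zeta>. ?g B (s B)) \<partial>Pi\<^sub>M \<zeta> (\<lambda>_. \<sigma>)) * tensor (drop n fs) \<omega>"
    by (simp add: prod.distrib)
  also have "(\<integral>s. (\<Prod>B\<in>\<zeta>. ?g B (s B)) \<partial>Pi\<^sub>M \<zeta> (\<lambda>_. \<sigma>)) = (\<Prod>B\<in>\<zeta>. integral\<^sup>L \<sigma> (?g B))"
    by (rule product_integral_prod[OF fin int])
  finally show "W_contract lam n \<zeta> (tensor fs) \<omega> =
      (\<Prod>B\<in>\<zeta>. block_weight lam (\<lambda>i. fs ! (n - i)) B) * tensor (drop n fs) \<omega>"
    by (simp add: block_weight_def)
qed

text \<open>The reversed argument of \<open>W_contract\<close> pairs the point i of the partition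
  with the factor at position n - i, the same indexing as in \<open>moment\<close>.\<close>

lemma sum_G_term_mon:
  assumes n: "n \<le> length fs" and fs: "set fs \<subseteq> \<D>1"
  shows "(\<Sum>\<zeta>\<in>NC2 n. G_term lam n \<zeta> (mon lam fs)) = moment lam (take n fs) *\<^sub>R mon lam (drop n fs)"
proof -
  have D: "set (drop n fs) \<subseteq> \<D>1" using fs set_drop_subset by fast
  have T: "tensor (drop n fs) \<in> \<D> (length fs - n)" using tensor_in_D[OF D] by simp
  have "G_term lam n \<zeta> (mon lam fs) = (\<Prod>B\<in>\<zeta>. block_weight lam (\<lambda>i. fs ! (n - i)) B) *\<^sub>R mon lam (drop n fs)"
    if z: "\<zeta> \<in> NC2 n" for \<zeta>
    using G_term(2)[OF lam NC2_partition[OF z] tensor_in_D[OF fs]] n monomial_tensor[OF lam fs]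
      monomial_tensor[OF lam D] W_contract_tensor[OF NC2_partition[OF z] n fs]
      linear_on_D_scale[OF lam linear_monomial[OF lam] T] by simp
  then have "(\<Sum>\<zeta>\<in>NC2 n. G_term lam n \<zeta> (mon lam fs)) =
      NC2_sum (block_weight lam (\<lambda>i. fs ! (n - i))) {1..n} *\<^sub>R mon lam (drop n fs)"
    unfolding NC2_sum_def scaleR_sum_left NC2_eq[symmetric] by (intro sum.cong refl)
  also have "NC2_sum (block_weight lam (\<lambda>i. fs ! (n - i))) {1..n} = moment lam (take n fs)"
    unfolding moment_def using n
    by (simp add: min_absorb2) (intro NC2_sum_cong block_weight_cong, auto)
  finally show ?thesis .
qed

section \<open>The global operator on elements of bounded degree\<close>

lemma CP_operator_span:
  assumes L: "CP_operator lam L" and p: "p \<in> graded_span (monomial lam) d"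
    and V: "\<And>i f. i < d \<Longrightarrow> f \<in> \<D> i \<Longrightarrow> L (monomial lam i f) \<in> V" "0 \<in> V" "\<And>p q. p \<in> V \<Longrightarrow> q \<in> V \<Longrightarrow> p + q \<in> V"
  shows "L p \<in> V"
proof -
  obtain f where f: "\<forall>i. f i \<in> \<D> i" "p = (\<Sum>i<d. monomial lam i (f i))" using p by (auto simp: graded_span_def)
  have "L p = (\<Sum>i<d. L (monomial lam i (f i)))"
    unfolding f(2) using f(1) by (intro CP_operator_sum[OF lam L]) (auto intro: monomial_in_CP[OF lam])
  moreover have "(\<Sum>i\<in>I. L (monomial lam i (f i))) \<in> V" if "finite I" "I \<subseteq> {..<d}" for I
    using that by (induction I rule: finite_induct) (auto intro!: V f(1)[rule_format])
  ultimately show ?thesis by simp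
qed

lemma G_term_vanish:
  assumes "\<zeta> \<in> NC2 n" "p \<in> graded_span (monomial lam) d" "d \<le> n"
  shows "G_term lam n \<zeta> p = 0"
  using CP_operator_span[OF G_term(1)[OF lam NC2_partition[OF assms(1)]] assms(2), of "{0}"]
    G_term(2)[OF lam NC2_partition[OF assms(1)]] assms(3) by simp

lemma G_term_in_CP: "\<zeta> \<in> NC2 n \<Longrightarrow> p \<in> CP lam \<Longrightarrow> G_term lam n \<zeta> p \<in> CP lam"
  using CP_operator_in[OF G_term(1)[OF lam NC2_partition]] .

lemma G_eq:
  assumes "p \<in> graded_span (monomial lam) d"
  shows "G lam p = p + (\<Sum>n\<in>{2..<d}. \<Sum>\<zeta>\<in>NC2 n. G_term lam n \<zeta> p)"
  unfolding G_def using G_term_vanish[OF _ assms] by (subst finite_sum_eq[of "{2..<d}"]) auto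

lemma span_in_CP: "p \<in> graded_span (monomial lam) d \<Longrightarrow> p \<in> CP lam"
  unfolding CP_eq[OF lam] by blast

text \<open>The index set of \<open>finite_sum\<close> depends on p. A fixed degree bound d turns it
  into an ordinary finite sum of operators, so that linearity can be proved with a common d.\<close>

lemma DG_eq:
  assumes p: "p \<in> graded_span (monomial lam) d"
  shows "DG lam t p = free_diff lam t p + (\<Sum>n\<in>{2..<d}. \<Sum>\<zeta>\<in>NC2 n. free_diff lam t (G_term lam n \<zeta> p))"
proof -
  note F = free_diff(1)[OF lam, of t]
  have CPp: "p \<in> CP lam" by (rule span_in_CP[OF p])
  have CPz: "G_term lam n \<zeta> p \<in> CP lam" if "\<zeta> \<in> NC2 n" for n \<zeta> by (rule G_term_in_CP[OF that CPp])
  have CPn: "(\<Sum>\<zeta>\<in>NC2 n. G_term lam n \<zeta> p) \<in> CP lam" for n by (rule CP_sum[OF lam CPz])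
  have CPs: "(\<Sum>n\<in>{2..<d}. \<Sum>\<zeta>\<in>NC2 n. G_term lam n \<zeta> p) \<in> CP lam" by (rule CP_sum[OF lam CPn])
  have "free_diff lam t (\<Sum>n\<in>{2..<d}. \<Sum>\<zeta>\<in>NC2 n. G_term lam n \<zeta> p) =
      (\<Sum>n\<in>{2..<d}. free_diff lam t (\<Sum>\<zeta>\<in>NC2 n. G_term lam n \<zeta> p))"
    by (rule CP_operator_sum[OF lam F finite_atLeastLessThan CPn])
  also have "\<dots> = (\<Sum>n\<in>{2..<d}. \<Sum>\<zeta>\<in>NC2 n. free_diff lam t (G_term lam n \<zeta> p))"
    by (intro sum.cong refl CP_operator_sum[OF lam F finite_NC2 CPz])
  finally show ?thesis
    unfolding DG_def G_eq[OF p] CP_operator_add[OF F CPp CPs] by simp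
qed

lemma CP_common:
  assumes "p \<in> CP lam" "q \<in> CP lam"
  obtains d where "p \<in> graded_span (monomial lam) d" "q \<in> graded_span (monomial lam) d"
proof -
  note mono = graded_span_mono[OF linear_monomial[OF lam]]
  obtain d e where "p \<in> graded_span (monomial lam) d" "q \<in> graded_span (monomial lam) e"
    using assms unfolding CP_eq[OF lam] by blast
  then have "p \<in> graded_span (monomial lam) (max d e)" "q \<in> graded_span (monomial lam) (max d e)"
    using mono[of d "max d e"] mono[of e "max d e"] by auto
  then show ?thesis by (rule that)
qed

lemma DG_in_CP:
  assumes "p \<in> CP lam"
  shows "DG lam t p \<in> CP lam"
proof -
  obtain d where p: "p \<in> graded_span (monomial lam) d" using assms unfolding CP_eq[OF lam] by blast
  show ?thesis unfolding DG_eq[OF p]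
    by (intro CP_add[OF lam] CP_sum[OF lam] CP_operator_in[OF free_diff(1)[OF lam]] assms G_term_in_CP)
qed

lemma DG_lincomb:
  assumes pq: "p \<in> CP lam" "q \<in> CP lam"
  shows "DG lam t (a *\<^sub>R p + b *\<^sub>R q) = a *\<^sub>R DG lam t p + b *\<^sub>R DG lam t q"
proof -
  obtain d where d: "p \<in> graded_span (monomial lam) d" "q \<in> graded_span (monomial lam) d" by (rule CP_common[OF pq])
  have dab: "a *\<^sub>R p + b *\<^sub>R q \<in> graded_span (monomial lam) d" by (rule graded_span_lincomb[OF linear_monomial[OF lam] d])
  have "free_diff lam t (G_term lam n \<zeta> (a *\<^sub>R p + b *\<^sub>R q)) =
      a *\<^sub>R free_diff lam t (G_term lam n \<zeta> p) + b *\<^sub>R free_diff lam t (G_term lam n \<zeta> q)" if z: "\<zeta> \<in> NC2 n" for n \<zeta>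
    unfolding CP_operator_lincomb[OF G_term(1)[OF lam NC2_partition[OF z]] pq]
    by (rule CP_operator_lincomb[OF free_diff(1)[OF lam] G_term_in_CP[OF z pq(1)] G_term_in_CP[OF z pq(2)]])
  then show ?thesis
    unfolding DG_eq[OF d(1)] DG_eq[OF d(2)] DG_eq[OF dab] CP_operator_lincomb[OF free_diff(1)[OF lam] pq]
    by (simp add: sum.distrib scaleR_sum_right[symmetric] scaleR_add_right)
qed

text \<open>\<open>DG\<close> is not normalised outside \<open>CP lam\<close>, hence the
  restriction.\<close>

lemma CP_operator_DG: "CP_operator lam (restrict (DG lam t) (CP lam))"
  unfolding CP_operator_def by (simp add: DG_in_CP DG_lincomb CP_lincomb'[OF lam])

lemma free_diff_monomial_span:
  assumes "f \<in> \<D> n" "n \<le> d"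
  shows "free_diff lam t (monomial lam n f) \<in> graded_span (monomial lam) d"
proof (cases n)
  case 0
  then show ?thesis using free_diff(2)[OF lam assms(1)] graded_span_zero[OF linear_monomial[OF lam]] by (simp add: bracket0_def)
next
  case (Suc m)
  have "slice t f \<in> \<D> m" using assms(1) unfolding Suc by (rule bdd_map_in[OF bdd_map_slice])
  then show ?thesis using free_diff(2)[OF lam assms(1)] graded_span_base[OF linear_monomial[OF lam]] assms(2) Suc
    by (simp add: bracket0_def)
qed

lemma DG_monomial:
  assumes f: "f \<in> \<D> N"
  shows "DG lam t (monomial lam N f) = free_diff lam t (monomial lam N f) +
    (\<Sum>n\<in>{2..<Suc N}. \<Sum>\<zeta>\<in>NC2 n. free_diff lam t (monomial lam (N - n) (W_contract lam n \<zeta> f)))"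
proof -
  have "monomial lam N f \<in> graded_span (monomial lam) (Suc N)"
    by (rule graded_span_base[OF linear_monomial[OF lam] f lessI])
  from DG_eq[OF this] show ?thesis using G_term(2)[OF lam NC2_partition f] by simp
qed

lemma DG_monomial_span:
  assumes f: "f \<in> \<D> N" and d: "N \<le> d"
  shows "DG lam t (monomial lam N f) \<in> graded_span (monomial lam) d"
  unfolding DG_monomial[OF f]
proof (intro graded_span_add[OF linear_monomial[OF lam]] graded_span_sum[OF linear_monomial[OF lam]] free_diff_monomial_span f d)
  fix n \<zeta> assume n: "n \<in> {2..<Suc N}" and z: "\<zeta> \<in> NC2 n"
  show "W_contract lam n \<zeta> f \<in> \<D> (N - n)"
    using n by (intro bdd_map_in[OF bdd_map_W_contract[OF lam NC2_partition[OF z]] f]) simp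
  show "N - n \<le> d" using d by simp
qed

text \<open>No term of the global operator raises the degree, and the free derivative lowers it by
  one. Local nilpotency follows.\<close>

lemma DG_span:
  assumes p: "p \<in> graded_span (monomial lam) (Suc d)"
  shows "DG lam t p \<in> graded_span (monomial lam) d"
proof -
  have "restrict (DG lam t) (CP lam) p \<in> graded_span (monomial lam) d"
    using DG_monomial_span monomial_in_CP[OF lam]
    by (intro CP_operator_span[OF CP_operator_DG p])
      (auto intro: graded_span_zero[OF linear_monomial[OF lam]] graded_span_add[OF linear_monomial[OF lam]])
  then show ?thesis using span_in_CP[OF p] by simp
qed

lemma DG_nilpotent: "p \<in> graded_span (monomial lam) d \<Longrightarrow> (DG lam t ^^ d) p = 0"
proof (induction d arbitrary: p)
  case 0
  then show ?case by (simp add: graded_span_def)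
next
  case (Suc d)
  show ?case using Suc.IH[OF DG_span[OF Suc.prems]] by (simp add: funpow_Suc_right del: funpow.simps)
qed

lemma G_mon:
  assumes fs: "set fs \<subseteq> \<D>1"
  shows "G lam (mon lam fs) = (\<Sum>n<Suc (length fs). moment lam (take n fs) *\<^sub>R mon lam (drop n fs))"
proof -
  let ?N = "length fs"
  have "mon lam fs \<in> graded_span (monomial lam) (Suc ?N)"
    unfolding monomial_tensor[OF lam fs, symmetric]
    by (rule graded_span_base[OF linear_monomial[OF lam] tensor_in_D[OF fs] lessI])
  then have "G lam (mon lam fs) = mon lam fs + (\<Sum>n\<in>{2..<Suc ?N}. moment lam (take n fs) *\<^sub>R mon lam (drop n fs))"
    using sum_G_term_mon[OF _ fs] by (simp add: G_eq)
  \<comment> \<open>The identity is the term n = 0, and n = 1 may be added because the moment of a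
    single factor is 0.\<close>
  also have "\<dots> = (\<Sum>n<Suc ?N. moment lam (take n fs) *\<^sub>R mon lam (drop n fs))"
  proof (cases fs)
    case (Cons f gs)
    have "{..<Suc ?N} = insert 0 (insert 1 {2..<Suc ?N})" using Cons by auto
    then show ?thesis using Cons by simp
  qed simp
  finally show ?thesis .
qed

lemma free_diff_mon_Cons:
  assumes "set (f # fs) \<subseteq> \<D>1"
  shows "free_diff lam t (mon lam (f # fs)) = f t *\<^sub>R mon lam fs"
proof -
  have D: "set fs \<subseteq> \<D>1" using assms by simp
  have T: "tensor fs \<in> \<D> (length fs)" by (rule tensor_in_D[OF D])
  show ?thesis
    using free_diff(2)[OF lam tensor_in_D[OF assms], of t] monomial_tensor[OF lam assms] monomial_tensor[OF lam D]
      linear_on_D_scale[OF lam linear_monomial[OF lam] T]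
    by (simp add: bracket0_def slice_tensor)
qed

lemma free_diff_id: "free_diff lam t id_blinfun = 0"
  using free_diff(2)[OF lam tensor_Nil_in_D[OF lam], of t] monomial_tensor[OF lam, of "[]"] by (simp add: bracket0_def)

lemma DG_mon:
  assumes fs: "set fs \<subseteq> \<D>1"
  shows "DG lam t (mon lam fs) =
    (\<Sum>n<length fs. (moment lam (take n fs) * (fs ! n) t) *\<^sub>R mon lam (drop (Suc n) fs))"
proof -
  note F = free_diff(1)[OF lam, of t]
  have D: "set (drop n fs) \<subseteq> \<D>1" for n using fs set_drop_subset by fast
  have "DG lam t (mon lam fs) = (\<Sum>n<Suc (length fs). free_diff lam t (moment lam (take n fs) *\<^sub>R mon lam (drop n fs)))"
    unfolding DG_def G_mon[OF fs] by (intro CP_operator_sum[OF lam F finite_lessThan] CP_scale[OF lam] mon_in_CP[OF lam] D)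
  also have "\<dots> = (\<Sum>n<Suc (length fs). moment lam (take n fs) *\<^sub>R free_diff lam t (mon lam (drop n fs)))"
    by (intro sum.cong refl CP_operator_scale[OF lam F] mon_in_CP[OF lam] D)
  \<comment> \<open>The summand for the full length is a constant, which the free derivative
    kills.\<close>
  also have "\<dots> = (\<Sum>n<length fs. moment lam (take n fs) *\<^sub>R free_diff lam t (mon lam (drop n fs)))"
    by (simp add: free_diff_id)
  also have "\<dots> = (\<Sum>n<length fs. (moment lam (take n fs) * (fs ! n) t) *\<^sub>R mon lam (drop (Suc n) fs))"
  proof (rule sum.cong[OF refl])
    fix n assume "n \<in> {..<length fs}"
    then have e: "drop n fs = fs ! n # drop (Suc n) fs" by (simp add: Cons_nth_drop_Suc)
    have "free_diff lam t (mon lam (drop n fs)) = (fs ! n) t *\<^sub>R mon lam (drop (Suc n) fs)"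
      using free_diff_mon_Cons[OF D[of n, unfolded e]] unfolding e .
    then show "moment lam (take n fs) *\<^sub>R free_diff lam t (mon lam (drop n fs)) =
        (moment lam (take n fs) * (fs ! n) t) *\<^sub>R mon lam (drop (Suc n) fs)" by simp
  qed
  finally show ?thesis .
qed

end


section \<open>The annihilation operator as a resolvent\<close>

text \<open>The geometric series b is checked to be a right inverse of \<Psi> under composition;
  composing with \<open>fps_inv\<close> on the left identifies the two.\<close>

lemma fps_inv_\<Psi>: "fps_nth (fps_inv (\<Psi> l)) k = (if k = 0 then 0 else l ^ (k - 1))"
proof -
  define a where "a = \<Psi> l"
  define b where "b = Abs_fps (\<lambda>k. if k = 0 then 0 else l ^ (k - 1))"
  let ?u = "1 + fps_const l * fps_X"
  have b0: "fps_nth b 0 = 0" by (simp add: b_def)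
  have au: "a * ?u = fps_X" unfolding a_def \<Psi>_def by (simp add: fps_divide_unit mult.assoc inverse_mult_eq_1)
  have a0: "fps_nth a 0 = 0" "fps_nth a 1 \<noteq> 0"
    using arg_cong[OF au, of "\<lambda>f. fps_nth f 0"] arg_cong[OF au, of "\<lambda>f. fps_nth f 1"]
    by (simp_all add: fps_mult_nth)
  have bu: "b * (1 - fps_const l * fps_X) = fps_X"
  proof (rule fps_ext)
    fix n
    have "fps_nth (b * (1 - fps_const l * fps_X)) n = fps_nth b n - l * (if n = 0 then 0 else fps_nth b (n - 1))"
      by (simp add: right_diff_distrib mult.left_commute[of b] mult.assoc[symmetric])
    then show "fps_nth (b * (1 - fps_const l * fps_X)) n = fps_nth (fps_X) n"
      by (cases n rule: nat.exhaust; cases "n - 1" rule: nat.exhaust) (auto simp: b_def)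
  qed
  \<comment> \<open>The equation a(1 + lX) = X after substituting b. The factor 1 + lb is then
    inverted by 1 - lX, since b(1 - lX) = X.\<close>
  have "(a oo b) * (1 + fps_const l * b) = b"
    using arg_cong[OF au, of "\<lambda>f. f oo b"]
    by (simp add: fps_compose_mult_distrib[OF b0] fps_compose_add_distrib b0)
  then have "(a oo b) * ((1 + fps_const l * b) * (1 - fps_const l * fps_X)) = b * (1 - fps_const l * fps_X)"
    by (metis mult.assoc)
  moreover have "(1 + fps_const l * b) * (1 - fps_const l * fps_X) = 1"
    unfolding distrib_right mult.assoc bu by simp
  ultimately have ab: "a oo b = fps_X" using bu by simp
  have "fps_inv a = fps_inv a oo (a oo b)" by (simp add: ab)
  also have "\<dots> = (fps_inv a oo a) oo b" by (rule fps_compose_assoc[OF b0 a0(1)])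
  also have "\<dots> = b" using b0 by (simp add: fps_inv[OF a0])
  finally show ?thesis by (simp add: a_def b_def)
qed

text \<open>Pure algebra of two linear maps with E locally nilpotent. The explicit inverse of 1 - lE
  is 1 + lA: one order of the product is the relation itself, the other also needs that A and E
  commute.\<close>

lemma resolvent_series:
  fixes A E :: "'b::real_vector \<Rightarrow> 'b" and l :: real
  assumes V: "0 \<in> V" "\<And>p q a b. p \<in> V \<Longrightarrow> q \<in> V \<Longrightarrow> a *\<^sub>R p + b *\<^sub>R q \<in> V"
    and A: "\<And>p. p \<in> V \<Longrightarrow> A p \<in> V" "\<And>p q a b. p \<in> V \<Longrightarrow> q \<in> V \<Longrightarrow> A (a *\<^sub>R p + b *\<^sub>R q) = a *\<^sub>R A p + b *\<^sub>R A q"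
    and E: "\<And>p. p \<in> V \<Longrightarrow> E p \<in> V" "\<And>p q a b. p \<in> V \<Longrightarrow> q \<in> V \<Longrightarrow> E (a *\<^sub>R p + b *\<^sub>R q) = a *\<^sub>R E p + b *\<^sub>R E q"
    and AE: "\<And>p. p \<in> V \<Longrightarrow> A p = E p + l *\<^sub>R A (E p)"
    and nil: "\<And>p. p \<in> V \<Longrightarrow> \<exists>d. (E ^^ d) p = 0"
  shows "p \<in> V \<Longrightarrow> (E ^^ d) p = 0 \<Longrightarrow> A p = (\<Sum>k\<in>{1..d}. l ^ (k - 1) *\<^sub>R (E ^^ k) p)"
    and "bij_betw (\<lambda>q. q - l *\<^sub>R E q) V V"
    and "p \<in> V \<Longrightarrow> A p = E (inv_into V (\<lambda>q. q - l *\<^sub>R E q) p)"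
proof -
  have zero: "A 0 = 0" "E 0 = 0" using A(2)[OF V(1,1), of 0 0] E(2)[OF V(1,1), of 0 0] by auto
  have series: "A p = (\<Sum>k<d. l ^ k *\<^sub>R (E ^^ Suc k) p)" if "p \<in> V" "(E ^^ d) p = 0" for d p
    using that
  proof (induction d arbitrary: p)
    case 0
    then show ?case using zero by simp
  next
    case (Suc d)
    have "(E ^^ d) (E p) = 0" using Suc.prems(2) by (simp add: funpow_swap1)
    from Suc.IH[OF E(1)[OF Suc.prems(1)] this]
    have "A (E p) = (\<Sum>k<d. l ^ k *\<^sub>R (E ^^ Suc (Suc k)) p)" by (simp add: funpow_swap1)
    then have "A p = E p + (\<Sum>k<d. l ^ Suc k *\<^sub>R (E ^^ Suc (Suc k)) p)"
      using AE[OF Suc.prems(1)] by (simp add: scaleR_sum_right)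
    then show ?case by (simp add: sum.lessThan_Suc_shift del: sum.lessThan_Suc)
  qed
  show "A p = (\<Sum>k\<in>{1..d}. l ^ (k - 1) *\<^sub>R (E ^^ k) p)" if "p \<in> V" "(E ^^ d) p = 0"
    unfolding series[OF that]
    by (rule sum.reindex_bij_witness[where i="\<lambda>k. k - 1" and j=Suc]) auto
  \<comment> \<open>Induction on the order of nilpotency: apply E to the relation for p, use the
    hypothesis for E p, and recognise the relation for E p.\<close>
  have comm0: "E (A p) = A (E p)" if "p \<in> V" "(E ^^ d) p = 0" for d p
    using that
  proof (induction d arbitrary: p)
    case 0
    then show ?case using zero by simp
  next
    case (Suc d)
    note Ep = E(1)[OF Suc.prems(1)]
    have "(E ^^ d) (E p) = 0" using Suc.prems(2) by (simp add: funpow_swap1)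
    from Suc.IH[OF Ep this] have "E (A (E p)) = A (E (E p))" .
    then have "E (A p) = E (E p) + l *\<^sub>R A (E (E p))"
      unfolding AE[OF Suc.prems(1)] using E(2)[OF Ep A(1)[OF Ep], of 1 l] by simp
    then show ?case using AE[OF Ep] by simp
  qed
  have comm: "E (A p) = A (E p)" if "p \<in> V" for p
    using nil[OF that] comm0[OF that] by blast
  let ?F = "\<lambda>q. q - l *\<^sub>R E q" and ?R = "\<lambda>p. p + l *\<^sub>R A p"
  have F: "?F q \<in> V" "A (?F q) = E q" if "q \<in> V" for q
  proof -
    show "?F q \<in> V" using V(2)[OF that E(1)[OF that], of 1 "- l"] by simp
    show "A (?F q) = E q" using A(2)[OF that E(1)[OF that], of 1 "- l"] AE[OF that] by simp
  qed
  have R: "?R p \<in> V" "?F (?R p) = p" if "p \<in> V" for p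
  proof -
    show "?R p \<in> V" using V(2)[OF that A(1)[OF that], of 1 l] by simp
    show "?F (?R p) = p" using E(2)[OF that A(1)[OF that], of 1 l] comm[OF that] AE[OF that] by simp
  qed
  have RF: "?R (?F q) = q" if "q \<in> V" for q using F(2)[OF that] by simp
  show bij: "bij_betw ?F V V"
    by (rule bij_betw_byWitness[where f'="?R"]) (use F R RF in auto)
  show "A p = E (inv_into V ?F p)" if p: "p \<in> V"
  proof -
    have "inv_into V ?F p \<in> V" "?F (inv_into V ?F p) = p"
      using bij p inv_into_into[of p ?F V] f_inv_into_f[of p ?F V] by (auto simp: bij_betw_def)
    then show ?thesis using F(2)[of "inv_into V ?F p"] by simp
  qed
qed

section \<open>The identity between annihilation and the free derivative of the global
  operator\<close>

context
  fixes lam :: "'a::radon_polish \<Rightarrow> real" and t :: 'a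
  assumes lam: "continuous_on UNIV lam"
begin

lemma mixed_in_CP: "f \<in> \<D> (j + k) \<Longrightarrow> mixed lam j k f \<in> CP lam"
proof -
  assume f: "f \<in> \<D> (j + k)"
  have "mixed lam j k f - P lam (j + k) f \<in> CP lam"
    using mixed_leading[OF lam f] unfolding CP_eq_P[OF lam] by blast
  from CP_add[OF lam this P_in_CP[OF lam f]] show ?thesis by simp
qed

text \<open>Continuity in the coefficient is obvious for \<open>P\<close>, where annihilation is a
  slice, and is carried to monomials along the recursion \<open>mixed\<close>, whose terms all lie
  in \<open>CP lam\<close>.\<close>

lemma bdd_fun_annihilation_mixed: "bdd_fun (j + k) (\<lambda>f. annihilation lam t (mixed lam j k f))"
proof (induction j arbitrary: k)
  case 0
  show ?case
  proof (cases k)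
    case 0
    show ?thesis
      by (rule bdd_fun_cong[OF bdd_fun_zero]) (simp add: 0 annihilation(2)[OF lam])
  next
    case (Suc m)
    have "bdd_fun (Suc m) (\<lambda>f. P lam m (slice t f))" by (rule bdd_fun_compose[OF bdd_fun_P[OF lam] bdd_map_slice])
    then have "bdd_fun (Suc m) (\<lambda>f. annihilation lam t (P lam (Suc m) f))"
      by (rule bdd_fun_cong) (simp add: annihilation(2)[OF lam])
    then show ?thesis by (simp add: Suc)
  qed
next
  case (Suc j)
  show ?case
  proof (cases k)
    case 0
    then show ?thesis using Suc[of 1] by simp
  next
    case (Suc k')
    let ?n = "Suc (Suc (j + k'))"
    have D: "bdd_map ?n (j + Suc k') (diag lam j)" "bdd_map ?n (j + k') (pair_int j :: ((nat \<Rightarrow> 'a) \<Rightarrow> real) \<Rightarrow> _)"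
      using bdd_map_diag[OF lam, of j "j + Suc k'"] bdd_map_pair_int[of j "j + k'"] by simp_all
    have "bdd_fun ?n (\<lambda>f. annihilation lam t (mixed lam j (Suc (Suc k')) f) +
        annihilation lam t (mixed lam j (Suc k') (diag lam j f)) + annihilation lam t (mixed lam j k' (pair_int j f)))"
      using Suc.IH[of "Suc (Suc k')"]
      by (intro bdd_fun_add bdd_fun_compose[OF Suc.IH D(1)] bdd_fun_compose[OF Suc.IH D(2)]) simp
    then have "bdd_fun ?n (\<lambda>f. annihilation lam t (mixed lam (Suc j) (Suc k') f))"
    proof (rule bdd_fun_cong)
      fix f :: "(nat \<Rightarrow> 'a) \<Rightarrow> real" assume f: "f \<in> \<D> ?n"
      have "mixed lam j (Suc (Suc k')) f \<in> CP lam" using f by (intro mixed_in_CP) simp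
      moreover have "mixed lam j (Suc k') (diag lam j f) \<in> CP lam" "mixed lam j k' (pair_int j f) \<in> CP lam"
        by (rule mixed_in_CP[OF bdd_map_in[OF D(1) f]], rule mixed_in_CP[OF bdd_map_in[OF D(2) f]])
      ultimately show "annihilation lam t (mixed lam (Suc j) (Suc k') f) =
          annihilation lam t (mixed lam j (Suc (Suc k')) f) +
          annihilation lam t (mixed lam j (Suc k') (diag lam j f)) + annihilation lam t (mixed lam j k' (pair_int j f))"
        by (simp add: CP_operator_add[OF annihilation(1)[OF lam]] CP_add[OF lam])
    qed
    then show ?thesis by (simp add: Suc)
  qed
qed

lemma bdd_fun_annihilation_monomial: "bdd_fun n (\<lambda>f. annihilation lam t (monomial lam n f))"
  using bdd_fun_cong[OF bdd_fun_annihilation_mixed[of n 0], of "\<lambda>f. annihilation lam t (monomial lam n f)"]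
  by (simp add: monomial_eq_mixed[OF lam])

text \<open>The operator \<open>DG\<close> acts on a monomial by slices and block contractions of
  its coefficient. Applying H afterwards keeps continuity because H is continuous in the coefficient
  of every monomial, although it need not be continuous as an operator.\<close>

lemma bdd_fun_DG_monomial:
  assumes H: "CP_operator lam H" and bdd: "\<And>n. bdd_fun n (\<lambda>f. H (monomial lam n f))"
  shows "bdd_fun N (\<lambda>f. H (DG lam t (monomial lam N f)))"
proof -
  note F = free_diff(1)[OF lam, of t]
  have free: "bdd_fun n (\<lambda>f. H (free_diff lam t (monomial lam n f)))" for n
  proof (cases n)
    case 0
    show ?thesis
      by (rule bdd_fun_cong[OF bdd_fun_zero]) (simp add: 0 free_diff(2)[OF lam] bracket0_def CP_operator_zero[OF lam H])
  next
    case (Suc m)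
    have "bdd_fun (Suc m) (\<lambda>f. H (monomial lam m (slice t f)))" by (rule bdd_fun_compose[OF bdd bdd_map_slice])
    then have "bdd_fun (Suc m) (\<lambda>f. H (free_diff lam t (monomial lam (Suc m) f)))"
      by (rule bdd_fun_cong) (simp add: free_diff(2)[OF lam] bracket0_def)
    then show ?thesis by (simp add: Suc)
  qed
  have W: "bdd_map N (N - n) (W_contract lam n \<zeta>)" if "n \<in> {2..<Suc N}" "\<zeta> \<in> NC2 n" for n \<zeta>
    using that by (intro bdd_map_W_contract[OF lam NC2_partition]) simp_all
  have "bdd_fun N (\<lambda>f. H (free_diff lam t (monomial lam N f)) +
      (\<Sum>n\<in>{2..<Suc N}. \<Sum>\<zeta>\<in>NC2 n. H (free_diff lam t (monomial lam (N - n) (W_contract lam n \<zeta> f)))))"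
    by (intro bdd_fun_add bdd_fun_sum finite_atLeastLessThan finite_NC2 free bdd_fun_compose[OF free W])
  then show ?thesis
  proof (rule bdd_fun_cong)
    fix f :: "(nat \<Rightarrow> 'a) \<Rightarrow> real" assume f: "f \<in> \<D> N"
    let ?Y = "\<lambda>n \<zeta>. free_diff lam t (monomial lam (N - n) (W_contract lam n \<zeta> f))"
    have Y: "?Y n \<zeta> \<in> CP lam" if "n \<in> {2..<Suc N}" "\<zeta> \<in> NC2 n" for n \<zeta>
      by (rule CP_operator_in[OF F monomial_in_CP[OF lam bdd_map_in[OF W[OF that] f]]])
    have Yn: "(\<Sum>\<zeta>\<in>NC2 n. ?Y n \<zeta>) \<in> CP lam" if "n \<in> {2..<Suc N}" for n
      by (rule CP_sum[OF lam Y[OF that]])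
    have YN: "(\<Sum>n\<in>{2..<Suc N}. \<Sum>\<zeta>\<in>NC2 n. ?Y n \<zeta>) \<in> CP lam" by (rule CP_sum[OF lam Yn])
    have "H (\<Sum>n\<in>{2..<Suc N}. \<Sum>\<zeta>\<in>NC2 n. ?Y n \<zeta>) = (\<Sum>n\<in>{2..<Suc N}. H (\<Sum>\<zeta>\<in>NC2 n. ?Y n \<zeta>))"
      by (rule CP_operator_sum[OF lam H finite_atLeastLessThan Yn])
    also have "\<dots> = (\<Sum>n\<in>{2..<Suc N}. \<Sum>\<zeta>\<in>NC2 n. H (?Y n \<zeta>))"
      by (rule sum.cong[OF refl], rule CP_operator_sum[OF lam H finite_NC2 Y])
    finally show "H (DG lam t (monomial lam N f)) = H (free_diff lam t (monomial lam N f)) +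
        (\<Sum>n\<in>{2..<Suc N}. \<Sum>\<zeta>\<in>NC2 n. H (?Y n \<zeta>))"
      unfolding DG_monomial[OF lam f]
        CP_operator_add[OF H CP_operator_in[OF F monomial_in_CP[OF lam f]] YN] by simp
  qed
qed

text \<open>H is 1 + \<lambda>(t) times annihilation. \<open>DG_mon\<close> and
  \<open>annihilation_mon\<close> have the same moments and evaluated factors; in the latter each
  tail is preceded by exactly this operator.\<close>

lemma annihilation_eq_on_mon:
  assumes fs: "set fs \<subseteq> \<D>1"
    and H: "CP_operator lam H" "\<And>p. p \<in> CP lam \<Longrightarrow> H p = p + lam t *\<^sub>R annihilation lam t p"
  shows "annihilation lam t (mon lam fs) = H (DG lam t (mon lam fs))"
proof -
  have D: "set (drop n fs) \<subseteq> \<D>1" for n using fs set_drop_subset by fast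
  note M = mon_in_CP[OF lam D]
  have "H (DG lam t (mon lam fs)) = (\<Sum>n<length fs. H ((moment lam (take n fs) * (fs ! n) t) *\<^sub>R mon lam (drop (Suc n) fs)))"
    unfolding DG_mon[OF lam fs] by (intro CP_operator_sum[OF lam H(1) finite_lessThan] CP_scale[OF lam] M)
  also have "\<dots> = annihilation lam t (mon lam fs)"
    unfolding annihilation_mon[OF lam fs] split_sum_def[OF lam]
    by (intro sum.cong refl)
      (simp add: CP_operator_scale[OF lam H(1) M] H(2)[OF M] scaleR_add_right mult_ac)
  finally show ?thesis ..
qed

text \<open>
  Both sides are continuous in the coefficient of a monomial, so it suffices to compare them on
  tensor products, where \<open>annihilation_mon\<close> and \<open>DG_mon\<close> give the same moments.
\<close>

lemma annihilation_eq_DG: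
  assumes p: "p \<in> CP lam"
  shows "annihilation lam t p = DG lam t p + lam t *\<^sub>R annihilation lam t (DG lam t p)"
proof -
  note A = annihilation(1)[OF lam, of t]
  define H where "H = restrict (\<lambda>p. p + lam t *\<^sub>R annihilation lam t p) (CP lam)"
  have H: "H p = p + lam t *\<^sub>R annihilation lam t p" if "p \<in> CP lam" for p using that by (simp add: H_def)
  have CPH: "CP_operator lam H"
    unfolding CP_operator_def
    by (auto simp: H_def CP_operator_lincomb[OF A] CP_lincomb'[OF lam] algebra_simps
        intro!: CP_add[OF lam] CP_scale[OF lam] CP_operator_in[OF A])
  have bH: "bdd_fun n (\<lambda>f. H (monomial lam n f))" for n
  proof (rule bdd_fun_cong)
    show "bdd_fun n (\<lambda>f. monomial lam n f + lam t *\<^sub>R annihilation lam t (monomial lam n f))"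
      by (intro bdd_fun_add bdd_fun_monomial[OF lam]
          bdd_fun_bounded_linear[OF bdd_fun_annihilation_monomial bounded_linear_scaleR_right])
  qed (simp add: H monomial_in_CP[OF lam])
  have eq: "annihilation lam t (monomial lam n f) = H (DG lam t (monomial lam n f))" if f: "f \<in> \<D> n" for n f
  proof (rule bdd_fun_eq[OF bdd_fun_annihilation_monomial bdd_fun_DG_monomial[OF CPH bH] _ f])
    fix fs :: "('a \<Rightarrow> real) list" assume fs: "length fs = n" "set fs \<subseteq> \<D>1"
    show "annihilation lam t (monomial lam n (tensor fs)) = H (DG lam t (monomial lam n (tensor fs)))"
      unfolding fs(1)[symmetric] monomial_tensor[OF lam fs(2)] by (rule annihilation_eq_on_mon[OF fs(2) CPH H])
  qed
  obtain d f where f: "\<forall>i. f i \<in> \<D> i" "p = (\<Sum>i<d. monomial lam i (f i))"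
    using p unfolding CP_eq[OF lam] graded_span_def by blast
  note M = monomial_in_CP[OF lam f(1)[rule_format]]
  have "restrict (DG lam t) (CP lam) (\<Sum>i<d. monomial lam i (f i)) =
      (\<Sum>i<d. restrict (DG lam t) (CP lam) (monomial lam i (f i)))"
    by (rule CP_operator_sum[OF lam CP_operator_DG[OF lam] finite_lessThan M])
  then have "DG lam t p = (\<Sum>i<d. DG lam t (monomial lam i (f i)))"
    by (simp add: f(2) M CP_sum[OF lam M])
  then have "H (DG lam t p) = (\<Sum>i<d. H (DG lam t (monomial lam i (f i))))"
    using CP_operator_sum[OF lam CPH finite_lessThan DG_in_CP[OF lam M]] by simp
  also have "\<dots> = annihilation lam t p"
    unfolding f(2) CP_operator_sum[OF lam A finite_lessThan M] by (intro sum.cong refl eq[symmetric] f(1)[rule_format])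
  finally show ?thesis using H[OF DG_in_CP[OF lam p]] by simp
qed

end

theorem theorem4p1:
  fixes lam :: "'a::radon_polish \<Rightarrow> real" and t :: 'a
  assumes "continuous_on UNIV lam"
  shows "(\<forall>p\<in>CP lam.
            annihilation lam t p = op_series (fps_inv (\<Psi> (lam t))) (DG lam t) p) \<and>
         bij_betw (\<lambda>q. q - lam t *\<^sub>R DG lam t q) (CP lam) (CP lam) \<and>
         (\<forall>p\<in>CP lam.
            annihilation lam t p =
              DG lam t (inv_into (CP lam) (\<lambda>q. q - lam t *\<^sub>R DG lam t q) p)) \<and>
         (\<forall>p\<in>CP lam.
            finite {k. 1 \<le> k \<and> lam t ^ (k - 1) *\<^sub>R (DG lam t ^^ k) p \<noteq> 0} \<and>
            annihilation lam t p =
              finite_sum {1..} (\<lambda>k. lam t ^ (k - 1) *\<^sub>R (DG lam t ^^ k) p)) \<and>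
         (lam t = 0 \<longrightarrow> (\<forall>p\<in>CP lam. annihilation lam t p = DG lam t p))"
proof -
  note lam = assms
  let ?l = "lam t" and ?A = "annihilation lam t" and ?E = "DG lam t"
  note A = annihilation(1)[OF lam, of t]
  have nil: "\<exists>d. (?E ^^ d) p = 0" if "p \<in> CP lam" for p
    using that DG_nilpotent[OF lam] unfolding CP_eq[OF lam] by blast
  note V = zero_in_CP[OF lam] CP_lincomb'[OF lam] CP_operator_in[OF A] CP_operator_lincomb[OF A]
    DG_in_CP[OF lam] DG_lincomb[OF lam] annihilation_eq_DG[OF lam] nil
  have series: "?A p = (\<Sum>k\<in>{1..d}. ?l ^ (k - 1) *\<^sub>R (?E ^^ k) p)" if "p \<in> CP lam" "(?E ^^ d) p = 0" for p d
    by (rule resolvent_series(1)[where V="CP lam"]) (rule V that; assumption?)+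
  have bij: "bij_betw (\<lambda>q. q - ?l *\<^sub>R ?E q) (CP lam) (CP lam)"
    by (rule resolvent_series(2)[where A="?A"]) (rule V; assumption?)+
  have inverse: "?A p = ?E (inv_into (CP lam) (\<lambda>q. q - ?l *\<^sub>R ?E q) p)" if "p \<in> CP lam" for p
    by (rule resolvent_series(3)) (rule V that; assumption?)+
  have sums: "finite {k. 1 \<le> k \<and> ?l ^ (k - 1) *\<^sub>R (?E ^^ k) p \<noteq> 0}"
    "?A p = finite_sum {1..} (\<lambda>k. ?l ^ (k - 1) *\<^sub>R (?E ^^ k) p)"
    "?A p = op_series (fps_inv (\<Psi> ?l)) ?E p" if p: "p \<in> CP lam" for p
  proof -
    obtain d where d: "(?E ^^ d) p = 0" using nil[OF p] by blast
    have E0: "?E 0 = 0" using DG_lincomb[OF lam p p, of t 0 0] by simp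
    have vanish: "(?E ^^ k) p = 0" if "d \<le> k" for k
      using that by (induction k rule: dec_induct) (simp_all add: d E0)
    have "{k. 1 \<le> k \<and> ?l ^ (k - 1) *\<^sub>R (?E ^^ k) p \<noteq> 0} \<subseteq> {..<d}"
    proof
      fix k assume "k \<in> {k. 1 \<le> k \<and> ?l ^ (k - 1) *\<^sub>R (?E ^^ k) p \<noteq> 0}"
      then show "k \<in> {..<d}" using vanish[of k] by (cases "d \<le> k") auto
    qed
    then show "finite {k. 1 \<le> k \<and> ?l ^ (k - 1) *\<^sub>R (?E ^^ k) p \<noteq> 0}" using finite_subset by blast
    have Ap: "?A p = (\<Sum>k\<in>{1..d}. ?l ^ (k - 1) *\<^sub>R (?E ^^ k) p)" by (rule series[OF p d])
    show "?A p = finite_sum {1..} (\<lambda>k. ?l ^ (k - 1) *\<^sub>R (?E ^^ k) p)"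
      unfolding Ap using vanish by (intro finite_sum_eq[symmetric]) auto
    \<comment> \<open>The coefficient of order 0 vanishes, so the sum over all k starts at 1; from d
      on the powers of E are 0 on p.\<close>
    have "op_series (fps_inv (\<Psi> ?l)) ?E p = (\<Sum>k\<in>{1..d}. fps_nth (fps_inv (\<Psi> ?l)) k *\<^sub>R (?E ^^ k) p)"
      unfolding op_series_def using vanish by (intro finite_sum_eq) (auto simp: fps_inv_\<Psi> not_le)
    also have "\<dots> = ?A p" unfolding Ap by (intro sum.cong refl) (simp add: fps_inv_\<Psi>)
    finally show "?A p = op_series (fps_inv (\<Psi> ?l)) ?E p" ..
  qed
  have "?A p = ?E p" if "?l = 0" "p \<in> CP lam" for p
    using annihilation_eq_DG[OF lam that(2), of t] that(1) by simp
  then show ?thesis using sums bij inverse by (intro conjI ballI impI)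
qed

end
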